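(* Let $d\ge1$, let $m,m'\ge0$ be integers, and let $\alpha,\beta$ be such that $0<\alpha,\beta\le1$ and $\alpha+\beta>1$. There is a unique map $$\wedge\colon\mathbf{CH}^{m,\alpha}(\mathbb{R}^d)\times\mathbf{CH}^{m',\beta}(\mathbb{R}^d)\to\mathbf{CH}^{m+m',\alpha+\beta-1}(\mathbb{R}^d)$$ such that: (A) $\wedge$ extends the pointwise wedge product between smooth forms; (B) (weak*-to-weak* continuity) if $(\omega_n)$ and $(\eta_n)$ are two sequences that converge weakly-* to $\omega$ in $\mathbf{CH}^{m,\alpha}(\mathbb{R}^d)$ and to $\eta$ in $\mathbf{CH}^{m',\beta}(\mathbb{R}^d)$ respectively, then $\omega_n\wedge\eta_n$ converges weakly-* to $\omega\wedge\eta$ in $\mathbf{CH}^{m+m',\alpha+\beta-1}(\mathbb{R}^d)$. Moreover, $\wedge$ is continuous (for the Fréchet topologies).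
   Context: Currents: a (compactly supported) $m$-current $T$ in $\mathbb{R}^d$ is a continuous linear functional on $C^\infty(\mathbb{R}^d;\wedge^m\mathbb{R}^d)$ (smooth $m$-forms with the usual topology); $\partial T(\omega)=T(d\omega)$ for $m\ge1$. Covectors carry the comass norm and $\|\omega\|_\infty$ is the supremum of the comass. $\mathbf M(T)=\sup\{T(\omega):\|\omega\|_\infty\le1\}$; $\mathbf N(T)=\mathbf M(T)+\mathbf M(\partial T)$ for $m\ge1$, $\mathbf N=\mathbf M$ for $m=0$; $T$ is normal if $\mathbf N(T)<\infty$. For normal $T$, the flat norm is $\mathbf F(T)=\sup\{T(\omega):\max\{\|\omega\|_\infty,\|d\omega\|_\infty\}\le1\}$. $\mathbf N_m(\mathbb{R}^d)$ is the space of normal $m$-currents, $\mathbf N_m(K)$ the subspace of those supported in the compact set $K$. An $m$-charge over $\mathbb{R}^d$ is a linear map $\omega\colon\mathbf N_m(\mathbb{R}^d)\to\mathbb{R}$ such that $\omega(T_n)\to0$ whenever $\mathbf F(T_n)\to0$, $\sup_n\mathbf N(T_n)<\infty$ and $\bigcup_n\operatorname{spt}T_n$ is bounded. The space $\mathbf{CH}^m(\mathbb{R}^d)$ of $m$-charges has the Fréchet topology given by the seminorms $\|\omega\|_{\mathbf{CH}^m,K}=\sup\{\omega(T):T\in\mathbf N_m(K),\ \mathbf N(T)\le1\}$, $K\subset\mathbb{R}^d$ compact. For $\alpha\in(0,1]$, an $\alpha$-fractional $m$-charge over $\mathbb{R}^d$ is a linear functional $\omega\colon\mathbf N_m(\mathbb{R}^d)\to\mathbb{R}$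 such that for every compact $K$ there is $C_K\ge0$ with $|\omega(T)|\le C_K\mathbf N(T)^{1-\alpha}\mathbf F(T)^\alpha$ for all $T\in\mathbf N_m(K)$; the least such $C_K$ is denoted $\|\omega\|_{\mathbf{CH}^{m,\alpha},K}$. $\mathbf{CH}^{m,\alpha}(\mathbb{R}^d)\subset\mathbf{CH}^m(\mathbb{R}^d)$ is the space of these, with the Fréchet topology given by the seminorms $\|\cdot\|_{\mathbf{CH}^{m,\alpha},K}$. A smooth $m$-form $\omega$ is identified with the charge $T\mapsto T(\omega)$, which belongs to $\mathbf{CH}^{m,\alpha}(\mathbb{R}^d)$ for every $\alpha\in(0,1]$. A sequence $(\omega_n)$ converges weakly-* to $\omega$ in $\mathbf{CH}^{m,\alpha}(\mathbb{R}^d)$ if $\sup_n\|\omega_n\|_{\mathbf{CH}^{m,\alpha},K}<\infty$ for every compact $K$ and $\omega_n\to\omega$ in $\mathbf{CH}^m(\mathbb{R}^d)$. *)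

theory Defs
  imports "HOL-Analysis.Analysis"
begin

section \<open>Topology given by a family of seminorms\<close>

text \<open>The carrier \<open>S\<close> is a linear subspace of a function space, with pointwise subtraction.\<close>

definition seminorm_topology :: "'v::minus set \<Rightarrow> ('v \<Rightarrow> real) set \<Rightarrow> 'v topology" where
  "seminorm_topology S P =
     topology_generated_by {{y \<in> S. p (y - x) < e} | p x e. p \<in> P \<and> x \<in> S \<and> 0 < e}"

lemma topspace_seminorm_topology:
  assumes "P \<noteq> {}"
  shows "topspace (seminorm_topology S P) = S"
proof -
  obtain p where p: "p \<in> P" using assms by blast
  have "x \<in> \<Union>{{y \<in> S. p (y - x) < e} | p x e. p \<in> P \<and> x \<in> S \<and> 0 < e}" if "x \<in> S" for x
  proof -
    have "x \<in> {y \<in> S. p (y - x) < \<bar>p (x - x)\<bar> + 1}" using that by simp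
    moreover have "0 < \<bar>p (x - x)\<bar> + 1" by simp
    ultimately show ?thesis using p that by blast
  qed
  then show ?thesis
    unfolding seminorm_topology_def topology_generated_by_topspace by blast
qed


section \<open>Smooth forms\<close>

text \<open>Alternating \<open>m\<close>-linear maps take as argument a sequence of vectors, of which only the first
  \<open>m\<close> entries matter.\<close>

type_synonym 'a covector = "(nat \<Rightarrow> 'a) \<Rightarrow> real"
type_synonym 'a form = "'a \<Rightarrow> 'a covector"

definition covectors :: "nat \<Rightarrow> 'a::euclidean_space covector set" where
  "covectors m = {\<phi>.
     (\<forall>v w. (\<forall>i<m. v i = w i) \<longrightarrow> \<phi> v = \<phi> w) \<and>
     (\<forall>v. \<forall>i<m. linear (\<lambda>x. \<phi> (v(i := x)))) \<and>
     (\<forall>v. \<forall>i<m. \<forall>j<m. i \<noteq> j \<and> v i = v j \<longrightarrow> \<phi> v = 0)}"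

text \<open>The comass of \<open>\<phi>\<close> is the supremum of its values on simple \<open>m\<close>-vectors of Euclidean norm at
  most \<open>1\<close>. A unit simple \<open>m\<close>-vector is the exterior product of an orthonormal family, and the
  exterior product of vectors in the unit ball has norm at most \<open>1\<close> by Hadamard's inequality. The
  absolute value is relevant for \<open>m = 0\<close> only.\<close>

definition comass :: "nat \<Rightarrow> 'a::euclidean_space covector \<Rightarrow> real" where
  "comass m \<phi> = (SUP v\<in>{v. \<forall>i<m. norm (v i) \<le> 1}. \<bar>\<phi> v\<bar>)"

fun iter_deriv :: "'a::euclidean_space list \<Rightarrow> ('a \<Rightarrow> real) \<Rightarrow> 'a \<Rightarrow> real" where
  "iter_deriv [] f = f"
| "iter_deriv (u # us) f = (\<lambda>x. frechet_derivative (iter_deriv us f) (at x) u)"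

definition smooth_function :: "('a::euclidean_space \<Rightarrow> real) \<Rightarrow> bool" where
  "smooth_function f \<longleftrightarrow> (\<forall>us x. iter_deriv us f differentiable (at x))"

text \<open>By multilinearity, it amounts to the same to require smoothness of the values of a form on all
  constant vectors or of its coefficients in a basis. The same remark applies to the seminorms
  below.\<close>

definition smooth_forms :: "nat \<Rightarrow> 'a::euclidean_space form set" where
  "smooth_forms m =
     {\<omega>. (\<forall>x. \<omega> x \<in> covectors m) \<and> (\<forall>v. smooth_function (\<lambda>x. \<omega> x v))}"

definition form_seminorm ::
    "'a::euclidean_space set \<Rightarrow> 'a list \<Rightarrow> (nat \<Rightarrow> 'a) \<Rightarrow> 'a form \<Rightarrow> real" where
  "form_seminorm K us v \<omega> = (SUP x\<in>K. \<bar>iter_deriv us (\<lambda>y. \<omega> y v) x\<bar>)"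

definition form_topology :: "nat \<Rightarrow> 'a::euclidean_space form topology" where
  "form_topology m =
     seminorm_topology (smooth_forms m) {form_seminorm K us v | K us v. compact K \<and> K \<noteq> {}}"

definition form_norm :: "nat \<Rightarrow> 'a::euclidean_space form \<Rightarrow> ereal" where
  "form_norm m \<omega> = (SUP x. ereal (comass m (\<omega> x)))"

text \<open>Exterior derivative of an \<open>m\<close>-form and exterior product of an \<open>m\<close>-form and an \<open>n\<close>-form,
  normalized so that the exterior product of \<open>m\<close> linear forms is a determinant.\<close>

definition ext_deriv :: "nat \<Rightarrow> 'a::euclidean_space form \<Rightarrow> 'a form" where
  "ext_deriv m \<omega> = (\<lambda>x v. \<Sum>i\<le>m. (-1) ^ i *
     frechet_derivative (\<lambda>y. \<omega> y (\<lambda>j. if j < i then v j else v (Suc j))) (at x) (v i))"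

definition wedge_form ::
    "nat \<Rightarrow> nat \<Rightarrow> 'a::euclidean_space form \<Rightarrow> 'a form \<Rightarrow> 'a form" where
  "wedge_form m n \<omega> \<eta> = (\<lambda>x v.
     (\<Sum>p | p permutes {..<m + n}.
        of_int (sign p) * \<omega> x (\<lambda>i. v (p i)) * \<eta> x (\<lambda>i. v (p (m + i)))) / (fact m * fact n))"


section \<open>Currents\<close>

text \<open>Functionals on a space of forms, and later on a space of currents, are extended by \<open>0\<close> outside
  of that space, so that equality of HOL functions is equality of functionals.\<close>

type_synonym 'a current = "'a form \<Rightarrow> real"

definition currents :: "nat \<Rightarrow> 'a::euclidean_space current set" where
  "currents m = {T.
     (\<forall>\<omega>. \<omega> \<notin> smooth_forms m \<longrightarrow> T \<omega> = 0) \<and>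
     (\<forall>\<omega>\<in>smooth_forms m. \<forall>\<eta>\<in>smooth_forms m. T (\<lambda>x v. \<omega> x v + \<eta> x v) = T \<omega> + T \<eta>) \<and>
     (\<forall>c. \<forall>\<omega>\<in>smooth_forms m. T (\<lambda>x v. c * \<omega> x v) = c * T \<omega>) \<and>
     continuous_map (form_topology m) euclideanreal T}"

definition boundary :: "nat \<Rightarrow> 'a::euclidean_space current \<Rightarrow> 'a current" where
  "boundary m T = (\<lambda>\<omega>. if \<omega> \<in> smooth_forms (m - 1) then T (ext_deriv (m - 1) \<omega>) else 0)"

definition spt :: "nat \<Rightarrow> 'a::euclidean_space current \<Rightarrow> 'a set" where
  "spt m T = - \<Union>{U. open U \<and>
     (\<forall>\<omega>\<in>smooth_forms m. closure {x. \<exists>v. \<omega> x v \<noteq> 0} \<subseteq> U \<longrightarrow> T \<omega> = 0)}"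

definition mass :: "nat \<Rightarrow> 'a::euclidean_space current \<Rightarrow> ereal" where
  "mass m T = (SUP \<omega>\<in>{\<omega> \<in> smooth_forms m. form_norm m \<omega> \<le> 1}. ereal (T \<omega>))"

definition normal_mass :: "nat \<Rightarrow> 'a::euclidean_space current \<Rightarrow> ereal" where
  "normal_mass m T = (if m = 0 then mass m T else mass m T + mass (m - 1) (boundary m T))"

definition flat_norm :: "nat \<Rightarrow> 'a::euclidean_space current \<Rightarrow> ereal" where
  "flat_norm m T =
     (SUP \<omega>\<in>{\<omega> \<in> smooth_forms m. max (form_norm m \<omega>) (form_norm (m + 1) (ext_deriv m \<omega>)) \<le> 1}.
        ereal (T \<omega>))"

definition normal_currents :: "nat \<Rightarrow> 'a::euclidean_space current set" where
  "normal_currents m = {T \<in> currents m. normal_mass m T < \<infinity>}"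

definition normal_currents_in :: "nat \<Rightarrow> 'a::euclidean_space set \<Rightarrow> 'a current set" where
  "normal_currents_in m K = {T \<in> normal_currents m. spt m T \<subseteq> K}"


section \<open>Charges\<close>

type_synonym 'a charge = "'a current \<Rightarrow> real"

definition normal_functionals :: "nat \<Rightarrow> 'a::euclidean_space charge set" where
  "normal_functionals m = {\<omega>.
     (\<forall>T. T \<notin> normal_currents m \<longrightarrow> \<omega> T = 0) \<and>
     (\<forall>S\<in>normal_currents m. \<forall>T\<in>normal_currents m. \<omega> (\<lambda>\<phi>. S \<phi> + T \<phi>) = \<omega> S + \<omega> T) \<and>
     (\<forall>c. \<forall>T\<in>normal_currents m. \<omega> (\<lambda>\<phi>. c * T \<phi>) = c * \<omega> T)}"

definition charges :: "nat \<Rightarrow> 'a::euclidean_space charge set" where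
  "charges m = {\<omega> \<in> normal_functionals m.
     \<forall>T. (\<forall>n. T n \<in> normal_currents m) \<and> (\<lambda>n. flat_norm m (T n)) \<longlonglongrightarrow> 0 \<and>
         (SUP n. normal_mass m (T n)) < \<infinity> \<and> bounded (\<Union>n. spt m (T n))
       \<longrightarrow> (\<lambda>n. \<omega> (T n)) \<longlonglongrightarrow> 0}"

definition charge_seminorm :: "nat \<Rightarrow> 'a::euclidean_space set \<Rightarrow> 'a charge \<Rightarrow> real" where
  "charge_seminorm m K \<omega> = (SUP T\<in>{T \<in> normal_currents_in m K. normal_mass m T \<le> 1}. \<omega> T)"

definition charge_topology :: "nat \<Rightarrow> 'a::euclidean_space charge topology" where
  "charge_topology m = seminorm_topology (charges m) {charge_seminorm m K | K. compact K}"

definition fractional_bound ::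
    "nat \<Rightarrow> real \<Rightarrow> 'a::euclidean_space set \<Rightarrow> 'a charge \<Rightarrow> real \<Rightarrow> bool" where
  "fractional_bound m \<alpha> K \<omega> C \<longleftrightarrow> C \<ge> 0 \<and>
     (\<forall>T\<in>normal_currents_in m K.
        \<bar>\<omega> T\<bar> \<le> C * real_of_ereal (normal_mass m T) powr (1 - \<alpha>)
                  * real_of_ereal (flat_norm m T) powr \<alpha>)"

definition fractional_charges :: "nat \<Rightarrow> real \<Rightarrow> 'a::euclidean_space charge set" where
  "fractional_charges m \<alpha> =
     {\<omega> \<in> normal_functionals m. \<forall>K. compact K \<longrightarrow> (\<exists>C. fractional_bound m \<alpha> K \<omega> C)}"

definition fractional_seminorm ::
    "nat \<Rightarrow> real \<Rightarrow> 'a::euclidean_space set \<Rightarrow> 'a charge \<Rightarrow> real" where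
  "fractional_seminorm m \<alpha> K \<omega> = Inf {C. fractional_bound m \<alpha> K \<omega> C}"

definition fractional_topology :: "nat \<Rightarrow> real \<Rightarrow> 'a::euclidean_space charge topology" where
  "fractional_topology m \<alpha> =
     seminorm_topology (fractional_charges m \<alpha>) {fractional_seminorm m \<alpha> K | K. compact K}"

definition charge_of_form :: "nat \<Rightarrow> 'a::euclidean_space form \<Rightarrow> 'a charge" where
  "charge_of_form m \<omega> = (\<lambda>T. if T \<in> normal_currents m then T \<omega> else 0)"

definition weakly_star_converges ::
    "nat \<Rightarrow> real \<Rightarrow> (nat \<Rightarrow> 'a::euclidean_space charge) \<Rightarrow> 'a charge \<Rightarrow> bool" where
  "weakly_star_converges m \<alpha> \<omega>s \<omega> \<longleftrightarrow>
     (\<forall>n. \<omega>s n \<in> fractional_charges m \<alpha>) \<and> \<omega> \<in> fractional_charges m \<alpha> \<and>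
     (\<forall>K. compact K \<longrightarrow> bdd_above (range (\<lambda>n. fractional_seminorm m \<alpha> K (\<omega>s n)))) \<and>
     limitin (charge_topology m) \<omega>s \<omega> sequentially"

definition extends_wedge_form ::
    "nat \<Rightarrow> nat \<Rightarrow> ('a::euclidean_space charge \<times> 'a charge \<Rightarrow> 'a charge) \<Rightarrow> bool" where
  "extends_wedge_form m m' W \<longleftrightarrow>
     (\<forall>\<omega>\<in>smooth_forms m. \<forall>\<eta>\<in>smooth_forms m'.
        W (charge_of_form m \<omega>, charge_of_form m' \<eta>)
          = charge_of_form (m + m') (wedge_form m m' \<omega> \<eta>))"

definition weak_star_continuous ::
    "nat \<Rightarrow> nat \<Rightarrow> real \<Rightarrow> real \<Rightarrow>
     ('a::euclidean_space charge \<times> 'a charge \<Rightarrow> 'a charge) \<Rightarrow> bool" where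
  "weak_star_continuous m m' \<alpha> \<beta> W \<longleftrightarrow>
     (\<forall>\<omega>s \<omega> \<eta>s \<eta>.
        weakly_star_converges m \<alpha> \<omega>s \<omega> \<and> weakly_star_converges m' \<beta> \<eta>s \<eta> \<longrightarrow>
        weakly_star_converges (m + m') (\<alpha> + \<beta> - 1) (\<lambda>n. W (\<omega>s n, \<eta>s n)) (W (\<omega>, \<eta>)))"

text \<open>Maps between the spaces of fractional charges are extensional (\<open>undefined\<close> outside of their
  domain), which makes the uniqueness of such a map meaningful.\<close>

definition fractional_wedge_products ::
    "nat \<Rightarrow> nat \<Rightarrow> real \<Rightarrow> real \<Rightarrow>
     ('a::euclidean_space charge \<times> 'a charge \<Rightarrow> 'a charge) set" where
  "fractional_wedge_products m m' \<alpha> \<beta> =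
     {W \<in> fractional_charges m \<alpha> \<times> fractional_charges m' \<beta>
            \<rightarrow>\<^sub>E fractional_charges (m + m') (\<alpha> + \<beta> - 1).
        extends_wedge_form m m' W \<and> weak_star_continuous m m' \<alpha> \<beta> W}"

end

theory Submission
  imports Defs
begin

text \<open>Convolution with a mollifier at scale \<open>e\<close> acts on normal currents, and the homotopy formula shows
  that it moves \<open>T\<close> by at most \<open>e N(T)\<close> in flat norm. By duality, a fractional charge \<open>\<omega>\<close> is approximated by
  the smooth form \<open>\<omega>\<^sub>e\<close> whose value at a point is the value of \<open>\<omega>\<close> on a mollified point evaluation:
  the error on \<open>T\<close> is \<open>O(e\<^sup>\<alpha>) N(T)\<close>, while \<open>\<omega>\<^sub>e\<close> and its exterior derivative are \<open>O(e\<^sup>\<alpha>\<^sup>-\<^sup>1)\<close> on compact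
  sets. At the dyadic scales \<open>e = 2\<^sup>-\<^sup>n\<close>, consecutive products \<open>\<omega>\<^sub>e \<and> \<eta>\<^sub>e\<close> therefore differ on \<open>T\<close> by
  \<open>O(e\<^sup>\<alpha>\<^sup>+\<^sup>\<beta>\<^sup>-\<^sup>1) N(T)\<close>, which is summable because \<open>\<alpha> + \<beta> > 1\<close>; the limit is the wedge product.
  Stopping at \<open>e\<close> comparable to \<open>F(T) / N(T)\<close> and estimating the product of forms by the flat norm
  gives its fractional regularity. Since charges are weak-* limits of their mollifications, weak-*
  continuity determines the product.\<close>

section \<open>Calculus in Euclidean space: smooth functions, bumps, averages and
  convolutions\<close>

section \<open>Smooth functions\<close>

text \<open>The estimate rests on one pairing: for fixed \<open>\<eta>\<close>, testing
  \<open>T\<close> against \<open>\<zeta> \<and> \<eta>\<close> is a normal current in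
  \<open>\<zeta>\<close>, whose normal mass is controlled by the comass of \<open>\<eta>\<close>
  and, through the Leibniz rule, by that of its exterior derivative. This is why the derivative of a
  mollified form must be bounded along with the form: the error e^\<alpha> of one factor then meets
  the size e^(\<beta> - 1) of the other. The bound on the derivative is available because the
  boundary of a mollified point evaluation, like the evaluation itself, has flat norm at most 1 and
  normal mass O(1/e). Currents are handled as functionals throughout: masses are known only through
  inequalities on test forms near a compact set. The delicate identity is that the mollified form
  acts on \<open>T\<close> as the charge acts on the mollified current. The charge is bounded by the
  normal mass only and cannot be moved through an integral directly; sums over sample points that
  converge in normal mass replace the integral. The constants of the two charges are kept as
  bilinear factors, so that one set of estimates yields regularity and both kinds of
  continuity.\<close>

definition dird :: "'a::euclidean_space \<Rightarrow> ('a \<Rightarrow> real) \<Rightarrow> 'a \<Rightarrow> real" where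
  "dird u f x = frechet_derivative f (at x) u"

lemma iter_deriv_Cons: "iter_deriv (u # us) f = dird u (iter_deriv us f)"
  by (simp add: dird_def fun_eq_iff)

lemma iter_deriv_append: "iter_deriv (us @ ws) f = iter_deriv us (iter_deriv ws f)"
  by (induction us) (simp_all add: iter_deriv_Cons del: iter_deriv.simps(2))

lemma iter_deriv_snoc: "iter_deriv (us @ [u]) f = iter_deriv us (dird u f)"
  by (simp add: iter_deriv_append iter_deriv_Cons del: iter_deriv.simps(2))

lemma has_derivative_dird:
  "f differentiable at x \<Longrightarrow> (f has_derivative (\<lambda>u. dird u f x)) (at x)"
  unfolding dird_def using frechet_derivative_works by blast

lemma dird_eqI: "(f has_derivative f') (at x) \<Longrightarrow> dird u f x = f' u"
  unfolding dird_def using frechet_derivative_at by metis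

lemma linear_dird: "f differentiable at x \<Longrightarrow> linear (\<lambda>u. dird u f x)"
  using has_derivative_dird has_derivative_linear by blast

text \<open>Smoothness up to a finite order, with derivatives taken from the inside: the recursion
  passes to \<open>dird u f\<close>, whereas \<open>iter_deriv\<close> adds derivatives on the
  outside. In this form sums, products, composites and inverses follow by induction on the order
  from the rules for a single derivative.\<close>

fun diff_order :: "nat \<Rightarrow> ('a::euclidean_space \<Rightarrow> real) \<Rightarrow> bool" where
  "diff_order 0 f = True"
| "diff_order (Suc n) f = ((\<forall>x. f differentiable at x) \<and> (\<forall>u. diff_order n (dird u f)))"

lemma diff_order_iff: "diff_order n f \<longleftrightarrow> (\<forall>us x. length us < n \<longrightarrow> iter_deriv us f differentiable at x)"
proof (induction n arbitrary: f)
  case (Suc n)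
  show ?case
  proof (intro iffI allI impI)
    fix us :: "'a list" and x
    assume "diff_order (Suc n) f" "length us < Suc n"
    then show "iter_deriv us f differentiable at x"
      by (cases us rule: rev_cases) (auto simp: Suc.IH iter_deriv_snoc)
  next
    assume R: "\<forall>us x. length us < Suc n \<longrightarrow> iter_deriv us f differentiable at x"
    have "f differentiable at x" for x using R[rule_format, of "[]"] by simp
    moreover have "iter_deriv us (dird u f) differentiable at x" if "length us < n" for us u x
      using R[rule_format, of "us @ [u]"] that by (simp add: iter_deriv_snoc)
    ultimately show "diff_order (Suc n) f" by (simp add: Suc.IH)
  qed
qed simp

lemma smooth_iff_diff_order: "smooth_function f \<longleftrightarrow> (\<forall>n. diff_order n f)"
  unfolding smooth_function_def diff_order_iff by blast

lemma smooth_differentiable: "smooth_function f \<Longrightarrow> f differentiable at x"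
  unfolding smooth_function_def by (metis iter_deriv.simps(1))

lemma smooth_has_derivative: "smooth_function f \<Longrightarrow> (f has_derivative (\<lambda>u. dird u f x)) (at x)"
  by (simp add: has_derivative_dird smooth_differentiable)

lemma smooth_dird: "smooth_function f \<Longrightarrow> smooth_function (dird u f)"
  unfolding smooth_iff_diff_order by (metis diff_order.simps(2))

lemma smooth_continuous_on: "smooth_function f \<Longrightarrow> continuous_on S f"
  by (meson continuous_at_imp_continuous_on differentiable_imp_continuous_within smooth_differentiable)

lemma diff_order_Suc_imp: "diff_order (Suc n) f \<Longrightarrow> diff_order n f"
  by (simp add: diff_order_iff)

text \<open>Coinduction principle: formulas for higher derivatives are avoided once some class
  containing \<open>f\<close> is closed under directional derivatives. Averages and mollified
  charges are treated this way, the class being indexed by the integrand or by the kernel.\<close>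

lemma smooth_coinduct:
  assumes "P f" and "\<And>f x. P f \<Longrightarrow> f differentiable at x" and "\<And>f u. P f \<Longrightarrow> P (dird u f)"
  shows "smooth_function f"
proof -
  have "P f \<Longrightarrow> diff_order n f" for n f
    by (induction n arbitrary: f) (auto intro: assms(2,3))
  with assms(1) show ?thesis by (auto simp: smooth_iff_diff_order)
qed

lemma dird_const: "dird u (\<lambda>_. c) = (\<lambda>_. 0)"
  by (auto intro!: dird_eqI derivative_eq_intros)

lemma dird_add:
  assumes "\<And>x. f differentiable at x" "\<And>x. g differentiable at x"
  shows "dird u (\<lambda>x. f x + g x) = (\<lambda>x. dird u f x + dird u g x)"
  using assms by (intro ext dird_eqI has_derivative_add has_derivative_dird)

lemma dird_mult:
  assumes "\<And>x. f differentiable at x" "\<And>x. g differentiable at x"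
  shows "dird u (\<lambda>x. f x * g x) = (\<lambda>x. f x * dird u g x + dird u f x * g x)"
proof
  fix x
  show "dird u (\<lambda>x. f x * g x) x = f x * dird u g x + dird u f x * g x"
    using dird_eqI[OF has_derivative_mult[OF has_derivative_dird has_derivative_dird], of f x g u] assms by auto
qed

lemma dird_cmult:
  assumes "\<And>x. f differentiable at x"
  shows "dird u (\<lambda>x. c * f x) = (\<lambda>x. c * dird u f x)"
  using assms by (intro ext dird_eqI has_derivative_mult_right has_derivative_dird)

lemma dird_sum:
  assumes "\<And>i x. i \<in> I \<Longrightarrow> f i differentiable at x"
  shows "dird u (\<lambda>x. \<Sum>i\<in>I. f i x) = (\<lambda>x. \<Sum>i\<in>I. dird u (f i) x)"
  using assms by (intro ext dird_eqI has_derivative_sum has_derivative_dird)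

lemma diff_order_add: "diff_order n f \<Longrightarrow> diff_order n g \<Longrightarrow> diff_order n (\<lambda>x. f x + g x)"
proof (induction n arbitrary: f g)
  case (Suc n)
  then show ?case by (auto simp: dird_add intro: differentiable_add)
qed simp

lemma diff_order_mult: "diff_order n f \<Longrightarrow> diff_order n g \<Longrightarrow> diff_order n (\<lambda>x. f x * g x)"
proof (induction n arbitrary: f g)
  case (Suc n)
  then have "diff_order n f" "diff_order n g" using diff_order_Suc_imp by blast+
  with Suc show ?case by (auto simp: dird_mult intro!: differentiable_mult diff_order_add)
qed simp

lemma diff_order_const: "diff_order n (\<lambda>_. c)"
  by (induction n arbitrary: c) (simp_all add: dird_const)

lemma smooth_const [simp]: "smooth_function (\<lambda>_. c)"
  by (simp add: smooth_iff_diff_order diff_order_const)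

lemma smooth_add: "smooth_function f \<Longrightarrow> smooth_function g \<Longrightarrow> smooth_function (\<lambda>x. f x + g x)"
  by (simp add: smooth_iff_diff_order diff_order_add)

lemma smooth_mult: "smooth_function f \<Longrightarrow> smooth_function g \<Longrightarrow> smooth_function (\<lambda>x. f x * g x)"
  by (simp add: smooth_iff_diff_order diff_order_mult)

lemma smooth_cmult: "smooth_function f \<Longrightarrow> smooth_function (\<lambda>x. c * f x)"
  by (intro smooth_mult) auto

lemma smooth_minus: "smooth_function f \<Longrightarrow> smooth_function (\<lambda>x. - f x)"
  using smooth_cmult[of f "-1"] by simp

lemma smooth_diff: "smooth_function f \<Longrightarrow> smooth_function g \<Longrightarrow> smooth_function (\<lambda>x. f x - g x)"
  using smooth_add[of f "\<lambda>x. - g x"] smooth_minus[of g] by simp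

lemma smooth_sum: "(\<And>i. i \<in> I \<Longrightarrow> smooth_function (f i)) \<Longrightarrow> smooth_function (\<lambda>x. \<Sum>i\<in>I. f i x)"
  by (induction I rule: infinite_finite_induct) (auto intro: smooth_add)

lemma smooth_bounded_linear:
  assumes "bounded_linear f" shows "smooth_function f"
proof -
  have "dird u f = (\<lambda>_. f u)" for u
    by (intro ext dird_eqI bounded_linear_imp_has_derivative assms)
  then have "diff_order (Suc n) f" for n
    using bounded_linear_imp_differentiable[OF assms] by (simp add: diff_order_const)
  then show ?thesis unfolding smooth_iff_diff_order using diff_order_Suc_imp by blast
qed

lemma dird_compose_real:
  assumes "\<And>x. f differentiable at x" "\<And>t. h differentiable at t"
  shows "dird u (\<lambda>x. h (f x)) = (\<lambda>x. dird 1 h (f x) * dird u f x)"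
proof
  fix x
  have "((\<lambda>x. h (f x)) has_derivative (\<lambda>u. dird (dird u f x) h (f x))) (at x)"
    by (rule has_derivative_compose[OF has_derivative_dird[OF assms(1)] has_derivative_dird[OF assms(2)]])
  then have "dird u (\<lambda>x. h (f x)) x = dird (dird u f x *\<^sub>R 1) h (f x)"
    by (simp add: dird_eqI)
  also have "\<dots> = dird u f x *\<^sub>R dird 1 h (f x)"
    by (rule linear_scale[OF linear_dird]) (simp add: assms)
  finally show "dird u (\<lambda>x. h (f x)) x = dird 1 h (f x) * dird u f x" by simp
qed

lemma diff_order_compose_real:
  "diff_order n f \<Longrightarrow> diff_order n h \<Longrightarrow> diff_order n (\<lambda>x. h (f x))"
proof (induction n arbitrary: f h)
  case (Suc n)
  have f: "diff_order n f" using Suc.prems diff_order_Suc_imp by blast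
  have df: "f differentiable at x" "diff_order n (dird u f)" for x u using Suc.prems by simp_all
  have dh: "h differentiable at x" "diff_order n (dird u h)" for x u using Suc.prems by simp_all
  have "(\<lambda>x. h (f x)) differentiable at x" for x
    by (rule differentiable_compose[OF dh(1) df(1)])
  moreover have "diff_order n (dird u (\<lambda>x. h (f x)))" for u
    unfolding dird_compose_real[OF df(1) dh(1)]
    by (rule diff_order_mult[OF Suc.IH[OF f dh(2)] df(2)])
  ultimately show ?case by simp
qed simp

lemma smooth_compose_real: "smooth_function f \<Longrightarrow> smooth_function h \<Longrightarrow> smooth_function (\<lambda>x. h (f x))"
  by (simp add: smooth_iff_diff_order diff_order_compose_real)

lemma dird_inverse:
  assumes "\<And>x. f differentiable at x" "\<And>x. f x \<noteq> 0"
  shows "dird u (\<lambda>x. inverse (f x)) = (\<lambda>x. - 1 * (inverse (f x) * inverse (f x)) * dird u f x)"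
proof
  fix x
  show "dird u (\<lambda>x. inverse (f x)) x = - 1 * (inverse (f x) * inverse (f x)) * dird u f x"
    using dird_eqI[OF Deriv.has_derivative_inverse[OF assms(2) has_derivative_dird[OF assms(1)]], of u x] by simp
qed

lemma diff_order_inverse:
  "(\<And>x. f x \<noteq> 0) \<Longrightarrow> diff_order n f \<Longrightarrow> diff_order n (\<lambda>x. inverse (f x))"
proof (induction n)
  case (Suc n)
  have f: "diff_order n f" using Suc.prems diff_order_Suc_imp by blast
  have d: "f differentiable at x" "diff_order n (dird u f)" for x u using Suc.prems by simp_all
  have "(\<lambda>x. inverse (f x)) differentiable at x" for x
    by (rule differentiable_inverse[OF d(1) Suc.prems(1)])
  moreover have "diff_order n (dird u (\<lambda>x. inverse (f x)))" for u
    unfolding dird_inverse[OF d(1) Suc.prems(1)]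
    by (rule diff_order_mult[OF diff_order_mult[OF diff_order_const
            diff_order_mult[OF Suc.IH[OF Suc.prems(1) f] Suc.IH[OF Suc.prems(1) f]]] d(2)])
  ultimately show ?case by simp
qed simp

lemma smooth_inverse:
  "smooth_function f \<Longrightarrow> (\<And>x. f x \<noteq> 0) \<Longrightarrow> smooth_function (\<lambda>x. inverse (f x))"
  by (simp add: smooth_iff_diff_order diff_order_inverse)

lemma dird_affine:
  assumes "\<And>x. f differentiable at x"
  shows "dird u (\<lambda>z. f (x + r *\<^sub>R z)) = (\<lambda>z. r * dird u f (x + r *\<^sub>R z))"
proof
  fix z
  have "((\<lambda>z. f (x + r *\<^sub>R z)) has_derivative (\<lambda>u. dird (r *\<^sub>R u) f (x + r *\<^sub>R z))) (at z)"
    by (rule has_derivative_compose[OF _ has_derivative_dird[OF assms]]) (auto intro!: derivative_eq_intros)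
  then have "dird u (\<lambda>z. f (x + r *\<^sub>R z)) z = dird (r *\<^sub>R u) f (x + r *\<^sub>R z)"
    by (simp add: dird_eqI)
  also have "\<dots> = r *\<^sub>R dird u f (x + r *\<^sub>R z)"
    by (rule linear_scale[OF linear_dird]) (simp add: assms)
  finally show "dird u (\<lambda>z. f (x + r *\<^sub>R z)) z = r * dird u f (x + r *\<^sub>R z)" by simp
qed

lemma smooth_affine:
  assumes "smooth_function f"
  shows "smooth_function (\<lambda>z. f (x + r *\<^sub>R z))"
proof (rule smooth_coinduct[where P="\<lambda>g. \<exists>f c. smooth_function f \<and> g = (\<lambda>z. c * f (x + r *\<^sub>R z))"])
  show "\<exists>g c. smooth_function g \<and> (\<lambda>z. f (x + r *\<^sub>R z)) = (\<lambda>z. c * g (x + r *\<^sub>R z))"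
    using assms by (intro exI[of _ f] exI[of _ 1]) simp
next
  fix g :: "'a \<Rightarrow> real" and y
  assume "\<exists>f c. smooth_function f \<and> g = (\<lambda>z. c * f (x + r *\<^sub>R z))"
  then obtain f c where f: "smooth_function f" "g = (\<lambda>z. c * f (x + r *\<^sub>R z))" by blast
  have d: "(\<lambda>z. f (x + r *\<^sub>R z)) differentiable at z" for z
    by (rule differentiable_compose[where f=f, OF smooth_differentiable[OF f(1)]]) simp
  show "g differentiable at y"
    unfolding f(2) by (rule differentiable_mult[OF differentiable_const d])
  fix u
  have "dird u g = (\<lambda>z. (c * r) * dird u f (x + r *\<^sub>R z))"
    unfolding f(2) by (subst dird_cmult[OF d]) (simp add: dird_affine smooth_differentiable f(1) mult.assoc)
  then show "\<exists>f c. smooth_function f \<and> dird u g = (\<lambda>z. c * f (x + r *\<^sub>R z))"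
    by (intro exI[of _ "dird u f"] exI[of _ "c * r"] conjI smooth_dird[OF f(1)])
qed

lemma dird_expand:
  assumes "\<And>x. f differentiable at x"
  shows "dird u f = (\<lambda>x. \<Sum>b\<in>Basis. (u \<bullet> b) * dird b f x)"
proof
  fix x
  have "dird u f x = dird (\<Sum>b\<in>Basis. (u \<bullet> b) *\<^sub>R b) f x" by (simp only: euclidean_representation)
  also have "\<dots> = (\<Sum>b\<in>Basis. (u \<bullet> b) * dird b f x)"
    by (simp only: linear_sum[OF linear_dird[OF assms]] linear_scale[OF linear_dird[OF assms]] real_scaleR_def)
  finally show "dird u f x = (\<Sum>b\<in>Basis. (u \<bullet> b) * dird b f x)" .
qed

lemma dird_zero_on_open:
  assumes "open S" "x \<in> S" "\<And>y. y \<in> S \<Longrightarrow> f y = 0"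
  shows "dird u f x = 0"
proof -
  have "(f has_derivative (\<lambda>_. 0)) (at x)"
    using has_derivative_transform_within_open[of "\<lambda>_. 0" "\<lambda>_. 0" x UNIV S f] assms by auto
  then show ?thesis by (simp add: dird_eqI)
qed

section \<open>Bump functions\<close>

text \<open>The powers of \<open>inverse t\<close> make the family closed under differentiation up
  to linear combinations: the derivative of member \<open>k\<close> involves members
  \<open>k + 1\<close> and \<open>k + 2\<close>. Member \<open>0\<close> is the usual
  exp(-1/t).\<close>

definition flat_exp :: "nat \<Rightarrow> real \<Rightarrow> real" where
  "flat_exp k t = (if t \<le> 0 then 0 else inverse t ^ k * exp (- inverse t))"

lemma flat_exp_tendsto_0: "(flat_exp k \<longlongrightarrow> 0) (at 0)"
proof (rule filterlim_split_at)
  have "eventually (\<lambda>t::real. t < 0) (at_left 0)" by (simp add: eventually_at_left_field) (meson zero_less_one lt_ex)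
  then have "eventually (\<lambda>t. flat_exp k t = 0) (at_left 0)"
    by eventually_elim (simp add: flat_exp_def)
  then show "(flat_exp k \<longlongrightarrow> 0) (at_left 0)" by (rule tendsto_eventually)
next
  have "((\<lambda>t. inverse t ^ k / exp (inverse t)) \<longlongrightarrow> (0::real)) (at_right 0)"
    by (rule filterlim_compose[OF tendsto_power_div_exp_0 filterlim_inverse_at_top_right])
  moreover have "eventually (\<lambda>t. inverse t ^ k / exp (inverse t) = flat_exp k t) (at_right 0)"
    using eventually_at_right_less by (rule eventually_mono) (simp add: flat_exp_def exp_minus divide_inverse)
  ultimately show "(flat_exp k \<longlongrightarrow> 0) (at_right 0)"
    by (rule Lim_transform_eventually)
qed

lemma flat_exp_has_derivative:
  "(flat_exp k has_real_derivative (- real k * flat_exp (Suc k) t + flat_exp (Suc (Suc k)) t)) (at t)"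
proof -
  consider "t < 0" | "t = 0" | "t > 0" by linarith
  then show ?thesis
  proof cases
    case 1
    have "(flat_exp k has_real_derivative 0) (at t)"
      by (rule has_field_derivative_transform_within_open[of "\<lambda>_. 0" 0 t "{..<0}"])
        (use 1 in \<open>auto simp: flat_exp_def\<close>)
    with 1 show ?thesis by (simp add: flat_exp_def)
  next
    case 2
    \<comment> \<open>At the origin the difference quotient of member \<open>k\<close> is member
      \<open>k + 1\<close> itself, which tends to 0.\<close>
    have "((\<lambda>h. flat_exp k h / h) \<longlongrightarrow> 0) (at 0)"
    proof (rule Lim_transform_eventually[OF flat_exp_tendsto_0[of "Suc k"]])
      show "\<forall>\<^sub>F h in at 0. flat_exp (Suc k) h = flat_exp k h / h"
        by (auto simp: flat_exp_def divide_inverse)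
    qed
    with 2 show ?thesis by (simp add: DERIV_def flat_exp_def)
  next
    case 3
    have "((\<lambda>t. inverse t ^ k * exp (- inverse t)) has_real_derivative
        (- real k * flat_exp (Suc k) t + flat_exp (Suc (Suc k)) t)) (at t)"
      using 3 by (auto intro!: derivative_eq_intros simp: flat_exp_def power2_eq_square)
        (cases k; simp add: field_simps)
    then show ?thesis
      by (rule has_field_derivative_transform_within_open[where S="{0<..}"])
        (use 3 in \<open>auto simp: flat_exp_def\<close>)
  qed
qed

lemma smooth_flat_exp: "smooth_function (flat_exp k)"
proof -
  have D: "dird u (flat_exp k) = (\<lambda>t. u * (- real k * flat_exp (Suc k) t + flat_exp (Suc (Suc k)) t))" for u k
    using flat_exp_has_derivative[of k]
    by (intro ext dird_eqI) (simp add: has_field_derivative_def mult_commute_abs)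
  have dif: "flat_exp k differentiable at x" for k x
    using flat_exp_has_derivative[of k x] real_differentiable_def by blast
  have "diff_order n (flat_exp k)" for n
  proof (induction n arbitrary: k)
    case (Suc n)
    then show ?case
      unfolding diff_order.simps D
      by (intro conjI allI dif diff_order_mult diff_order_add diff_order_const)
  qed simp
  then show ?thesis by (simp add: smooth_iff_diff_order)
qed

definition smooth_step :: "real \<Rightarrow> real" where
  "smooth_step t = flat_exp 0 t * inverse (flat_exp 0 t + flat_exp 0 (1 - t))"

lemma flat_exp_nonneg: "0 \<le> flat_exp 0 t" by (simp add: flat_exp_def)

text \<open>One of \<open>t\<close> and \<open>1 - t\<close> is positive; hence the denominator in
  \<open>smooth_step\<close> never vanishes.\<close>

lemma flat_exp_pos: "0 < flat_exp 0 t + flat_exp 0 (1 - t)"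
  by (auto simp: flat_exp_def add_pos_pos)

lemma smooth_smooth_step: "smooth_function smooth_step"
proof -
  have ne: "flat_exp 0 t + flat_exp 0 (1 - t) \<noteq> 0" for t
    using flat_exp_pos[of t] by linarith
  have 1: "smooth_function (\<lambda>t::real. 1 - t)"
    by (rule smooth_diff[OF smooth_const smooth_bounded_linear[OF bounded_linear_ident]])
  have 2: "smooth_function (\<lambda>t. flat_exp 0 (1 - t))"
    using smooth_compose_real[OF 1 smooth_flat_exp[of 0]] .
  have 3: "smooth_function (\<lambda>t. inverse (flat_exp 0 t + flat_exp 0 (1 - t)))"
    using smooth_inverse[OF smooth_add[OF smooth_flat_exp 2] ne] .
  show ?thesis
    unfolding smooth_step_def[abs_def] using smooth_mult[OF smooth_flat_exp 3] .
qed

lemma smooth_step_bounds: "0 \<le> smooth_step t" "smooth_step t \<le> 1"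
  using flat_exp_nonneg[of t] flat_exp_nonneg[of "1-t"] flat_exp_pos[of t]
  unfolding smooth_step_def divide_inverse[symmetric] by (simp_all add: divide_le_eq_1_pos)

lemma smooth_step_0: "t \<le> 0 \<Longrightarrow> smooth_step t = 0"
  by (simp add: smooth_step_def flat_exp_def)

lemma smooth_step_1: "t \<ge> 1 \<Longrightarrow> smooth_step t = 1"
  by (simp add: smooth_step_def flat_exp_def)

text \<open>The squared norm, being a polynomial, keeps the composite smooth at \<open>x0\<close>.
  For positive \<open>r\<close> the argument of the step is at least 1 on the ball of radius
  \<open>r\<close> and nonpositive from radius sqrt 2 * r on, which is less than
  \<open>2 * r\<close>.\<close>

definition bump :: "'a::euclidean_space \<Rightarrow> real \<Rightarrow> 'a \<Rightarrow> real" where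
  "bump x0 r x = smooth_step (2 - (norm (x - x0))\<^sup>2 / r\<^sup>2)"

lemma smooth_bump: "smooth_function (bump x0 r)"
proof -
  have "smooth_function (\<lambda>x. (x - x0) \<bullet> b)" for b
    using smooth_diff[OF smooth_bounded_linear[OF bounded_linear_inner_left] smooth_const, of b "x0 \<bullet> b"]
    by (simp add: inner_diff_left)
  then have "smooth_function (\<lambda>x. \<Sum>b\<in>Basis. ((x - x0) \<bullet> b) * ((x - x0) \<bullet> b))"
    by (intro smooth_sum smooth_mult)
  moreover have "(\<lambda>x. (norm (x - x0))\<^sup>2) = (\<lambda>x. \<Sum>b\<in>Basis. ((x - x0) \<bullet> b) * ((x - x0) \<bullet> b))"
    unfolding power2_norm_eq_inner by (rule ext, rule euclidean_inner)
  ultimately have "smooth_function (\<lambda>x. (norm (x - x0))\<^sup>2)" by (simp only:)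
  then have "smooth_function (\<lambda>x. 2 - (norm (x - x0))\<^sup>2 * inverse (r\<^sup>2))"
    by (rule smooth_diff[OF smooth_const smooth_mult[OF _ smooth_const]])
  from smooth_compose_real[OF this smooth_smooth_step] show ?thesis
    by (simp add: bump_def[abs_def] divide_inverse)
qed

lemma bump_bounds: "0 \<le> bump x0 r x" "bump x0 r x \<le> 1"
  by (auto simp: bump_def smooth_step_bounds)

lemma bump_eq_1:
  assumes "r > 0" "norm (x - x0) \<le> r" shows "bump x0 r x = 1"
proof -
  have "(norm (x - x0))\<^sup>2 \<le> r\<^sup>2" using assms by (intro power_mono) auto
  then have "(norm (x - x0))\<^sup>2 / r\<^sup>2 \<le> 1" using assms(1) by (simp add: divide_le_eq_1_pos)
  then show ?thesis unfolding bump_def by (intro smooth_step_1) linarith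
qed

lemma bump_eq_0:
  assumes "r > 0" "norm (x - x0) \<ge> 2 * r" shows "bump x0 r x = 0"
proof -
  have "2 * r\<^sup>2 \<le> (2 * r)\<^sup>2" by (simp add: power_mult_distrib)
  also have "\<dots> \<le> (norm (x - x0))\<^sup>2" using assms by (intro power_mono) auto
  finally have "2 \<le> (norm (x - x0))\<^sup>2 / r\<^sup>2" using assms(1) by (simp add: pos_le_divide_eq)
  then show ?thesis unfolding bump_def by (intro smooth_step_0) linarith
qed

section \<open>Averages of smooth functions\<close>

lemma bounded_smooth_on_compact:
  assumes "smooth_function f" "compact K"
  obtains C where "C \<ge> 0" "\<And>x. x \<in> K \<Longrightarrow> \<bar>f x\<bar> \<le> C"
proof -
  have "bounded (f ` K)"
    by (intro compact_imp_bounded compact_continuous_image smooth_continuous_on assms)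
  then obtain C where "\<forall>y\<in>f ` K. norm y \<le> C" unfolding bounded_iff by blast
  then show thesis by (intro that[of "max 0 C"]) auto
qed

lemma smooth_continuous_on_compose:
  "smooth_function g \<Longrightarrow> continuous_on S f \<Longrightarrow> continuous_on S (\<lambda>x. g (f x))"
  by (rule continuous_on_compose2[OF smooth_continuous_on[where S=UNIV]]) auto

text \<open>Differentiation under the integral sign in a generality that covers three uses:
  convolution with a kernel, the homotopy average over pairs of a direction and a time, and
  integration along a segment. Only the weight \<open>w p\<close> and the shift \<open>l p\<close>
  depend on the parameter.\<close>

lemma average_has_derivative:
  fixes g :: "'a::euclidean_space \<Rightarrow> real" and w :: "'p::euclidean_space \<Rightarrow> real" and l :: "'p \<Rightarrow> 'a"
  assumes g: "smooth_function g" and w: "continuous_on (cbox a b) w" and l: "continuous_on (cbox a b) l"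
  shows "((\<lambda>x. integral (cbox a b) (\<lambda>p. w p * g (x + l p))) has_derivative
          (\<lambda>u. integral (cbox a b) (\<lambda>p. w p * dird u g (x + l p)))) (at x)"
proof -
  \<comment> \<open>The differential of \<open>g\<close> as a continuous map into the dual space,
    the form in which the Leibniz rule expects the derivative of the integrand.\<close>
  define G :: "'a \<Rightarrow> 'a \<Rightarrow>\<^sub>L real" where "G = (\<lambda>y. \<Sum>c\<in>Basis. dird c g y *\<^sub>R blinfun_inner_left c)"
  have G: "blinfun_apply (G y) u = dird u g y" for y u
  proof -
    have "blinfun_apply (G y) u = (\<Sum>c\<in>Basis. (u \<bullet> c) * dird c g y)"
      unfolding G_def by (simp add: blinfun.sum_left blinfun.scaleR_left inner_commute mult.commute)
    then show ?thesis by (simp add: dird_expand[OF smooth_differentiable[OF g], of u])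
  qed
  have contd: "continuous_on S (dird c g)" for c S
    by (rule smooth_continuous_on[OF smooth_dird[OF g]])
  have contG: "continuous_on UNIV G"
    unfolding G_def by (intro continuous_intros contd)
  have contxl: "continuous_on (cbox a b) (\<lambda>p. x + l p)" for x
    by (intro continuous_intros l)
  have contc: "continuous_on (cbox a b) (\<lambda>p. w p * f (x + l p))" if "continuous_on UNIV f" for f x
    using continuous_on_compose2[OF that contxl] by (intro continuous_intros w) auto
  have contG2: "continuous_on (cbox a b) (\<lambda>p. w p *\<^sub>R G (x + l p))" for x
    using continuous_on_compose2[OF contG contxl] by (intro continuous_intros w) auto
  have "continuous_on (UNIV \<times> cbox a b) (\<lambda>q. fst q + l (snd q))"
    by (intro continuous_intros continuous_on_compose2[OF l]) auto
  from continuous_on_compose2[OF contG this]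
  have contG3: "continuous_on (UNIV \<times> cbox a b) (\<lambda>q. G (fst q + l (snd q)))" by simp
  have contw: "continuous_on (UNIV \<times> cbox a b) (\<lambda>q :: 'a \<times> 'p. w (snd q))"
    by (intro continuous_on_compose2[OF w] continuous_intros) auto
  have der: "((\<lambda>x. integral (cbox a b) (\<lambda>p. w p * g (x + l p))) has_derivative
          blinfun_apply (integral (cbox a b) (\<lambda>p. w p *\<^sub>R G (x + l p)))) (at x within UNIV)"
  proof (rule leibniz_rule[where U=UNIV])
    fix x p
    have 1: "((\<lambda>x. x + l p) has_derivative (\<lambda>u. u)) (at x)" by (auto intro!: derivative_eq_intros)
    have 2: "((\<lambda>x. g (x + l p)) has_derivative (\<lambda>u. dird u g (x + l p))) (at x)"
      by (rule has_derivative_compose[OF 1 smooth_has_derivative[OF g]])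
    have "((\<lambda>x. w p * g (x + l p)) has_derivative (\<lambda>u. w p * dird u g (x + l p))) (at x)"
      by (rule has_derivative_mult_right[OF 2])
    moreover have "(\<lambda>u. w p * dird u g (x + l p)) = blinfun_apply (w p *\<^sub>R G (x + l p))"
      by (simp add: fun_eq_iff blinfun.scaleR_left G)
    ultimately show "((\<lambda>x. w p * g (x + l p)) has_derivative blinfun_apply (w p *\<^sub>R G (x + l p))) (at x within UNIV)"
      by simp
  next
    show "(\<lambda>p. w p * g (x + l p)) integrable_on cbox a b" for x
      by (intro integrable_continuous contc smooth_continuous_on g)
  next
    show "continuous_on (UNIV \<times> cbox a b) (\<lambda>(x, p). w p *\<^sub>R G (x + l p))"
      unfolding case_prod_beta by (rule continuous_on_scaleR[OF contw contG3])
  qed auto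
  have "blinfun_apply (integral (cbox a b) (\<lambda>p. w p *\<^sub>R G (x + l p)))
      = (\<lambda>u. integral (cbox a b) (\<lambda>p. w p * dird u g (x + l p)))"
    by (rule ext, subst blinfun_apply_integral[OF integrable_continuous[OF contG2]])
      (simp add: blinfun.scaleR_left G)
  from der[unfolded this] show ?thesis by simp
qed

lemma dird_average:
  fixes g :: "'a::euclidean_space \<Rightarrow> real" and w :: "'p::euclidean_space \<Rightarrow> real" and l :: "'p \<Rightarrow> 'a"
  assumes "smooth_function g" "continuous_on (cbox a b) w" "continuous_on (cbox a b) l"
  shows "dird u (\<lambda>x. integral (cbox a b) (\<lambda>p. w p * g (x + l p))) =
         (\<lambda>x. integral (cbox a b) (\<lambda>p. w p * dird u g (x + l p)))"
  using dird_eqI[OF average_has_derivative[OF assms]] by (intro ext)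

lemma smooth_average:
  fixes g :: "'a::euclidean_space \<Rightarrow> real" and w :: "'p::euclidean_space \<Rightarrow> real" and l :: "'p \<Rightarrow> 'a"
  assumes g: "smooth_function g" and wl: "continuous_on (cbox a b) w" "continuous_on (cbox a b) l"
  shows "smooth_function (\<lambda>x. integral (cbox a b) (\<lambda>p. w p * g (x + l p)))"
proof (rule smooth_coinduct[where
      P="\<lambda>f. \<exists>g. smooth_function g \<and> f = (\<lambda>x. integral (cbox a b) (\<lambda>p. w p * g (x + l p)))"])
  show "\<exists>h. smooth_function h \<and> (\<lambda>x. integral (cbox a b) (\<lambda>p. w p * g (x + l p)))
      = (\<lambda>x. integral (cbox a b) (\<lambda>p. w p * h (x + l p)))"
    by (rule exI[of _ g]) (simp add: g)
next
  fix f :: "'a \<Rightarrow> real" and x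
  assume "\<exists>g. smooth_function g \<and> f = (\<lambda>x. integral (cbox a b) (\<lambda>p. w p * g (x + l p)))"
  then obtain g where g: "smooth_function g" and f: "f = (\<lambda>x. integral (cbox a b) (\<lambda>p. w p * g (x + l p)))" by blast
  show "f differentiable at x"
    unfolding f using average_has_derivative[OF g wl] by (rule differentiableI)
  show "\<exists>g. smooth_function g \<and> dird u f = (\<lambda>x. integral (cbox a b) (\<lambda>p. w p * g (x + l p)))" for u
    by (rule exI[of _ "dird u g"]) (simp add: f smooth_dird[OF g] dird_average[OF g wl])
qed

text \<open>The increment f(x + t v) - f(x) is the integral of the \<open>v\<close>-derivative along
  the segment. Differentiating this identity in direction \<open>u\<close> under the integral sign,
  and comparing with the same identity for the \<open>u\<close>-derivative of \<open>f\<close>,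
  gives equal integrals of the two mixed derivatives over every interval [0, t].\<close>

lemma dird_commute:
  assumes f: "smooth_function f"
  shows "dird u (dird v f) = dird v (dird u f)"
proof
  fix x
  have l: "continuous_on (cbox 0 t) (\<lambda>s. s *\<^sub>R v)" for t :: real by (intro continuous_intros)
  have FTC: "((\<lambda>s. dird v g (x + s *\<^sub>R v)) has_integral g (x + t *\<^sub>R v) - g x) (cbox 0 t)"
    if g: "smooth_function g" and t: "0 \<le> t" for g t x
  proof -
    have D: "((\<lambda>s. g (x + s *\<^sub>R v)) has_vector_derivative dird v g (x + s *\<^sub>R v)) (at s within S)" for s S
    proof -
      have "((\<lambda>s. x + s *\<^sub>R v) has_vector_derivative v) (at s within S)"
        by (auto intro!: derivative_eq_intros)
      from vector_derivative_diff_chain_within[OF this has_derivative_at_withinI[OF smooth_has_derivative[OF g]]]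
      show ?thesis by (simp add: o_def)
    qed
    have "((\<lambda>s. dird v g (x + s *\<^sub>R v)) has_integral g (x + t *\<^sub>R v) - g (x + 0 *\<^sub>R v)) {0..t}"
      by (rule fundamental_theorem_of_calculus[OF t D])
    then show ?thesis by simp
  qed
  have eq: "integral {0..t} (\<lambda>s. dird u (dird v f) (x + s *\<^sub>R v)) = integral {0..t} (\<lambda>s. dird v (dird u f) (x + s *\<^sub>R v))"
    if t: "0 \<le> t" for t :: real
  proof -
    have E: "(\<lambda>x. integral (cbox 0 t) (\<lambda>s. 1 * dird v f (x + s *\<^sub>R v))) = (\<lambda>x. f (x + t *\<^sub>R v) - f x)"
      using integral_unique[OF FTC[OF f t]] by simp
    have 1: "((\<lambda>x. x + t *\<^sub>R v) has_derivative (\<lambda>u. u)) (at x)" by (auto intro!: derivative_eq_intros)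
    have 2: "((\<lambda>x. f (x + t *\<^sub>R v) - f x) has_derivative (\<lambda>u. dird u f (x + t *\<^sub>R v) - dird u f x)) (at x)"
      by (rule has_derivative_diff[OF has_derivative_compose[OF 1 smooth_has_derivative[OF f]] smooth_has_derivative[OF f]])
    have "integral (cbox 0 t) (\<lambda>s. 1 * dird u (dird v f) (x + s *\<^sub>R v)) = dird u f (x + t *\<^sub>R v) - dird u f x"
      using fun_cong[OF dird_average[OF smooth_dird[OF f, of v] continuous_on_const[of _ 1] l[of t], where u=u], of x]
      unfolding E dird_eqI[OF 2] by simp
    also have "\<dots> = integral (cbox 0 t) (\<lambda>s. dird v (dird u f) (x + s *\<^sub>R v))"
      using integral_unique[OF FTC[OF smooth_dird[OF f] t]] by simp
    finally show ?thesis by simp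
  qed
  \<comment> \<open>The difference of the mixed derivatives along the segment is continuous and has
    vanishing integral over every [0, t]; its value at 0 is the right derivative of that
    integral.\<close>
  define k where "k = (\<lambda>s. dird u (dird v f) (x + s *\<^sub>R v) - dird v (dird u f) (x + s *\<^sub>R v))"
  have contk: "continuous_on S k" for S
    unfolding k_def
    by (intro continuous_intros smooth_continuous_on_compose[OF smooth_dird[OF smooth_dird[OF f]]])
  have int: "(\<lambda>s. dird u' (dird v' f) (x + s *\<^sub>R v)) integrable_on {0..t}" for t :: real and u' v'
    by (intro integrable_continuous_interval continuous_intros
        smooth_continuous_on_compose[OF smooth_dird[OF smooth_dird[OF f]]])
  have zero: "integral {0..t} k = 0" if "0 \<le> t" for t :: real
    unfolding k_def by (simp add: integral_diff int eq[OF that])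
  have "((\<lambda>t. integral {0..t} k) has_vector_derivative k 0) (at 0 within {0..1})"
    by (rule integral_has_vector_derivative[OF contk]) simp
  moreover have "((\<lambda>t. integral {0..t} k) has_vector_derivative 0) (at 0 within {0..1})"
    by (rule has_vector_derivative_transform[of 0 "{0..1}" _ "\<lambda>_. 0"]) (auto simp: zero)
  ultimately have "k 0 = 0"
    by (rule vector_derivative_unique_within[rotated]) (simp add: at_within_Icc_at_right)
  then show "dird u (dird v f) x = dird v (dird u f) x" by (simp add: k_def)
qed

section \<open>Convolution with a test function\<close>

abbreviation unit_box :: "'a::euclidean_space set" where
  "unit_box \<equiv> cbox (- One) One"

text \<open>Estimates use the support in the closed unit ball, while integrals are taken over the
  box around it; this keeps all domains of integration of the form \<open>cbox\<close>.\<close>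

definition test_function :: "('a::euclidean_space \<Rightarrow> real) \<Rightarrow> bool" where
  "test_function \<psi> \<longleftrightarrow> smooth_function \<psi> \<and> (\<forall>z. norm z > 1 \<longrightarrow> \<psi> z = 0)"

lemma test_function_smooth: "test_function \<psi> \<Longrightarrow> smooth_function \<psi>"
  by (simp add: test_function_def)

lemma norm_le_1_imp_unit_box:
  assumes z: "norm (z::'a::euclidean_space) \<le> 1" shows "z \<in> unit_box"
  unfolding mem_box
proof
  fix b :: 'a assume b: "b \<in> Basis"
  have "\<bar>z \<bullet> b\<bar> \<le> 1" using Basis_le_norm[OF b, of z] z by linarith
  then show "- One \<bullet> b \<le> z \<bullet> b \<and> z \<bullet> b \<le> One \<bullet> b" using b by (simp add: abs_le_iff)
qed

lemma test_function_outside: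
  assumes "test_function \<psi>" "z \<notin> unit_box" shows "\<psi> z = 0"
proof -
  have "norm z > 1" using norm_le_1_imp_unit_box[of z] assms(2) by linarith
  then show ?thesis using assms(1) by (simp add: test_function_def)
qed

lemma test_function_dird:
  assumes "test_function \<psi>" shows "test_function (dird u \<psi>)"
proof -
  have "dird u \<psi> z = 0" if "norm z > 1" for z
    by (rule dird_zero_on_open[of "- cball 0 1"]) (use assms that in \<open>auto simp: test_function_def\<close>)
  with assms show ?thesis by (auto simp: test_function_def smooth_dird)
qed

lemma test_function_mult: "test_function \<psi> \<Longrightarrow> smooth_function g \<Longrightarrow> test_function (\<lambda>z. g z * \<psi> z)"
  by (simp add: test_function_def smooth_mult)

lemma test_function_cmult: "test_function \<psi> \<Longrightarrow> test_function (\<lambda>z. c * \<psi> z)"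
  by (simp add: test_function_def smooth_cmult)

lemma test_function_bounded:
  assumes "test_function \<psi>"
  obtains C where "C \<ge> 0" "\<And>x. \<bar>\<psi> x\<bar> \<le> C"
proof -
  obtain C where C: "C \<ge> 0" "\<And>x. x \<in> cball 0 1 \<Longrightarrow> \<bar>\<psi> x\<bar> \<le> C"
    using bounded_smooth_on_compact[OF test_function_smooth[OF assms] compact_cball] by blast
  have "\<bar>\<psi> x\<bar> \<le> C" for x
    using C assms by (cases "norm x \<le> 1") (auto simp: test_function_def)
  with C(1) show thesis by (rule that)
qed

text \<open>Translation invariance: the integral of a translate of \<open>f\<close> over a large box
  does not change under small translations, and its derivative in the translation is the integral of
  \<open>dird u f\<close>.\<close>

lemma integral_dird_eq_0:
  assumes f: "test_function f"
  shows "integral unit_box (dird u f) = 0"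
proof -
  \<comment> \<open>The box of half-width 3 contains the support of every translate by a vector of
    norm less than 1.\<close>
  define F where "F = (\<lambda>x. integral (cbox (- 3 *\<^sub>R One) (3 *\<^sub>R One)) (\<lambda>z. 1 * f (x + z)))"
  have F: "F x = integral unit_box f" if x: "norm x < 1" for x
  proof -
    have xb: "\<bar>x \<bullet> b\<bar> \<le> 1" if "b \<in> Basis" for b
      using Basis_le_norm[OF that, of x] x by simp
    have sub: "unit_box \<subseteq> cbox (- 3 *\<^sub>R One + x) (3 *\<^sub>R One + x)"
    proof
      fix z :: 'a assume z: "z \<in> unit_box"
      show "z \<in> cbox (- 3 *\<^sub>R One + x) (3 *\<^sub>R One + x)"
        unfolding mem_box
      proof
        fix b :: 'a assume b: "b \<in> Basis"
        have "- 1 \<le> z \<bullet> b" "z \<bullet> b \<le> 1" using z b by (auto simp: mem_box)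
        then show "(- 3 *\<^sub>R One + x) \<bullet> b \<le> z \<bullet> b \<and> z \<bullet> b \<le> (3 *\<^sub>R One + x) \<bullet> b"
          using xb[OF b] b by (auto simp: inner_add_left inner_diff_left)
      qed
    qed
    have "f integrable_on unit_box"
      by (intro integrable_continuous smooth_continuous_on test_function_smooth f)
    then have "(f has_integral integral unit_box f) (cbox (- 3 *\<^sub>R One + x) (3 *\<^sub>R One + x))"
      by (intro has_integral_on_superset[OF integrable_integral _ sub]) (auto simp: test_function_outside[OF f])
    then have "((f \<circ> ((+) x)) has_integral integral unit_box f) (cbox (- 3 *\<^sub>R One) (3 *\<^sub>R One))"
      unfolding has_integral_shift_cbox_iff .
    then show ?thesis unfolding F_def by (simp add: o_def integral_unique)
  qed
  have "(F has_derivative (\<lambda>_. 0)) (at 0)"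
    by (rule has_derivative_transform_within_open[of "\<lambda>_. integral unit_box f" _ _ _ "ball 0 1"])
      (auto simp: F)
  then have "dird u F 0 = 0" by (simp add: dird_eqI)
  moreover have "dird u F = (\<lambda>x. integral (cbox (- 3 *\<^sub>R One) (3 *\<^sub>R One)) (\<lambda>z. 1 * dird u f (x + z)))"
    unfolding F_def by (rule dird_average[OF test_function_smooth[OF f]]) (auto intro: continuous_intros)
  ultimately have "integral (cbox (- 3 *\<^sub>R One) (3 *\<^sub>R One)) (dird u f) = 0" by simp
  moreover have "(dird u f has_integral integral unit_box (dird u f)) (cbox (- 3 *\<^sub>R One) (3 *\<^sub>R One))"
  proof (rule has_integral_on_superset[OF integrable_integral])
    show "dird u f integrable_on unit_box"
      by (intro integrable_continuous smooth_continuous_on test_function_smooth test_function_dird f)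
    show "dird u f z = 0" if "z \<notin> unit_box" for z
      using that by (rule test_function_outside[OF test_function_dird[OF f]])
    show "(unit_box :: 'a set) \<subseteq> cbox (- 3 *\<^sub>R One) (3 *\<^sub>R One)"
      unfolding subset_box by auto
  qed
  ultimately show ?thesis by (simp add: integral_unique)
qed

lemma integral_by_parts:
  assumes g: "smooth_function g" and \<psi>: "test_function \<psi>"
  shows "integral unit_box (\<lambda>z. \<psi> z * dird u g z) = - integral unit_box (\<lambda>z. dird u \<psi> z * g z)"
proof -
  have s: "smooth_function \<psi>" by (rule test_function_smooth[OF \<psi>])
  have i1: "(\<lambda>z. \<psi> z * dird u g z) integrable_on unit_box"
    by (intro integrable_continuous smooth_continuous_on smooth_mult[OF s smooth_dird[OF g]])
  have i2: "(\<lambda>z. dird u \<psi> z * g z) integrable_on unit_box"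
    by (intro integrable_continuous smooth_continuous_on smooth_mult[OF smooth_dird[OF s] g])
  have "test_function (\<lambda>z. \<psi> z * g z)"
    using test_function_mult[OF \<psi> g] by (simp add: mult.commute)
  from integral_dird_eq_0[OF this, of u] have "integral unit_box (\<lambda>z. \<psi> z * dird u g z + dird u \<psi> z * g z) = 0"
    by (simp add: dird_mult[OF smooth_differentiable[OF s] smooth_differentiable[OF g]])
  then show ?thesis by (simp add: integral_add[OF i1 i2])
qed

text \<open>Convolution with the reflected kernel at scale \<open>e\<close>, written in the rescaled
  variable, so that no factor e^(-d) appears and the domain of integration does not depend on
  \<open>e\<close>.\<close>

definition smear :: "real \<Rightarrow> ('a::euclidean_space \<Rightarrow> real) \<Rightarrow> ('a \<Rightarrow> real) \<Rightarrow> 'a \<Rightarrow> real" where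
  "smear e \<psi> g x = integral unit_box (\<lambda>z. \<psi> z * g (x + e *\<^sub>R z))"

lemma smear_integrable:
  assumes "smooth_function \<psi>" "smooth_function g"
  shows "(\<lambda>z. \<psi> z * g (x + e *\<^sub>R z)) integrable_on cbox a b"
  by (intro integrable_continuous smooth_continuous_on smooth_mult[OF assms(1) smooth_affine[OF assms(2)]])

lemma smooth_smear:
  assumes "smooth_function \<psi>" "smooth_function g"
  shows "smooth_function (smear e \<psi> g)"
  unfolding smear_def[abs_def]
  by (rule smooth_average[OF assms(2) smooth_continuous_on[OF assms(1)]]) (intro continuous_intros)

lemma dird_smear:
  assumes "smooth_function \<psi>" "smooth_function g"
  shows "dird u (smear e \<psi> g) = smear e \<psi> (dird u g)"
  unfolding smear_def[abs_def]
  by (rule dird_average[OF assms(2) smooth_continuous_on[OF assms(1)]]) (intro continuous_intros)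

text \<open>Integration by parts moves the derivative onto the kernel at the price of a factor 1/e.
  The negative powers of the scale in the later estimates originate here.\<close>

lemma smear_dird:
  assumes \<psi>: "test_function \<psi>" and g: "smooth_function g" and e: "e \<noteq> 0"
  shows "smear e \<psi> (dird u g) = smear e (\<lambda>z. - (1 / e) * dird u \<psi> z) g"
proof
  fix x
  have "e * smear e \<psi> (dird u g) x = integral unit_box (\<lambda>z. \<psi> z * dird u (\<lambda>z. g (x + e *\<^sub>R z)) z)"
    unfolding smear_def dird_affine[OF smooth_differentiable[OF g]]
    by (subst integral_mult_right[symmetric]) (simp add: ac_simps)
  also have "\<dots> = - integral unit_box (\<lambda>z. dird u \<psi> z * g (x + e *\<^sub>R z))"
    by (rule integral_by_parts[OF smooth_affine[OF g] \<psi>])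
  also have "\<dots> = e * smear e (\<lambda>z. - (1 / e) * dird u \<psi> z) g x"
    unfolding smear_def using e by (subst integral_mult_right[symmetric]) (simp add: ac_simps)
  finally show "smear e \<psi> (dird u g) x = smear e (\<lambda>z. - (1 / e) * dird u \<psi> z) g x"
    using e by simp
qed

lemma smear_add_right:
  assumes "smooth_function \<psi>" "smooth_function g" "smooth_function h"
  shows "smear e \<psi> (\<lambda>x. g x + h x) x = smear e \<psi> g x + smear e \<psi> h x"
  unfolding smear_def using smear_integrable[OF assms(1,2)] smear_integrable[OF assms(1,3)]
  by (simp add: distrib_left integral_add)

lemma smear_cmult_right: "smear e \<psi> (\<lambda>x. c * g x) x = c * smear e \<psi> g x"
  unfolding smear_def by (subst integral_mult_right[symmetric]) (simp add: ac_simps)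

lemma smear_cmult_left: "smear e (\<lambda>x. c * \<psi> x) g x = c * smear e \<psi> g x"
  unfolding smear_def by (subst integral_mult_right[symmetric]) (simp add: ac_simps)

lemma smear_add_left:
  assumes "smooth_function \<psi>" "smooth_function \<theta>" "smooth_function g"
  shows "smear e (\<lambda>z. \<psi> z + \<theta> z) g x = smear e \<psi> g x + smear e \<theta> g x"
  unfolding smear_def using smear_integrable[OF assms(1,3)] smear_integrable[OF assms(2,3)]
  by (simp add: distrib_right integral_add)

text \<open>The weight has to dominate the integrand on the ball only; outside of it the kernel
  vanishes and nonnegativity of \<open>w\<close> suffices. The two uses take a constant weight and a
  multiple of \<open>moll\<close>.\<close>

lemma smear_weighted_bound:
  assumes \<psi>: "test_function \<psi>" and g: "smooth_function g"
    and w: "w integrable_on unit_box" and bnd: "\<And>z. norm z \<le> 1 \<Longrightarrow> \<bar>\<psi> z\<bar> * \<bar>g (x + e *\<^sub>R z)\<bar> \<le> w z"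
    and w0: "\<And>z. z \<in> unit_box \<Longrightarrow> 0 \<le> w z"
  shows "\<bar>smear e \<psi> g x\<bar> \<le> integral unit_box w"
  unfolding smear_def real_norm_def[symmetric]
proof (rule integral_norm_bound_integral[OF smear_integrable[OF test_function_smooth[OF \<psi>] g] w])
  fix z :: 'a assume "z \<in> unit_box"
  then show "norm (\<psi> z * g (x + e *\<^sub>R z)) \<le> w z"
    using bnd[of z] w0[of z] \<psi> by (cases "norm z \<le> 1") (auto simp: test_function_def abs_mult)
qed

lemma integral_unit_box_const: "integral unit_box (\<lambda>_::'a::euclidean_space. c::real) = c * 2 ^ DIM('a)"
proof -
  have "(unit_box :: 'a set) \<noteq> {}" by (auto simp: box_ne_empty)
  then show ?thesis by (simp add: integral_const content_cbox_if)
qed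

text \<open>The factor \<open>2 ^ DIM('a)\<close> is the volume of \<open>unit_box\<close>.\<close>

lemma smear_bound:
  fixes g :: "'a::euclidean_space \<Rightarrow> real"
  assumes "test_function \<psi>" "smooth_function g" "\<And>z. \<bar>\<psi> z\<bar> \<le> C" "0 \<le> C" "0 \<le> e" "0 \<le> B"
    and B: "\<And>y. y \<in> cball x e \<Longrightarrow> \<bar>g y\<bar> \<le> B"
  shows "\<bar>smear e \<psi> g x\<bar> \<le> C * B * 2 ^ DIM('a)"
proof -
  have "\<bar>smear e \<psi> g x\<bar> \<le> integral unit_box (\<lambda>_::'a. C * B)"
  proof (rule smear_weighted_bound[OF assms(1,2)])
    fix z :: 'a assume "norm z \<le> 1"
    then have "x + e *\<^sub>R z \<in> cball x e" using assms(5) by (simp add: dist_norm mult_left_le)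
    then show "\<bar>\<psi> z\<bar> * \<bar>g (x + e *\<^sub>R z)\<bar> \<le> C * B"
      by (intro mult_mono assms B) auto
  qed (use assms in auto)
  then show ?thesis by (simp only: integral_unit_box_const)
qed

definition moll :: "'a::euclidean_space \<Rightarrow> real" where
  "moll z = inverse (integral unit_box (bump (0::'a) (1/2))) * bump 0 (1/2) z"

lemma test_function_bump: "test_function (bump 0 (1/2))"
  by (auto simp: test_function_def smooth_bump intro: bump_eq_0)

lemma integral_bump_pos: "0 < integral unit_box (bump (0::'a::euclidean_space) (1/2))"
proof -
  have i: "bump (0::'a) (1/2) integrable_on unit_box"
    by (intro integrable_continuous smooth_continuous_on smooth_bump)
  have "0 \<le> integral unit_box (bump (0::'a) (1/2))"
    by (rule integral_nonneg[OF i]) (simp add: bump_bounds)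
  \<comment> \<open>A nonnegative continuous function with integral 0 vanishes, whereas the bump is
    1 at the origin.\<close>
  moreover have "integral unit_box (bump (0::'a) (1/2)) \<noteq> 0"
  proof
    assume 0: "integral unit_box (bump (0::'a) (1/2)) = 0"
    have c: "continuous_on unit_box (bump (0::'a) (1/2))" by (intro smooth_continuous_on smooth_bump)
    have h: "(bump (0::'a) (1/2) has_integral 0) unit_box" using integrable_integral[OF i] 0 by simp
    have ne: "box (- One) (One::'a) \<noteq> {}" by (auto simp: box_ne_empty)
    have "bump (0::'a) (1/2) 0 = 0"
      by (rule has_integral_0_cbox_imp_0[OF c bump_bounds(1) h ne]) (auto simp: mem_box)
    then show False using bump_eq_1[of "1/2" 0 "0::'a"] by simp
  qed
  ultimately show ?thesis by simp
qed

lemma test_function_moll: "test_function moll"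
  unfolding moll_def[abs_def] by (rule test_function_cmult[OF test_function_bump])

lemma smooth_moll: "smooth_function moll"
  by (rule test_function_smooth[OF test_function_moll])

lemma moll_nonneg: "0 \<le> moll (z::'a::euclidean_space)"
  unfolding moll_def using less_imp_le[OF integral_bump_pos[where 'a='a]] by (intro mult_nonneg_nonneg) (auto simp: bump_bounds)

lemma moll_integrable: "moll integrable_on unit_box"
  by (intro integrable_continuous smooth_continuous_on smooth_moll)

lemma integral_moll: "integral unit_box (moll :: 'a::euclidean_space \<Rightarrow> real) = 1"
  unfolding moll_def integral_mult_right using less_imp_neq[OF integral_bump_pos[where 'a='a]] by simp

text \<open>Nonnegativity and total integral 1 give the constant 1, in contrast with a general
  kernel. For this reason mollification of currents increases neither mass nor flat norm.\<close>

lemma moll_average_bound: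
  fixes g :: "'a::euclidean_space \<Rightarrow> real"
  assumes g: "smooth_function g" and e: "0 \<le> e" and B: "\<And>y. y \<in> cball x e \<Longrightarrow> \<bar>g y\<bar> \<le> B"
  shows "\<bar>smear e moll g x\<bar> \<le> B"
proof -
  have B0: "0 \<le> B" using B[of x] e by simp
  have "\<bar>smear e moll g x\<bar> \<le> integral unit_box (\<lambda>z::'a. moll z * B)"
  proof (rule smear_weighted_bound[OF test_function_moll g])
    fix z :: 'a assume "norm z \<le> 1"
    then have "x + e *\<^sub>R z \<in> cball x e" using e by (simp add: dist_norm mult_left_le)
    then show "\<bar>moll z\<bar> * \<bar>g (x + e *\<^sub>R z)\<bar> \<le> moll z * B"
      using moll_nonneg[of z] by (intro mult_mono B) auto
  qed (auto intro!: integrable_on_mult_left moll_integrable mult_nonneg_nonneg moll_nonneg B0)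
  then show ?thesis by (simp add: integral_moll)
qed

section \<open>The homotopy between a function and its mollification\<close>

text \<open>The component along \<open>b\<close> of the displacement e z enters as a weight; the
  average is over the kernel variable \<open>z\<close> and over the time in [0, 1] at which the
  segment from x to x + e z is visited. Parameters are pairs, so that a single integral over a box
  is involved.\<close>

definition homotopy_average :: "real \<Rightarrow> 'a::euclidean_space \<Rightarrow> ('a \<Rightarrow> real) \<Rightarrow> 'a \<Rightarrow> real" where
  "homotopy_average e b g x =
     integral (cbox (- One, 0) (One, 1)) (\<lambda>p. moll (fst p) * (e * (fst p \<bullet> b)) * g (x + (snd p * e) *\<^sub>R fst p))"

lemma continuous_on_moll: "continuous_on S f \<Longrightarrow> continuous_on S (\<lambda>p. moll (f p))"
  by (rule smooth_continuous_on_compose[OF smooth_moll])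

lemma homotopy_weight_continuous:
  "continuous_on S (\<lambda>p::'a::euclidean_space \<times> real. moll (fst p) * (e * (fst p \<bullet> b)))"
  "continuous_on S (\<lambda>p::'a::euclidean_space \<times> real. (snd p * e) *\<^sub>R fst p)"
  by (intro continuous_intros continuous_on_moll)+

lemma smooth_homotopy_average: "smooth_function g \<Longrightarrow> smooth_function (homotopy_average e b g)"
  unfolding homotopy_average_def[abs_def]
  by (rule smooth_average[OF _ homotopy_weight_continuous])

lemma dird_homotopy_average:
  "smooth_function g \<Longrightarrow> dird u (homotopy_average e b g) = homotopy_average e b (dird u g)"
  unfolding homotopy_average_def[abs_def]
  by (rule dird_average[OF _ homotopy_weight_continuous])

lemma homotopy_integrand_continuous:
  assumes "smooth_function g"
  shows "continuous_on S (\<lambda>p. moll (fst p) * (e * (fst p \<bullet> b)) * g (x + (snd p * e) *\<^sub>R fst p))"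
  by (intro continuous_intros continuous_on_moll smooth_continuous_on_compose[OF assms])

lemma homotopy_average_add:
  assumes "smooth_function g" "smooth_function h"
  shows "homotopy_average e b (\<lambda>x. g x + h x) x = homotopy_average e b g x + homotopy_average e b h x"
  unfolding homotopy_average_def distrib_left
  by (intro integral_add integrable_continuous homotopy_integrand_continuous assms)

lemma homotopy_average_cmult: "homotopy_average e b (\<lambda>x. c * g x) x = c * homotopy_average e b g x"
  unfolding homotopy_average_def by (subst integral_mult_right[symmetric]) (simp add: ac_simps)

lemma sum_homotopy_average:
  assumes "\<And>b. b \<in> Basis \<Longrightarrow> smooth_function (g b)"
  shows "(\<Sum>b\<in>Basis. homotopy_average e b (g b) x) =
    integral (cbox (- One, 0) (One, 1)) (\<lambda>p. moll (fst p) * e * (\<Sum>b\<in>Basis. (fst p \<bullet> b) * g b (x + (snd p * e) *\<^sub>R fst p)))"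
  unfolding homotopy_average_def
  by (subst integral_sum[symmetric])
    (use homotopy_integrand_continuous[OF assms] in \<open>auto intro!: integrable_continuous simp: sum_distrib_left mult.assoc\<close>)

text \<open>For fixed \<open>z\<close> the sum over the basis is the derivative of \<open>g\<close>
  along the segment from x to x + e z. The fundamental theorem of calculus gives the increment of
  \<open>g\<close>, and averaging over \<open>z\<close> gives the mollified value minus the
  value.\<close>

lemma sum_homotopy_average_dird:
  fixes g :: "'a::euclidean_space \<Rightarrow> real"
  assumes g: "smooth_function g"
  shows "(\<Sum>b\<in>Basis. homotopy_average e b (dird b g) x) = smear e moll g x - g x"
proof -
  define f where "f = (\<lambda>p::'a \<times> real. moll (fst p) * e * (\<Sum>b\<in>Basis. (fst p \<bullet> b) * dird b g (x + (snd p * e) *\<^sub>R fst p)))"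
  have contf: "continuous_on S f" for S
    unfolding f_def by (intro continuous_intros continuous_on_moll
      smooth_continuous_on_compose[OF smooth_dird[OF g]])
  have inner: "integral (cbox 0 1) (\<lambda>t. f (z, t)) = moll z * g (x + e *\<^sub>R z) - moll z * g x" for z
  proof -
    have f: "f (z, t) = moll z * (e * dird z g (x + (t * e) *\<^sub>R z))" for t
      unfolding f_def by (simp add: dird_expand[OF smooth_differentiable[OF g], of z])
    have D: "((\<lambda>t. moll z * g (x + (t * e) *\<^sub>R z)) has_vector_derivative f (z, t)) (at t within S)" for t S
    proof -
      have 1: "((\<lambda>t. x + (t * e) *\<^sub>R z) has_vector_derivative e *\<^sub>R z) (at t within S)"
        by (auto intro!: derivative_eq_intros)
      have "((\<lambda>t. g (x + (t * e) *\<^sub>R z)) has_vector_derivative dird (e *\<^sub>R z) g (x + (t * e) *\<^sub>R z)) (at t within S)"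
        using vector_derivative_diff_chain_within[OF 1 has_derivative_at_withinI[OF smooth_has_derivative[OF g]]]
        by (simp add: o_def)
      moreover have "dird (e *\<^sub>R z) g y = e * dird z g y" for y
        using linear_scale[OF linear_dird[OF smooth_differentiable[OF g, of y]], of e z] by simp
      ultimately show ?thesis
        unfolding f by (auto intro!: derivative_eq_intros)
    qed
    have "((\<lambda>t. f (z, t)) has_integral moll z * g (x + (1 * e) *\<^sub>R z) - moll z * g (x + (0 * e) *\<^sub>R z)) {0..1}"
      by (rule fundamental_theorem_of_calculus[OF _ D]) simp
    then show ?thesis by (simp add: integral_unique)
  qed
  have "(\<Sum>b\<in>Basis. homotopy_average e b (dird b g) x) = integral (cbox (- One, 0) (One, 1)) f"
    unfolding f_def by (rule sum_homotopy_average[OF smooth_dird[OF g]])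
  also have "\<dots> = integral unit_box (\<lambda>z. integral (cbox 0 1) (\<lambda>t. f (z, t)))"
    by (rule integral_prod_continuous[OF contf])
  also have "\<dots> = integral unit_box (\<lambda>z. moll z * g (x + e *\<^sub>R z) - moll z * g x)"
    unfolding inner ..
  also have "\<dots> = smear e moll g x - integral unit_box (\<lambda>z::'a. moll z * g x)"
    unfolding smear_def
    by (intro integral_diff smear_integrable[OF smooth_moll g]
        integrable_on_mult_left moll_integrable)
  finally show ?thesis by (simp add: integral_moll)
qed

text \<open>The sum over the basis is estimated as a whole: it is an average of values in a single
  direction \<open>z\<close> of norm at most 1. This avoids a dimensional factor and matches the
  comass of a contraction.\<close>

lemma homotopy_bound:
  fixes G :: "'a::euclidean_space \<Rightarrow> 'a \<Rightarrow> real"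
  assumes G: "\<And>b. b \<in> Basis \<Longrightarrow> smooth_function (G b)" and e: "0 \<le> e"
    and bnd: "\<And>z y. norm z \<le> 1 \<Longrightarrow> \<bar>\<Sum>b\<in>Basis. (z \<bullet> b) * G b y\<bar> \<le> B"
  shows "\<bar>\<Sum>b\<in>Basis. homotopy_average e b (G b) x\<bar> \<le> e * B"
proof -
  have B0: "0 \<le> B" using bnd[of 0 x] by simp
  have cm: "continuous_on S (\<lambda>p::'a \<times> real. moll (fst p) * (e * B))" for S
    by (intro continuous_intros continuous_on_moll)
  have eq: "(\<Sum>b\<in>Basis. homotopy_average e b (G b) x) = integral (cbox (- One, 0) (One, 1))
      (\<lambda>p. moll (fst p) * e * (\<Sum>b\<in>Basis. (fst p \<bullet> b) * G b (x + (snd p * e) *\<^sub>R fst p)))"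
    by (rule sum_homotopy_average) (rule G)
  have "\<bar>\<Sum>b\<in>Basis. homotopy_average e b (G b) x\<bar> \<le> integral (cbox (- One, 0) (One, 1)) (\<lambda>p::'a \<times> real. moll (fst p) * (e * B))"
    unfolding eq real_norm_def[symmetric]
  proof (rule integral_norm_bound_integral)
    show "(\<lambda>p. moll (fst p) * e * (\<Sum>b\<in>Basis. (fst p \<bullet> b) * G b (x + (snd p * e) *\<^sub>R fst p))) integrable_on cbox (- One, 0) (One, 1)"
      by (intro integrable_continuous continuous_intros continuous_on_moll
        smooth_continuous_on_compose[OF G])
    show "(\<lambda>p::'a \<times> real. moll (fst p) * (e * B)) integrable_on cbox (- One, 0) (One, 1)"
      by (intro integrable_continuous cm)
    fix p :: "'a \<times> real"
    show "norm (moll (fst p) * e * (\<Sum>b\<in>Basis. (fst p \<bullet> b) * G b (x + (snd p * e) *\<^sub>R fst p))) \<le> moll (fst p) * (e * B)"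
    proof (cases "norm (fst p) \<le> 1")
      case True
      then show ?thesis using moll_nonneg[of "fst p"] e bnd[OF True]
        by (simp add: abs_mult mult.assoc mult_left_mono)
    next
      case False
      then have "moll (fst p) = 0" using test_function_moll[where 'a='a] by (simp add: test_function_def)
      then show ?thesis by simp
    qed
  qed
  also have "\<dots> = integral unit_box (\<lambda>z::'a. integral (cbox 0 1) (\<lambda>t::real. moll z * (e * B)))"
    by (subst integral_prod_continuous[OF cm]) simp
  also have "\<dots> = e * B" by (simp add: integral_moll)
  finally show ?thesis .
qed

section \<open>Exterior algebra and exterior calculus of smooth forms\<close>

section \<open>Alternating maps\<close>

text \<open>Antisymmetrization without normalization; the factorials are carried explicitly, so that
  \<open>Alt\<close> is a plain signed sum over permutations.\<close>

definition Alt :: "nat \<Rightarrow> ((nat \<Rightarrow> 'a) \<Rightarrow> real) \<Rightarrow> (nat \<Rightarrow> 'a) \<Rightarrow> real" where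
  "Alt k f v = (\<Sum>p | p permutes {..<k}. of_int (sign p) * f (v \<circ> p))"

lemma permutes_lessThan_permutation: "p permutes {..<k::nat} \<Longrightarrow> permutation p"
  by (rule permutes_imp_permutation[OF finite_lessThan])

lemma sign_compose_permutes:
  "p permutes {..<k::nat} \<Longrightarrow> q permutes {..<k} \<Longrightarrow> sign (p \<circ> q) = sign p * sign q"
  by (intro sign_compose permutes_lessThan_permutation)

lemma sign_square: "(of_int (sign p) :: real) * of_int (sign p) = 1"
  by (simp add: sign_def)

lemma Alt_permute:
  assumes q: "q permutes {..<k}"
  shows "Alt k f (v \<circ> q) = of_int (sign q) * Alt k f v"
proof -
  have "Alt k f v = (\<Sum>p | p permutes {..<k}. of_int (sign (q \<circ> p)) * f (v \<circ> (q \<circ> p)))"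
    unfolding Alt_def by (rule setum_permutations_compose_left[OF q])
  also have "\<dots> = (\<Sum>p | p permutes {..<k}. of_int (sign q) * (of_int (sign p) * f (v \<circ> q \<circ> p)))"
    by (rule sum.cong) (auto simp: sign_compose_permutes[OF q] o_assoc)
  also have "\<dots> = of_int (sign q) * Alt k f (v \<circ> q)"
    by (simp add: Alt_def sum_distrib_left)
  finally show ?thesis using sign_square[of q] by (simp add: mult.assoc[symmetric])
qed

lemma Alt_compose:
  assumes q: "q permutes {..<k}"
  shows "Alt k (\<lambda>w. f (w \<circ> q)) v = of_int (sign q) * Alt k f v"
proof -
  have "Alt k f v = (\<Sum>p | p permutes {..<k}. of_int (sign (p \<circ> q)) * f (v \<circ> (p \<circ> q)))"
    unfolding Alt_def by (rule sum_permutations_compose_right[OF q])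
  also have "\<dots> = (\<Sum>p | p permutes {..<k}. of_int (sign q) * (of_int (sign p) * f (v \<circ> p \<circ> q)))"
    by (rule sum.cong) (auto simp: sign_compose_permutes[OF _ q] o_assoc)
  also have "\<dots> = of_int (sign q) * Alt k (\<lambda>w. f (w \<circ> q)) v"
    by (simp add: Alt_def sum_distrib_left)
  finally show ?thesis using sign_square[of q] by (simp add: mult.assoc[symmetric])
qed

lemma Alt_add: "Alt k (\<lambda>w. f w + g w) v = Alt k f v + Alt k g v"
  by (simp add: Alt_def distrib_left sum.distrib)

lemma Alt_cmult: "Alt k (\<lambda>w. c * f w) v = c * Alt k f v"
  by (simp add: Alt_def sum_distrib_left mult.left_commute)

lemma Alt_sum: "Alt k (\<lambda>w. \<Sum>i\<in>I. f i w) v = (\<Sum>i\<in>I. Alt k (f i) v)"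
  unfolding Alt_def by (subst sum.swap) (simp add: sum_distrib_left)

text \<open>An inner signed sum over permutations is absorbed by the outer antisymmetrization, each
  term contributing equally. The map \<open>h\<close> embeds the inner permutations, for instance as
  permutations of a block of the arguments.\<close>

lemma Alt_average:
  assumes "\<And>q. q \<in> Q \<Longrightarrow> h q permutes {..<k} \<and> sign (h q) = sign q"
  shows "Alt k (\<lambda>w. \<Sum>q\<in>Q. of_int (sign q) * f (w \<circ> h q)) v = real (card Q) * Alt k f v"
proof -
  have "Alt k (\<lambda>w. \<Sum>q\<in>Q. of_int (sign q) * f (w \<circ> h q)) v
      = (\<Sum>q\<in>Q. of_int (sign q) * (of_int (sign (h q)) * Alt k f v))"
    unfolding Alt_sum Alt_cmult by (intro sum.cong refl) (simp add: Alt_compose assms)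
  also have "\<dots> = (\<Sum>q\<in>Q. Alt k f v)"
    using assms by (intro sum.cong refl) (simp add: mult.assoc[symmetric] sign_square)
  finally show ?thesis by simp
qed

text \<open>Multilinearity without alternation, for objects that still have to be antisymmetrized,
  such as tensor products and \<open>dform\<close>.\<close>

definition multilin :: "nat \<Rightarrow> 'a::euclidean_space covector \<Rightarrow> bool" where
  "multilin k f \<longleftrightarrow> (\<forall>v w. (\<forall>i<k. v i = w i) \<longrightarrow> f v = f w) \<and> (\<forall>v. \<forall>i<k. linear (\<lambda>x. f (v(i := x))))"

lemma covectors_multilin: "\<phi> \<in> covectors k \<Longrightarrow> multilin k \<phi>"
  by (simp add: covectors_def multilin_def)

lemma multilin_cong: "multilin k f \<Longrightarrow> (\<And>i. i < k \<Longrightarrow> v i = w i) \<Longrightarrow> f v = f w"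
  by (simp add: multilin_def)

lemma multilin_linear: "multilin k f \<Longrightarrow> i < k \<Longrightarrow> linear (\<lambda>x. f (v(i := x)))"
  by (simp add: multilin_def)

lemma covectorsI:
  assumes "multilin k f" "\<And>v i j. i < k \<Longrightarrow> j < k \<Longrightarrow> i \<noteq> j \<Longrightarrow> v i = v j \<Longrightarrow> f v = 0"
  shows "f \<in> covectors k"
  using assms by (auto simp: covectors_def multilin_def)

lemma linear_cmult: "linear f \<Longrightarrow> linear (\<lambda>x. (c::real) * f x)"
  using linear_compose_scale_right[of f c] by simp

lemma Alt_multilin:
  assumes f: "multilin k f" shows "multilin k (Alt k f)"
  unfolding multilin_def
proof (intro conjI allI impI)
  fix v w :: "nat \<Rightarrow> 'a" assume vw: "\<forall>i<k. v i = w i"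
  have "f (v \<circ> p) = f (w \<circ> p)" if "p permutes {..<k}" for p
    using permutes_in_image[OF that] vw by (intro multilin_cong[OF f]) auto
  then show "Alt k f v = Alt k f w" unfolding Alt_def by (intro sum.cong) auto
next
  fix v :: "nat \<Rightarrow> 'a" and i assume i: "i < k"
  have "linear (\<lambda>x. of_int (sign p) * f (v(i := x) \<circ> p))" if p: "p permutes {..<k}" for p
  proof -
    have "v(i := x) \<circ> p = (v \<circ> p)(inv p i := x)" for x
      by (auto simp: fun_eq_iff permutes_inverses[OF p])
    moreover have "inv p i < k" using permutes_in_image[OF permutes_inv[OF p], of i] i by simp
    ultimately show ?thesis by (simp add: linear_cmult[OF multilin_linear[OF f]])
  qed
  then show "linear (\<lambda>x. Alt k f (v(i := x)))"
    unfolding Alt_def by (intro linear_compose_sum) auto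
qed

lemma transpose_permutes_lessThan: "i < k \<Longrightarrow> j < k \<Longrightarrow> Transposition.transpose i j permutes {..<k::nat}"
  by (rule permutes_swap_id) auto

lemma Alt_covector:
  assumes f: "multilin k f" shows "Alt k f \<in> covectors k"
proof (rule covectorsI[OF Alt_multilin[OF f]])
  fix v :: "nat \<Rightarrow> 'a" and i j assume ij: "i < k" "j < k" "i \<noteq> j" "v i = v j"
  have "v \<circ> Transposition.transpose i j = v"
    using ij(4) by (auto simp: fun_eq_iff Transposition.transpose_def)
  with Alt_permute[OF transpose_permutes_lessThan[OF ij(1,2)], of f v]
  show "Alt k f v = 0" using ij(3) by (simp add: sign_swap_id)
qed

text \<open>Polarization: as a function of the two slots the covector vanishes on the diagonal, and
  expanding it at \<open>v i + v j\<close> leaves the sum of the two mixed terms.\<close>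

lemma covector_transpose:
  assumes \<phi>: "\<phi> \<in> covectors k" and ij: "i < k" "j < k" "i \<noteq> j"
  shows "\<phi> (v \<circ> Transposition.transpose i j) = - \<phi> v"
proof -
  define F where "F x y = \<phi> (v(i := x, j := y))" for x y
  have alt: "F x x = 0" for x
    using \<phi> ij unfolding F_def covectors_def by simp
  have lin2: "F x (y + z) = F x y + F x z" for x y z
    unfolding F_def using linear_add[OF multilin_linear[OF covectors_multilin[OF \<phi>] ij(2)]] .
  have tw: "F x y = \<phi> (v(j := y, i := x))" for x y
    unfolding F_def using ij(3) by (simp add: fun_upd_twist)
  have lin1: "F (y + z) x = F y x + F z x" for x y z
    unfolding tw using linear_add[OF multilin_linear[OF covectors_multilin[OF \<phi>] ij(1)]] .
  have "F (v i + v j) (v i + v j) = F (v i) (v i) + F (v i) (v j) + F (v j) (v i) + F (v j) (v j)"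
    by (simp only: lin1 lin2 add.assoc add.commute add.left_commute)
  then have "F (v j) (v i) = - F (v i) (v j)"
    using alt[of "v i + v j"] alt[of "v i"] alt[of "v j"] by linarith
  moreover have "v \<circ> Transposition.transpose i j = v(i := v j, j := v i)"
    using ij(3) by (auto simp: fun_eq_iff Transposition.transpose_def)
  ultimately show ?thesis by (simp add: F_def)
qed

lemma covector_permute:
  assumes \<phi>: "\<phi> \<in> covectors k" and p: "p permutes {..<k}"
  shows "\<phi> (v \<circ> p) = of_int (sign p) * \<phi> v"
  using p finite_lessThan[of k]
proof (induction arbitrary: v rule: permutes_induct)
  case id
  then show ?case by (simp add: sign_id)
next
  case (swap a b p)
  have ab: "a < k" "b < k" using swap(1,2) by auto
  have s: "sign (Transposition.transpose a b \<circ> p) = - sign p"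
    using sign_compose_permutes[OF transpose_permutes_lessThan[OF ab] swap.hyps(4)] swap(3)
    by (simp add: sign_swap_id)
  have "\<phi> (v \<circ> (Transposition.transpose a b \<circ> p)) = of_int (sign p) * \<phi> (v \<circ> Transposition.transpose a b)"
    unfolding o_assoc by (rule swap.IH)
  then show ?case
    by (simp only: covector_transpose[OF \<phi> ab swap(3)] s of_int_minus mult_minus_left mult_minus_right)
qed

lemma Alt_of_covector:
  assumes \<phi>: "\<phi> \<in> covectors k" shows "Alt k \<phi> v = fact k * \<phi> v"
proof -
  have "Alt k \<phi> v = (\<Sum>p | p permutes {..<k}. \<phi> v)"
    unfolding Alt_def by (rule sum.cong) (simp_all add: covector_permute[OF \<phi>] mult.assoc[symmetric] sign_square)
  then show ?thesis by (simp add: card_permutations)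
qed

lemma covectors_add:
  assumes "\<phi> \<in> covectors k" "\<psi> \<in> covectors k"
  shows "(\<lambda>v. \<phi> v + \<psi> v) \<in> covectors k"
  using assms unfolding covectors_def by (auto intro!: linear_compose_add) (metis+)

lemma covectors_cmult: "\<phi> \<in> covectors k \<Longrightarrow> (\<lambda>v. c * \<phi> v) \<in> covectors k"
  unfolding covectors_def by (auto intro!: linear_cmult)

lemma covectors_zero: "(\<lambda>v. 0) \<in> covectors k"
  unfolding covectors_def by (auto intro!: linear_zero)

lemma covectors_sum: "(\<And>i. i \<in> I \<Longrightarrow> \<phi> i \<in> covectors k) \<Longrightarrow> (\<lambda>v. \<Sum>i\<in>I. \<phi> i v) \<in> covectors k"
  by (induction I rule: infinite_finite_induct) (auto intro: covectors_add covectors_zero)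

section \<open>Expansion in coordinates and comass\<close>

text \<open>All tuples of basis vectors, not only increasing ones, which avoids orderings of the
  basis. Entries from \<open>m\<close> on are fixed by extensionality, so that the set is
  finite.\<close>

definition tuples :: "nat \<Rightarrow> (nat \<Rightarrow> 'a::euclidean_space) set" where
  "tuples m = PiE {..<m} (\<lambda>_. Basis)"

lemma finite_tuples: "finite (tuples m)"
  unfolding tuples_def by (intro finite_PiE) auto

lemma multilin_expand:
  assumes \<phi>: "multilin m \<phi>"
  shows "\<phi> v = (\<Sum>I\<in>tuples m. (\<Prod>k<m. v k \<bullet> I k) * \<phi> I)"
proof -
  \<comment> \<open>After \<open>k\<close> steps the first \<open>k\<close> arguments have been
    replaced by basis vectors and the others are still those of \<open>v\<close>.\<close>
  have "k \<le> m \<Longrightarrow> \<phi> v = (\<Sum>I\<in>tuples k. (\<Prod>j<k. v j \<bullet> I j) * \<phi> (\<lambda>j. if j < k then I j else v j))" for k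
  proof (induction k)
    case 0
    then show ?case by (simp add: tuples_def)
  next
    case (Suc k)
    then have k: "k < m" by simp
    have step: "\<phi> (\<lambda>j. if j < k then I j else v j)
        = (\<Sum>b\<in>Basis. (v k \<bullet> b) * \<phi> (\<lambda>j. if j < Suc k then (I(k := b)) j else v j))" for I
    proof -
      let ?w = "\<lambda>j. if j < k then I j else v j"
      have "?w = ?w(k := (\<Sum>b\<in>Basis. (v k \<bullet> b) *\<^sub>R b))"
        by (simp add: euclidean_representation fun_eq_iff)
      then have "\<phi> ?w = \<phi> (?w(k := (\<Sum>b\<in>Basis. (v k \<bullet> b) *\<^sub>R b)))" by (rule arg_cong)
      also have "\<dots> = (\<Sum>b\<in>Basis. (v k \<bullet> b) * \<phi> (?w(k := b)))"
        by (simp only: linear_sum[OF multilin_linear[OF \<phi> k]] linear_scale[OF multilin_linear[OF \<phi> k]] real_scaleR_def)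
      also have "\<dots> = (\<Sum>b\<in>Basis. (v k \<bullet> b) * \<phi> (\<lambda>j. if j < Suc k then (I(k := b)) j else v j))"
        by (intro sum.cong refl arg_cong[where f="\<lambda>w. _ * \<phi> w"]) (auto simp: fun_eq_iff less_Suc_eq)
      finally show ?thesis .
    qed
    have t: "tuples (Suc k) = (\<lambda>(y, g). g(k := y)) ` (Basis \<times> tuples k)"
      unfolding tuples_def lessThan_Suc by (rule PiE_insert_eq)
    have inj: "inj_on (\<lambda>(y, g). g(k := y)) (Basis \<times> (tuples k :: (nat \<Rightarrow> 'a) set))"
      unfolding tuples_def using inj_combinator[of k "{..<k}" "\<lambda>_. Basis"] by simp
    have pr: "(\<Prod>j<Suc k. v j \<bullet> (I(k := b)) j) = (\<Prod>j<k. v j \<bullet> I j) * (v k \<bullet> b)" for I b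
    proof -
      have "(\<Prod>j<k. v j \<bullet> (I(k := b)) j) = (\<Prod>j<k. v j \<bullet> I j)" by (rule prod.cong) auto
      then show ?thesis by simp
    qed
    have "(\<Sum>I\<in>tuples (Suc k). (\<Prod>j<Suc k. v j \<bullet> I j) * \<phi> (\<lambda>j. if j < Suc k then I j else v j))
      = (\<Sum>(b, I)\<in>Basis \<times> tuples k. (\<Prod>j<Suc k. v j \<bullet> (I(k := b)) j) * \<phi> (\<lambda>j. if j < Suc k then (I(k := b)) j else v j))"
      unfolding t by (subst sum.reindex[OF inj], rule sum.cong) (auto simp: o_def)
    also have "\<dots> = (\<Sum>b\<in>Basis. \<Sum>I\<in>tuples k. (\<Prod>j<k. v j \<bullet> I j) * ((v k \<bullet> b) * \<phi> (\<lambda>j. if j < Suc k then (I(k := b)) j else v j)))"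
      unfolding sum.cartesian_product[symmetric] pr mult.assoc ..
    also have "\<dots> = (\<Sum>I\<in>tuples k. (\<Prod>j<k. v j \<bullet> I j) * \<phi> (\<lambda>j. if j < k then I j else v j))"
      unfolding step sum_distrib_left by (rule sum.swap)
    finally show ?case using Suc by simp
  qed
  from this[of m] have "\<phi> v = (\<Sum>I\<in>tuples m. (\<Prod>j<m. v j \<bullet> I j) * \<phi> (\<lambda>j. if j < m then I j else v j))" by simp
  also have "\<dots> = (\<Sum>I\<in>tuples m. (\<Prod>k<m. v k \<bullet> I k) * \<phi> I)"
    by (intro sum.cong refl arg_cong[where f="\<lambda>w. _ * w"] multilin_cong[OF \<phi>]) simp
  finally show ?thesis .
qed

text \<open>The antisymmetrized product of the coordinate functionals of \<open>I\<close>. The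
  division by m! compensates for the expansion of a covector over all tuples, permuted ones
  included.\<close>

definition dual_tuple :: "nat \<Rightarrow> (nat \<Rightarrow> 'a) \<Rightarrow> 'a::euclidean_space covector" where
  "dual_tuple m I v = inverse (fact m) * Alt m (\<lambda>w. \<Prod>k<m. w k \<bullet> I k) v"

lemma multilin_prod: "multilin m (\<lambda>w. \<Prod>k<m. w k \<bullet> I k)"
  unfolding multilin_def
proof (intro conjI allI impI)
  fix v :: "nat \<Rightarrow> 'a" and i assume i: "i < m"
  have "(\<Prod>k<m. (v(i := x)) k \<bullet> I k) = (\<Prod>k\<in>{..<m} - {i}. v k \<bullet> I k) * (x \<bullet> I i)" for x
  proof -
    have "(\<Prod>k<m. (v(i := x)) k \<bullet> I k) = (x \<bullet> I i) * (\<Prod>k\<in>{..<m} - {i}. (v(i := x)) k \<bullet> I k)"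
      using i by (subst prod.remove[of _ i]) auto
    also have "(\<Prod>k\<in>{..<m} - {i}. (v(i := x)) k \<bullet> I k) = (\<Prod>k\<in>{..<m} - {i}. v k \<bullet> I k)"
      by (rule prod.cong) auto
    finally show ?thesis by simp
  qed
  then show "linear (\<lambda>x. \<Prod>k<m. (v(i := x)) k \<bullet> I k)"
    using linear_cmult[OF bounded_linear.linear[OF bounded_linear_inner_left]] by simp
qed (auto intro!: prod.cong)

lemma dual_tuple_covector: "dual_tuple m I \<in> covectors m"
  unfolding dual_tuple_def[abs_def] by (rule covectors_cmult[OF Alt_covector[OF multilin_prod]])

lemma covector_expand:
  assumes \<phi>: "\<phi> \<in> covectors m"
  shows "\<phi> v = (\<Sum>I\<in>tuples m. \<phi> I * dual_tuple m I v)"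
proof -
  have "fact m * \<phi> v = Alt m \<phi> v" by (simp add: Alt_of_covector[OF \<phi>])
  also have "\<dots> = Alt m (\<lambda>v. \<Sum>I\<in>tuples m. \<phi> I * (\<Prod>k<m. v k \<bullet> I k)) v"
    by (subst multilin_expand[OF covectors_multilin[OF \<phi>], abs_def]) (simp add: mult.commute)
  also have "\<dots> = (\<Sum>I\<in>tuples m. \<phi> I * (fact m * dual_tuple m I v))"
    unfolding Alt_sum Alt_cmult dual_tuple_def by (simp add: mult.assoc[symmetric])
  also have "\<dots> = fact m * (\<Sum>I\<in>tuples m. \<phi> I * dual_tuple m I v)"
    by (simp add: sum_distrib_left mult.left_commute)
  finally show ?thesis by simp
qed

abbreviation unit_vectors :: "nat \<Rightarrow> (nat \<Rightarrow> 'a::euclidean_space) \<Rightarrow> bool" where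
  "unit_vectors m v \<equiv> \<forall>i<m. norm (v i) \<le> 1"

text \<open>Coordinates of vectors in the unit ball are at most 1, so finitely many values control
  all others. In particular the supremum that defines the comass is finite.\<close>

lemma multilin_bound:
  assumes \<phi>: "multilin m \<phi>" and v: "unit_vectors m v"
  shows "\<bar>\<phi> v\<bar> \<le> (\<Sum>I\<in>tuples m. \<bar>\<phi> I\<bar>)"
proof -
  have "\<bar>(\<Prod>k<m. v k \<bullet> I k) * \<phi> I\<bar> \<le> \<bar>\<phi> I\<bar>" if I: "I \<in> tuples m" for I
  proof -
    have "\<bar>\<Prod>k<m. v k \<bullet> I k\<bar> \<le> 1"
      unfolding abs_prod
    proof (rule prod_le_1)
      fix k assume k: "k \<in> {..<m}"
      then have "I k \<in> Basis" using I by (auto simp: tuples_def)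
      then show "0 \<le> \<bar>v k \<bullet> I k\<bar> \<and> \<bar>v k \<bullet> I k\<bar> \<le> 1"
        using Basis_le_norm[of "I k" "v k"] v k by force
    qed
    then show ?thesis by (simp add: abs_mult mult_left_le_one_le)
  qed
  then have "\<bar>\<Sum>I\<in>tuples m. (\<Prod>k<m. v k \<bullet> I k) * \<phi> I\<bar> \<le> (\<Sum>I\<in>tuples m. \<bar>\<phi> I\<bar>)"
    by (intro order_trans[OF sum_abs] sum_mono)
  then show ?thesis unfolding multilin_expand[OF \<phi>, of v] .
qed

lemma comass_ge:
  assumes \<phi>: "\<phi> \<in> covectors m" and v: "unit_vectors m v"
  shows "\<bar>\<phi> v\<bar> \<le> comass m \<phi>"
  unfolding comass_def
proof (rule cSUP_upper)
  show "bdd_above ((\<lambda>v. \<bar>\<phi> v\<bar>) ` {v. unit_vectors m v})"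
    using multilin_bound[OF covectors_multilin[OF \<phi>]] by (intro bdd_aboveI2[where M="\<Sum>I\<in>tuples m. \<bar>\<phi> I\<bar>"]) simp
qed (use v in simp)

lemma comass_le:
  assumes "\<And>v. unit_vectors m v \<Longrightarrow> \<bar>\<phi> v\<bar> \<le> B"
  shows "comass m \<phi> \<le> B"
  unfolding comass_def
proof (rule cSUP_least)
  show "{v::nat \<Rightarrow> 'a. unit_vectors m v} \<noteq> {}" by (auto intro!: exI[of _ "\<lambda>_. 0"])
qed (use assms in simp)

text \<open>Plays the role of the inequality between the comass on \<open>S\<close> and
  \<open>B\<close>. A predicate with an explicit bound makes sense for every set, also an unbounded
  or empty one, without finiteness of suprema.\<close>

definition form_le :: "nat \<Rightarrow> 'a::euclidean_space set \<Rightarrow> real \<Rightarrow> 'a form \<Rightarrow> bool" where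
  "form_le m S B \<omega> \<longleftrightarrow> (\<forall>x\<in>S. \<forall>v. unit_vectors m v \<longrightarrow> \<bar>\<omega> x v\<bar> \<le> B)"

lemma form_leD: "form_le m S B \<omega> \<Longrightarrow> x \<in> S \<Longrightarrow> unit_vectors m v \<Longrightarrow> \<bar>\<omega> x v\<bar> \<le> B"
  by (simp add: form_le_def)

lemma form_leI: "(\<And>x v. x \<in> S \<Longrightarrow> unit_vectors m v \<Longrightarrow> \<bar>\<omega> x v\<bar> \<le> B) \<Longrightarrow> form_le m S B \<omega>"
  by (simp add: form_le_def)

lemma form_le_mono: "form_le m S B \<omega> \<Longrightarrow> R \<subseteq> S \<Longrightarrow> B \<le> C \<Longrightarrow> form_le m R C \<omega>"
  unfolding form_le_def by (meson order_trans subsetD)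

lemma form_le_add:
  assumes "form_le m S A \<omega>" "form_le m S B \<eta>"
  shows "form_le m S (A + B) (\<lambda>x v. \<omega> x v + \<eta> x v)"
  using assms unfolding form_le_def by (meson abs_triangle_ineq add_mono order_trans)

lemma form_le_cmult:
  assumes "form_le m S A \<omega>"
  shows "form_le m S (\<bar>c\<bar> * A) (\<lambda>x v. c * \<omega> x v)"
  using assms unfolding form_le_def by (simp add: abs_mult mult_left_mono)

lemma form_norm_le_iff:
  assumes "\<And>x. \<omega> x \<in> covectors m"
  shows "form_norm m \<omega> \<le> ereal B \<longleftrightarrow> form_le m UNIV B \<omega>"
proof -
  have "form_norm m \<omega> \<le> ereal B \<longleftrightarrow> (\<forall>x. comass m (\<omega> x) \<le> B)"
    by (simp add: form_norm_def SUP_le_iff)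
  also have "\<dots> \<longleftrightarrow> form_le m UNIV B \<omega>"
  proof
    assume "\<forall>x. comass m (\<omega> x) \<le> B"
    then show "form_le m UNIV B \<omega>"
      by (intro form_leI) (rule order_trans[OF comass_ge[OF assms]], simp_all)
  next
    assume "form_le m UNIV B \<omega>"
    then show "\<forall>x. comass m (\<omega> x) \<le> B"
      by (intro allI comass_le) (simp add: form_le_def)
  qed
  finally show ?thesis .
qed

section \<open>Smooth forms\<close>

lemma smooth_forms_covector: "\<omega> \<in> smooth_forms m \<Longrightarrow> \<omega> x \<in> covectors m"
  by (simp add: smooth_forms_def)

lemma smooth_forms_multilin: "\<omega> \<in> smooth_forms m \<Longrightarrow> multilin m (\<omega> x)"
  by (intro covectors_multilin smooth_forms_covector)

lemma smooth_forms_smooth: "\<omega> \<in> smooth_forms m \<Longrightarrow> smooth_function (\<lambda>x. \<omega> x v)"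
  by (simp add: smooth_forms_def)

lemma smooth_forms_differentiable: "\<omega> \<in> smooth_forms m \<Longrightarrow> (\<lambda>x. \<omega> x v) differentiable at x"
  by (intro smooth_differentiable smooth_forms_smooth)

lemma smooth_formsI:
  "(\<And>x. \<omega> x \<in> covectors m) \<Longrightarrow> (\<And>v. smooth_function (\<lambda>x. \<omega> x v)) \<Longrightarrow> \<omega> \<in> smooth_forms m"
  by (simp add: smooth_forms_def)

lemma smooth_forms_add:
  "\<omega> \<in> smooth_forms m \<Longrightarrow> \<eta> \<in> smooth_forms m \<Longrightarrow> (\<lambda>x v. \<omega> x v + \<eta> x v) \<in> smooth_forms m"
  by (rule smooth_formsI[OF covectors_add[OF smooth_forms_covector smooth_forms_covector]
        smooth_add[OF smooth_forms_smooth smooth_forms_smooth]])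

lemma smooth_forms_mult:
  "\<omega> \<in> smooth_forms m \<Longrightarrow> smooth_function f \<Longrightarrow> (\<lambda>x v. f x * \<omega> x v) \<in> smooth_forms m"
  by (rule smooth_formsI[OF covectors_cmult[OF smooth_forms_covector]
        smooth_mult[OF _ smooth_forms_smooth]])

lemma smooth_forms_cmult: "\<omega> \<in> smooth_forms m \<Longrightarrow> (\<lambda>x v. c * \<omega> x v) \<in> smooth_forms m"
  by (intro smooth_forms_mult smooth_const)

lemma smooth_forms_zero: "(\<lambda>x v. 0) \<in> smooth_forms m"
  by (intro smooth_formsI covectors_zero smooth_const)

lemma smooth_forms_diff:
  assumes "\<omega> \<in> smooth_forms m" "\<eta> \<in> smooth_forms m"
  shows "(\<lambda>x v. \<omega> x v - \<eta> x v) \<in> smooth_forms m"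
  using smooth_forms_add[OF assms(1) smooth_forms_cmult[OF assms(2), of "-1"]] by simp

lemma smooth_forms_sum:
  "(\<And>i. i \<in> I \<Longrightarrow> \<omega> i \<in> smooth_forms m) \<Longrightarrow> (\<lambda>x v. \<Sum>i\<in>I. \<omega> i x v) \<in> smooth_forms m"
  by (rule smooth_formsI[OF covectors_sum[OF smooth_forms_covector] smooth_sum[OF smooth_forms_smooth]])

lemma smooth_forms_const: "\<phi> \<in> covectors m \<Longrightarrow> smooth_function f \<Longrightarrow> (\<lambda>x v. f x * \<phi> v) \<in> smooth_forms m"
  by (rule smooth_formsI[OF covectors_cmult smooth_mult[OF _ smooth_const]])

section \<open>The exterior derivative\<close>

definition shift_perm :: "nat \<Rightarrow> (nat \<Rightarrow> nat) \<Rightarrow> nat \<Rightarrow> nat" where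
  "shift_perm s p j = (if j < s then j else s + p (j - s))"

lemma shift_perm_permutes_sign:
  assumes p: "p permutes {..<k}"
  shows "shift_perm s p permutes {..<s + k} \<and> sign (shift_perm s p) = sign p"
  using p finite_lessThan[of k]
proof (induction rule: permutes_induct)
  case id
  have "shift_perm s id = id" by (auto simp: shift_perm_def fun_eq_iff)
  then show ?case by (simp only: permutes_id sign_id simp_thms)
next
  case (swap a b p)
  have ab: "a < k" "b < k" using swap(1,2) by auto
  have ab': "s + a < s + k" "s + b < s + k" using ab by auto
  have eq: "shift_perm s (Transposition.transpose a b \<circ> p) = Transposition.transpose (s + a) (s + b) \<circ> shift_perm s p"
    by (auto simp: shift_perm_def fun_eq_iff Transposition.transpose_def)
  have IH: "shift_perm s p permutes {..<s + k}" "sign (shift_perm s p) = sign p"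
    using swap.IH by auto
  have "sign (Transposition.transpose (s + a) (s + b) \<circ> shift_perm s p) = sign (Transposition.transpose a b \<circ> p)"
    unfolding sign_compose_permutes[OF transpose_permutes_lessThan[OF ab'] IH(1)]
      sign_compose_permutes[OF transpose_permutes_lessThan[OF ab] swap.hyps(4)] IH(2)
    by (simp add: sign_swap_id)
  then show ?case
    unfolding eq by (rule conjI[OF permutes_compose[OF IH(1) transpose_permutes_lessThan[OF ab']]])
qed

text \<open>The cycle that brings argument \<open>i\<close> to the front and keeps the order of the
  others, as in the summands of the exterior derivative. It is a product of \<open>i\<close>
  adjacent transpositions, whence its sign.\<close>

definition cycle_perm :: "nat \<Rightarrow> nat \<Rightarrow> nat" where
  "cycle_perm i j = (if j = 0 then i else if j \<le> i then j - 1 else j)"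

lemma cycle_perm_permutes_sign:
  "i < k \<Longrightarrow> cycle_perm i permutes {..<k} \<and> sign (cycle_perm i) = (-1) ^ i"
proof (induction i)
  case 0
  have "cycle_perm 0 = id" by (auto simp: cycle_perm_def fun_eq_iff)
  then show ?case by (simp only: permutes_id sign_id power_0 simp_thms)
next
  case (Suc i)
  have i: "i < k" "Suc i < k" using Suc.prems by auto
  have eq: "cycle_perm (Suc i) = Transposition.transpose i (Suc i) \<circ> cycle_perm i"
    by (auto simp: cycle_perm_def fun_eq_iff Transposition.transpose_def)
  have IH: "cycle_perm i permutes {..<k}" "sign (cycle_perm i) = (-1) ^ i" using Suc by auto
  have "sign (Transposition.transpose i (Suc i) \<circ> cycle_perm i) = (-1) ^ Suc i"
    unfolding sign_compose_permutes[OF transpose_permutes_lessThan[OF i] IH(1)] IH(2)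
    by (simp add: sign_swap_id)
  then show ?case
    unfolding eq by (rule conjI[OF permutes_compose[OF IH(1) transpose_permutes_lessThan[OF i]]])
qed

text \<open>The derivative of a form as a multilinear map whose argument 0 is the direction; its
  antisymmetrization is a multiple of the exterior derivative.\<close>

definition dform :: "'a::euclidean_space form \<Rightarrow> 'a form" where
  "dform \<omega> x w = dird (w 0) (\<lambda>y. \<omega> y (\<lambda>j. w (Suc j))) x"

lemma ext_deriv_cycle: "ext_deriv m \<omega> x v = (\<Sum>i\<le>m. (-1) ^ i * dform \<omega> x (v \<circ> cycle_perm i))"
proof -
  have "(\<lambda>j. (v \<circ> cycle_perm i) (Suc j)) = (\<lambda>j. if j < i then v j else v (Suc j))" for i
    by (auto simp: cycle_perm_def fun_eq_iff)
  then show ?thesis by (simp add: ext_deriv_def dform_def dird_def cycle_perm_def)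
qed

lemma ext_deriv_dird:
  "ext_deriv m \<omega> x v = (\<Sum>i\<le>m. (-1) ^ i * dird (v i) (\<lambda>y. \<omega> y (\<lambda>j. if j < i then v j else v (Suc j))) x)"
  by (simp add: ext_deriv_def dird_def)

lemma dform_multilin:
  assumes \<omega>: "\<omega> \<in> smooth_forms m"
  shows "multilin (Suc m) (dform \<omega> x)"
  unfolding multilin_def
proof (intro conjI allI impI)
  fix v w :: "nat \<Rightarrow> 'a" assume vw: "\<forall>i<Suc m. v i = w i"
  then have "(\<lambda>y. \<omega> y (\<lambda>j. v (Suc j))) = (\<lambda>y. \<omega> y (\<lambda>j. w (Suc j)))"
    by (intro ext multilin_cong[OF smooth_forms_multilin[OF \<omega>]]) simp
  then show "dform \<omega> x v = dform \<omega> x w" using vw by (simp add: dform_def)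
next
  fix v :: "nat \<Rightarrow> 'a" and i assume i: "i < Suc m"
  show "linear (\<lambda>z. dform \<omega> x (v(i := z)))"
  proof (cases i)
    case 0
    then show ?thesis
      by (simp add: dform_def linear_dird[OF smooth_forms_differentiable[OF \<omega>]])
  next
    case (Suc k)
    have k: "k < m" using i Suc by simp
    have u: "(\<lambda>j. (v(i := z)) (Suc j)) = (\<lambda>j. v (Suc j))(k := z)" for z
      using Suc by (auto simp: fun_eq_iff)
    have L: "linear (\<lambda>z. \<omega> y ((\<lambda>j. v (Suc j))(k := z)))" for y
      by (rule multilin_linear[OF smooth_forms_multilin[OF \<omega>] k])
    show ?thesis
    proof (rule linearI)
      fix a b
      show "dform \<omega> x (v(i := a + b)) = dform \<omega> x (v(i := a)) + dform \<omega> x (v(i := b))"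
        unfolding dform_def u linear_add[OF L] using Suc
        by (simp add: dird_add[OF smooth_forms_differentiable[OF \<omega>] smooth_forms_differentiable[OF \<omega>]])
    next
      fix c a
      show "dform \<omega> x (v(i := c *\<^sub>R a)) = c *\<^sub>R dform \<omega> x (v(i := a))"
        unfolding dform_def u linear_scale[OF L] using Suc
        by (simp add: dird_cmult[OF smooth_forms_differentiable[OF \<omega>]])
    qed
  qed
qed

lemma dform_shift:
  assumes \<omega>: "\<omega> \<in> smooth_forms m" and q: "q permutes {..<m}"
  shows "dform \<omega> x (w \<circ> shift_perm 1 q) = of_int (sign q) * dform \<omega> x w"
proof -
  have "(\<lambda>j. (w \<circ> shift_perm 1 q) (Suc j)) = (\<lambda>j. w (Suc j)) \<circ> q"
    by (auto simp: shift_perm_def fun_eq_iff)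
  then have "dform \<omega> x (w \<circ> shift_perm 1 q) = dird (w 0) (\<lambda>y. of_int (sign q) * \<omega> y (\<lambda>j. w (Suc j))) x"
    by (simp add: dform_def covector_permute[OF smooth_forms_covector[OF \<omega>] q] shift_perm_def)
  then show ?thesis
    by (simp add: dird_cmult[OF smooth_forms_differentiable[OF \<omega>]] dform_def)
qed

text \<open>Every permutation of m + 1 indices is, in a unique way, a cycle bringing some
  \<open>i\<close> to the front composed with a permutation of the remaining ones. The latter act by
  their sign on the alternating \<open>\<omega>\<close>, so each \<open>i\<close> contributes m!
  equal terms.\<close>

lemma ext_deriv_Alt:
  assumes \<omega>: "\<omega> \<in> smooth_forms m"
  shows "Alt (Suc m) (dform \<omega> x) v = fact m * ext_deriv m \<omega> x v"
proof -
  let ?P = "{p. p permutes {..<Suc m}}" and ?Q = "{q. q permutes {..<m}}"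
  define h where "h = (\<lambda>(i, q). cycle_perm i \<circ> shift_perm 1 q)"
  have c: "cycle_perm i permutes {..<Suc m}" "sign (cycle_perm i) = (-1) ^ i" if "i \<le> m" for i
    using cycle_perm_permutes_sign[of i "Suc m"] that by auto
  have s: "shift_perm 1 q permutes {..<Suc m}" "sign (shift_perm 1 q) = sign q" if "q \<in> ?Q" for q
    using shift_perm_permutes_sign[of q m 1] that by auto
  have inj: "inj_on h ({..m} \<times> ?Q)"
  proof (rule inj_onI, clarify)
    fix i q j r
    assume A: "i \<le> m" "j \<le> m" "q permutes {..<m}" "r permutes {..<m}" "h (i, q) = h (j, r)"
    have "h (i, q) 0 = i" "h (j, r) 0 = j" by (simp_all add: h_def cycle_perm_def shift_perm_def)
    then have ij: "i = j" using A(5) by simp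
    have "shift_perm 1 q = shift_perm 1 r"
      using A(5) permutes_inj[OF c(1)[OF A(1)]] unfolding h_def ij by (simp add: fun_eq_iff inj_eq)
    from fun_cong[OF this, of "Suc k" for k] have "q k = r k" for k by (simp add: shift_perm_def)
    with ij show "i = j \<and> q = r" by auto
  qed
  \<comment> \<open>Surjectivity by counting: the image has (m + 1) * m! elements, the number of all
    permutations.\<close>
  have im: "h ` ({..m} \<times> ?Q) = ?P"
  proof (rule card_subset_eq)
    show "finite ?P" by (rule finite_permutations) simp
    show "h ` ({..m} \<times> ?Q) \<subseteq> ?P"
      using c(1) s(1) by (auto simp: h_def intro!: permutes_compose)
    show "card (h ` ({..m} \<times> ?Q)) = card ?P"
      by (simp add: card_image[OF inj] card_cartesian_product card_permutations)
  qed
  have "Alt (Suc m) (dform \<omega> x) v = (\<Sum>(i, q)\<in>{..m} \<times> ?Q. of_int (sign (h (i, q))) * dform \<omega> x (v \<circ> h (i, q)))"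
    unfolding Alt_def im[symmetric] by (subst sum.reindex[OF inj]) (simp add: case_prod_beta)
  also have "\<dots> = (\<Sum>i\<le>m. \<Sum>q\<in>?Q. (-1) ^ i * dform \<omega> x (v \<circ> cycle_perm i))"
    unfolding sum.cartesian_product[symmetric]
  proof (intro sum.cong refl)
    fix i q assume i: "i \<in> {..m}" and q: "q \<in> ?Q"
    have i': "i \<le> m" using i by simp
    have "sign (h (i, q)) = (-1) ^ i * sign q"
      unfolding h_def using sign_compose_permutes[OF c(1)[OF i'] s(1)[OF q]] c(2)[OF i'] s(2)[OF q] by simp
    moreover have "dform \<omega> x (v \<circ> h (i, q)) = of_int (sign q) * dform \<omega> x (v \<circ> cycle_perm i)"
      unfolding h_def using dform_shift[OF \<omega>, of q x "v \<circ> cycle_perm i"] q by (simp add: o_assoc)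
    ultimately show "of_int (sign (h (i, q))) * dform \<omega> x (v \<circ> h (i, q)) = (-1) ^ i * dform \<omega> x (v \<circ> cycle_perm i)"
      using sign_square[of q] by (simp add: mult.assoc)
  qed
  also have "\<dots> = fact m * ext_deriv m \<omega> x v"
    unfolding ext_deriv_cycle by (simp add: sum_distrib_left card_permutations)
  finally show ?thesis .
qed

lemma ext_deriv_eq_Alt:
  "\<omega> \<in> smooth_forms m \<Longrightarrow> ext_deriv m \<omega> x v = inverse (fact m) * Alt (Suc m) (dform \<omega> x) v"
  by (simp add: ext_deriv_Alt mult.assoc[symmetric])

lemma smooth_forms_ext_deriv:
  assumes \<omega>: "\<omega> \<in> smooth_forms m"
  shows "ext_deriv m \<omega> \<in> smooth_forms (Suc m)"
proof (rule smooth_formsI)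
  fix x
  have "ext_deriv m \<omega> x = (\<lambda>v. inverse (fact m) * Alt (Suc m) (dform \<omega> x) v)"
    by (rule ext, rule ext_deriv_eq_Alt[OF \<omega>])
  then show "ext_deriv m \<omega> x \<in> covectors (Suc m)"
    using covectors_cmult[OF Alt_covector[OF dform_multilin[OF \<omega>]]] by simp
next
  show "smooth_function (\<lambda>x. ext_deriv m \<omega> x v)" for v
    unfolding ext_deriv_dird by (intro smooth_sum smooth_cmult smooth_dird smooth_forms_smooth[OF \<omega>])
qed

lemma ext_deriv_add:
  assumes "\<omega> \<in> smooth_forms m" "\<eta> \<in> smooth_forms m"
  shows "ext_deriv m (\<lambda>x v. \<omega> x v + \<eta> x v) = (\<lambda>x v. ext_deriv m \<omega> x v + ext_deriv m \<eta> x v)"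
  by (simp add: fun_eq_iff ext_deriv_dird distrib_left sum.distrib
      dird_add[OF smooth_forms_differentiable[OF assms(1)] smooth_forms_differentiable[OF assms(2)]])

lemma ext_deriv_cmult:
  assumes "\<omega> \<in> smooth_forms m"
  shows "ext_deriv m (\<lambda>x v. c * \<omega> x v) = (\<lambda>x v. c * ext_deriv m \<omega> x v)"
  by (simp add: fun_eq_iff ext_deriv_dird sum_distrib_left mult.left_commute
      dird_cmult[OF smooth_forms_differentiable[OF assms(1)]])

lemma ext_deriv_mult:
  assumes \<omega>: "\<omega> \<in> smooth_forms m" and f: "smooth_function f"
  shows "ext_deriv m (\<lambda>x v. f x * \<omega> x v) x v = f x * ext_deriv m \<omega> x v +
    (\<Sum>i\<le>m. (-1) ^ i * (dird (v i) f x * \<omega> x (\<lambda>j. if j < i then v j else v (Suc j))))"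
  by (simp add: ext_deriv_dird sum_distrib_left sum.distrib[symmetric] distrib_left mult.left_commute
      dird_mult[OF smooth_differentiable[OF f] smooth_forms_differentiable[OF \<omega>]])

lemma ext_deriv_zero_on_open:
  assumes "open S" "x \<in> S" "\<And>y. y \<in> S \<Longrightarrow> \<omega> y = (\<lambda>v. 0)"
  shows "ext_deriv m \<omega> x = (\<lambda>v. 0)"
proof
  fix v
  have "dird u (\<lambda>y. \<omega> y w) x = 0" for u w
    by (rule dird_zero_on_open[OF assms(1,2)]) (simp add: assms(3))
  then show "ext_deriv m \<omega> x v = 0" by (simp add: ext_deriv_dird)
qed

text \<open>Up to factorials, applying the exterior derivative twice antisymmetrizes the second
  derivative \<open>H\<close>. Since \<open>H\<close> is symmetric in its two directions, exchanging
  these slots both preserves the antisymmetrization and changes its sign.\<close>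

lemma ext_deriv_ext_deriv:
  assumes \<omega>: "\<omega> \<in> smooth_forms m"
  shows "ext_deriv (Suc m) (ext_deriv m \<omega>) = (\<lambda>x v. 0)"
proof (intro ext)
  fix x v
  define H where "H w = dird (w 0) (dird (w 1) (\<lambda>z. \<omega> z (\<lambda>j. w (Suc (Suc j))))) x" for w
  let ?Q = "{q. q permutes {..<Suc m}}"
  have ext: "ext_deriv m \<omega> y u = (\<Sum>q\<in>?Q. inverse (fact m) * of_int (sign q) * dird (u (q 0)) (\<lambda>z. \<omega> z (\<lambda>j. u (q (Suc j)))) y)" for y u
    unfolding ext_deriv_eq_Alt[OF \<omega>] by (simp add: Alt_def dform_def sum_distrib_left mult.assoc)
  have dd: "dform (ext_deriv m \<omega>) x w = inverse (fact m) * (\<Sum>q\<in>?Q. of_int (sign q) * H (w \<circ> shift_perm 1 q))" for w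
  proof -
    have "dform (ext_deriv m \<omega>) x w
      = (\<Sum>q\<in>?Q. inverse (fact m) * of_int (sign q) * dird (w 0) (dird (w (Suc (q 0))) (\<lambda>z. \<omega> z (\<lambda>j. w (Suc (q (Suc j)))))) x)"
      unfolding dform_def ext
      by (subst dird_sum) (auto intro!: sum.cong differentiable_mult smooth_differentiable[OF smooth_dird[OF smooth_forms_smooth[OF \<omega>]]]
          simp: dird_cmult[OF smooth_differentiable[OF smooth_dird[OF smooth_forms_smooth[OF \<omega>]]]])
    then show ?thesis by (simp add: sum_distrib_left H_def shift_perm_def mult.assoc)
  qed
  have tr: "Transposition.transpose 0 1 permutes {..<Suc (Suc m)}"
    by (rule transpose_permutes_lessThan) auto
  have "H (w \<circ> Transposition.transpose 0 1) = H w" for w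
    unfolding H_def by (simp add: Transposition.transpose_def dird_commute[OF smooth_forms_smooth[OF \<omega>], of "w 0"])
  then have "Alt (Suc (Suc m)) H v = - Alt (Suc (Suc m)) H v"
    using Alt_compose[OF tr, of H v] by (simp add: sign_swap_id)
  then have H0: "Alt (Suc (Suc m)) H v = 0" by simp
  have "Alt (Suc (Suc m)) (dform (ext_deriv m \<omega>) x) v
    = inverse (fact m) * Alt (Suc (Suc m)) (\<lambda>w. \<Sum>q\<in>?Q. of_int (sign q) * H (w \<circ> shift_perm 1 q)) v"
    unfolding dd Alt_cmult ..
  also have "\<dots> = 0"
    by (subst Alt_average) (use shift_perm_permutes_sign[of _ "Suc m" 1] H0 in auto)
  finally show "ext_deriv (Suc m) (ext_deriv m \<omega>) x v = 0"
    unfolding ext_deriv_Alt[OF smooth_forms_ext_deriv[OF \<omega>]] by simp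
qed

section \<open>The exterior product\<close>

lemma wedge_form_Alt:
  "wedge_form m n \<omega> \<eta> x v = inverse (fact m * fact n) * Alt (m + n) (\<lambda>w. \<omega> x w * \<eta> x (\<lambda>i. w (m + i))) v"
  by (simp add: wedge_form_def Alt_def divide_inverse comp_def mult.commute mult.left_commute)

lemma multilin_tensor:
  assumes \<phi>: "multilin m \<phi>" and \<psi>: "multilin n \<psi>"
  shows "multilin (m + n) (\<lambda>w. \<phi> w * \<psi> (\<lambda>i. w (m + i)))"
  unfolding multilin_def
proof (intro conjI allI impI)
  fix v w :: "nat \<Rightarrow> 'a" assume vw: "\<forall>i<m + n. v i = w i"
  then show "\<phi> v * \<psi> (\<lambda>i. v (m + i)) = \<phi> w * \<psi> (\<lambda>i. w (m + i))"
    by (simp add: multilin_cong[OF \<phi>, of v w] multilin_cong[OF \<psi>, of "\<lambda>i. v (m + i)" "\<lambda>i. w (m + i)"])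
next
  fix v :: "nat \<Rightarrow> 'a" and i assume i: "i < m + n"
  show "linear (\<lambda>x. \<phi> (v(i := x)) * \<psi> (\<lambda>k. (v(i := x)) (m + k)))"
  proof (cases "i < m")
    case True
    have "(\<lambda>k. (v(i := x)) (m + k)) = (\<lambda>k. v (m + k))" for x using True by (auto simp: fun_eq_iff)
    then have "(\<lambda>x. \<phi> (v(i := x)) * \<psi> (\<lambda>k. (v(i := x)) (m + k))) = (\<lambda>x. \<psi> (\<lambda>k. v (m + k)) * \<phi> (v(i := x)))"
      by (simp add: mult.commute)
    then show ?thesis using linear_cmult[OF multilin_linear[OF \<phi> True]] by simp
  next
    case False
    have "(\<lambda>k. (v(i := x)) (m + k)) = (\<lambda>k. v (m + k))(i - m := x)" for x using False by (auto simp: fun_eq_iff)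
    moreover have "\<phi> (v(i := x)) = \<phi> v" for x using False by (intro multilin_cong[OF \<phi>]) auto
    moreover have "i - m < n" using i False by simp
    ultimately show ?thesis using linear_cmult[OF multilin_linear[OF \<psi>]] by simp
  qed
qed

lemma smooth_forms_wedge:
  assumes \<omega>: "\<omega> \<in> smooth_forms m" and \<eta>: "\<eta> \<in> smooth_forms n"
  shows "wedge_form m n \<omega> \<eta> \<in> smooth_forms (m + n)"
proof (rule smooth_formsI)
  show "wedge_form m n \<omega> \<eta> x \<in> covectors (m + n)" for x
    unfolding wedge_form_Alt[abs_def]
    by (rule covectors_cmult[OF Alt_covector[OF multilin_tensor[OF smooth_forms_multilin[OF \<omega>] smooth_forms_multilin[OF \<eta>]]]])
  show "smooth_function (\<lambda>x. wedge_form m n \<omega> \<eta> x v)" for v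
    unfolding wedge_form_Alt Alt_def
    by (intro smooth_cmult smooth_sum smooth_mult[OF smooth_forms_smooth[OF \<omega>] smooth_forms_smooth[OF \<eta>]])
qed

text \<open>The binomial coefficient of m + n over m, that is, the number of shuffles.\<close>

definition wedge_const :: "nat \<Rightarrow> nat \<Rightarrow> real" where
  "wedge_const m n = fact (m + n) / (fact m * fact n)"

lemma wedge_const_pos: "0 < wedge_const m n"
  by (simp add: wedge_const_def)

text \<open>Each of the (m + n)! terms is at most A * B in absolute value; the factorials in the
  definition of the product leave the binomial coefficient.\<close>

lemma wedge_form_le:
  assumes A: "form_le m S A \<omega>" and B: "form_le n S B \<eta>" and A0: "0 \<le> A"
  shows "form_le (m + n) S (wedge_const m n * A * B) (wedge_form m n \<omega> \<eta>)"
proof (rule form_leI)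
  fix x and v :: "nat \<Rightarrow> 'a" assume x: "x \<in> S" and v: "unit_vectors (m + n) v"
  have "\<bar>of_int (sign p) * (\<omega> x (v \<circ> p) * \<eta> x (\<lambda>i. (v \<circ> p) (m + i)))\<bar> \<le> A * B" if p: "p permutes {..<m + n}" for p
  proof -
    have vp: "norm ((v \<circ> p) i) \<le> 1" if "i < m + n" for i
      using permutes_in_image[OF p, of i] that v by simp
    have "\<bar>\<omega> x (v \<circ> p)\<bar> \<le> A" by (rule form_leD[OF A x]) (use vp in auto)
    moreover have "\<bar>\<eta> x (\<lambda>i. (v \<circ> p) (m + i))\<bar> \<le> B" by (rule form_leD[OF B x]) (use vp in auto)
    moreover have "\<bar>of_int (sign p) :: real\<bar> = 1" by (simp add: sign_def)
    ultimately show ?thesis using A0 by (simp add: abs_mult mult_mono)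
  qed
  then have "\<bar>Alt (m + n) (\<lambda>w. \<omega> x w * \<eta> x (\<lambda>i. w (m + i))) v\<bar> \<le> (\<Sum>p | p permutes {..<m + n}. A * B)"
    unfolding Alt_def by (intro order_trans[OF sum_abs] sum_mono) simp
  then have "\<bar>Alt (m + n) (\<lambda>w. \<omega> x w * \<eta> x (\<lambda>i. w (m + i))) v\<bar> \<le> fact (m + n) * (A * B)"
    by (simp add: card_permutations)
  then show "\<bar>wedge_form m n \<omega> \<eta> x v\<bar> \<le> wedge_const m n * A * B"
    unfolding wedge_form_Alt wedge_const_def by (simp add: abs_mult field_simps)
qed

lemma wedge_form_linear_left:
  "wedge_form m n (\<lambda>x v. \<omega> x v + \<omega>' x v) \<eta> x v = wedge_form m n \<omega> \<eta> x v + wedge_form m n \<omega>' \<eta> x v"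
  "wedge_form m n (\<lambda>x v. c * \<omega> x v) \<eta> x v = c * wedge_form m n \<omega> \<eta> x v"
  unfolding wedge_form_Alt by (simp_all add: distrib_right Alt_add distrib_left mult.assoc Alt_cmult)

lemma wedge_form_linear_right:
  "wedge_form m n \<omega> (\<lambda>x v. \<eta> x v + \<eta>' x v) x v = wedge_form m n \<omega> \<eta> x v + wedge_form m n \<omega> \<eta>' x v"
  "wedge_form m n \<omega> (\<lambda>x v. c * \<eta> x v) x v = c * wedge_form m n \<omega> \<eta> x v"
  unfolding wedge_form_Alt by (simp_all add: distrib_left Alt_add mult.left_commute[of _ c] Alt_cmult)

text \<open>Both sides antisymmetrize first derivatives of a tensor product. \<open>G1\<close> and
  \<open>G2\<close> are the two halves of the product rule, with the direction in slot 0. In the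
  last term of the statement \<open>\<omega>\<close> occupies the first slots, so the direction sits
  in slot \<open>m\<close>; this is \<open>G3\<close>, and moving the direction to the front costs
  the sign (-1)^m.\<close>

lemma ext_deriv_wedge:
  assumes \<omega>: "\<omega> \<in> smooth_forms m" and \<eta>: "\<eta> \<in> smooth_forms n"
  shows "ext_deriv (m + n) (wedge_form m n \<omega> \<eta>) x v =
    wedge_form (Suc m) n (ext_deriv m \<omega>) \<eta> x v + (-1) ^ m * wedge_form m (Suc n) \<omega> (ext_deriv n \<eta>) x v"
proof -
  define G1 where "G1 w = dform \<omega> x w * \<eta> x (\<lambda>i. w (Suc m + i))" for w
  define G2 where "G2 w = \<omega> x (\<lambda>j. w (Suc j)) * dird (w 0) (\<lambda>y. \<eta> y (\<lambda>i. w (Suc m + i))) x" for w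
  define G3 where "G3 w = \<omega> x w * dform \<eta> x (\<lambda>i. w (m + i))" for w
  let ?c = "inverse (fact m * fact n) :: real"
  note w = smooth_forms_wedge[OF \<omega> \<eta>]
  have D: "dform (wedge_form m n \<omega> \<eta>) x w =
     ?c * (\<Sum>p | p permutes {..<m + n}. of_int (sign p) * (G1 (w \<circ> shift_perm 1 p) + G2 (w \<circ> shift_perm 1 p)))" for w
  proof -
    let ?f = "\<lambda>p y. \<omega> y (\<lambda>i. w (Suc (p i))) * \<eta> y (\<lambda>i. w (Suc (p (m + i))))"
    have sm: "smooth_function (?f p)" for p
      by (rule smooth_mult[OF smooth_forms_smooth[OF \<omega>] smooth_forms_smooth[OF \<eta>]])
    have "dform (wedge_form m n \<omega> \<eta>) x w = dird (w 0) (\<lambda>y. ?c * (\<Sum>p | p permutes {..<m + n}. of_int (sign p) * ?f p y)) x"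
      unfolding dform_def wedge_form_Alt Alt_def by (simp add: comp_def)
    also have "\<dots> = ?c * (\<Sum>p | p permutes {..<m + n}. of_int (sign p) * dird (w 0) (?f p) x)"
    proof -
      have s2: "smooth_function (\<lambda>y. of_int (sign p) * ?f p y)" for p by (rule smooth_cmult[OF sm])
      have s3: "smooth_function (\<lambda>y. \<Sum>p | p permutes {..<m + n}. of_int (sign p) * ?f p y)"
        by (rule smooth_sum[OF s2])
      show ?thesis
        by (subst dird_cmult[OF smooth_differentiable[OF s3]], subst dird_sum,
            rule smooth_differentiable[OF s2], subst dird_cmult[OF smooth_differentiable[OF sm]], rule refl)
    qed
    also have "\<dots> = ?c * (\<Sum>p | p permutes {..<m + n}. of_int (sign p) * (G1 (w \<circ> shift_perm 1 p) + G2 (w \<circ> shift_perm 1 p)))"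
    proof (intro arg_cong[where f="\<lambda>t. ?c * t"] sum.cong refl arg_cong[where f="\<lambda>t. of_int _ * t"])
      fix p
      show "dird (w 0) (?f p) x = G1 (w \<circ> shift_perm 1 p) + G2 (w \<circ> shift_perm 1 p)"
        unfolding dird_mult[OF smooth_forms_differentiable[OF \<omega>] smooth_forms_differentiable[OF \<eta>]]
        by (simp add: G1_def G2_def dform_def shift_perm_def)
    qed
    finally show ?thesis .
  qed
  have "fact (m + n) * ext_deriv (m + n) (wedge_form m n \<omega> \<eta>) x v = Alt (Suc (m + n)) (dform (wedge_form m n \<omega> \<eta>) x) v"
    by (simp add: ext_deriv_Alt[OF w])
  also have "\<dots> = ?c * (fact (m + n) * Alt (Suc (m + n)) (\<lambda>w. G1 w + G2 w) v)"
    unfolding D Alt_cmult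
    by (subst Alt_average[where f="\<lambda>w. G1 w + G2 w"])
      (use shift_perm_permutes_sign[of _ "m + n" 1] in \<open>auto simp: card_permutations\<close>)
  finally have L: "ext_deriv (m + n) (wedge_form m n \<omega> \<eta>) x v = ?c * (Alt (Suc (m + n)) G1 v + Alt (Suc (m + n)) G2 v)"
    by (simp add: Alt_add)
  have ext: "ext_deriv k \<zeta> x u = inverse (fact k) * (\<Sum>q | q permutes {..<Suc k}. of_int (sign q) * dform \<zeta> x (u \<circ> q))"
    if "\<zeta> \<in> smooth_forms k" for k \<zeta> u
    unfolding ext_deriv_eq_Alt[OF that] by (simp add: Alt_def)
  have 1: "ext_deriv m \<omega> x w * \<eta> x (\<lambda>i. w (Suc m + i))
      = inverse (fact m) * (\<Sum>q | q permutes {..<Suc m}. of_int (sign q) * G1 (w \<circ> q))" for w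
  proof -
    have "(\<lambda>i. (w \<circ> q) (Suc m + i)) = (\<lambda>i. w (Suc m + i))" if "q permutes {..<Suc m}" for q
      using permutes_not_in[OF that] by (auto simp: fun_eq_iff)
    then show ?thesis unfolding ext[OF \<omega>] G1_def
      by (simp add: sum_distrib_right sum_distrib_left mult.assoc)
  qed
  have "wedge_form (Suc m) n (ext_deriv m \<omega>) \<eta> x v = inverse (fact (Suc m) * fact n) * (inverse (fact m) * (fact (Suc m) * Alt (Suc (m + n)) G1 v))"
    unfolding wedge_form_Alt 1 Alt_cmult
    by (subst Alt_average) (auto simp: card_permutations intro: permutes_subset simp del: fact_Suc)
  then have W1: "wedge_form (Suc m) n (ext_deriv m \<omega>) \<eta> x v = ?c * Alt (Suc (m + n)) G1 v"
    by (simp del: fact_Suc add: field_simps)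
  have 2: "\<omega> x w * ext_deriv n \<eta> x (\<lambda>i. w (m + i))
      = inverse (fact n) * (\<Sum>q | q permutes {..<Suc n}. of_int (sign q) * G3 (w \<circ> shift_perm m q))" for w
  proof -
    have "\<omega> x (w \<circ> shift_perm m q) = \<omega> x w" for q
      by (rule multilin_cong[OF smooth_forms_multilin[OF \<omega>]]) (simp add: shift_perm_def)
    moreover have "(\<lambda>i. (w \<circ> shift_perm m q) (m + i)) = (\<lambda>i. w (m + i)) \<circ> q" for q
      by (auto simp: fun_eq_iff shift_perm_def)
    ultimately show ?thesis unfolding ext[OF \<eta>] G3_def
      by (simp add: sum_distrib_left mult.left_commute)
  qed
  have "wedge_form m (Suc n) \<omega> (ext_deriv n \<eta>) x v = inverse (fact m * fact (Suc n)) * (inverse (fact n) * (fact (Suc n) * Alt (Suc (m + n)) G3 v))"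
    unfolding wedge_form_Alt 2 Alt_cmult
    by (subst Alt_average) (use shift_perm_permutes_sign[of _ "Suc n" m] in \<open>auto simp: card_permutations simp del: fact_Suc\<close>)
  then have W2: "wedge_form m (Suc n) \<omega> (ext_deriv n \<eta>) x v = ?c * Alt (Suc (m + n)) G3 v"
    by (simp del: fact_Suc add: field_simps)
  have G3: "G3 = (\<lambda>w. G2 (w \<circ> cycle_perm m))"
  proof
    fix w
    have "\<omega> x (\<lambda>j. (w \<circ> cycle_perm m) (Suc j)) = \<omega> x w"
      by (rule multilin_cong[OF smooth_forms_multilin[OF \<omega>]]) (simp add: cycle_perm_def)
    then show "G3 w = G2 (w \<circ> cycle_perm m)" by (simp add: G3_def G2_def dform_def cycle_perm_def)
  qed
  have cyc: "cycle_perm m permutes {..<Suc (m + n)}" "sign (cycle_perm m) = (-1) ^ m"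
    using cycle_perm_permutes_sign[of m "Suc (m + n)"] by simp_all
  have "Alt (Suc (m + n)) G3 v = (-1) ^ m * Alt (Suc (m + n)) G2 v"
    unfolding G3 Alt_compose[OF cyc(1), of G2 v] cyc(2) by simp
  then have "(-1) ^ m * Alt (Suc (m + n)) G3 v = Alt (Suc (m + n)) G2 v"
    by (simp add: mult.assoc[symmetric] power_add[symmetric])
  then show ?thesis unfolding L W1 W2 by (simp add: distrib_left mult.left_commute)
qed

section \<open>Contraction with a constant vector field\<close>

definition contract :: "'a::euclidean_space \<Rightarrow> 'a form \<Rightarrow> 'a form" where
  "contract b \<omega> y u = \<omega> y (case_nat b u)"

lemma smooth_forms_contract:
  assumes \<omega>: "\<omega> \<in> smooth_forms (Suc k)"
  shows "contract b \<omega> \<in> smooth_forms k"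
proof (rule smooth_formsI)
  fix x
  show "contract b \<omega> x \<in> covectors k"
  proof (rule covectorsI)
    show "multilin k (contract b \<omega> x)"
      unfolding multilin_def
    proof (intro conjI allI impI)
      fix v w :: "nat \<Rightarrow> 'a" assume "\<forall>i<k. v i = w i"
      then show "contract b \<omega> x v = contract b \<omega> x w"
        unfolding contract_def by (intro multilin_cong[OF smooth_forms_multilin[OF \<omega>]]) (auto split: nat.split)
    next
      fix v :: "nat \<Rightarrow> 'a" and i assume i: "i < k"
      have "case_nat b (v(i := z)) = (case_nat b v)(Suc i := z)" for z
        by (auto simp: fun_eq_iff split: nat.split)
      then show "linear (\<lambda>z. contract b \<omega> x (v(i := z)))"
        unfolding contract_def using multilin_linear[OF smooth_forms_multilin[OF \<omega>], of "Suc i"] i by simp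
    qed
    fix v :: "nat \<Rightarrow> 'a" and i j assume "i < k" "j < k" "i \<noteq> j" "v i = v j"
    then have "Suc i < Suc k" "Suc j < Suc k" "Suc i \<noteq> Suc j" "case_nat b v (Suc i) = case_nat b v (Suc j)" by auto
    with smooth_forms_covector[OF \<omega>, of x] show "contract b \<omega> x v = 0"
      unfolding contract_def covectors_def by blast
  qed
next
  show "smooth_function (\<lambda>x. contract b \<omega> x v)" for v
    unfolding contract_def by (rule smooth_forms_smooth[OF \<omega>])
qed

lemma ext_deriv_0_contract: "ext_deriv 0 \<omega> x (case_nat b v) = dird b (\<lambda>y. \<omega> y v) x"
  by (simp add: ext_deriv_dird)

text \<open>Cartan's formula for a constant vector field.\<close>

lemma ext_deriv_contract:
  "ext_deriv (Suc k) \<omega> x (case_nat b v) = dird b (\<lambda>y. \<omega> y v) x - ext_deriv k (contract b \<omega>) x v"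
proof -
  have "(\<lambda>j. if j < Suc i then case_nat b v j else case_nat b v (Suc j))
      = case_nat b (\<lambda>j. if j < i then v j else v (Suc j))" for i
    by (auto simp: fun_eq_iff split: nat.split)
  then show ?thesis
    unfolding ext_deriv_dird sum.atMost_Suc_shift contract_def by (simp add: sum_negf)
qed

section \<open>Currents and normal currents: supports, masses, flat norms\<close>

section \<open>Currents\<close>

lemma dird_cong_open:
  assumes "open S" "x \<in> S" "\<And>y. y \<in> S \<Longrightarrow> f y = g y"
  shows "dird u f x = dird u g x"
proof -
  have "(f has_derivative D) (at x) \<longleftrightarrow> (g has_derivative D) (at x)" for D
    using has_derivative_transform_within_open[of f D x UNIV S g]
      has_derivative_transform_within_open[of g D x UNIV S f] assms by auto
  then show ?thesis unfolding dird_def frechet_derivative_def by simp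
qed

lemma iter_deriv_cong_open:
  assumes "open S" "x \<in> S" "\<And>y. y \<in> S \<Longrightarrow> f y = g y"
  shows "iter_deriv us f x = iter_deriv us g x"
  using assms(2)
proof (induction us arbitrary: x)
  case (Cons u us)
  show ?case unfolding iter_deriv_Cons
    by (rule dird_cong_open[OF assms(1) Cons.prems Cons.IH])
qed (simp add: assms(3))

text \<open>The algebraic part of \<open>currents\<close>, separated from continuity because for the
  functionals constructed below continuity is a consequence of mass bounds.\<close>

definition form_functional :: "nat \<Rightarrow> 'a::euclidean_space current \<Rightarrow> bool" where
  "form_functional m T \<longleftrightarrow> (\<forall>\<omega>. \<omega> \<notin> smooth_forms m \<longrightarrow> T \<omega> = 0) \<and>
     (\<forall>\<omega>\<in>smooth_forms m. \<forall>\<eta>\<in>smooth_forms m. T (\<lambda>x v. \<omega> x v + \<eta> x v) = T \<omega> + T \<eta>) \<and>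
     (\<forall>c. \<forall>\<omega>\<in>smooth_forms m. T (\<lambda>x v. c * \<omega> x v) = c * T \<omega>)"

lemma form_functionalD:
  assumes "form_functional m T"
  shows "\<omega> \<notin> smooth_forms m \<Longrightarrow> T \<omega> = 0"
    and "\<omega> \<in> smooth_forms m \<Longrightarrow> \<eta> \<in> smooth_forms m \<Longrightarrow> T (\<lambda>x v. \<omega> x v + \<eta> x v) = T \<omega> + T \<eta>"
    and "\<omega> \<in> smooth_forms m \<Longrightarrow> T (\<lambda>x v. c * \<omega> x v) = c * T \<omega>"
  using assms by (auto simp: form_functional_def)

lemma form_functional_diff:
  assumes T: "form_functional m T" and \<omega>: "\<omega> \<in> smooth_forms m" "\<eta> \<in> smooth_forms m"
  shows "T (\<lambda>x v. \<omega> x v - \<eta> x v) = T \<omega> - T \<eta>"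
  using form_functionalD(2)[OF T \<omega>(1) smooth_forms_cmult[OF \<omega>(2), of "-1"]]
    form_functionalD(3)[OF T \<omega>(2), of "-1"] by simp

lemma form_functional_zero: "form_functional m T \<Longrightarrow> T (\<lambda>x v. 0) = 0"
  using form_functionalD(3)[OF _ smooth_forms_zero, of m T 0] by simp

lemma form_functional_sum:
  assumes T: "form_functional m T" and \<omega>: "\<And>i. i \<in> I \<Longrightarrow> \<omega> i \<in> smooth_forms m"
  shows "T (\<lambda>x v. \<Sum>i\<in>I. \<omega> i x v) = (\<Sum>i\<in>I. T (\<omega> i))"
  using \<omega>
proof (induction I rule: infinite_finite_induct)
  case (insert i I)
  then show ?case
    using form_functionalD(2)[OF T, of "\<omega> i" "\<lambda>x v. \<Sum>i\<in>I. \<omega> i x v"] by (simp add: smooth_forms_sum)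
qed (simp_all add: form_functional_zero[OF T])

lemma currents_functional: "T \<in> currents m \<Longrightarrow> form_functional m T"
  by (simp add: currents_def form_functional_def)

lemma form_seminorms_nonempty:
  "{form_seminorm K us v | K us v. compact K \<and> K \<noteq> {}} \<noteq> {}" (is "?S \<noteq> {}")
proof
  assume "?S = {}"
  moreover have "form_seminorm {0} [] (\<lambda>_. 0) \<in> ?S"
    by (rule CollectI, rule exI[of _ "{0}"]) auto
  ultimately show False by (simp only: empty_iff)
qed

lemma topspace_form_topology: "topspace (form_topology m) = smooth_forms m"
  unfolding form_topology_def by (rule topspace_seminorm_topology[OF form_seminorms_nonempty])

abbreviation vanishes_on :: "'a::euclidean_space set \<Rightarrow> 'a form \<Rightarrow> bool" where
  "vanishes_on V \<omega> \<equiv> \<forall>x\<in>V. \<omega> x = (\<lambda>v. 0)"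

text \<open>A neighbourhood of 0 in the form topology constrains finitely many derivatives on
  compact sets. A form vanishing near a suitable compact set therefore lies in it, together with all
  its multiples; on the neighbourhood where \<open>T\<close> is less than 1 in absolute value this
  forces the value 0.\<close>

lemma current_vanishes_near:
  fixes T :: "'a::euclidean_space current"
  assumes T: "T \<in> currents m"
  obtains K where "compact K"
    "\<And>\<omega> V. \<omega> \<in> smooth_forms m \<Longrightarrow> open V \<Longrightarrow> K \<subseteq> V \<Longrightarrow> vanishes_on V \<omega> \<Longrightarrow> T \<omega> = 0"
proof -
  let ?G = "{{y \<in> smooth_forms m. p (y - x) < e} | p x e.
      p \<in> {form_seminorm K us v | K us v. compact K \<and> K \<noteq> {}} \<and> x \<in> smooth_forms m \<and> 0 < e}"
  define z :: "'a form" where "z = (\<lambda>x v. 0)"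
  \<comment> \<open>\<open>Q K U\<close> says that forms vanishing near \<open>K\<close> cannot
    leave \<open>U\<close>. Some compact \<open>K\<close> with this property is found along the
    generation of the open sets containing the zero form.\<close>
  define Q where "Q K U \<longleftrightarrow> (\<forall>\<omega> V. \<omega> \<in> smooth_forms m \<and> open V \<and> K \<subseteq> V \<and> vanishes_on V \<omega> \<longrightarrow> \<omega> \<in> U)"
    for K :: "'a set" and U
  have QD: "\<omega> \<in> U" if "Q K U" "\<omega> \<in> smooth_forms m" "open V" "K \<subseteq> V" "vanishes_on V \<omega>" for K U \<omega> V
    using that unfolding Q_def by blast
  have step: "z \<in> U \<Longrightarrow> \<exists>K. compact K \<and> Q K U"
    if "generate_topology_on ?G U" for U
    using that
  proof (induction rule: generate_topology_on.induct)
    case (Int a b)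
    obtain K where K: "compact K" "Q K a" using Int.IH(1) Int.prems by auto
    obtain L where L: "compact L" "Q L b" using Int.IH(2) Int.prems by auto
    have "Q (K \<union> L) (a \<inter> b)"
      unfolding Q_def
    proof (intro allI impI, elim conjE)
      fix \<omega> :: "'a form" and V assume w: "\<omega> \<in> smooth_forms m" "open V" "K \<union> L \<subseteq> V" "vanishes_on V \<omega>"
      show "\<omega> \<in> a \<inter> b" using QD[OF K(2) w(1,2) _ w(4)] QD[OF L(2) w(1,2) _ w(4)] w(3) by simp
    qed
    with compact_Un[OF K(1) L(1)] show ?case by (intro exI conjI)
  next
    case (UN \<K>)
    then obtain k where k: "k \<in> \<K>" "z \<in> k" by auto
    then obtain K where K: "compact K" "Q K k" using UN.IH by auto
    have "Q K (\<Union>\<K>)"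
      unfolding Q_def
    proof (intro allI impI, elim conjE)
      fix \<omega> :: "'a form" and V assume w: "\<omega> \<in> smooth_forms m" "open V" "K \<subseteq> V" "vanishes_on V \<omega>"
      show "\<omega> \<in> \<Union>\<K>" using QD[OF K(2) w] k(1) by auto
    qed
    with K(1) show ?case by (intro exI conjI)
  next
    case (Basis s)
    from Basis.hyps obtain p x e where p: "s = {y \<in> smooth_forms m. p (y - x) < e}"
      "p \<in> {form_seminorm K us v | K us v. compact K \<and> K \<noteq> {}}" by blast
    from p(2) obtain K us v where K: "p = form_seminorm K us v" "compact K" by blast
    have s: "s = {y \<in> smooth_forms m. form_seminorm K us v (y - x) < e}" "compact K"
      using p(1) K by simp_all
    have "Q K s"
      unfolding Q_def
    proof (intro allI impI, elim conjE)
      fix \<omega> :: "'a form" and V assume w: "\<omega> \<in> smooth_forms m" "open V" "K \<subseteq> V" "vanishes_on V \<omega>"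
      \<comment> \<open>On \<open>K\<close> the derivatives of the form are those of the zero form,
        so the seminorm does not distinguish the two, whatever the centre \<open>x\<close> of the
        subbasic ball.\<close>
      have "iter_deriv us (\<lambda>y. (\<omega> - x) y v) a = iter_deriv us (\<lambda>y. (z - x) y v) a" if "a \<in> K" for a
      proof (rule iter_deriv_cong_open[OF w(2)])
        show "a \<in> V" using that w(3) by blast
        show "(\<omega> - x) y v = (z - x) y v" if "y \<in> V" for y using that w(4) by (simp add: z_def)
      qed
      then have "form_seminorm K us v (\<omega> - x) = form_seminorm K us v (z - x)"
        unfolding form_seminorm_def by simp
      then show "\<omega> \<in> s" using Basis.prems w(1) unfolding s by simp
    qed
    with s(2) show ?case by (intro exI conjI)
  qed simp
  note F = currents_functional[OF T]
  have "continuous_map (form_topology m) euclideanreal T" using T by (simp add: currents_def)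
  then have "openin (form_topology m) {\<omega> \<in> topspace (form_topology m). T \<omega> \<in> {-1<..<1}}"
    by (rule openin_continuous_map_preimage) simp
  then have gen: "generate_topology_on ?G {\<omega> \<in> smooth_forms m. T \<omega> \<in> {-1<..<1}}"
    unfolding topspace_form_topology unfolding form_topology_def seminorm_topology_def openin_topology_generated_by_iff .
  have "z \<in> {\<omega> \<in> smooth_forms m. T \<omega> \<in> {-1<..<1}}"
    unfolding z_def by (simp add: smooth_forms_zero form_functional_zero[OF F])
  from step[OF gen this] obtain K where K: "compact K" "Q K {\<omega> \<in> smooth_forms m. T \<omega> \<in> {-1<..<1}}" by auto
  show thesis
  proof (rule that[OF K(1)])
    fix \<omega> :: "'a form" and V assume \<omega>: "\<omega> \<in> smooth_forms m" "open V" "K \<subseteq> V" "vanishes_on V \<omega>"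
    show "T \<omega> = 0"
    proof (rule ccontr)
      \<comment> \<open>Rescaled to have value 1, the form would still have to lie in the set where
        \<open>T\<close> takes values in the open interval.\<close>
      assume n: "T \<omega> \<noteq> 0"
      have "vanishes_on V (\<lambda>x v. (1 / T \<omega>) * \<omega> x v)" using \<omega>(4) by simp
      from QD[OF K(2) smooth_forms_cmult[OF \<omega>(1)] \<omega>(2,3) this]
      have "T (\<lambda>x v. (1 / T \<omega>) * \<omega> x v) \<in> {-1<..<1}" by simp
      then show False using n by (simp only: form_functionalD(3)[OF F \<omega>(1)]) simp
    qed
  qed
qed

lemma tuples_nonempty: "(tuples m :: (nat \<Rightarrow> 'a::euclidean_space) set) \<noteq> {}"
  unfolding tuples_def by (simp add: PiE_eq_empty_iff)

text \<open>A mass bound over a compact set implies continuity: the comass on the set is controlled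
  by the finitely many seminorms of order zero that evaluate a form on tuples of basis
  vectors.\<close>

lemma currentI:
  fixes T :: "'a::euclidean_space current"
  assumes F: "form_functional m T" and K: "compact K" and C: "0 \<le> C"
    and bnd: "\<And>\<omega> B. \<omega> \<in> smooth_forms m \<Longrightarrow> 0 \<le> B \<Longrightarrow> form_le m K B \<omega> \<Longrightarrow> \<bar>T \<omega>\<bar> \<le> C * B"
  shows "T \<in> currents m"
proof -
  \<comment> \<open>A point is added because the seminorms of the topology are indexed by nonempty
    compact sets.\<close>
  define L where "L = insert 0 K"
  have L: "compact L" "L \<noteq> {}" using K by (auto simp: L_def)
  define p :: "(nat \<Rightarrow> 'a) \<Rightarrow> 'a form \<Rightarrow> real" where "p I = form_seminorm L [] I" for I
  have p: "\<bar>\<omega> x I\<bar> \<le> p I \<omega>" if a: "\<omega> \<in> smooth_forms m" "x \<in> L" for \<omega> x I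
  proof -
    obtain D where "\<And>x. x \<in> L \<Longrightarrow> \<bar>\<omega> x I\<bar> \<le> D"
      using bounded_smooth_on_compact[OF smooth_forms_smooth[OF a(1)] L(1)] by blast
    then show ?thesis unfolding p_def form_seminorm_def iter_deriv.simps
      by (intro cSUP_upper a(2) bdd_aboveI2[where M=D]) auto
  qed
  have "openin (form_topology m) {\<omega> \<in> smooth_forms m. T \<omega> \<in> U}" if U: "open U" for U
  proof (subst openin_subopen, intro ballI)
    fix \<omega>0 assume "\<omega>0 \<in> {\<omega> \<in> smooth_forms m. T \<omega> \<in> U}"
    then have \<omega>0: "\<omega>0 \<in> smooth_forms m" "T \<omega>0 \<in> U" by auto
    obtain e where e: "e > 0" "ball (T \<omega>0) e \<subseteq> U" using U \<omega>0(2) open_contains_ball by blast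
    define n where "n = real (card (tuples m :: (nat \<Rightarrow> 'a) set))"
    \<comment> \<open>Small enough that \<open>C\<close> times the number of tuples times
      \<open>d\<close> is less than \<open>e\<close>; the summands 1 keep the denominator
      positive.\<close>
    define d where "d = e / ((C + 1) * (n + 1))"
    have n: "0 \<le> n" by (simp add: n_def)
    have d: "d > 0" unfolding d_def using e C n by simp
    define N where "N = (\<Inter>I\<in>tuples m. {y \<in> smooth_forms m. p I (y - \<omega>0) < d})"
    have "openin (form_topology m) {y \<in> smooth_forms m. p I (y - \<omega>0) < d}" for I
      unfolding form_topology_def seminorm_topology_def
    proof (rule topology_generated_by_Basis, rule CollectI, intro exI conjI)
      show "p I \<in> {form_seminorm K us v | K us v. compact K \<and> K \<noteq> {}}"
        unfolding p_def by (rule CollectI, rule exI[of _ L], rule exI[of _ "[]"], rule exI[of _ I]) (use L in simp)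
    qed (use \<omega>0(1) d in simp_all)
    then have N: "openin (form_topology m) N"
      unfolding N_def by (intro openin_INT2 finite_tuples tuples_nonempty)
    have 0: "\<omega>0 \<in> N"
    proof -
      have "p I (\<omega>0 - \<omega>0) = 0" for I
        unfolding p_def form_seminorm_def using L(2) by simp
      then show ?thesis unfolding N_def using \<omega>0(1) d by auto
    qed
    have "T y \<in> U" if y: "y \<in> N" for y
    proof -
      have yS: "y \<in> smooth_forms m" and yp: "\<And>I. I \<in> tuples m \<Longrightarrow> p I (y - \<omega>0) < d"
        using y tuples_nonempty[of m] unfolding N_def by auto
      have yd: "y - \<omega>0 = (\<lambda>x v. y x v - \<omega>0 x v)" by (simp add: fun_eq_iff)
      have S: "(\<lambda>x v. y x v - \<omega>0 x v) \<in> smooth_forms m" by (rule smooth_forms_diff[OF yS \<omega>0(1)])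
      have "form_le m K (n * d) (\<lambda>x v. y x v - \<omega>0 x v)"
      proof (rule form_leI)
        fix x and v :: "nat \<Rightarrow> 'a" assume x: "x \<in> K" and v: "unit_vectors m v"
        have "\<bar>y x v - \<omega>0 x v\<bar> \<le> (\<Sum>I\<in>tuples m. \<bar>y x I - \<omega>0 x I\<bar>)"
          by (rule multilin_bound[OF smooth_forms_multilin[OF S] v])
        also have "\<dots> \<le> (\<Sum>I\<in>(tuples m :: (nat \<Rightarrow> 'a) set). d)"
        proof (rule sum_mono)
          fix I :: "nat \<Rightarrow> 'a" assume I: "I \<in> tuples m"
          show "\<bar>y x I - \<omega>0 x I\<bar> \<le> d"
            using p[OF S, of x I] yp[OF I] x unfolding yd by (simp add: L_def)
        qed
        finally show "\<bar>y x v - \<omega>0 x v\<bar> \<le> n * d" by (simp add: n_def)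
      qed
      then have "\<bar>T (\<lambda>x v. y x v - \<omega>0 x v)\<bar> \<le> C * (n * d)"
        using n d by (intro bnd S) auto
      also have "C * (n * d) < e"
      proof -
        have "C * n < (C + 1) * (n + 1)" using C n by (simp add: algebra_simps)
        then have "C * n / ((C + 1) * (n + 1)) < 1" using C n by (simp add: divide_less_eq_1_pos)
        from mult_strict_left_mono[OF this e(1)] show ?thesis unfolding d_def by (simp add: mult.commute mult.left_commute)
      qed
      finally have "\<bar>T y - T \<omega>0\<bar> < e"
        by (simp add: form_functional_diff[OF F yS \<omega>0(1)])
      then show ?thesis using e(2) by (auto simp: dist_real_def subset_iff abs_minus_commute)
    qed
    then have "N \<subseteq> {\<omega> \<in> smooth_forms m. T \<omega> \<in> U}"
      using tuples_nonempty[of m] unfolding N_def by blast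
    with N 0 show "\<exists>N. openin (form_topology m) N \<and> \<omega>0 \<in> N \<and> N \<subseteq> {\<omega> \<in> smooth_forms m. T \<omega> \<in> U}"
      by blast
  qed
  then have "continuous_map (form_topology m) euclideanreal T"
    unfolding continuous_map_def topspace_form_topology by simp
  with F show ?thesis by (simp add: currents_def form_functional_def)
qed

subsection \<open>Supports\<close>

lemma closed_spt: "closed (spt m T)"
  unfolding spt_def by (intro closed_Compl open_Union) auto

lemma spt_subsetI:
  assumes Z: "closed Z"
    and van: "\<And>\<omega> V. \<omega> \<in> smooth_forms m \<Longrightarrow> open V \<Longrightarrow> Z \<subseteq> V \<Longrightarrow> vanishes_on V \<omega> \<Longrightarrow> T \<omega> = 0"
  shows "spt m T \<subseteq> Z"
proof -
  have "T \<omega> = 0" if "\<omega> \<in> smooth_forms m" "closure {x. \<exists>v. \<omega> x v \<noteq> 0} \<subseteq> - Z" for \<omega>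
  proof (rule van[OF that(1)])
    show "open (- closure {x. \<exists>v. \<omega> x v \<noteq> 0})" by (intro open_Compl closed_closure)
    show "Z \<subseteq> - closure {x. \<exists>v. \<omega> x v \<noteq> 0}" using that(2) by blast
    show "vanishes_on (- closure {x. \<exists>v. \<omega> x v \<noteq> 0}) \<omega>"
      using closure_subset[of "{x. \<exists>v. \<omega> x v \<noteq> 0}"] by (auto simp: fun_eq_iff)
  qed
  moreover have "open (- Z)" using Z by (rule open_Compl)
  ultimately show ?thesis unfolding spt_def by blast
qed

text \<open>The definition of the support only gives the value 0 on forms supported in a single open
  set of the family. A compact set \<open>K\<close> carries \<open>T\<close>, and finitely many
  balls on which \<open>T\<close> is locally zero cover \<open>K - V\<close>. Multiplying
  \<open>\<omega>\<close> by 1 - bump for each ball leaves the value of \<open>T\<close> unchanged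
  and produces a form that vanishes near \<open>K\<close>.\<close>

lemma spt_vanish:
  fixes T :: "'a::euclidean_space current"
  assumes T: "T \<in> currents m" and \<omega>: "\<omega> \<in> smooth_forms m"
    and V: "open V" "spt m T \<subseteq> V" "vanishes_on V \<omega>"
  shows "T \<omega> = 0"
proof -
  note F = currents_functional[OF T]
  obtain K where K: "compact K"
    "\<And>\<omega> V. \<omega> \<in> smooth_forms m \<Longrightarrow> open V \<Longrightarrow> K \<subseteq> V \<Longrightarrow> vanishes_on V \<omega> \<Longrightarrow> T \<omega> = 0"
    using current_vanishes_near[OF T] by blast
  have C: "compact (K - V)" using K(1) V(1) by (rule compact_diff)
  have "\<exists>r>0. \<forall>\<zeta>\<in>smooth_forms m. T (\<lambda>y v. bump x r y * \<zeta> y v) = 0" if x: "x \<in> K - V" for x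
  proof -
    have "x \<notin> spt m T" using x V(2) by blast
    then obtain U where U: "open U" "x \<in> U"
      "\<And>\<omega>. \<omega> \<in> smooth_forms m \<Longrightarrow> closure {x. \<exists>v. \<omega> x v \<noteq> 0} \<subseteq> U \<Longrightarrow> T \<omega> = 0"
      unfolding spt_def by auto
    then obtain e where e: "e > 0" "cball x e \<subseteq> U" using open_contains_cball by blast
    have "T (\<lambda>y v. bump x (e/2) y * \<zeta> y v) = 0" if \<zeta>: "\<zeta> \<in> smooth_forms m" for \<zeta>
    proof (rule U(3)[OF smooth_forms_mult[OF \<zeta> smooth_bump]])
      have "{y. \<exists>v. bump x (e/2) y * \<zeta> y v \<noteq> 0} \<subseteq> cball x e"
      proof clarsimp
        fix y assume "bump x (e/2) y \<noteq> 0"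
        then show "dist x y \<le> e" using bump_eq_0[of "e/2" y x] e(1) by (force simp: dist_norm norm_minus_commute)
      qed
      then have "closure {y. \<exists>v. bump x (e/2) y * \<zeta> y v \<noteq> 0} \<subseteq> cball x e"
        by (rule closure_minimal) simp
      with e(2) show "closure {y. \<exists>v. bump x (e/2) y * \<zeta> y v \<noteq> 0} \<subseteq> U" by blast
    qed
    then show ?thesis using e(1) by (intro exI[of _ "e/2"]) auto
  qed
  then obtain r where r: "\<And>x. x \<in> K - V \<Longrightarrow> r x > 0"
    "\<And>x \<zeta>. x \<in> K - V \<Longrightarrow> \<zeta> \<in> smooth_forms m \<Longrightarrow> T (\<lambda>y v. bump x (r x) y * \<zeta> y v) = 0" by metis
  have "K - V \<subseteq> (\<Union>x\<in>K - V. ball x (r x))" using r(1) by force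
  then obtain D where D: "D \<subseteq> K - V" "finite D" "K - V \<subseteq> (\<Union>x\<in>D. ball x (r x))"
    using compactE_image[OF C, of "K - V" "\<lambda>x. ball x (r x)"] by auto
  \<comment> \<open>One ball is removed at a time; the removed part is a bump times a smooth form,
    on which \<open>T\<close> vanishes.\<close>
  have "(\<lambda>y v. (\<Prod>x\<in>D. 1 - bump x (r x) y) * \<omega> y v) \<in> smooth_forms m \<and>
      T (\<lambda>y v. (\<Prod>x\<in>D. 1 - bump x (r x) y) * \<omega> y v) = T \<omega>"
    using D(2,1)
  proof (induction D rule: finite_induct)
    case empty
    then show ?case using \<omega> by simp
  next
    case (insert x D)
    let ?z = "\<lambda>y v. (\<Prod>x\<in>D. 1 - bump x (r x) y) * \<omega> y v"
    have z: "?z \<in> smooth_forms m" "T ?z = T \<omega>" using insert by auto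
    have bz: "(\<lambda>y v. bump x (r x) y * ?z y v) \<in> smooth_forms m" by (rule smooth_forms_mult[OF z(1) smooth_bump])
    have eq: "(\<lambda>y v. (\<Prod>x\<in>insert x D. 1 - bump x (r x) y) * \<omega> y v) = (\<lambda>y v. ?z y v - bump x (r x) y * ?z y v)"
      using insert(1,2) by (simp add: fun_eq_iff algebra_simps)
    have "T (\<lambda>y v. bump x (r x) y * ?z y v) = 0" by (rule r(2)) (use insert z in auto)
    then show ?case
      unfolding eq using smooth_forms_diff[OF z(1) bz] form_functional_diff[OF F z(1) bz] z(2) by simp
  qed
  moreover have "T (\<lambda>y v. (\<Prod>x\<in>D. 1 - bump x (r x) y) * \<omega> y v) = 0"
  proof (rule K(2)[of _ "V \<union> (\<Union>x\<in>D. ball x (r x))"])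
    show "vanishes_on (V \<union> (\<Union>x\<in>D. ball x (r x))) (\<lambda>y v. (\<Prod>x\<in>D. 1 - bump x (r x) y) * \<omega> y v)"
    proof
      fix y assume "y \<in> V \<union> (\<Union>x\<in>D. ball x (r x))"
      then consider "y \<in> V" | x where "x \<in> D" "y \<in> ball x (r x)" by blast
      then show "(\<lambda>v. (\<Prod>x\<in>D. 1 - bump x (r x) y) * \<omega> y v) = (\<lambda>v. 0)"
      proof cases
        case 1
        then show ?thesis using V(3) by simp
      next
        case 2
        have "bump x (r x) y = 1"
          using 2 D(1) by (intro bump_eq_1 r(1)) (auto simp: dist_norm norm_minus_commute)
        then have "(\<Prod>x\<in>D. 1 - bump x (r x) y) = 0" using 2(1) D(2) by (intro prod_zero) auto
        then show ?thesis by simp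
      qed
    qed
  qed (use calculation D(3) V(1) in auto)
  ultimately show ?thesis by simp
qed

lemma compact_spt:
  assumes T: "T \<in> currents m" shows "compact (spt m T)"
proof -
  obtain K where K: "compact K"
    "\<And>\<omega> V. \<omega> \<in> smooth_forms m \<Longrightarrow> open V \<Longrightarrow> K \<subseteq> V \<Longrightarrow> vanishes_on V \<omega> \<Longrightarrow> T \<omega> = 0"
    using current_vanishes_near[OF T] by blast
  have "spt m T \<subseteq> K" using K by (intro spt_subsetI compact_imp_closed) blast+
  with K(1) closed_spt[of m T] show ?thesis by (metis compact_Int_closed inf.absorb_iff2)
qed

subsection \<open>Cutoff functions\<close>

text \<open>The closed \<open>r\<close>-neighbourhood of a compact set, written as a Minkowski sum
  so that compactness is immediate.\<close>

definition thick :: "real \<Rightarrow> 'a::euclidean_space set \<Rightarrow> 'a set" where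
  "thick r K = {x + y | x y. x \<in> K \<and> y \<in> cball 0 r}"

lemma compact_thick: "compact K \<Longrightarrow> compact (thick r K)"
  unfolding thick_def by (intro compact_sums compact_cball)

lemma thickI: "x \<in> K \<Longrightarrow> dist x y \<le> r \<Longrightarrow> y \<in> thick r K"
  unfolding thick_def by (rule CollectI, rule exI[of _ x], rule exI[of _ "y - x"]) (simp add: dist_norm norm_minus_commute)

lemma thickE:
  assumes "y \<in> thick r K" obtains x where "x \<in> K" "dist x y \<le> r"
  using assms unfolding thick_def by (auto simp: dist_norm)

lemma subset_thick: "0 \<le> r \<Longrightarrow> K \<subseteq> thick r K"
  using thickI[of _ K _ r] by force

lemma thick_mono: "r \<le> s \<Longrightarrow> K \<subseteq> L \<Longrightarrow> thick r K \<subseteq> thick s L"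
  by (meson order_trans subset_iff thickE thickI)

lemma thick_thick: "thick r (thick s K) \<subseteq> thick (r + s) K"
proof
  fix y assume "y \<in> thick r (thick s K)"
  then obtain z where z: "z \<in> thick s K" "dist z y \<le> r" by (rule thickE)
  then obtain x where x: "x \<in> K" "dist x z \<le> s" by (meson thickE)
  have "dist x y \<le> r + s" using z(2) x(2) dist_triangle[of x y z] by linarith
  with x(1) show "y \<in> thick (r + s) K" by (rule thickI)
qed

text \<open>The function is one minus the product of 1 - bump over a finite cover by balls of radius
  r/2; each bump vanishes outside the ball of radius \<open>r\<close>.\<close>

lemma cutoff_exists:
  fixes K :: "'a::euclidean_space set"
  assumes K: "compact K" and r: "r > 0"
  obtains \<kappa> V where "smooth_function \<kappa>" "\<And>x. 0 \<le> \<kappa> x" "\<And>x. \<kappa> x \<le> 1" "open V" "K \<subseteq> V"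
    "\<And>x. x \<in> V \<Longrightarrow> \<kappa> x = 1" "\<And>x. x \<notin> thick r K \<Longrightarrow> \<kappa> x = 0"
proof -
  have "K \<subseteq> (\<Union>x\<in>K. ball x (r/2))" using r by force
  then obtain D where D: "D \<subseteq> K" "finite D" "K \<subseteq> (\<Union>x\<in>D. ball x (r/2))"
    using compactE_image[OF K, of K "\<lambda>x. ball x (r/2)"] by auto
  define P where "P y = (\<Prod>x\<in>D. 1 - bump x (r/2) y)" for y
  have sm: "smooth_function P"
    unfolding P_def[abs_def] using D(2)
  proof (induction D rule: finite_induct)
    case (insert x D)
    then show ?case
      using smooth_mult[OF smooth_diff[OF smooth_const[of 1] smooth_bump[of x "r/2"]] insert.IH] by simp
  qed simp
  have P: "0 \<le> P y" "P y \<le> 1" for y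
    unfolding P_def using bump_bounds[of _ "r/2" y] by (auto intro!: prod_nonneg prod_le_1)
  show thesis
  proof (rule that[of "\<lambda>y. 1 - P y" "\<Union>x\<in>D. ball x (r/2)"])
    fix y assume "y \<in> (\<Union>x\<in>D. ball x (r/2))"
    then obtain x where x: "x \<in> D" "dist x y < r/2" by auto
    have "bump x (r/2) y = 1" using x(2) r by (intro bump_eq_1) (auto simp: dist_norm norm_minus_commute)
    then have "P y = 0" unfolding P_def using x(1) D(2) by (intro prod_zero) auto
    then show "1 - P y = 1" by simp
  next
    fix y assume y: "y \<notin> thick r K"
    have "bump x (r/2) y = 0" if "x \<in> D" for x
    proof (rule bump_eq_0)
      have "\<not> dist x y \<le> r" using y that D(1) thickI[of x K y r] by blast
      then show "2 * (r/2) \<le> norm (y - x)" by (simp add: dist_norm norm_minus_commute)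
    qed (use r in simp)
    then show "1 - P y = 0" unfolding P_def by simp
  qed (use P D(3) in \<open>auto intro: smooth_diff sm\<close>)
qed

lemma current_cutoff:
  assumes T: "T \<in> currents m" and K: "spt m T \<subseteq> V" "open V" and \<kappa>: "smooth_function \<kappa>" "\<And>x. x \<in> V \<Longrightarrow> \<kappa> x = 1"
    and \<omega>: "\<omega> \<in> smooth_forms m"
  shows "T (\<lambda>x v. \<kappa> x * \<omega> x v) = T \<omega>"
proof -
  have s: "(\<lambda>x v. \<kappa> x * \<omega> x v) \<in> smooth_forms m" by (rule smooth_forms_mult[OF \<omega> \<kappa>(1)])
  have "T (\<lambda>x v. \<omega> x v - \<kappa> x * \<omega> x v) = 0"
    by (rule spt_vanish[OF T smooth_forms_diff[OF \<omega> s] K(2,1)]) (simp add: \<kappa>(2))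
  then show ?thesis using form_functional_diff[OF currents_functional[OF T] \<omega> s] by simp
qed

lemma form_le_cutoff:
  fixes S :: "'a::euclidean_space set"
  assumes "form_le m S B \<omega>" "0 \<le> B" "\<And>x. 0 \<le> \<kappa> x" "\<And>x. \<kappa> x \<le> 1" "\<And>x. x \<notin> S \<Longrightarrow> \<kappa> x = 0"
  shows "form_le m UNIV B (\<lambda>x v. \<kappa> x * \<omega> x v)"
proof (rule form_leI)
  fix x and v :: "nat \<Rightarrow> 'a" assume v: "unit_vectors m v"
  show "\<bar>\<kappa> x * \<omega> x v\<bar> \<le> B"
  proof (cases "x \<in> S")
    case True
    have "\<bar>\<kappa> x * \<omega> x v\<bar> \<le> 1 * B"
      unfolding abs_mult by (intro mult_mono form_leD[OF assms(1) True v]) (use assms(3,4)[of x] in auto)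
    then show ?thesis by simp
  qed (use assms in simp)
qed

subsection \<open>Mass and flat norm\<close>

text \<open>A supremum over a symmetric unit ball turns into a two-sided homogeneous inequality by
  rescaling with 1/B and -1/B. The predicate \<open>N B\<close> stands for the ball of radius
  \<open>B\<close>; it is instantiated for the mass and for the flat norm.\<close>

lemma gauge_sup_le_iff:
  fixes T :: "'a::euclidean_space current"
  assumes F: "form_functional m T"
    and N: "\<And>\<omega> a B. \<omega> \<in> smooth_forms m \<Longrightarrow> N B \<omega> \<Longrightarrow> N (\<bar>a\<bar> * B) (\<lambda>x v. a * \<omega> x v)"
  shows "(SUP \<omega>\<in>{\<omega> \<in> smooth_forms m. N 1 \<omega>}. ereal (T \<omega>)) \<le> ereal c \<longleftrightarrow>
    (\<forall>\<omega>\<in>smooth_forms m. \<forall>B>0. N B \<omega> \<longrightarrow> \<bar>T \<omega>\<bar> \<le> c * B)"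
proof
  assume L: "(SUP \<omega>\<in>{\<omega> \<in> smooth_forms m. N 1 \<omega>}. ereal (T \<omega>)) \<le> ereal c"
  have le: "T \<omega> \<le> c" if "\<omega> \<in> smooth_forms m" "N 1 \<omega>" for \<omega>
    using L that by (simp add: SUP_le_iff)
  show "\<forall>\<omega>\<in>smooth_forms m. \<forall>B>0. N B \<omega> \<longrightarrow> \<bar>T \<omega>\<bar> \<le> c * B"
  proof (intro ballI allI impI)
    fix \<omega> :: "'a form" and B :: real assume \<omega>: "\<omega> \<in> smooth_forms m" and B: "B > 0" and "N B \<omega>"
    have "T (\<lambda>x v. (1/B) * \<omega> x v) \<le> c"
      by (rule le[OF smooth_forms_cmult[OF \<omega>]]) (use N[OF \<omega> \<open>N B \<omega>\<close>, of "1/B"] B in simp)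
    moreover have "T (\<lambda>x v. (-1/B) * \<omega> x v) \<le> c"
      by (rule le[OF smooth_forms_cmult[OF \<omega>]]) (use N[OF \<omega> \<open>N B \<omega>\<close>, of "-1/B"] B in simp)
    ultimately have 1: "T \<omega> / B \<le> c" and 2: "(- T \<omega>) / B \<le> c"
      unfolding form_functionalD(3)[OF F \<omega>] by auto
    have "T \<omega> \<le> c * B" using 1 pos_divide_le_eq[OF B, of "T \<omega>" c] by blast
    moreover have "- T \<omega> \<le> c * B" using 2 pos_divide_le_eq[OF B, of "- T \<omega>" c] by blast
    ultimately show "\<bar>T \<omega>\<bar> \<le> c * B" by linarith
  qed
next
  assume R: "\<forall>\<omega>\<in>smooth_forms m. \<forall>B>0. N B \<omega> \<longrightarrow> \<bar>T \<omega>\<bar> \<le> c * B"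
  have "T \<omega> \<le> c" if "\<omega> \<in> smooth_forms m" "N 1 \<omega>" for \<omega>
    using R[rule_format, OF that(1) zero_less_one that(2)] by simp
  then show "(SUP \<omega>\<in>{\<omega> \<in> smooth_forms m. N 1 \<omega>}. ereal (T \<omega>)) \<le> ereal c"
    by (simp add: SUP_le_iff)
qed

definition flat_form_le :: "nat \<Rightarrow> 'a::euclidean_space set \<Rightarrow> real \<Rightarrow> 'a form \<Rightarrow> bool" where
  "flat_form_le m S B \<omega> \<longleftrightarrow> form_le m S B \<omega> \<and> form_le (Suc m) S B (ext_deriv m \<omega>)"

lemma mass_le_iff:
  fixes T :: "'a::euclidean_space current"
  assumes F: "form_functional m T"
  shows "mass m T \<le> ereal c \<longleftrightarrow> (\<forall>\<omega>\<in>smooth_forms m. \<forall>B>0. form_le m UNIV B \<omega> \<longrightarrow> \<bar>T \<omega>\<bar> \<le> c * B)"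
proof -
  have "form_norm m \<omega> \<le> 1 \<longleftrightarrow> form_le m UNIV 1 \<omega>" if "\<omega> \<in> smooth_forms m" for \<omega> :: "'a form"
    using form_norm_le_iff[OF smooth_forms_covector[OF that], where B=1] by (simp add: one_ereal_def)
  then have "{\<omega> \<in> (smooth_forms m :: 'a form set). form_norm m \<omega> \<le> 1} = {\<omega> \<in> smooth_forms m. form_le m UNIV 1 \<omega>}"
    by (intro Collect_cong conj_cong refl)
  then show ?thesis
    unfolding mass_def by (simp only: gauge_sup_le_iff[where N="form_le m UNIV", OF F form_le_cmult])
qed

lemma flat_norm_le_iff:
  fixes T :: "'a::euclidean_space current"
  assumes F: "form_functional m T"
  shows "flat_norm m T \<le> ereal c \<longleftrightarrow>
    (\<forall>\<omega>\<in>smooth_forms m. \<forall>B>0. flat_form_le m UNIV B \<omega> \<longrightarrow> \<bar>T \<omega>\<bar> \<le> c * B)"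
proof -
  have "max (form_norm m \<omega>) (form_norm (m + 1) (ext_deriv m \<omega>)) \<le> 1 \<longleftrightarrow> flat_form_le m UNIV 1 \<omega>"
    if "\<omega> \<in> smooth_forms m" for \<omega> :: "'a form"
    using form_norm_le_iff[OF smooth_forms_covector[OF that], where B=1]
      form_norm_le_iff[OF smooth_forms_covector[OF smooth_forms_ext_deriv[OF that]], where B=1]
    by (simp add: flat_form_le_def one_ereal_def)
  then have "{\<omega> \<in> (smooth_forms m :: 'a form set). max (form_norm m \<omega>) (form_norm (m + 1) (ext_deriv m \<omega>)) \<le> 1}
      = {\<omega> \<in> smooth_forms m. flat_form_le m UNIV 1 \<omega>}" by (intro Collect_cong conj_cong refl)
  moreover have "flat_form_le m UNIV (\<bar>a\<bar> * B) (\<lambda>x v. a * \<omega> x v)"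
    if "\<omega> \<in> smooth_forms m" "flat_form_le m UNIV B \<omega>" for \<omega> :: "'a form" and a B
    using that form_le_cmult[of m UNIV B \<omega> a] form_le_cmult[of "Suc m" UNIV B "ext_deriv m \<omega>" a]
    by (simp add: flat_form_le_def ext_deriv_cmult[OF that(1)])
  ultimately show ?thesis
    unfolding flat_norm_def by (simp only: gauge_sup_le_iff[OF F])
qed

text \<open>Inequalities obtained from suprema hold for positive bounds; letting the bound decrease
  recovers the case \<open>B = 0\<close>, from which statements about supports are derived.\<close>

lemma le_mult_limit:
  fixes t c B :: real
  assumes "0 \<le> B" "\<And>B'. B < B' \<Longrightarrow> t \<le> c * B'" shows "t \<le> c * B"
proof (rule tendsto_lowerbound[of "\<lambda>b. c * b" _ "at_right B"])
  show "((\<lambda>b. c * b) \<longlongrightarrow> c * B) (at_right B)" by (intro tendsto_intros)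
  show "\<forall>\<^sub>F b in at_right B. t \<le> c * b"
    using eventually_at_right_less by (rule eventually_mono) (rule assms(2))
qed simp

lemma ext_deriv_zero: "ext_deriv m (\<lambda>(x::'a::euclidean_space) v. 0) = (\<lambda>x v. 0)"
  using ext_deriv_cmult[OF smooth_forms_zero, where c=0 and m=m] by simp

lemma mass_nonneg:
  fixes T :: "'a::euclidean_space current"
  assumes "form_functional m T" shows "0 \<le> mass m T"
  unfolding mass_def
proof (rule SUP_upper2[of "\<lambda>x v. 0"])
  have "form_norm m (\<lambda>(x::'a) v. 0) \<le> ereal 1"
    by (subst form_norm_le_iff) (auto intro: covectors_zero form_leI)
  then show "(\<lambda>(x::'a) v. 0) \<in> {\<omega> \<in> smooth_forms m. form_norm m \<omega> \<le> 1}"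
    by (simp add: smooth_forms_zero one_ereal_def)
  show "0 \<le> ereal (T (\<lambda>x v. 0))" using form_functional_zero[OF assms] by simp
qed

lemma flat_norm_nonneg:
  fixes T :: "'a::euclidean_space current"
  assumes "form_functional m T" shows "0 \<le> flat_norm m T"
proof (rule ccontr)
  assume "\<not> 0 \<le> flat_norm m T"
  then have "flat_norm m T < 0" by simp
  then obtain c where c: "flat_norm m T \<le> ereal c" "c < 0"
    by (metis ereal_dense2 ereal_less(2) less_imp_le order_less_le_trans zero_ereal_def ereal_less_eq(3) less_ereal.simps(1))
  have "flat_form_le m UNIV 1 (\<lambda>(x::'a) v. 0)"
    by (simp add: flat_form_le_def form_le_def ext_deriv_zero)
  then have "\<bar>T (\<lambda>x v. 0)\<bar> \<le> c * 1"
    using c(1) unfolding flat_norm_le_iff[OF assms] by (metis smooth_forms_zero zero_less_one)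
  with c(2) show False by simp
qed

abbreviation real_normal_mass :: "nat \<Rightarrow> 'a::euclidean_space current \<Rightarrow> real" where
  "real_normal_mass m T \<equiv> real_of_ereal (normal_mass m T)"

abbreviation real_flat_norm :: "nat \<Rightarrow> 'a::euclidean_space current \<Rightarrow> real" where
  "real_flat_norm m T \<equiv> real_of_ereal (flat_norm m T)"

lemma boundary_functional:
  assumes F: "form_functional (Suc k) T" shows "form_functional k (boundary (Suc k) T)"
  unfolding form_functional_def boundary_def
  by (auto simp: smooth_forms_add smooth_forms_cmult ext_deriv_add ext_deriv_cmult smooth_forms_ext_deriv
      form_functionalD[OF F])

lemma boundary_apply: "\<omega> \<in> smooth_forms k \<Longrightarrow> boundary (Suc k) T \<omega> = T (ext_deriv k \<omega>)"
  by (simp add: boundary_def)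

lemma normal_currents_currents: "T \<in> normal_currents m \<Longrightarrow> T \<in> currents m"
  by (simp add: normal_currents_def)

lemma normal_currents_functional: "T \<in> normal_currents m \<Longrightarrow> form_functional m T"
  by (intro currents_functional normal_currents_currents)

text \<open>The next two lemmas stand in for all further computations with masses. They are not symmetric: the
  estimates for a normal current involve a neighbourhood of its support, whereas estimates over a
  compact set alone suffice to recognize a normal current.\<close>

lemma normal_currentD:
  fixes T :: "'a::euclidean_space current"
  assumes T: "T \<in> normal_currents m"
  obtains a b where "0 \<le> a" "0 \<le> b" "normal_mass m T = ereal (a + b)"
    "\<And>K r \<omega> B. compact K \<Longrightarrow> spt m T \<subseteq> K \<Longrightarrow> 0 < r \<Longrightarrow> \<omega> \<in> smooth_forms m \<Longrightarrow> 0 \<le> B \<Longrightarrow>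
      form_le m (thick r K) B \<omega> \<Longrightarrow> \<bar>T \<omega>\<bar> \<le> a * B"
    "\<And>k K r \<omega> B. m = Suc k \<Longrightarrow> compact K \<Longrightarrow> spt m T \<subseteq> K \<Longrightarrow> 0 < r \<Longrightarrow> \<omega> \<in> smooth_forms k \<Longrightarrow> 0 \<le> B \<Longrightarrow>
      form_le k (thick r K) B \<omega> \<Longrightarrow> \<bar>T (ext_deriv k \<omega>)\<bar> \<le> b * B"
proof -
  note cur = normal_currents_currents[OF T]
  note F = currents_functional[OF cur]
  have fin: "normal_mass m T < \<infinity>" using T by (simp add: normal_currents_def)
  define a where "a = real_of_ereal (mass m T)"
  define b where "b = (if m = 0 then 0 else real_of_ereal (mass (m - 1) (boundary m T)))"
  have m0: "0 \<le> mass m T" by (rule mass_nonneg[OF F])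
  have b0: "0 \<le> mass (m - 1) (boundary m T)" if "m \<noteq> 0"
    using that F by (cases m) (auto intro!: mass_nonneg boundary_functional)
  have mfin: "mass m T < \<infinity>"
    using fin b0 by (cases "m = 0") (auto simp: normal_mass_def)
  have bfin: "mass (m - 1) (boundary m T) < \<infinity>" if "m \<noteq> 0"
    using fin that m0 by (auto simp: normal_mass_def)
  have ma: "mass m T = ereal a"
    unfolding a_def using m0 mfin by (cases "mass m T") auto
  have mb: "mass (m - 1) (boundary m T) = ereal b" if "m \<noteq> 0"
    unfolding b_def using b0[OF that] bfin[OF that] that by (cases "mass (m - 1) (boundary m T)") auto
  have ab: "0 \<le> a" "0 \<le> b"
    using real_of_ereal_pos[OF m0] real_of_ereal_pos[OF b0] by (simp_all add: a_def b_def)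
  show thesis
  proof (rule that[OF ab])
    show "normal_mass m T = ereal (a + b)"
    proof (cases "m = 0")
      case True
      then show ?thesis using ma by (simp add: normal_mass_def b_def)
    next
      case False
      then show ?thesis unfolding normal_mass_def mb[OF False] ma by simp
    qed
  next
    fix K :: "'a set" and r \<omega> B
    assume K: "compact K" "spt m T \<subseteq> K" and r: "0 < r" and \<omega>: "\<omega> \<in> smooth_forms m" and B: "0 \<le> B" "form_le m (thick r K) B \<omega>"
    obtain \<kappa> V where \<kappa>: "smooth_function \<kappa>" "\<And>x. 0 \<le> \<kappa> x" "\<And>x. \<kappa> x \<le> 1" "open V" "K \<subseteq> V"
      "\<And>x. x \<in> V \<Longrightarrow> \<kappa> x = 1" "\<And>x. x \<notin> thick r K \<Longrightarrow> \<kappa> x = 0"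
      using cutoff_exists[OF K(1) r] by blast
    have "T (\<lambda>x v. \<kappa> x * \<omega> x v) = T \<omega>"
      by (rule current_cutoff[OF cur _ \<kappa>(4,1) \<kappa>(6) \<omega>]) (use K(2) \<kappa>(5) in blast)
    moreover have "\<bar>T (\<lambda>x v. \<kappa> x * \<omega> x v)\<bar> \<le> a * B"
    proof (rule le_mult_limit[OF B(1)])
      fix B' assume "B < B'"
      moreover have "form_le m UNIV B' (\<lambda>x v. \<kappa> x * \<omega> x v)"
        using form_le_mono[OF form_le_cutoff[OF B(2,1) \<kappa>(2,3,7)] subset_UNIV] \<open>B < B'\<close> by simp
      ultimately show "\<bar>T (\<lambda>x v. \<kappa> x * \<omega> x v)\<bar> \<le> a * B'"
        using mass_le_iff[OF F, of a] ma B(1) smooth_forms_mult[OF \<omega> \<kappa>(1)] by auto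
    qed
    ultimately show "\<bar>T \<omega>\<bar> \<le> a * B" by simp
  next
    fix k and K :: "'a set" and r \<omega> B
    assume m: "m = Suc k" and K: "compact K" "spt m T \<subseteq> K" and r: "0 < r" and \<omega>: "\<omega> \<in> smooth_forms k" and B: "0 \<le> B" "form_le k (thick r K) B \<omega>"
    obtain \<kappa> V where \<kappa>: "smooth_function \<kappa>" "\<And>x. 0 \<le> \<kappa> x" "\<And>x. \<kappa> x \<le> 1" "open V" "K \<subseteq> V"
      "\<And>x. x \<in> V \<Longrightarrow> \<kappa> x = 1" "\<And>x. x \<notin> thick r K \<Longrightarrow> \<kappa> x = 0"
      using cutoff_exists[OF K(1) r] by blast
    note s = smooth_forms_mult[OF \<omega> \<kappa>(1)]
    have Fb: "form_functional k (boundary m T)" using boundary_functional F unfolding m by blast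
    \<comment> \<open>The form and its cut-off version agree near the support of \<open>T\<close>,
      hence so do their exterior derivatives: the boundary inherits locality from
      \<open>T\<close>.\<close>
    have "T (ext_deriv k (\<lambda>x v. \<omega> x v - \<kappa> x * \<omega> x v)) = 0"
    proof (rule spt_vanish[OF cur _ \<kappa>(4)])
      show "ext_deriv k (\<lambda>x v. \<omega> x v - \<kappa> x * \<omega> x v) \<in> smooth_forms m"
        unfolding m by (intro smooth_forms_ext_deriv smooth_forms_diff[OF \<omega> s])
      show "spt m T \<subseteq> V" using K(2) \<kappa>(5) by blast
      show "vanishes_on V (ext_deriv k (\<lambda>x v. \<omega> x v - \<kappa> x * \<omega> x v))"
        by (intro ballI ext_deriv_zero_on_open[OF \<kappa>(4)]) (auto simp: \<kappa>(6))
    qed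
    then have "boundary m T (\<lambda>x v. \<omega> x v - \<kappa> x * \<omega> x v) = 0"
      using boundary_apply[OF smooth_forms_diff[OF \<omega> s]] m by simp
    then have "boundary m T \<omega> = boundary m T (\<lambda>x v. \<kappa> x * \<omega> x v)"
      using form_functional_diff[OF Fb \<omega> s] by simp
    moreover have "\<bar>boundary m T (\<lambda>x v. \<kappa> x * \<omega> x v)\<bar> \<le> b * B"
    proof (rule le_mult_limit[OF B(1)])
      fix B' assume "B < B'"
      moreover have "form_le k UNIV B' (\<lambda>x v. \<kappa> x * \<omega> x v)"
        using form_le_mono[OF form_le_cutoff[OF B(2,1) \<kappa>(2,3,7)] subset_UNIV] \<open>B < B'\<close> by simp
      ultimately show "\<bar>boundary m T (\<lambda>x v. \<kappa> x * \<omega> x v)\<bar> \<le> b * B'"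
        using mass_le_iff[OF Fb, of b] mb B(1) s m by auto
    qed
    ultimately show "\<bar>T (ext_deriv k \<omega>)\<bar> \<le> b * B" using boundary_apply[OF \<omega>, of T] m by simp
  qed
qed

lemma real_normal_mass:
  assumes T: "T \<in> normal_currents m"
  shows "normal_mass m T = ereal (real_normal_mass m T)" "0 \<le> real_normal_mass m T"
proof -
  obtain a b where "0 \<le> a" "0 \<le> b" "normal_mass m T = ereal (a + b)"
    by (rule normal_currentD[OF T]) blast
  then show "normal_mass m T = ereal (real_normal_mass m T)" "0 \<le> real_normal_mass m T" by simp_all
qed

lemma flat_norm_le_normal_mass:
  assumes T: "T \<in> normal_currents m" shows "flat_norm m T \<le> normal_mass m T"
proof -
  note F = normal_currents_functional[OF T]
  obtain a b where ab: "0 \<le> a" "0 \<le> b" "normal_mass m T = ereal (a + b)"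
    "\<And>K r \<omega> B. compact K \<Longrightarrow> spt m T \<subseteq> K \<Longrightarrow> 0 < r \<Longrightarrow> \<omega> \<in> smooth_forms m \<Longrightarrow> 0 \<le> B \<Longrightarrow>
      form_le m (thick r K) B \<omega> \<Longrightarrow> \<bar>T \<omega>\<bar> \<le> a * B"
    by (rule normal_currentD[OF T]) blast
  have "flat_norm m T \<le> ereal (a + b)"
    unfolding flat_norm_le_iff[OF F]
  proof (intro ballI allI impI)
    fix \<omega> :: "'a form" and B :: real assume \<omega>: "\<omega> \<in> smooth_forms m" "0 < B" "flat_form_le m UNIV B \<omega>"
    have "\<bar>T \<omega>\<bar> \<le> a * B"
      using \<omega> by (intro ab(4)[OF compact_spt[OF normal_currents_currents[OF T]] subset_refl zero_less_one])
        (auto simp: flat_form_le_def intro: form_le_mono)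
    also have "\<dots> \<le> (a + b) * B" using ab \<omega>(2) by (intro mult_right_mono) auto
    finally show "\<bar>T \<omega>\<bar> \<le> (a + b) * B" .
  qed
  then show ?thesis by (simp add: ab(3))
qed

lemma real_flat_norm:
  assumes T: "T \<in> normal_currents m"
  shows "flat_norm m T = ereal (real_flat_norm m T)" "0 \<le> real_flat_norm m T"
    "real_flat_norm m T \<le> real_normal_mass m T"
proof -
  have le: "flat_norm m T \<le> ereal (real_normal_mass m T)"
    using flat_norm_le_normal_mass[OF T] real_normal_mass(1)[OF T] by simp
  have ge: "0 \<le> flat_norm m T" by (rule flat_norm_nonneg[OF normal_currents_functional[OF T]])
  show 1: "flat_norm m T = ereal (real_flat_norm m T)"
    using le ge by (cases "flat_norm m T") auto
  show "0 \<le> real_flat_norm m T" using ge by (rule real_of_ereal_pos)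
  show "real_flat_norm m T \<le> real_normal_mass m T" using le 1 by (metis ereal_less_eq(3))
qed

lemma real_flat_norm_apply:
  assumes T: "T \<in> normal_currents m" and \<omega>: "\<omega> \<in> smooth_forms m" and B: "0 \<le> B" "flat_form_le m UNIV B \<omega>"
  shows "\<bar>T \<omega>\<bar> \<le> real_flat_norm m T * B"
proof (rule le_mult_limit[OF B(1)])
  fix B' assume B': "B < B'"
  then have "flat_form_le m UNIV B' \<omega>" using B(2) by (auto simp: flat_form_le_def intro: form_le_mono)
  then show "\<bar>T \<omega>\<bar> \<le> real_flat_norm m T * B'"
    using flat_norm_le_iff[OF normal_currents_functional[OF T], of "real_flat_norm m T"] real_flat_norm(1)[OF T] \<omega> B' B(1)
    by auto
qed

lemma real_flat_norm_leI:
  assumes T: "T \<in> normal_currents m"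
    and le: "\<And>\<omega> B. \<omega> \<in> smooth_forms m \<Longrightarrow> 0 < B \<Longrightarrow> flat_form_le m UNIV B \<omega> \<Longrightarrow> \<bar>T \<omega>\<bar> \<le> c * B"
  shows "real_flat_norm m T \<le> c"
proof -
  have "flat_norm m T \<le> ereal c"
    unfolding flat_norm_le_iff[OF normal_currents_functional[OF T]] using le by blast
  then show ?thesis using real_flat_norm(1)[OF T] by (metis ereal_less_eq(3))
qed

lemma normal_currentI:
  fixes T :: "'a::euclidean_space current"
  assumes F: "form_functional m T" and K: "compact K" and ab: "0 \<le> a" "0 \<le> b"
    and bnd: "\<And>\<omega> B. \<omega> \<in> smooth_forms m \<Longrightarrow> 0 \<le> B \<Longrightarrow> form_le m K B \<omega> \<Longrightarrow> \<bar>T \<omega>\<bar> \<le> a * B"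
    and bbnd: "\<And>k \<omega> B. m = Suc k \<Longrightarrow> \<omega> \<in> smooth_forms k \<Longrightarrow> 0 \<le> B \<Longrightarrow> form_le k K B \<omega> \<Longrightarrow> \<bar>T (ext_deriv k \<omega>)\<bar> \<le> b * B"
  shows "T \<in> normal_currents_in m K" "normal_mass m T \<le> ereal (a + b)" "real_normal_mass m T \<le> a + b"
proof -
  have cur: "T \<in> currents m" by (rule currentI[OF F K ab(1) bnd])
  have ma: "mass m T \<le> ereal a"
    unfolding mass_le_iff[OF F] by (intro ballI allI impI bnd less_imp_le) (auto intro: form_le_mono)
  have mb: "mass (m - 1) (boundary m T) \<le> ereal b" if nz: "m \<noteq> 0"
  proof -
    obtain k where m: "m = Suc k" using nz not0_implies_Suc by blast
    have Fb: "form_functional k (boundary m T)" using boundary_functional F unfolding m by blast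
    have "mass k (boundary m T) \<le> ereal b"
      unfolding mass_le_iff[OF Fb]
    proof (intro ballI allI impI)
      fix \<omega> :: "'a form" and B :: real assume \<omega>: "\<omega> \<in> smooth_forms k" "0 < B" "form_le k UNIV B \<omega>"
      have "\<bar>T (ext_deriv k \<omega>)\<bar> \<le> b * B"
        by (rule bbnd[OF m \<omega>(1) less_imp_le[OF \<omega>(2)] form_le_mono[OF \<omega>(3)]]) auto
      then show "\<bar>boundary m T \<omega>\<bar> \<le> b * B" using boundary_apply[OF \<omega>(1), of T] m by simp
    qed
    then show ?thesis using m by simp
  qed
  show N: "normal_mass m T \<le> ereal (a + b)"
  proof (cases "m = 0")
    case True
    have "ereal a \<le> ereal (a + b)" using ab(2) by simp
    with True show ?thesis unfolding normal_mass_def using order_trans[OF ma] by simp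
  next
    case False
    then show ?thesis using add_mono[OF ma mb[OF False]] by (simp add: normal_mass_def)
  qed
  then have "normal_mass m T < \<infinity>" by (rule le_less_trans) simp
  with cur have nT: "T \<in> normal_currents m" by (simp add: normal_currents_def)
  show "real_normal_mass m T \<le> a + b"
    using N real_normal_mass(1)[OF nT] by (metis ereal_less_eq(3))
  \<comment> \<open>A form vanishing on \<open>K\<close> satisfies the bound with
    \<open>B = 0\<close>.\<close>
  have "spt m T \<subseteq> K"
  proof (rule spt_subsetI[OF compact_imp_closed[OF K]])
    fix \<omega> :: "'a form" and V assume \<omega>: "\<omega> \<in> smooth_forms m" "K \<subseteq> V" "vanishes_on V \<omega>"
    then have "form_le m K 0 \<omega>" by (intro form_leI) auto
    then show "T \<omega> = 0" using bnd[OF \<omega>(1), of 0] by simp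
  qed
  with nT show "T \<in> normal_currents_in m K" by (simp add: normal_currents_in_def)
qed

lemma normal_currents_inD: "T \<in> normal_currents_in m K \<Longrightarrow> T \<in> normal_currents m" "T \<in> normal_currents_in m K \<Longrightarrow> spt m T \<subseteq> K"
  by (simp_all add: normal_currents_in_def)

lemma normal_currents_in_mono: "T \<in> normal_currents_in m K \<Longrightarrow> K \<subseteq> L \<Longrightarrow> T \<in> normal_currents_in m L"
  by (auto simp: normal_currents_in_def)

lemma normal_currents_in_spt: "T \<in> normal_currents m \<Longrightarrow> T \<in> normal_currents_in m (spt m T)"
  by (simp add: normal_currents_in_def)

subsection \<open>Linear combinations\<close>

lemma functional_comb:
  assumes "form_functional m S" "form_functional m T"
  shows "form_functional m (\<lambda>\<phi>. c * S \<phi> + d * T \<phi>)"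
  unfolding form_functional_def
  by (auto simp: form_functionalD[OF assms(1)] form_functionalD[OF assms(2)] distrib_left mult.left_commute)

lemma normal_comb:
  fixes S T :: "'a::euclidean_space current"
  assumes S: "S \<in> normal_currents_in m K" and T: "T \<in> normal_currents_in m K" and K: "compact K"
  shows "(\<lambda>\<phi>. c * S \<phi> + d * T \<phi>) \<in> normal_currents_in m K"
    and "real_normal_mass m (\<lambda>\<phi>. c * S \<phi> + d * T \<phi>) \<le> \<bar>c\<bar> * real_normal_mass m S + \<bar>d\<bar> * real_normal_mass m T"
proof -
  let ?R = "\<lambda>\<phi>. c * S \<phi> + d * T \<phi>"
  note nS = normal_currents_inD[OF S] and nT = normal_currents_inD[OF T]
  obtain a b where ab: "0 \<le> a" "0 \<le> b" "normal_mass m S = ereal (a + b)"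
    "\<And>K r \<omega> B. compact K \<Longrightarrow> spt m S \<subseteq> K \<Longrightarrow> 0 < r \<Longrightarrow> \<omega> \<in> smooth_forms m \<Longrightarrow> 0 \<le> B \<Longrightarrow>
      form_le m (thick r K) B \<omega> \<Longrightarrow> \<bar>S \<omega>\<bar> \<le> a * B"
    "\<And>k K r \<omega> B. m = Suc k \<Longrightarrow> compact K \<Longrightarrow> spt m S \<subseteq> K \<Longrightarrow> 0 < r \<Longrightarrow> \<omega> \<in> smooth_forms k \<Longrightarrow> 0 \<le> B \<Longrightarrow>
      form_le k (thick r K) B \<omega> \<Longrightarrow> \<bar>S (ext_deriv k \<omega>)\<bar> \<le> b * B"
    by (rule normal_currentD[OF nS(1)]) blast
  obtain a' b' where ab': "0 \<le> a'" "0 \<le> b'" "normal_mass m T = ereal (a' + b')"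
    "\<And>K r \<omega> B. compact K \<Longrightarrow> spt m T \<subseteq> K \<Longrightarrow> 0 < r \<Longrightarrow> \<omega> \<in> smooth_forms m \<Longrightarrow> 0 \<le> B \<Longrightarrow>
      form_le m (thick r K) B \<omega> \<Longrightarrow> \<bar>T \<omega>\<bar> \<le> a' * B"
    "\<And>k K r \<omega> B. m = Suc k \<Longrightarrow> compact K \<Longrightarrow> spt m T \<subseteq> K \<Longrightarrow> 0 < r \<Longrightarrow> \<omega> \<in> smooth_forms k \<Longrightarrow> 0 \<le> B \<Longrightarrow>
      form_le k (thick r K) B \<omega> \<Longrightarrow> \<bar>T (ext_deriv k \<omega>)\<bar> \<le> b' * B"
    by (rule normal_currentD[OF nT(1)]) blast
  have comb: "\<bar>c * s + d * t\<bar> \<le> (\<bar>c\<bar> * p + \<bar>d\<bar> * q) * B" if "\<bar>s\<bar> \<le> p * B" "\<bar>t\<bar> \<le> q * B" for s t p q B :: real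
  proof -
    have "\<bar>c * s + d * t\<bar> \<le> \<bar>c\<bar> * \<bar>s\<bar> + \<bar>d\<bar> * \<bar>t\<bar>" by (metis abs_mult abs_triangle_ineq)
    also have "\<dots> \<le> \<bar>c\<bar> * (p * B) + \<bar>d\<bar> * (q * B)" by (intro add_mono mult_left_mono that) auto
    finally show ?thesis by (simp add: algebra_simps)
  qed
  have 1: "\<bar>?R \<omega>\<bar> \<le> (\<bar>c\<bar> * a + \<bar>d\<bar> * a') * B"
    if "\<omega> \<in> smooth_forms m" "0 \<le> B" "form_le m (thick 1 K) B \<omega>" for \<omega> B
    using that by (intro comb ab(4)[OF K nS(2) zero_less_one] ab'(4)[OF K nT(2) zero_less_one])
  have 2: "\<bar>?R (ext_deriv k \<omega>)\<bar> \<le> (\<bar>c\<bar> * b + \<bar>d\<bar> * b') * B"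
    if "m = Suc k" "\<omega> \<in> smooth_forms k" "0 \<le> B" "form_le k (thick 1 K) B \<omega>" for k \<omega> B
    using that by (intro comb ab(5)[OF _ K nS(2) zero_less_one] ab'(5)[OF _ K nT(2) zero_less_one])
  have 3: "0 \<le> \<bar>c\<bar> * a + \<bar>d\<bar> * a'" "0 \<le> \<bar>c\<bar> * b + \<bar>d\<bar> * b'" using ab ab' by simp_all
  have F: "form_functional m ?R"
    by (rule functional_comb[OF normal_currents_functional[OF nS(1)] normal_currents_functional[OF nT(1)]])
  have N1: "?R \<in> normal_currents_in m (thick 1 K)"
    by (rule normal_currentI(1)[OF F compact_thick[OF K] 3]) (rule 1 2; assumption)+
  have N2: "real_normal_mass m ?R \<le> (\<bar>c\<bar> * a + \<bar>d\<bar> * a') + (\<bar>c\<bar> * b + \<bar>d\<bar> * b')"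
    by (rule normal_currentI(3)[OF F compact_thick[OF K] 3]) (rule 1 2; assumption)+
  \<comment> \<open>The mass estimates only place the support in \<open>thick 1 K\<close>; the sharp
    inclusion comes from the supports of \<open>S\<close> and \<open>T\<close>.\<close>
  have "spt m ?R \<subseteq> K"
  proof (rule spt_subsetI[OF compact_imp_closed[OF K]])
    fix \<omega> :: "'a form" and V assume \<omega>: "\<omega> \<in> smooth_forms m" and V: "open V" "K \<subseteq> V" "vanishes_on V \<omega>"
    have "S \<omega> = 0" by (rule spt_vanish[OF normal_currents_currents[OF nS(1)] \<omega> V(1) _ V(3)]) (use nS V in blast)
    moreover have "T \<omega> = 0" by (rule spt_vanish[OF normal_currents_currents[OF nT(1)] \<omega> V(1) _ V(3)]) (use nT V in blast)
    ultimately show "?R \<omega> = 0" by simp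
  qed
  with N1 show "?R \<in> normal_currents_in m K" by (simp add: normal_currents_in_def)
  show "real_normal_mass m ?R \<le> \<bar>c\<bar> * real_normal_mass m S + \<bar>d\<bar> * real_normal_mass m T"
    using N2 by (simp add: ab(3) ab'(3) algebra_simps)
qed

subsection \<open>A localized flat norm estimate\<close>

lemma dird_bounded:
  fixes f :: "'a::euclidean_space \<Rightarrow> real"
  assumes f: "smooth_function f" and K: "compact K" "\<And>x. x \<notin> K \<Longrightarrow> f x = 0"
  obtains D where "0 \<le> D" "\<And>x u. norm u \<le> 1 \<Longrightarrow> \<bar>dird u f x\<bar> \<le> D"
proof -
  have "\<exists>C\<ge>0. \<forall>x\<in>K. \<bar>dird b f x\<bar> \<le> C" for b
    using bounded_smooth_on_compact[OF smooth_dird[OF f] K(1)] by metis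
  then obtain C where C: "\<And>b. C b \<ge> 0" "\<And>b x. x \<in> K \<Longrightarrow> \<bar>dird b f x\<bar> \<le> C b" by metis
  show thesis
  proof (rule that[of "\<Sum>b\<in>Basis. C b"])
    show "0 \<le> (\<Sum>b\<in>Basis. C b)" by (intro sum_nonneg C)
    fix x and u :: 'a assume u: "norm u \<le> 1"
    show "\<bar>dird u f x\<bar> \<le> (\<Sum>b\<in>Basis. C b)"
    proof (cases "x \<in> K")
      case True
      have "\<bar>dird u f x\<bar> \<le> (\<Sum>b\<in>Basis. \<bar>(u \<bullet> b) * dird b f x\<bar>)"
        unfolding fun_cong[OF dird_expand[OF smooth_differentiable[OF f], of u], of x] by (rule sum_abs)
      also have "\<dots> \<le> (\<Sum>b\<in>Basis. C b)"
      proof (rule sum_mono)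
        fix b :: 'a assume b: "b \<in> Basis"
        have "\<bar>u \<bullet> b\<bar> \<le> 1" using Basis_le_norm[OF b, of u] u by linarith
        then have "\<bar>u \<bullet> b\<bar> * \<bar>dird b f x\<bar> \<le> 1 * C b" by (intro mult_mono C True) auto
        then show "\<bar>(u \<bullet> b) * dird b f x\<bar> \<le> C b" by (simp add: abs_mult)
      qed
      finally show ?thesis .
    next
      case False
      have "dird u f x = 0"
        by (rule dird_zero_on_open[of "- K"]) (use False K compact_imp_closed in auto)
      then show ?thesis by (simp add: sum_nonneg C)
    qed
  qed
qed

text \<open>The flat norm tests against forms bounded on the whole space, and multiplying by a
  cutoff makes a local bound global. The derivative of the cutoff contributes m + 1 terms to the
  exterior derivative, hence the constant, which depends on \<open>K\<close>, \<open>r\<close> and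
  \<open>m\<close> but not on \<open>T\<close>.\<close>

lemma flat_norm_local:
  fixes K :: "'a::euclidean_space set"
  assumes K: "compact K" and r: "0 < r"
  obtains C where "1 \<le> C"
    "\<And>T \<omega> B. T \<in> normal_currents_in m K \<Longrightarrow> \<omega> \<in> smooth_forms m \<Longrightarrow> 0 \<le> B \<Longrightarrow> flat_form_le m (thick r K) B \<omega> \<Longrightarrow>
      \<bar>T \<omega>\<bar> \<le> C * real_flat_norm m T * B"
proof -
  obtain \<kappa> V where \<kappa>: "smooth_function \<kappa>" "\<And>x. 0 \<le> \<kappa> x" "\<And>x. \<kappa> x \<le> 1" "open V" "K \<subseteq> V"
    "\<And>x. x \<in> V \<Longrightarrow> \<kappa> x = 1" "\<And>x. x \<notin> thick r K \<Longrightarrow> \<kappa> x = 0"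
    using cutoff_exists[OF K(1) r] by blast
  obtain D where D: "0 \<le> D" "\<And>x u. norm u \<le> 1 \<Longrightarrow> \<bar>dird u \<kappa> x\<bar> \<le> D"
    using dird_bounded[OF \<kappa>(1) compact_thick[OF K] \<kappa>(7)] by blast
  define C where "C = 1 + real (Suc m) * D"
  have C1: "1 \<le> C" using D by (simp add: C_def)
  show thesis
  proof (rule that[OF C1])
    fix T and \<omega> :: "'a form" and B
    assume T: "T \<in> normal_currents_in m K" and \<omega>: "\<omega> \<in> smooth_forms m" and B: "0 \<le> B" "flat_form_le m (thick r K) B \<omega>"
    note nT = normal_currents_inD[OF T]
    have B1: "form_le m (thick r K) B \<omega>" "form_le (Suc m) (thick r K) B (ext_deriv m \<omega>)"
      using B(2) by (auto simp: flat_form_le_def)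
    have 1: "form_le m UNIV (C * B) (\<lambda>x v. \<kappa> x * \<omega> x v)"
      using form_le_mono[OF form_le_cutoff[OF B1(1) B(1) \<kappa>(2,3,7)] subset_UNIV, where C="C * B"] C1 B(1)
      by (simp add: mult_left_mono mult_le_cancel_right1)
    have 2: "form_le (Suc m) UNIV (C * B) (ext_deriv m (\<lambda>x v. \<kappa> x * \<omega> x v))"
    proof (rule form_leI)
      fix x and v :: "nat \<Rightarrow> 'a" assume v: "unit_vectors (Suc m) v"
      have t1: "\<bar>\<kappa> x * ext_deriv m \<omega> x v\<bar> \<le> B"
        using form_leD[OF form_le_cutoff[OF B1(2) B(1) \<kappa>(2,3,7)] UNIV_I v] .
      have t2: "\<bar>(-1) ^ i * (dird (v i) \<kappa> x * \<omega> x (\<lambda>j. if j < i then v j else v (Suc j)))\<bar> \<le> D * B" if i: "i \<le> m" for i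
      proof (cases "x \<in> thick r K")
        case True
        have "\<bar>dird (v i) \<kappa> x\<bar> \<le> D" by (rule D(2)) (use v i in auto)
        moreover have "\<bar>\<omega> x (\<lambda>j. if j < i then v j else v (Suc j))\<bar> \<le> B"
          by (rule form_leD[OF B1(1) True]) (use v i in auto)
        ultimately have "\<bar>dird (v i) \<kappa> x\<bar> * \<bar>\<omega> x (\<lambda>j. if j < i then v j else v (Suc j))\<bar> \<le> D * B"
          by (intro mult_mono D(1)) auto
        then show ?thesis by (simp add: abs_mult power_abs)
      next
        case False
        have "dird (v i) \<kappa> x = 0"
          by (rule dird_zero_on_open[of "- thick r K"]) (use False \<kappa>(7) compact_imp_closed[OF compact_thick[OF K]] in auto)
        then show ?thesis using D B by simp
      qed
      have "\<bar>ext_deriv m (\<lambda>x v. \<kappa> x * \<omega> x v) x v\<bar> \<le> B + (\<Sum>i\<le>m. D * B)"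
        unfolding ext_deriv_mult[OF \<omega> \<kappa>(1)]
        by (intro order_trans[OF abs_triangle_ineq] add_mono t1 order_trans[OF sum_abs] sum_mono t2) auto
      also have "\<dots> = C * B" by (simp add: C_def algebra_simps)
      finally show "\<bar>ext_deriv m (\<lambda>x v. \<kappa> x * \<omega> x v) x v\<bar> \<le> C * B" .
    qed
    have "T (\<lambda>x v. \<kappa> x * \<omega> x v) = T \<omega>"
      by (rule current_cutoff[OF normal_currents_currents[OF nT(1)] _ \<kappa>(4,1) \<kappa>(6) \<omega>]) (use nT(2) \<kappa>(5) in blast)
    moreover have "\<bar>T (\<lambda>x v. \<kappa> x * \<omega> x v)\<bar> \<le> real_flat_norm m T * (C * B)"
      by (rule real_flat_norm_apply[OF nT(1) smooth_forms_mult[OF \<omega> \<kappa>(1)]])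
        (use C1 B 1 2 in \<open>auto simp: flat_form_le_def\<close>)
    ultimately show "\<bar>T \<omega>\<bar> \<le> C * real_flat_norm m T * B" by (simp add: mult.commute mult.left_commute)
  qed
qed

section \<open>Mollification of forms and of currents, and the homotopy formula\<close>

section \<open>Mollification of forms\<close>

text \<open>What convolution and homotopy averages have in common as operators on functions:
  linearity, preservation of smoothness, commutation with derivatives. Acting on the coefficients of
  forms, such an operator commutes with the exterior derivative.\<close>

definition averaging :: "(('a::euclidean_space \<Rightarrow> real) \<Rightarrow> 'a \<Rightarrow> real) \<Rightarrow> bool" where
  "averaging A \<longleftrightarrow>
     (\<forall>g h x. smooth_function g \<longrightarrow> smooth_function h \<longrightarrow> A (\<lambda>x. g x + h x) x = A g x + A h x) \<and>
     (\<forall>g c x. smooth_function g \<longrightarrow> A (\<lambda>x. c * g x) x = c * A g x) \<and>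
     (\<forall>g. smooth_function g \<longrightarrow> smooth_function (A g)) \<and>
     (\<forall>g u. smooth_function g \<longrightarrow> dird u (A g) = A (dird u g))"

lemma averagingD:
  assumes "averaging A"
  shows "smooth_function g \<Longrightarrow> smooth_function h \<Longrightarrow> A (\<lambda>x. g x + h x) x = A g x + A h x"
    and "smooth_function g \<Longrightarrow> A (\<lambda>x. c * g x) x = c * A g x"
    and "smooth_function g \<Longrightarrow> smooth_function (A g)"
    and "smooth_function g \<Longrightarrow> dird u (A g) = A (dird u g)"
  using assms by (simp_all add: averaging_def)

lemma averaging_zero: "averaging A \<Longrightarrow> A (\<lambda>x. 0) x = 0"
  using averagingD(2)[OF _ smooth_const, of A 0 0 x] by simp

lemma averaging_sum:
  assumes A: "averaging A" and g: "\<And>i. i \<in> I \<Longrightarrow> smooth_function (g i)"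
  shows "A (\<lambda>x. \<Sum>i\<in>I. g i x) x = (\<Sum>i\<in>I. A (g i) x)"
  using g
proof (induction I rule: infinite_finite_induct)
  case (insert i I)
  then have 1: "smooth_function (g i)" "smooth_function (\<lambda>x. \<Sum>i\<in>I. g i x)" by (simp_all add: smooth_sum)
  have 2: "A (\<lambda>x. \<Sum>i\<in>I. g i x) x = (\<Sum>i\<in>I. A (g i) x)" using insert by simp
  show ?case using averagingD(1)[OF A 1, of x] insert(1,2) 2 by simp
qed (simp_all add: averaging_zero[OF A])

lemma averaging_smear:
  assumes "smooth_function \<psi>" shows "averaging (smear e \<psi>)"
  unfolding averaging_def
  using smear_add_right[OF assms] smear_cmult_right smooth_smear[OF assms] dird_smear[OF assms] by blast

lemma averaging_homotopy: "averaging (homotopy_average e b)"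
  unfolding averaging_def
  using homotopy_average_add homotopy_average_cmult smooth_homotopy_average dird_homotopy_average by blast

definition average_form :: "(('a::euclidean_space \<Rightarrow> real) \<Rightarrow> 'a \<Rightarrow> real) \<Rightarrow> 'a form \<Rightarrow> 'a form" where
  "average_form A \<zeta> x v = A (\<lambda>y. \<zeta> y v) x"

lemma smooth_forms_average:
  assumes A: "averaging A" and \<zeta>: "\<zeta> \<in> smooth_forms m"
  shows "average_form A \<zeta> \<in> smooth_forms m"
proof (rule smooth_formsI)
  note sm = smooth_forms_smooth[OF \<zeta>]
  fix x
  show "average_form A \<zeta> x \<in> covectors m"
  proof (rule covectorsI)
    show "multilin m (average_form A \<zeta> x)"
      unfolding multilin_def
    proof (intro conjI allI impI)
      fix v w :: "nat \<Rightarrow> 'a" assume vw: "\<forall>i<m. v i = w i"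
      have "(\<lambda>y. \<zeta> y v) = (\<lambda>y. \<zeta> y w)"
        by (rule ext, rule multilin_cong[OF smooth_forms_multilin[OF \<zeta>]]) (use vw in simp)
      then show "average_form A \<zeta> x v = average_form A \<zeta> x w" by (simp add: average_form_def)
    next
      fix v :: "nat \<Rightarrow> 'a" and i assume i: "i < m"
      note L = multilin_linear[OF smooth_forms_multilin[OF \<zeta>] i]
      show "linear (\<lambda>z. average_form A \<zeta> x (v(i := z)))"
      proof (rule linearI)
        show "average_form A \<zeta> x (v(i := a + b)) = average_form A \<zeta> x (v(i := a)) + average_form A \<zeta> x (v(i := b))" for a b
          unfolding average_form_def linear_add[OF L] by (rule averagingD(1)[OF A sm sm])
        show "average_form A \<zeta> x (v(i := c *\<^sub>R a)) = c *\<^sub>R average_form A \<zeta> x (v(i := a))" for c a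
          unfolding average_form_def linear_scale[OF L] real_scaleR_def by (rule averagingD(2)[OF A sm])
      qed
    qed
    fix v :: "nat \<Rightarrow> 'a" and i j assume "i < m" "j < m" "i \<noteq> j" "v i = v j"
    then have "\<zeta> y v = 0" for y using smooth_forms_covector[OF \<zeta>, of y] by (auto simp: covectors_def)
    then show "average_form A \<zeta> x v = 0" by (simp add: average_form_def averaging_zero[OF A])
  qed
next
  show "smooth_function (\<lambda>x. average_form A \<zeta> x v)" for v
    unfolding average_form_def by (rule averagingD(3)[OF A smooth_forms_smooth[OF \<zeta>]])
qed

lemma ext_deriv_average:
  assumes A: "averaging A" and \<zeta>: "\<zeta> \<in> smooth_forms m"
  shows "ext_deriv m (average_form A \<zeta>) = average_form A (ext_deriv m \<zeta>)"
proof (intro ext)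
  fix x v
  have sm: "smooth_function (\<lambda>y. dird u (\<lambda>y. \<zeta> y w) y)" for u w
    by (rule smooth_dird[OF smooth_forms_smooth[OF \<zeta>]])
  have "average_form A (ext_deriv m \<zeta>) x v
    = (\<Sum>i\<le>m. A (\<lambda>y. (-1) ^ i * dird (v i) (\<lambda>y. \<zeta> y (\<lambda>j. if j < i then v j else v (Suc j))) y) x)"
    unfolding average_form_def ext_deriv_dird by (rule averaging_sum[OF A smooth_cmult[OF sm]])
  also have "\<dots> = ext_deriv m (average_form A \<zeta>) x v"
    unfolding ext_deriv_dird average_form_def averagingD(2)[OF A sm] averagingD(4)[OF A smooth_forms_smooth[OF \<zeta>]] ..
  finally show "ext_deriv m (average_form A \<zeta>) x v = average_form A (ext_deriv m \<zeta>) x v" ..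
qed

abbreviation smear_form :: "real \<Rightarrow> ('a::euclidean_space \<Rightarrow> real) \<Rightarrow> 'a form \<Rightarrow> 'a form" where
  "smear_form e \<psi> \<equiv> average_form (smear e \<psi>)"

lemma form_le_moll:
  assumes \<zeta>: "\<zeta> \<in> smooth_forms m" and e: "0 \<le> e" and B: "form_le m (thick e S) B \<zeta>"
  shows "form_le m S B (smear_form e moll \<zeta>)"
proof (rule form_leI)
  fix x and v :: "nat \<Rightarrow> 'a" assume x: "x \<in> S" and v: "unit_vectors m v"
  show "\<bar>smear_form e moll \<zeta> x v\<bar> \<le> B"
    unfolding average_form_def
    by (rule moll_average_bound[OF smooth_forms_smooth[OF \<zeta>] e], rule form_leD[OF B _ v])
      (use x thickI[of x S _ e] in auto)
qed

section \<open>The homotopy formula\<close>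

text \<open>The average over \<open>z\<close> and over s in [0, 1] of the contraction with e z of
  the form at x + s e z: the chain homotopy of the translations that join the identity to the
  mollification.\<close>

definition homotopy_form :: "real \<Rightarrow> 'a::euclidean_space form \<Rightarrow> 'a form" where
  "homotopy_form e \<zeta> x v = (\<Sum>b\<in>Basis. average_form (homotopy_average e b) (contract b \<zeta>) x v)"

lemma smooth_forms_homotopy:
  "\<zeta> \<in> smooth_forms (Suc k) \<Longrightarrow> homotopy_form e \<zeta> \<in> smooth_forms k"
  unfolding homotopy_form_def[abs_def]
  by (rule smooth_forms_sum) (rule smooth_forms_average[OF averaging_homotopy smooth_forms_contract])

text \<open>The displacement has length at most \<open>e\<close>, and contraction with a vector of
  norm at most 1 does not increase the comass.\<close>

lemma form_le_homotopy:
  assumes \<zeta>: "\<zeta> \<in> smooth_forms (Suc k)" and e: "0 \<le> e" and B: "form_le (Suc k) UNIV B \<zeta>"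
  shows "form_le k UNIV (e * B) (homotopy_form e \<zeta>)"
proof (rule form_leI)
  fix x and v :: "nat \<Rightarrow> 'a" assume v: "unit_vectors k v"
  have "(\<Sum>b\<in>Basis. (z \<bullet> b) * \<zeta> y (case_nat b v)) = \<zeta> y (case_nat z v)" for z y
  proof -
    have u: "(case_nat 0 v)(0 := z) = case_nat z v" for z :: 'a by (auto simp: fun_eq_iff split: nat.split)
    have L: "linear (\<lambda>z. \<zeta> y (case_nat z v))"
      using multilin_linear[OF smooth_forms_multilin[OF \<zeta>] zero_less_Suc, of y "case_nat 0 v"] unfolding u .
    have "\<zeta> y (case_nat z v) = \<zeta> y (case_nat (\<Sum>b\<in>Basis. (z \<bullet> b) *\<^sub>R b) v)"
      by (simp only: euclidean_representation)
    also have "\<dots> = (\<Sum>b\<in>Basis. (z \<bullet> b) * \<zeta> y (case_nat b v))"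
      by (simp only: linear_sum[OF L] linear_scale[OF L] real_scaleR_def)
    finally show ?thesis ..
  qed
  moreover have "\<bar>\<zeta> y (case_nat z v)\<bar> \<le> B" if z: "norm z \<le> 1" for z y
  proof (rule form_leD[OF B UNIV_I], intro allI impI)
    fix i assume "i < Suc k"
    then show "norm (case_nat z v i) \<le> 1" using z v by (cases i) auto
  qed
  ultimately have "\<bar>\<Sum>b\<in>Basis. (z \<bullet> b) * \<zeta> y (case_nat b v)\<bar> \<le> B" if "norm z \<le> 1" for z y
    using that by simp
  then show "\<bar>homotopy_form e \<zeta> x v\<bar> \<le> e * B"
    unfolding homotopy_form_def average_form_def contract_def
    by (intro homotopy_bound smooth_forms_smooth[OF \<zeta>] e)
qed

lemma homotopy_formula_0:
  assumes \<zeta>: "\<zeta> \<in> smooth_forms 0"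
  shows "smear_form e moll \<zeta> x v - \<zeta> x v = homotopy_form e (ext_deriv 0 \<zeta>) x v"
  unfolding homotopy_form_def average_form_def contract_def ext_deriv_0_contract
  by (simp add: sum_homotopy_average_dird[OF smooth_forms_smooth[OF \<zeta>]])

text \<open>Cartan's formula inside the average: the exterior derivatives of the contractions cancel
  between the two terms on the right, and the remaining directional derivatives add up to the
  left-hand side by \<open>sum_homotopy_average_dird\<close>.\<close>

lemma homotopy_formula:
  assumes \<zeta>: "\<zeta> \<in> smooth_forms (Suc k)"
  shows "smear_form e moll \<zeta> x v - \<zeta> x v
    = ext_deriv k (homotopy_form e \<zeta>) x v + homotopy_form e (ext_deriv (Suc k) \<zeta>) x v"
proof -
  note sm = smooth_forms_smooth[OF \<zeta>]
  have sc: "contract b \<zeta> \<in> smooth_forms k" for b by (rule smooth_forms_contract[OF \<zeta>])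
  note se = smooth_forms_smooth[OF smooth_forms_ext_deriv[OF sc]]
  note sa = smooth_forms_average[OF averaging_homotopy sc]
  have 1: "ext_deriv k (homotopy_form e \<zeta>) x v = (\<Sum>b\<in>Basis. homotopy_average e b (\<lambda>y. ext_deriv k (contract b \<zeta>) y v) x)"
  proof -
    have "ext_deriv k (homotopy_form e \<zeta>) x v = (\<Sum>b\<in>Basis. ext_deriv k (average_form (homotopy_average e b) (contract b \<zeta>)) x v)"
      unfolding homotopy_form_def ext_deriv_dird
      by (subst dird_sum[OF smooth_forms_differentiable[OF sa]]) (simp add: sum_distrib_left sum.swap[of _ "{..k}"])
    then show ?thesis unfolding ext_deriv_average[OF averaging_homotopy sc] by (simp add: average_form_def)
  qed
  have 2: "homotopy_form e (ext_deriv (Suc k) \<zeta>) x v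
     = (\<Sum>b\<in>Basis. homotopy_average e b (dird b (\<lambda>y. \<zeta> y v)) x - homotopy_average e b (\<lambda>y. ext_deriv k (contract b \<zeta>) y v) x)"
    unfolding homotopy_form_def average_form_def
  proof (rule sum.cong[OF refl])
    fix b :: 'a
    have "(\<lambda>y. contract b (ext_deriv (Suc k) \<zeta>) y v) = (\<lambda>y. dird b (\<lambda>y. \<zeta> y v) y + (-1) * ext_deriv k (contract b \<zeta>) y v)"
      by (simp add: contract_def ext_deriv_contract)
    then show "homotopy_average e b (\<lambda>y. contract b (ext_deriv (Suc k) \<zeta>) y v) x
      = homotopy_average e b (dird b (\<lambda>y. \<zeta> y v)) x - homotopy_average e b (\<lambda>y. ext_deriv k (contract b \<zeta>) y v) x"
      using homotopy_average_add[OF smooth_dird[OF sm] smooth_cmult[OF se], of e b b v "-1" b v x]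
        homotopy_average_cmult[of e b "-1" "\<lambda>y. ext_deriv k (contract b \<zeta>) y v" x] by simp
  qed
  show ?thesis
    unfolding 1 2 by (simp add: sum_subtractf sum_homotopy_average_dird[OF sm] average_form_def)
qed

section \<open>Mollification of currents\<close>

definition moll_current :: "nat \<Rightarrow> real \<Rightarrow> 'a::euclidean_space current \<Rightarrow> 'a current" where
  "moll_current m e T \<zeta> = (if \<zeta> \<in> smooth_forms m then T (smear_form e moll \<zeta>) else 0)"

lemma smooth_forms_moll: "\<zeta> \<in> smooth_forms m \<Longrightarrow> smear_form e moll \<zeta> \<in> smooth_forms m"
  by (rule smooth_forms_average[OF averaging_smear[OF smooth_moll]])

lemma average_form_add:
  assumes A: "averaging A" and "\<omega> \<in> smooth_forms m" "\<eta> \<in> smooth_forms m"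
  shows "average_form A (\<lambda>x v. \<omega> x v + \<eta> x v) = (\<lambda>x v. average_form A \<omega> x v + average_form A \<eta> x v)"
  using assms(2,3) by (simp add: average_form_def fun_eq_iff averagingD(1)[OF A] smooth_forms_smooth)

lemma average_form_cmult:
  assumes A: "averaging A" and "\<omega> \<in> smooth_forms m"
  shows "average_form A (\<lambda>x v. c * \<omega> x v) = (\<lambda>x v. c * average_form A \<omega> x v)"
  using assms(2) by (simp add: average_form_def fun_eq_iff averagingD(2)[OF A] smooth_forms_smooth)

lemma moll_current_functional:
  assumes F: "form_functional m T" shows "form_functional m (moll_current m e T)"
  unfolding form_functional_def
proof (intro conjI allI ballI impI)
  fix \<omega> \<eta> :: "'a form" assume s: "\<omega> \<in> smooth_forms m" "\<eta> \<in> smooth_forms m"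
  show "moll_current m e T (\<lambda>x v. \<omega> x v + \<eta> x v) = moll_current m e T \<omega> + moll_current m e T \<eta>"
    using s form_functionalD(2)[OF F smooth_forms_moll smooth_forms_moll]
    by (simp add: moll_current_def smooth_forms_add average_form_add[OF averaging_smear[OF smooth_moll] s])
next
  fix c and \<omega> :: "'a form" assume s: "\<omega> \<in> smooth_forms m"
  show "moll_current m e T (\<lambda>x v. c * \<omega> x v) = c * moll_current m e T \<omega>"
    using s form_functionalD(3)[OF F smooth_forms_moll]
    by (simp add: moll_current_def smooth_forms_cmult average_form_cmult[OF averaging_smear[OF smooth_moll] s])
qed (simp add: moll_current_def)

text \<open>Duality: mollification of forms commutes with the exterior derivative and does not
  increase the comass, so neither the mass nor the boundary mass of the current increases.\<close>

lemma moll_current_normal: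
  fixes T :: "'a::euclidean_space current"
  assumes T: "T \<in> normal_currents_in m K" and K: "compact K" and e: "0 < e"
  shows "moll_current m e T \<in> normal_currents_in m (thick (2 * e) K)"
    and "real_normal_mass m (moll_current m e T) \<le> real_normal_mass m T"
proof -
  note nT = normal_currents_inD[OF T]
  obtain a b where ab: "0 \<le> a" "0 \<le> b" "normal_mass m T = ereal (a + b)"
    "\<And>K r \<omega> B. compact K \<Longrightarrow> spt m T \<subseteq> K \<Longrightarrow> 0 < r \<Longrightarrow> \<omega> \<in> smooth_forms m \<Longrightarrow> 0 \<le> B \<Longrightarrow>
      form_le m (thick r K) B \<omega> \<Longrightarrow> \<bar>T \<omega>\<bar> \<le> a * B"
    "\<And>k K r \<omega> B. m = Suc k \<Longrightarrow> compact K \<Longrightarrow> spt m T \<subseteq> K \<Longrightarrow> 0 < r \<Longrightarrow> \<omega> \<in> smooth_forms k \<Longrightarrow> 0 \<le> B \<Longrightarrow>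
      form_le k (thick r K) B \<omega> \<Longrightarrow> \<bar>T (ext_deriv k \<omega>)\<bar> \<le> b * B"
    by (rule normal_currentD[OF nT(1)]) blast
  \<comment> \<open>One \<open>e\<close> is spent by the convolution, the other is the neighbourhood
    that the bounds of a normal current require.\<close>
  have sub: "thick e (thick e K) \<subseteq> thick (2 * e) K" using thick_thick[of e e K] by simp
  have 1: "\<bar>moll_current m e T \<omega>\<bar> \<le> a * B"
    if w: "\<omega> \<in> smooth_forms m" "0 \<le> B" "form_le m (thick (2 * e) K) B \<omega>" for \<omega> B
  proof -
    have "form_le m (thick e K) B (smear_form e moll \<omega>)"
      by (rule form_le_moll[OF w(1) less_imp_le[OF e] form_le_mono[OF w(3) sub order_refl]])
    from ab(4)[OF K nT(2) e smooth_forms_moll[OF w(1)] w(2) this] show ?thesis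
      using w(1) by (simp add: moll_current_def)
  qed
  have 2: "\<bar>moll_current m e T (ext_deriv k \<omega>)\<bar> \<le> b * B"
    if w: "m = Suc k" "\<omega> \<in> smooth_forms k" "0 \<le> B" "form_le k (thick (2 * e) K) B \<omega>" for k \<omega> B
  proof -
    have "form_le k (thick e K) B (smear_form e moll \<omega>)"
      by (rule form_le_moll[OF w(2) less_imp_le[OF e] form_le_mono[OF w(4) sub order_refl]])
    from ab(5)[OF w(1) K nT(2) e smooth_forms_moll[OF w(2)] w(3) this] show ?thesis
      using smooth_forms_ext_deriv[OF w(2)] w(1)
      by (simp add: moll_current_def ext_deriv_average[OF averaging_smear[OF smooth_moll] w(2)])
  qed
  note F = moll_current_functional[OF normal_currents_functional[OF nT(1)], of e]
  show "moll_current m e T \<in> normal_currents_in m (thick (2 * e) K)"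
    by (rule normal_currentI(1)[OF F compact_thick[OF K] ab(1,2)]) (rule 1 2; assumption)+
  have "real_normal_mass m (moll_current m e T) \<le> a + b"
    by (rule normal_currentI(3)[OF F compact_thick[OF K] ab(1,2)]) (rule 1 2; assumption)+
  then show "real_normal_mass m (moll_current m e T) \<le> real_normal_mass m T" by (simp add: ab(3))
qed

text \<open>The homotopy formula splits the difference, on a test form, into \<open>T\<close> on the
  derivative of its homotopy form and \<open>T\<close> on the homotopy form of its derivative. The
  first is bounded by the boundary mass, the second by the mass, both with the factor
  \<open>e\<close> of the homotopy operator. The difference is spelled with coefficients to fit
  \<open>normal_comb\<close>.\<close>

lemma moll_current_flat:
  fixes T :: "'a::euclidean_space current"
  assumes T: "T \<in> normal_currents_in m K" and K: "compact K" and e: "0 < e"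
  shows "real_flat_norm m (\<lambda>\<phi>. 1 * moll_current m e T \<phi> + (-1) * T \<phi>) \<le> e * real_normal_mass m T"
proof (rule real_flat_norm_leI)
  note nT = normal_currents_inD[OF T]
  note F = normal_currents_functional[OF nT(1)]
  have K2: "K \<subseteq> thick (2 * e) K" by (rule subset_thick) (use e in simp)
  show "(\<lambda>\<phi>. 1 * moll_current m e T \<phi> + (-1) * T \<phi>) \<in> normal_currents m"
    by (rule normal_currents_inD(1)[OF normal_comb(1)[OF moll_current_normal(1)[OF T K e]
          normal_currents_in_mono[OF T K2] compact_thick[OF K]]])
  obtain a b where ab: "0 \<le> a" "0 \<le> b" "normal_mass m T = ereal (a + b)"
    "\<And>K r \<omega> B. compact K \<Longrightarrow> spt m T \<subseteq> K \<Longrightarrow> 0 < r \<Longrightarrow> \<omega> \<in> smooth_forms m \<Longrightarrow> 0 \<le> B \<Longrightarrow>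
      form_le m (thick r K) B \<omega> \<Longrightarrow> \<bar>T \<omega>\<bar> \<le> a * B"
    "\<And>k K r \<omega> B. m = Suc k \<Longrightarrow> compact K \<Longrightarrow> spt m T \<subseteq> K \<Longrightarrow> 0 < r \<Longrightarrow> \<omega> \<in> smooth_forms k \<Longrightarrow> 0 \<le> B \<Longrightarrow>
      form_le k (thick r K) B \<omega> \<Longrightarrow> \<bar>T (ext_deriv k \<omega>)\<bar> \<le> b * B"
    by (rule normal_currentD[OF nT(1)]) blast
  fix \<omega> :: "'a form" and B :: real
  assume \<omega>: "\<omega> \<in> smooth_forms m" and B: "0 < B" "flat_form_le m UNIV B \<omega>"
  have eB: "0 \<le> e * B" using e B by simp
  have B1: "form_le m UNIV B \<omega>" "form_le (Suc m) UNIV B (ext_deriv m \<omega>)"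
    using B(2) by (auto simp: flat_form_le_def)
  have Hd: "homotopy_form e (ext_deriv m \<omega>) \<in> smooth_forms m"
    by (rule smooth_forms_homotopy[OF smooth_forms_ext_deriv[OF \<omega>]])
  have "form_le m (thick 1 K) (e * B) (homotopy_form e (ext_deriv m \<omega>))"
    by (rule form_le_mono[OF form_le_homotopy[OF smooth_forms_ext_deriv[OF \<omega>] less_imp_le[OF e] B1(2)]]) auto
  from ab(4)[OF K nT(2) zero_less_one Hd eB this]
  have T1: "\<bar>T (homotopy_form e (ext_deriv m \<omega>))\<bar> \<le> a * (e * B)" .
  have diff: "T (smear_form e moll \<omega>) - T \<omega> = T (\<lambda>x v. smear_form e moll \<omega> x v - \<omega> x v)"
    by (rule form_functional_diff[OF F smooth_forms_moll[OF \<omega>] \<omega>, symmetric])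
  have "\<bar>T (smear_form e moll \<omega>) - T \<omega>\<bar> \<le> (a + b) * (e * B)"
  proof (cases m)
    case 0
    have "(\<lambda>x v. smear_form e moll \<omega> x v - \<omega> x v) = homotopy_form e (ext_deriv m \<omega>)"
      using homotopy_formula_0[of \<omega> e] \<omega> unfolding 0 by (intro ext) simp
    then have "\<bar>T (smear_form e moll \<omega>) - T \<omega>\<bar> \<le> a * (e * B)" using T1 diff by simp
    also have "\<dots> \<le> (a + b) * (e * B)" using ab eB by (intro mult_right_mono) auto
    finally show ?thesis .
  next
    case (Suc k)
    note w = \<omega>[unfolded Suc]
    have H: "homotopy_form e \<omega> \<in> smooth_forms k" by (rule smooth_forms_homotopy[OF w])
    have dH: "ext_deriv k (homotopy_form e \<omega>) \<in> smooth_forms m" unfolding Suc by (rule smooth_forms_ext_deriv[OF H])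
    have "form_le k (thick 1 K) (e * B) (homotopy_form e \<omega>)"
      by (rule form_le_mono[OF form_le_homotopy[OF w less_imp_le[OF e] B1(1)[unfolded Suc]]]) auto
    from ab(5)[OF Suc K nT(2) zero_less_one H eB this]
    have T2: "\<bar>T (ext_deriv k (homotopy_form e \<omega>))\<bar> \<le> b * (e * B)" .
    have "(\<lambda>x v. smear_form e moll \<omega> x v - \<omega> x v)
        = (\<lambda>x v. ext_deriv k (homotopy_form e \<omega>) x v + homotopy_form e (ext_deriv m \<omega>) x v)"
      unfolding Suc by (intro ext) (rule homotopy_formula[OF w])
    then have "T (smear_form e moll \<omega>) - T \<omega> = T (ext_deriv k (homotopy_form e \<omega>)) + T (homotopy_form e (ext_deriv m \<omega>))"
      unfolding diff using form_functionalD(2)[OF F dH Hd] by simp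
    then show ?thesis using T1 T2 by (simp add: distrib_right abs_le_iff)
  qed
  then show "\<bar>1 * moll_current m e T \<omega> + (-1) * T \<omega>\<bar> \<le> (e * real_normal_mass m T) * B"
    using \<omega> by (simp add: moll_current_def ab(3) algebra_simps)
qed

section \<open>Mollified point evaluations and the smooth form of a charge\<close>

section \<open>Estimates for convolutions\<close>

lemma mvt_dird:
  assumes g: "smooth_function g"
  obtains t where "0 \<le> t" "t \<le> 1" "g (x + h) - g x = dird h g (x + t *\<^sub>R h)"
proof -
  have D: "((\<lambda>t. g (x + t *\<^sub>R h)) has_real_derivative dird h g (x + t *\<^sub>R h)) (at t)" for t
  proof -
    have 1: "((\<lambda>t. x + t *\<^sub>R h) has_vector_derivative h) (at t)" by (auto intro!: derivative_eq_intros)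
    from vector_derivative_diff_chain_within[OF 1 has_derivative_at_withinI[OF smooth_has_derivative[OF g]]]
    show ?thesis by (simp add: o_def has_real_derivative_iff_has_vector_derivative)
  qed
  have "\<exists>t. 0 < t \<and> t < 1 \<and> g (x + 1 *\<^sub>R h) - g (x + 0 *\<^sub>R h) = (1 - 0) * dird h g (x + t *\<^sub>R h)"
    by (rule MVT2[of 0 1 "\<lambda>t. g (x + t *\<^sub>R h)", OF zero_less_one D])
  then obtain t where "0 < t" "t < 1" "g (x + h) - g x = dird h g (x + t *\<^sub>R h)" by auto
  then show thesis by (intro that[of t]) auto
qed

lemma dird_scaleR:
  assumes "smooth_function g" shows "dird (c *\<^sub>R u) g x = c * dird u g x"
  using linear_scale[OF linear_dird[OF smooth_differentiable[OF assms]], of c u] by simp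

lemma dird_norm_bound:
  assumes g: "smooth_function g" and D: "\<And>u. norm u \<le> 1 \<Longrightarrow> \<bar>dird u g x\<bar> \<le> D"
  shows "\<bar>dird h g x\<bar> \<le> norm h * D"
proof (cases "h = 0")
  case True
  then show ?thesis using dird_scaleR[OF g, of 0 0 x] by simp
next
  case False
  have "dird h g x = norm h * dird (inverse (norm h) *\<^sub>R h) g x"
    unfolding dird_scaleR[OF g] using False by simp
  moreover have "\<bar>dird (inverse (norm h) *\<^sub>R h) g x\<bar> \<le> D" by (rule D) (simp add: False)
  ultimately show ?thesis by (simp add: abs_mult mult_left_mono)
qed

lemma taylor2_dird:
  assumes g: "smooth_function g"
    and M: "\<And>t. 0 \<le> t \<Longrightarrow> t \<le> 1 \<Longrightarrow> \<bar>dird h (dird h g) (x + t *\<^sub>R h)\<bar> \<le> M"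
  shows "\<bar>g (x + h) - g x - dird h g x\<bar> \<le> M"
proof -
  obtain s where s: "0 \<le> s" "s \<le> 1" "g (x + h) - g x = dird h g (x + s *\<^sub>R h)"
    by (rule mvt_dird[OF g])
  obtain t where t: "0 \<le> t" "t \<le> 1" "dird h g (x + s *\<^sub>R h) - dird h g x = dird (s *\<^sub>R h) (dird h g) (x + t *\<^sub>R (s *\<^sub>R h))"
    by (rule mvt_dird[OF smooth_dird[OF g]])
  have ts: "0 \<le> t * s" "t * s \<le> 1" using s t by (auto simp: mult_le_one)
  have "g (x + h) - g x - dird h g x = s * dird h (dird h g) (x + (t * s) *\<^sub>R h)"
    using s(3) t(3) by (simp add: dird_scaleR[OF smooth_dird[OF g]])
  then have "\<bar>g (x + h) - g x - dird h g x\<bar> = s * \<bar>dird h (dird h g) (x + (t * s) *\<^sub>R h)\<bar>"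
    using s(1) by (simp add: abs_mult)
  also have "\<dots> \<le> 1 * M" using s M[OF ts] by (intro mult_mono) auto
  finally show ?thesis by simp
qed

lemma test_function_bounds:
  assumes \<psi>: "test_function (\<psi> :: 'a::euclidean_space \<Rightarrow> real)"
  obtains C where "0 \<le> C" "\<And>z. \<bar>\<psi> z\<bar> \<le> C" "\<And>u z. \<bar>dird u \<psi> z\<bar> \<le> norm u * C"
    "\<And>u h z. \<bar>dird h (dird u \<psi>) z\<bar> \<le> norm h * norm u * C"
proof -
  have out: "\<And>x. x \<notin> cball 0 1 \<Longrightarrow> \<theta> x = 0" if "test_function \<theta>" for \<theta> :: "'a \<Rightarrow> real"
    using that by (simp add: test_function_def)
  have D: "\<exists>D\<ge>0. \<forall>x u. norm u \<le> 1 \<longrightarrow> \<bar>dird u \<theta> x\<bar> \<le> D" if t: "test_function \<theta>" for \<theta> :: "'a \<Rightarrow> real"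
    by (rule dird_bounded[OF test_function_smooth[OF t] compact_cball[of 0 1] out[OF t]]) auto
  obtain C0 where C0: "C0 \<ge> 0" "\<And>z. \<bar>\<psi> z\<bar> \<le> C0" using test_function_bounded[OF \<psi>] by blast
  obtain C1 where C1: "C1 \<ge> 0" "\<And>x u. norm u \<le> 1 \<Longrightarrow> \<bar>dird u \<psi> x\<bar> \<le> C1" using D[OF \<psi>] by blast
  have "\<exists>D\<ge>0. \<forall>x u. norm u \<le> 1 \<longrightarrow> \<bar>dird u (dird b \<psi>) x\<bar> \<le> D" for b
    by (rule D[OF test_function_dird[OF \<psi>]])
  then obtain E where E: "\<And>b. E b \<ge> 0" "\<And>b x u. norm u \<le> 1 \<Longrightarrow> \<bar>dird u (dird b \<psi>) x\<bar> \<le> E b" by metis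
  define C2 where "C2 = (\<Sum>b\<in>(Basis :: 'a set). E b)"
  have C2: "0 \<le> C2" unfolding C2_def by (intro sum_nonneg E)
  note s = test_function_smooth[OF \<psi>]
  have two: "\<bar>dird h (dird u \<psi>) z\<bar> \<le> norm h * norm u * C2" for u h z
  proof -
    have sb: "smooth_function (\<lambda>x. (u \<bullet> b) * dird b \<psi> x)" for b by (intro smooth_cmult smooth_dird s)
    have "dird h (dird u \<psi>) z = dird h (\<lambda>x. \<Sum>b\<in>Basis. (u \<bullet> b) * dird b \<psi> x) z"
      by (simp only: dird_expand[OF smooth_differentiable[OF s], of u])
    also have "\<dots> = (\<Sum>b\<in>Basis. (u \<bullet> b) * dird h (dird b \<psi>) z)"
      unfolding dird_sum[OF smooth_differentiable[OF sb]] dird_cmult[OF smooth_differentiable[OF smooth_dird[OF s]]] ..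
    finally have "\<bar>dird h (dird u \<psi>) z\<bar> \<le> (\<Sum>b\<in>Basis. \<bar>(u \<bullet> b) * dird h (dird b \<psi>) z\<bar>)"
      by (simp only: sum_abs)
    also have "\<dots> \<le> (\<Sum>b\<in>(Basis :: 'a set). norm u * (norm h * E b))"
    proof (rule sum_mono)
      fix b :: 'a assume b: "b \<in> Basis"
      have "\<bar>dird h (dird b \<psi>) z\<bar> \<le> norm h * E b" by (rule dird_norm_bound[OF smooth_dird[OF s] E(2)])
      then show "\<bar>(u \<bullet> b) * dird h (dird b \<psi>) z\<bar> \<le> norm u * (norm h * E b)"
        unfolding abs_mult using Basis_le_norm[OF b, of u] by (intro mult_mono) auto
    qed
    also have "\<dots> = norm h * norm u * C2" by (simp add: C2_def sum_distrib_left algebra_simps)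
    finally show ?thesis .
  qed
  have one: "\<bar>dird u \<psi> z\<bar> \<le> norm u * C1" for u z by (rule dird_norm_bound[OF s C1(2)])
  show thesis
  proof (rule that[of "C0 + C1 + C2"])
    show "0 \<le> C0 + C1 + C2" using C0 C1 C2 by simp
    show "\<bar>\<psi> z\<bar> \<le> C0 + C1 + C2" for z using C0(2)[of z] C1 C2 by simp
    have "norm u * C1 \<le> norm u * (C0 + C1 + C2)" for u :: 'a using C0 C1 C2 by (intro mult_left_mono) auto
    with one show "\<bar>dird u \<psi> z\<bar> \<le> norm u * (C0 + C1 + C2)" for u z using order_trans by blast
    have "norm h * norm u * C2 \<le> norm h * norm u * (C0 + C1 + C2)" for u h :: 'a
      using C0 C1 C2 by (intro mult_left_mono) auto
    with two show "\<bar>dird h (dird u \<psi>) z\<bar> \<le> norm h * norm u * (C0 + C1 + C2)" for u h z using order_trans by blast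
  qed
qed

text \<open>The derivative in the base point is moved to the kernel, so that only the sup norm of
  \<open>g\<close> enters. The second-order version that follows costs another factor 1/e.\<close>

lemma smear_lipschitz:
  fixes g :: "'a::euclidean_space \<Rightarrow> real"
  assumes \<psi>: "test_function \<psi>" and g: "smooth_function g" and e: "0 < e" and B: "0 \<le> B" and C: "0 \<le> C"
    and D: "\<And>u z. \<bar>dird u \<psi> z\<bar> \<le> norm u * C"
    and bnd: "\<And>y. y \<in> cball x (norm h + e) \<Longrightarrow> \<bar>g y\<bar> \<le> B"
  shows "\<bar>smear e \<psi> g (x + h) - smear e \<psi> g x\<bar> \<le> norm h * (C / e * 2 ^ DIM('a)) * B"
proof -
  obtain t where t: "0 \<le> t" "t \<le> 1" "smear e \<psi> g (x + h) - smear e \<psi> g x = dird h (smear e \<psi> g) (x + t *\<^sub>R h)"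
    by (rule mvt_dird[OF smooth_smear[OF test_function_smooth[OF \<psi>] g]])
  have "dird h (smear e \<psi> g) (x + t *\<^sub>R h) = smear e (\<lambda>z. - (1 / e) * dird h \<psi> z) g (x + t *\<^sub>R h)"
    unfolding dird_smear[OF test_function_smooth[OF \<psi>] g] using smear_dird[OF \<psi> g, of e h] e by simp
  moreover have "\<bar>smear e (\<lambda>z. - (1 / e) * dird h \<psi> z) g (x + t *\<^sub>R h)\<bar> \<le> (1 / e * (norm h * C)) * B * 2 ^ DIM('a)"
  proof (rule smear_bound[OF test_function_cmult[OF test_function_dird[OF \<psi>]] g])
    show "\<bar>- (1 / e) * dird h \<psi> z\<bar> \<le> 1 / e * (norm h * C)" for z
      unfolding abs_mult using e D[of h z] by (intro mult_mono) auto
    fix y assume "y \<in> cball (x + t *\<^sub>R h) e"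
    moreover have "dist x (x + t *\<^sub>R h) \<le> norm h" using t(1,2) by (simp add: dist_norm mult_le_cancel_right1 mult_left_le_one_le)
    ultimately have "y \<in> cball x (norm h + e)" using dist_triangle[of x y "x + t *\<^sub>R h"] by simp
    then show "\<bar>g y\<bar> \<le> B" by (rule bnd)
  qed (use e B C in auto)
  ultimately show ?thesis using t(3) by (simp add: ac_simps)
qed

lemma smear_taylor:
  fixes g :: "'a::euclidean_space \<Rightarrow> real"
  assumes \<psi>: "test_function \<psi>" and g: "smooth_function g" and e: "0 < e" and B: "0 \<le> B" and C: "0 \<le> C"
    and D: "\<And>u h z. \<bar>dird h (dird u \<psi>) z\<bar> \<le> norm h * norm u * C"
    and bnd: "\<And>y. y \<in> cball x (norm h + e) \<Longrightarrow> \<bar>g y\<bar> \<le> B"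
  shows "\<bar>smear e \<psi> g (x + h) - smear e \<psi> g x - smear e (\<lambda>z. - (1 / e) * dird h \<psi> z) g x\<bar>
     \<le> (norm h)\<^sup>2 * (C / e\<^sup>2 * 2 ^ DIM('a)) * B"
proof -
  note s = test_function_smooth[OF \<psi>]
  let ?\<theta> = "\<lambda>z. - (1 / e) * dird h \<psi> z"
  have \<theta>: "test_function ?\<theta>" by (rule test_function_cmult[OF test_function_dird[OF \<psi>]])
  have d1: "dird h (smear e \<psi> g) = smear e ?\<theta> g"
    unfolding dird_smear[OF s g] using smear_dird[OF \<psi> g, of e h] e by simp
  have d2: "dird h (smear e ?\<theta> g) = smear e (\<lambda>z. - (1 / e) * dird h ?\<theta> z) g"
    unfolding dird_smear[OF test_function_smooth[OF \<theta>] g] using smear_dird[OF \<theta> g, of e h] e by simp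
  have d3: "dird h ?\<theta> z = - (1 / e) * dird h (dird h \<psi>) z" for z
    by (subst dird_cmult[OF smooth_differentiable[OF smooth_dird[OF s]]]) simp
  have "\<bar>smear e \<psi> g (x + h) - smear e \<psi> g x - dird h (smear e \<psi> g) x\<bar> \<le> (1 / e\<^sup>2 * (norm h * norm h * C)) * B * 2 ^ DIM('a)"
  proof (rule taylor2_dird[OF smooth_smear[OF s g]])
    fix t :: real assume t: "0 \<le> t" "t \<le> 1"
    show "\<bar>dird h (dird h (smear e \<psi> g)) (x + t *\<^sub>R h)\<bar> \<le> (1 / e\<^sup>2 * (norm h * norm h * C)) * B * 2 ^ DIM('a)"
      unfolding d1 d2
    proof (rule smear_bound[OF test_function_cmult[OF test_function_dird[OF \<theta>]] g])
      have "\<bar>- (1 / e) * dird h ?\<theta> z\<bar> = 1 / e\<^sup>2 * \<bar>dird h (dird h \<psi>) z\<bar>" for z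
        unfolding d3 using e by (simp add: abs_mult power2_eq_square)
      moreover have "1 / e\<^sup>2 * \<bar>dird h (dird h \<psi>) z\<bar> \<le> 1 / e\<^sup>2 * (norm h * norm h * C)" for z
        by (intro mult_left_mono D) simp
      ultimately show "\<bar>- (1 / e) * dird h ?\<theta> z\<bar> \<le> 1 / e\<^sup>2 * (norm h * norm h * C)" for z by simp
      fix y assume "y \<in> cball (x + t *\<^sub>R h) e"
      moreover have "dist x (x + t *\<^sub>R h) \<le> norm h" using t(1,2) by (simp add: dist_norm mult_le_cancel_right1 mult_left_le_one_le)
      ultimately have "y \<in> cball x (norm h + e)" using dist_triangle[of x y "x + t *\<^sub>R h"] by simp
      then show "\<bar>g y\<bar> \<le> B" by (rule bnd)
    qed (use e B C in auto)
  qed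
  then show ?thesis unfolding d1 by (simp add: power2_eq_square ac_simps)
qed

section \<open>Mollified point evaluations\<close>

text \<open>Evaluation at \<open>x\<close> on the vectors \<open>v\<close>, spread out by the
  kernel. General kernels are allowed because derivatives in \<open>x\<close> and boundaries both
  lead to derivatives of the kernel.\<close>

definition eval_current :: "nat \<Rightarrow> real \<Rightarrow> ('a::euclidean_space \<Rightarrow> real) \<Rightarrow> 'a \<Rightarrow> (nat \<Rightarrow> 'a) \<Rightarrow> 'a current" where
  "eval_current m e \<psi> x v \<zeta> = (if \<zeta> \<in> smooth_forms m then smear_form e \<psi> \<zeta> x v else 0)"

abbreviation delete :: "nat \<Rightarrow> (nat \<Rightarrow> 'a) \<Rightarrow> nat \<Rightarrow> 'a" where
  "delete i v \<equiv> (\<lambda>j. if j < i then v j else v (Suc j))"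

abbreviation scaled_dird :: "real \<Rightarrow> 'a::euclidean_space \<Rightarrow> ('a \<Rightarrow> real) \<Rightarrow> 'a \<Rightarrow> real" where
  "scaled_dird e u \<psi> \<equiv> (\<lambda>z. - (1 / e) * dird u \<psi> z)"

lemma test_function_scaled_dird: "test_function \<psi> \<Longrightarrow> test_function (scaled_dird e u \<psi>)"
  by (rule test_function_cmult[OF test_function_dird])

lemma abs_sign_mult: "\<bar>(-1) ^ i * (t::real)\<bar> = \<bar>t\<bar>"
  by (simp add: abs_mult power_abs)

lemma eval_current_functional:
  assumes \<psi>: "smooth_function \<psi>"
  shows "form_functional m (eval_current m e \<psi> x v)"
  unfolding form_functional_def
proof (intro conjI allI ballI impI)
  fix \<omega> \<eta> :: "'a form" assume s: "\<omega> \<in> smooth_forms m" "\<eta> \<in> smooth_forms m"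
  show "eval_current m e \<psi> x v (\<lambda>x v. \<omega> x v + \<eta> x v) = eval_current m e \<psi> x v \<omega> + eval_current m e \<psi> x v \<eta>"
    using s by (simp add: eval_current_def smooth_forms_add average_form_add[OF averaging_smear[OF \<psi>] s])
next
  fix c and \<omega> :: "'a form" assume s: "\<omega> \<in> smooth_forms m"
  show "eval_current m e \<psi> x v (\<lambda>x v. c * \<omega> x v) = c * eval_current m e \<psi> x v \<omega>"
    using s by (simp add: eval_current_def smooth_forms_cmult average_form_cmult[OF averaging_smear[OF \<psi>] s])
qed (simp add: eval_current_def)

text \<open>Boundaries stay within the family: the boundary of an evaluation is a signed sum of
  evaluations of one degree less, with differentiated kernels.\<close>

lemma eval_current_ext_deriv:
  assumes \<psi>: "test_function \<psi>" and e: "e \<noteq> 0" and \<zeta>: "\<zeta> \<in> smooth_forms k"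
  shows "eval_current (Suc k) e \<psi> x v (ext_deriv k \<zeta>)
    = (\<Sum>i\<le>k. (-1) ^ i * eval_current k e (scaled_dird e (v i) \<psi>) x (delete i v) \<zeta>)"
proof -
  note A = averaging_smear[OF test_function_smooth[OF \<psi>]]
  have "eval_current (Suc k) e \<psi> x v (ext_deriv k \<zeta>) = ext_deriv k (smear_form e \<psi> \<zeta>) x v"
    by (simp add: eval_current_def smooth_forms_ext_deriv[OF \<zeta>] ext_deriv_average[OF A \<zeta>])
  also have "\<dots> = (\<Sum>i\<le>k. (-1) ^ i * smear e \<psi> (dird (v i) (\<lambda>y. \<zeta> y (delete i v))) x)"
    unfolding ext_deriv_dird average_form_def dird_smear[OF test_function_smooth[OF \<psi>] smooth_forms_smooth[OF \<zeta>]] ..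
  also have "\<dots> = (\<Sum>i\<le>k. (-1) ^ i * eval_current k e (scaled_dird e (v i) \<psi>) x (delete i v) \<zeta>)"
    unfolding smear_dird[OF \<psi> smooth_forms_smooth[OF \<zeta>] e] by (simp add: eval_current_def average_form_def \<zeta>)
  finally show ?thesis .
qed

text \<open>A crude bound for evaluations on arguments that are not unit vectors. The form of a
  charge is a multilinear function of arbitrary vectors, so all these evaluations have to be normal
  currents.\<close>

definition tuple_norm :: "nat \<Rightarrow> (nat \<Rightarrow> 'a::euclidean_space) \<Rightarrow> real" where
  "tuple_norm m v = real (card (tuples m :: (nat \<Rightarrow> 'a) set)) * (\<Prod>k<m. norm (v k))"

lemma tuple_norm_nonneg: "0 \<le> tuple_norm m v"
  unfolding tuple_norm_def by (intro mult_nonneg_nonneg prod_nonneg) auto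

lemma form_le_tuple_norm:
  fixes \<zeta> :: "'a::euclidean_space form"
  assumes \<zeta>: "\<zeta> \<in> smooth_forms m" and B: "form_le m S B \<zeta>" "0 \<le> B" and y: "y \<in> S"
  shows "\<bar>\<zeta> y v\<bar> \<le> tuple_norm m v * B"
proof -
  have "\<bar>(\<Prod>k<m. v k \<bullet> I k) * \<zeta> y I\<bar> \<le> (\<Prod>k<m. norm (v k)) * B" if I: "I \<in> tuples m" for I
  proof -
    have Ib: "I k \<in> Basis" if "k < m" for k using I that by (auto simp: tuples_def)
    have "\<bar>\<Prod>k<m. v k \<bullet> I k\<bar> \<le> (\<Prod>k<m. norm (v k))"
      unfolding abs_prod
    proof (rule prod_mono)
      fix k assume "k \<in> {..<m}"
      then show "0 \<le> \<bar>v k \<bullet> I k\<bar> \<and> \<bar>v k \<bullet> I k\<bar> \<le> norm (v k)" using Basis_le_norm[OF Ib, of k "v k"] by simp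
    qed
    moreover have "\<bar>\<zeta> y I\<bar> \<le> B" by (rule form_leD[OF B(1) y]) (use Ib in simp)
    ultimately show ?thesis unfolding abs_mult by (intro mult_mono) (auto intro: prod_nonneg)
  qed
  then have "\<bar>\<Sum>I\<in>tuples m. (\<Prod>k<m. v k \<bullet> I k) * \<zeta> y I\<bar> \<le> (\<Sum>I\<in>(tuples m :: (nat \<Rightarrow> 'a) set). (\<Prod>k<m. norm (v k)) * B)"
    by (intro order_trans[OF sum_abs] sum_mono)
  then show ?thesis
    unfolding multilin_expand[OF smooth_forms_multilin[OF \<zeta>], of y v] by (simp add: tuple_norm_def mult.assoc)
qed

lemma eval_current_bound:
  fixes \<psi> :: "'a::euclidean_space \<Rightarrow> real"
  assumes \<psi>: "test_function \<psi>" and C: "0 \<le> C" "\<And>z. \<bar>\<psi> z\<bar> \<le> C" and e: "0 \<le> e"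
    and \<zeta>: "\<zeta> \<in> smooth_forms m" and B: "0 \<le> B" "form_le m (cball x e) B \<zeta>"
  shows "\<bar>eval_current m e \<psi> x v \<zeta>\<bar> \<le> C * tuple_norm m v * 2 ^ DIM('a) * B"
proof -
  have "\<bar>smear e \<psi> (\<lambda>y. \<zeta> y v) x\<bar> \<le> C * (tuple_norm m v * B) * 2 ^ DIM('a)"
    by (rule smear_bound[OF \<psi> smooth_forms_smooth[OF \<zeta>] C(2,1) e])
      (use form_le_tuple_norm[OF \<zeta> B(2,1)] tuple_norm_nonneg[of m v] B(1) in auto)
  then show ?thesis using \<zeta> by (simp add: eval_current_def average_form_def ac_simps)
qed

lemma eval_current_normal:
  fixes \<psi> :: "'a::euclidean_space \<Rightarrow> real"
  assumes \<psi>: "test_function \<psi>" and e: "0 < e"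
  shows "eval_current m e \<psi> x v \<in> normal_currents_in m (cball x e)"
proof -
  obtain C where C: "0 \<le> C" "\<And>z. \<bar>\<psi> z\<bar> \<le> C" using test_function_bounded[OF \<psi>] by blast
  have "\<exists>D\<ge>0. \<forall>z. \<bar>scaled_dird e (v i) \<psi> z\<bar> \<le> D" for i
    using test_function_bounded[OF test_function_scaled_dird[OF \<psi>]] by metis
  then obtain D where D: "\<And>i. 0 \<le> D i" "\<And>i z. \<bar>scaled_dird e (v i) \<psi> z\<bar> \<le> D i" by metis
  \<comment> \<open>The sum runs up to \<open>m\<close> and the degree is written
    \<open>m - 1\<close>, so that \<open>b\<close> makes sense before a predecessor of
    \<open>m\<close> is available.\<close>
  define b where "b = (\<Sum>i\<le>m. D i * tuple_norm (m - 1) (delete i v) * 2 ^ DIM('a))"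
  have Dn: "0 \<le> D i * tuple_norm k (delete i v) * 2 ^ DIM('a)" for i k
    using D(1)[of i] tuple_norm_nonneg[of k "delete i v"] by simp
  show ?thesis
  proof (rule normal_currentI(1)[OF eval_current_functional[OF test_function_smooth[OF \<psi>]] compact_cball, where b=b])
    show "0 \<le> C * tuple_norm m v * 2 ^ DIM('a)" using C(1) tuple_norm_nonneg[of m v] by simp
    show "0 \<le> b" unfolding b_def by (intro sum_nonneg Dn)
    show "\<bar>eval_current m e \<psi> x v \<omega>\<bar> \<le> C * tuple_norm m v * 2 ^ DIM('a) * B"
      if "\<omega> \<in> smooth_forms m" "0 \<le> B" "form_le m (cball x e) B \<omega>" for \<omega> B
      by (rule eval_current_bound[OF \<psi> C less_imp_le[OF e] that])
    fix k and \<omega> :: "'a form" and B assume m: "m = Suc k" and w: "\<omega> \<in> smooth_forms k" "0 \<le> B" "form_le k (cball x e) B \<omega>"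
    have "\<bar>eval_current m e \<psi> x v (ext_deriv k \<omega>)\<bar>
      \<le> (\<Sum>i\<le>k. \<bar>(-1) ^ i * eval_current k e (scaled_dird e (v i) \<psi>) x (delete i v) \<omega>\<bar>)"
      using eval_current_ext_deriv[OF \<psi> _ w(1), of e x v] e unfolding m by (simp add: sum_abs)
    also have "\<dots> \<le> (\<Sum>i\<le>k. D i * tuple_norm k (delete i v) * 2 ^ DIM('a) * B)"
      using eval_current_bound[OF test_function_scaled_dird[OF \<psi>] D(1,2) less_imp_le[OF e] w]
      by (intro sum_mono) (simp add: abs_mult power_abs)
    also have "\<dots> = (\<Sum>i\<le>k. D i * tuple_norm k (delete i v) * 2 ^ DIM('a)) * B"
      by (simp add: sum_distrib_right)
    also have "\<dots> \<le> b * B"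
      unfolding b_def m using Dn[of "Suc k" k] w(2) by (intro mult_right_mono) (auto simp: mult_nonneg_nonneg)
    finally show "\<bar>eval_current m e \<psi> x v (ext_deriv k \<omega>)\<bar> \<le> b * B" .
  qed
qed

lemma unit_vectors_delete: "unit_vectors (Suc k) v \<Longrightarrow> i \<le> k \<Longrightarrow> unit_vectors k (delete i v)"
  by auto

lemma eval_moll_bound:
  assumes \<zeta>: "\<zeta> \<in> smooth_forms m" and e: "0 \<le> e" and v: "unit_vectors m v" and B: "form_le m (cball x e) B \<zeta>"
  shows "\<bar>eval_current m e moll x v \<zeta>\<bar> \<le> B"
proof -
  have "\<bar>smear e moll (\<lambda>y. \<zeta> y v) x\<bar> \<le> B"
    by (rule moll_average_bound[OF smooth_forms_smooth[OF \<zeta>] e form_leD[OF B _ v]])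
  then show ?thesis using \<zeta> by (simp add: eval_current_def average_form_def)
qed

text \<open>Chosen once for each space, so that it can occur in constants that must be uniform over
  charges and currents.\<close>

definition moll_bound :: "'a::euclidean_space itself \<Rightarrow> real" where
  "moll_bound _ = (SOME C. 0 \<le> C \<and> (\<forall>u z. \<bar>dird u (moll :: 'a \<Rightarrow> real) z\<bar> \<le> norm u * C) \<and>
     (\<forall>u h z. \<bar>dird h (dird u (moll :: 'a \<Rightarrow> real)) z\<bar> \<le> norm h * norm u * C))"

lemma moll_bound:
  "0 \<le> moll_bound TYPE('a::euclidean_space)"
  "\<bar>dird u moll z\<bar> \<le> norm u * moll_bound TYPE('a)"
  "\<bar>dird h (dird u moll) z\<bar> \<le> norm h * norm (u::'a) * moll_bound TYPE('a)"
proof -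
  obtain C where "0 \<le> C" "\<And>u z. \<bar>dird u (moll :: 'a \<Rightarrow> real) z\<bar> \<le> norm u * C"
    "\<And>u h z. \<bar>dird h (dird u (moll :: 'a \<Rightarrow> real)) z\<bar> \<le> norm h * norm u * C"
    by (rule test_function_bounds[OF test_function_moll[where 'a='a]]) blast
  then have "\<exists>C. 0 \<le> C \<and> (\<forall>u z. \<bar>dird u (moll :: 'a \<Rightarrow> real) z\<bar> \<le> norm u * C) \<and>
     (\<forall>u h z. \<bar>dird h (dird u (moll :: 'a \<Rightarrow> real)) z\<bar> \<le> norm h * norm u * C)" by blast
  from someI_ex[OF this] show "0 \<le> moll_bound TYPE('a)" "\<bar>dird u moll z\<bar> \<le> norm u * moll_bound TYPE('a)"
    "\<bar>dird h (dird u moll) z\<bar> \<le> norm h * norm u * moll_bound TYPE('a)"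
    unfolding moll_bound_def by blast+
qed

text \<open>The summand 1 accounts for the mass, the other for the boundary. An evaluation of degree
  m + 1 has m + 1 boundary terms, so the same constant serves for boundaries of evaluations of one
  degree more.\<close>

definition eval_const :: "'a::euclidean_space itself \<Rightarrow> nat \<Rightarrow> real" where
  "eval_const T m = 1 + real (Suc m) * (moll_bound T * 2 ^ DIM('a))"

lemma eval_const_ge_1: "1 \<le> eval_const TYPE('a::euclidean_space) m"
  unfolding eval_const_def using moll_bound(1)[where 'a='a] by simp

lemma eval_scaled_moll_bound:
  fixes u :: "'a::euclidean_space"
  assumes \<zeta>: "\<zeta> \<in> smooth_forms k" and e: "0 < e" and u: "norm u \<le> 1" and v: "unit_vectors k v"
    and B: "0 \<le> B" "form_le k (cball x e) B \<zeta>"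
  shows "\<bar>eval_current k e (scaled_dird e u moll) x v \<zeta>\<bar> \<le> moll_bound TYPE('a) * 2 ^ DIM('a) / e * B"
proof -
  have "\<bar>scaled_dird e u moll z\<bar> \<le> moll_bound TYPE('a) / e" for z
  proof -
    have "\<bar>dird u moll z\<bar> \<le> 1 * moll_bound TYPE('a)"
      using moll_bound(2)[of u z] moll_bound(1)[where 'a='a] u by (meson mult_right_mono order_trans)
    then show ?thesis using e by (simp add: abs_mult field_simps)
  qed
  then have "\<bar>smear e (scaled_dird e u moll) (\<lambda>y. \<zeta> y v) x\<bar> \<le> moll_bound TYPE('a) / e * B * 2 ^ DIM('a)"
    by (intro smear_bound test_function_scaled_dird test_function_moll smooth_forms_smooth[OF \<zeta>] form_leD[OF B(2) _ v])
      (use e B moll_bound(1)[where 'a='a] in auto)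
  then show ?thesis using \<zeta> by (simp add: eval_current_def average_form_def ac_simps)
qed

lemma eval_moll_ext_deriv_bound:
  fixes \<zeta> :: "'a::euclidean_space form"
  assumes \<zeta>: "\<zeta> \<in> smooth_forms k" and e: "0 < e" and v: "unit_vectors (Suc k) v"
    and B: "0 \<le> B" "form_le k (cball x e) B \<zeta>"
  shows "\<bar>eval_current (Suc k) e moll x v (ext_deriv k \<zeta>)\<bar> \<le> real (Suc k) * (moll_bound TYPE('a) * 2 ^ DIM('a)) / e * B"
proof -
  have "\<bar>eval_current (Suc k) e moll x v (ext_deriv k \<zeta>)\<bar>
      \<le> (\<Sum>i\<le>k. \<bar>(-1) ^ i * eval_current k e (scaled_dird e (v i) moll) x (delete i v) \<zeta>\<bar>)"
    using eval_current_ext_deriv[OF test_function_moll _ \<zeta>, of e x v] e by (simp add: sum_abs)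
  also have "\<dots> \<le> (\<Sum>i\<le>k. moll_bound TYPE('a) * 2 ^ DIM('a) / e * B)"
  proof (rule sum_mono)
    fix i assume "i \<in> {..k}"
    then show "\<bar>(-1) ^ i * eval_current k e (scaled_dird e (v i) moll) x (delete i v) \<zeta>\<bar> \<le> moll_bound TYPE('a) * 2 ^ DIM('a) / e * B"
      using eval_scaled_moll_bound[OF \<zeta> e _ unit_vectors_delete[OF v] B, of "v i" i] v
      by (simp add: abs_mult power_abs)
  qed
  finally show ?thesis by simp
qed

text \<open>Interpolating between these two bounds produces the rate: a charge of exponent \<alpha>
  is of order e^(\<alpha> - 1) on such a current.\<close>

lemma eval_moll_normal:
  fixes x :: "'a::euclidean_space"
  assumes e: "0 < e" "e \<le> 1" and v: "unit_vectors m v"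
  shows "real_normal_mass m (eval_current m e moll x v) \<le> eval_const TYPE('a) m / e"
    and "real_flat_norm m (eval_current m e moll x v) \<le> 1"
proof -
  let ?M = "moll_bound TYPE('a) * 2 ^ DIM('a)"
  have M: "0 \<le> ?M" using moll_bound(1)[where 'a='a] by simp
  have "real_normal_mass m (eval_current m e moll x v) \<le> 1 + real m * ?M / e"
  proof (rule normal_currentI(3)[OF eval_current_functional[OF smooth_moll] compact_cball])
    show "\<bar>eval_current m e moll x v \<omega>\<bar> \<le> 1 * B"
      if "\<omega> \<in> smooth_forms m" "0 \<le> B" "form_le m (cball x e) B \<omega>" for \<omega> B
      using eval_moll_bound[OF that(1) less_imp_le[OF e(1)] v that(3)] by simp
    show "\<bar>eval_current m e moll x v (ext_deriv k \<omega>)\<bar> \<le> real m * ?M / e * B"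
      if "m = Suc k" "\<omega> \<in> smooth_forms k" "0 \<le> B" "form_le k (cball x e) B \<omega>" for k \<omega> B
      using eval_moll_ext_deriv_bound[OF that(2) e(1) _ that(3,4), of v] v that(1) by simp
  qed (use M e in auto)
  also have "\<dots> \<le> eval_const TYPE('a) m / e"
  proof -
    have "1 \<le> 1 / e" using e by simp
    moreover have "real m * ?M / e \<le> real (Suc m) * ?M / e"
      using M e by (intro divide_right_mono mult_right_mono) auto
    ultimately show ?thesis by (simp only: eval_const_def add_divide_distrib)
  qed
  finally show "real_normal_mass m (eval_current m e moll x v) \<le> eval_const TYPE('a) m / e" .
  show "real_flat_norm m (eval_current m e moll x v) \<le> 1"
  proof (rule real_flat_norm_leI[OF normal_currents_inD(1)[OF eval_current_normal[OF test_function_moll e(1)]]])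
    fix \<omega> :: "'a form" and B :: real assume w: "\<omega> \<in> smooth_forms m" "0 < B" "flat_form_le m UNIV B \<omega>"
    have "form_le m (cball x e) B \<omega>" using w(3) by (auto simp: flat_form_le_def intro: form_le_mono)
    from eval_moll_bound[OF w(1) less_imp_le[OF e(1)] v this]
    show "\<bar>eval_current m e moll x v \<omega>\<bar> \<le> 1 * B" by simp
  qed
qed

text \<open>A boundary has no boundary, so its normal mass is its mass. Its flat norm is at most 1
  because a form admissible for the flat norm has an exterior derivative of comass at most 1. These
  bounds control the exterior derivative of a mollified charge.\<close>

lemma eval_moll_boundary_normal:
  fixes x :: "'a::euclidean_space"
  assumes e: "0 < e" and v: "unit_vectors (Suc m) v"
  shows "boundary (Suc m) (eval_current (Suc m) e moll x v) \<in> normal_currents_in m (cball x e)"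
    and "real_normal_mass m (boundary (Suc m) (eval_current (Suc m) e moll x v)) \<le> eval_const TYPE('a) m / e"
    and "real_flat_norm m (boundary (Suc m) (eval_current (Suc m) e moll x v)) \<le> 1"
proof -
  let ?M = "moll_bound TYPE('a) * 2 ^ DIM('a)"
  let ?T = "eval_current (Suc m) e moll x v"
  have M: "0 \<le> ?M" using moll_bound(1)[where 'a='a] by simp
  have a: "0 \<le> real (Suc m) * ?M / e" using M e by simp
  note FT = eval_current_functional[OF smooth_moll, of "Suc m" e x v]
  note F = boundary_functional[OF FT]
  have 1: "\<bar>boundary (Suc m) ?T \<omega>\<bar> \<le> real (Suc m) * ?M / e * B"
    if "\<omega> \<in> smooth_forms m" "0 \<le> B" "form_le m (cball x e) B \<omega>" for \<omega> B
    using eval_moll_ext_deriv_bound[OF that(1) e v that(2,3)] by (simp add: boundary_apply[OF that(1)])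
  have 2: "\<bar>boundary (Suc m) ?T (ext_deriv k \<omega>)\<bar> \<le> 0 * B"
    if "m = Suc k" "\<omega> \<in> smooth_forms k" "0 \<le> B" "form_le k (cball x e) B \<omega>" for k \<omega> B
    using boundary_apply[OF smooth_forms_ext_deriv[OF that(2)], of ?T] form_functional_zero[OF FT]
    unfolding that(1) by (simp add: ext_deriv_ext_deriv[OF that(2)])
  show N: "boundary (Suc m) ?T \<in> normal_currents_in m (cball x e)"
    by (rule normal_currentI(1)[OF F compact_cball a order_refl]) (rule 1 2; assumption)+
  have "real_normal_mass m (boundary (Suc m) ?T) \<le> real (Suc m) * ?M / e + 0"
    by (rule normal_currentI(3)[OF F compact_cball a order_refl]) (rule 1 2; assumption)+
  also have "\<dots> \<le> eval_const TYPE('a) m / e"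
    unfolding eval_const_def using e by (simp add: divide_right_mono)
  finally show "real_normal_mass m (boundary (Suc m) ?T) \<le> eval_const TYPE('a) m / e" .
  show "real_flat_norm m (boundary (Suc m) ?T) \<le> 1"
  proof (rule real_flat_norm_leI[OF normal_currents_inD(1)[OF N]])
    fix \<omega> :: "'a form" and B :: real assume w: "\<omega> \<in> smooth_forms m" "0 < B" "flat_form_le m UNIV B \<omega>"
    have "form_le (Suc m) (cball x e) B (ext_deriv m \<omega>)" using w(3) by (auto simp: flat_form_le_def intro: form_le_mono)
    from eval_moll_bound[OF smooth_forms_ext_deriv[OF w(1)] less_imp_le[OF e] v this]
    show "\<bar>boundary (Suc m) ?T \<omega>\<bar> \<le> 1 * B" by (simp add: boundary_apply[OF w(1)])
  qed
qed

text \<open>Evaluations depend on their centre in a Lipschitz way with respect to the normal mass: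
  this is the mass part, the next lemma the boundary part. It makes sums over sample points converge
  in normal mass.\<close>

lemma eval_moll_lipschitz:
  fixes \<zeta> :: "'a::euclidean_space form"
  assumes \<zeta>: "\<zeta> \<in> smooth_forms m" and e: "0 < e" and v: "unit_vectors m v" and h: "norm h \<le> 1"
    and B: "0 \<le> B" "form_le m (cball x (1 + e)) B \<zeta>"
  shows "\<bar>eval_current m e moll (x + h) v \<zeta> - eval_current m e moll x v \<zeta>\<bar> \<le> norm h * (moll_bound TYPE('a) / e * 2 ^ DIM('a)) * B"
proof -
  have "\<bar>smear e moll (\<lambda>y. \<zeta> y v) (x + h) - smear e moll (\<lambda>y. \<zeta> y v) x\<bar> \<le> norm h * (moll_bound TYPE('a) / e * 2 ^ DIM('a)) * B"
    by (rule smear_lipschitz[OF test_function_moll smooth_forms_smooth[OF \<zeta>] e B(1) moll_bound(1,2) form_leD[OF B(2) _ v]])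
      (use h in auto)
  then show ?thesis using \<zeta> by (simp add: eval_current_def average_form_def)
qed

lemma eval_moll_ext_deriv_lipschitz:
  fixes \<zeta> :: "'a::euclidean_space form"
  assumes \<zeta>: "\<zeta> \<in> smooth_forms k" and e: "0 < e" and v: "unit_vectors (Suc k) v" and h: "norm h \<le> 1"
    and B: "0 \<le> B" "form_le k (cball x (1 + e)) B \<zeta>"
  shows "\<bar>eval_current (Suc k) e moll (x + h) v (ext_deriv k \<zeta>) - eval_current (Suc k) e moll x v (ext_deriv k \<zeta>)\<bar>
    \<le> norm h * (real (Suc k) * (moll_bound TYPE('a) / e / e * 2 ^ DIM('a))) * B"
proof -
  note t = test_function_scaled_dird[OF test_function_moll]
  have each: "\<bar>eval_current k e (scaled_dird e (v i) moll) (x + h) (delete i v) \<zeta> - eval_current k e (scaled_dird e (v i) moll) x (delete i v) \<zeta>\<bar>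
    \<le> norm h * (moll_bound TYPE('a) / e / e * 2 ^ DIM('a)) * B" if i: "i \<le> k" for i
  proof -
    have D: "\<bar>dird u (scaled_dird e (v i) moll) z\<bar> \<le> norm u * (moll_bound TYPE('a) / e)" for u z
    proof -
      have "dird u (scaled_dird e (v i) moll) z = - (1 / e) * dird u (dird (v i) moll) z"
        by (subst dird_cmult[OF smooth_differentiable[OF smooth_dird[OF smooth_moll]]]) simp
      moreover have "\<bar>dird u (dird (v i) moll) z\<bar> \<le> norm u * moll_bound TYPE('a)"
      proof -
        have "norm u * norm (v i) * moll_bound TYPE('a) \<le> norm u * 1 * moll_bound TYPE('a)"
          using v i moll_bound(1)[where 'a='a] by (intro mult_right_mono mult_left_mono) auto
        then show ?thesis using moll_bound(3)[of u "v i" z] by simp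
      qed
      ultimately show ?thesis using e by (simp add: abs_mult field_simps)
    qed
    have M: "0 \<le> moll_bound TYPE('a) / e" using moll_bound(1)[where 'a='a] e by simp
    have "\<bar>smear e (scaled_dird e (v i) moll) (\<lambda>y. \<zeta> y (delete i v)) (x + h) - smear e (scaled_dird e (v i) moll) (\<lambda>y. \<zeta> y (delete i v)) x\<bar>
      \<le> norm h * (moll_bound TYPE('a) / e / e * 2 ^ DIM('a)) * B"
      by (rule smear_lipschitz[OF t smooth_forms_smooth[OF \<zeta>] e B(1) M D form_leD[OF B(2) _ unit_vectors_delete[OF v i]]])
        (use h in auto)
    then show ?thesis using \<zeta> by (simp add: eval_current_def average_form_def)
  qed
  have "\<bar>eval_current (Suc k) e moll (x + h) v (ext_deriv k \<zeta>) - eval_current (Suc k) e moll x v (ext_deriv k \<zeta>)\<bar>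
    = \<bar>\<Sum>i\<le>k. (-1) ^ i * (eval_current k e (scaled_dird e (v i) moll) (x + h) (delete i v) \<zeta> - eval_current k e (scaled_dird e (v i) moll) x (delete i v) \<zeta>)\<bar>"
    using eval_current_ext_deriv[OF test_function_moll _ \<zeta>, of e _ v] e by (simp add: sum_subtractf right_diff_distrib)
  also have "\<dots> \<le> (\<Sum>i\<le>k. norm h * (moll_bound TYPE('a) / e / e * 2 ^ DIM('a)) * B)"
    by (intro order_trans[OF sum_abs] sum_mono) (simp only: abs_sign_mult each atMost_iff)
  finally show ?thesis by (simp add: ac_simps)
qed

section \<open>The smooth form of a mollified charge\<close>

text \<open>What mollifying a functional requires: boundedness by the normal mass over compact sets.
  Fractional charges have this property by interpolation.\<close>

definition locally_bounded :: "nat \<Rightarrow> 'a::euclidean_space charge \<Rightarrow> bool" where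
  "locally_bounded m \<omega> \<longleftrightarrow> \<omega> \<in> normal_functionals m \<and>
     (\<forall>K. compact K \<longrightarrow> (\<exists>C\<ge>0. \<forall>T\<in>normal_currents_in m K. \<bar>\<omega> T\<bar> \<le> C * real_normal_mass m T))"

lemma locally_boundedD:
  assumes "locally_bounded m \<omega>" "compact K"
  obtains C where "0 \<le> C" "\<And>T. T \<in> normal_currents_in m K \<Longrightarrow> \<bar>\<omega> T\<bar> \<le> C * real_normal_mass m T"
  using assms unfolding locally_bounded_def by blast

lemma locally_bounded_functional: "locally_bounded m \<omega> \<Longrightarrow> \<omega> \<in> normal_functionals m"
  by (simp add: locally_bounded_def)

lemma normal_comb_UNIV:
  assumes S: "S \<in> normal_currents m" and T: "T \<in> normal_currents m"
  shows "(\<lambda>\<phi>. c * S \<phi> + d * T \<phi>) \<in> normal_currents m"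
proof -
  let ?K = "spt m S \<union> spt m T"
  have "compact ?K" using compact_spt[OF normal_currents_currents[OF S]] compact_spt[OF normal_currents_currents[OF T]] by (rule compact_Un)
  moreover have "S \<in> normal_currents_in m ?K" "T \<in> normal_currents_in m ?K"
    using S T by (auto simp: normal_currents_in_def)
  ultimately show ?thesis using normal_comb(1) normal_currents_inD(1) by blast
qed

lemma normal_functional_comb:
  assumes \<omega>: "\<omega> \<in> normal_functionals m" and S: "S \<in> normal_currents m" and T: "T \<in> normal_currents m"
  shows "\<omega> (\<lambda>\<phi>. c * S \<phi> + d * T \<phi>) = c * \<omega> S + d * \<omega> T"
proof -
  have cS: "(\<lambda>\<phi>. c * S \<phi>) \<in> normal_currents m" "(\<lambda>\<phi>. d * T \<phi>) \<in> normal_currents m"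
    using normal_comb_UNIV[OF S S, of c 0] normal_comb_UNIV[OF T T, of d 0] by simp_all
  have add: "\<And>S T. S \<in> normal_currents m \<Longrightarrow> T \<in> normal_currents m \<Longrightarrow> \<omega> (\<lambda>\<phi>. S \<phi> + T \<phi>) = \<omega> S + \<omega> T"
    and mul: "\<And>c T. T \<in> normal_currents m \<Longrightarrow> \<omega> (\<lambda>\<phi>. c * T \<phi>) = c * \<omega> T"
    using \<omega> unfolding normal_functionals_def by blast+
  show ?thesis using add[OF cS] mul[OF S, of c] mul[OF T, of d] by simp
qed

lemma zero_current_normal: "compact K \<Longrightarrow> (\<lambda>\<phi>. 0) \<in> normal_currents_in m K"
  by (rule normal_currentI(1)[of m "\<lambda>\<phi>. 0" K 0 0]) (auto simp: form_functional_def)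

lemma normal_functional_zero:
  assumes \<omega>: "\<omega> \<in> normal_functionals m" shows "\<omega> (\<lambda>\<phi>. 0) = 0"
proof -
  have z: "(\<lambda>\<phi>. 0) \<in> normal_currents m" using zero_current_normal[OF compact_empty] normal_currents_inD(1) by blast
  show ?thesis using normal_functional_comb[OF \<omega> z z, of 0 0] by simp
qed

lemma normal_functional_sum:
  assumes \<omega>: "\<omega> \<in> normal_functionals m" and K: "compact K"
    and T: "\<And>i. i \<in> I \<Longrightarrow> T i \<in> normal_currents_in m K" and I: "finite I"
  shows "(\<lambda>\<phi>. \<Sum>i\<in>I. c i * T i \<phi>) \<in> normal_currents_in m K \<and> \<omega> (\<lambda>\<phi>. \<Sum>i\<in>I. c i * T i \<phi>) = (\<Sum>i\<in>I. c i * \<omega> (T i))"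
  using I T
proof (induction I rule: finite_induct)
  case empty
  then show ?case using zero_current_normal[OF K] normal_functional_zero[OF \<omega>] by simp
next
  case (insert i I)
  let ?S = "\<lambda>\<phi>. \<Sum>i\<in>I. c i * T i \<phi>"
  have S: "?S \<in> normal_currents_in m K" "\<omega> ?S = (\<Sum>i\<in>I. c i * \<omega> (T i))" using insert by auto
  have Ti: "T i \<in> normal_currents_in m K" using insert by simp
  have eq: "(\<lambda>\<phi>. \<Sum>i\<in>insert i I. c i * T i \<phi>) = (\<lambda>\<phi>. c i * T i \<phi> + 1 * ?S \<phi>)"
    using insert(1,2) by simp
  show ?case
    unfolding eq using normal_comb(1)[OF Ti S(1) K, of "c i" 1]
      normal_functional_comb[OF \<omega> normal_currents_inD(1)[OF Ti] normal_currents_inD(1)[OF S(1)], of "c i" 1] S(2) insert(1,2)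
    by simp
qed

text \<open>With the kernel \<open>moll\<close> this is the mollified charge as a form; other
  kernels arise as soon as it is differentiated.\<close>

definition charge_form :: "nat \<Rightarrow> real \<Rightarrow> ('a::euclidean_space \<Rightarrow> real) \<Rightarrow> 'a charge \<Rightarrow> 'a form" where
  "charge_form m e \<psi> \<omega> x v = \<omega> (eval_current m e \<psi> x v)"

lemma charge_form_covector:
  fixes \<psi> :: "'a::euclidean_space \<Rightarrow> real"
  assumes \<omega>: "\<omega> \<in> normal_functionals m" and \<psi>: "test_function \<psi>" and e: "0 < e"
  shows "charge_form m e \<psi> \<omega> x \<in> covectors m"
proof -
  note A = averaging_smear[OF test_function_smooth[OF \<psi>], of e]
  have cov: "smear_form e \<psi> \<zeta> x \<in> covectors m" if "\<zeta> \<in> smooth_forms m" for \<zeta>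
    by (rule smooth_forms_covector[OF smooth_forms_average[OF A that]])
  have N: "eval_current m e \<psi> x v \<in> normal_currents m" for v
    by (rule normal_currents_inD(1)[OF eval_current_normal[OF \<psi> e]])
  show ?thesis
  proof (rule covectorsI)
    show "multilin m (charge_form m e \<psi> \<omega> x)"
      unfolding multilin_def
    proof (intro conjI allI impI)
      fix v w :: "nat \<Rightarrow> 'a" assume vw: "\<forall>i<m. v i = w i"
      have "eval_current m e \<psi> x v = eval_current m e \<psi> x w"
      proof
        show "eval_current m e \<psi> x v \<zeta> = eval_current m e \<psi> x w \<zeta>" for \<zeta>
          using multilin_cong[OF covectors_multilin[OF cov], of \<zeta> v w] vw by (simp add: eval_current_def)
      qed
      then show "charge_form m e \<psi> \<omega> x v = charge_form m e \<psi> \<omega> x w" by (simp add: charge_form_def)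
    next
      fix v :: "nat \<Rightarrow> 'a" and i assume i: "i < m"
      show "linear (\<lambda>z. charge_form m e \<psi> \<omega> x (v(i := z)))"
      proof (rule linearI)
        fix a b
        have "eval_current m e \<psi> x (v(i := a + b)) = (\<lambda>\<phi>. 1 * eval_current m e \<psi> x (v(i := a)) \<phi> + 1 * eval_current m e \<psi> x (v(i := b)) \<phi>)"
        proof
          show "eval_current m e \<psi> x (v(i := a + b)) \<zeta> = 1 * eval_current m e \<psi> x (v(i := a)) \<zeta> + 1 * eval_current m e \<psi> x (v(i := b)) \<zeta>" for \<zeta>
            using linear_add[OF multilin_linear[OF covectors_multilin[OF cov] i], of \<zeta> v a b] by (simp add: eval_current_def)
        qed
        then show "charge_form m e \<psi> \<omega> x (v(i := a + b)) = charge_form m e \<psi> \<omega> x (v(i := a)) + charge_form m e \<psi> \<omega> x (v(i := b))"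
          unfolding charge_form_def using normal_functional_comb[OF \<omega> N N, of 1 "v(i := a)" 1 "v(i := b)"] by simp
      next
        fix c a
        have "eval_current m e \<psi> x (v(i := c *\<^sub>R a)) = (\<lambda>\<phi>. c * eval_current m e \<psi> x (v(i := a)) \<phi> + 0 * eval_current m e \<psi> x (v(i := a)) \<phi>)"
        proof
          show "eval_current m e \<psi> x (v(i := c *\<^sub>R a)) \<zeta> = c * eval_current m e \<psi> x (v(i := a)) \<zeta> + 0 * eval_current m e \<psi> x (v(i := a)) \<zeta>" for \<zeta>
            using linear_scale[OF multilin_linear[OF covectors_multilin[OF cov] i], of \<zeta> v c a] by (simp add: eval_current_def)
        qed
        then show "charge_form m e \<psi> \<omega> x (v(i := c *\<^sub>R a)) = c *\<^sub>R charge_form m e \<psi> \<omega> x (v(i := a))"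
          unfolding charge_form_def using normal_functional_comb[OF \<omega> N N, of c "v(i := a)" 0 "v(i := a)"] by simp
      qed
    qed
    fix v :: "nat \<Rightarrow> 'a" and i j assume ij: "i < m" "j < m" "i \<noteq> j" "v i = v j"
    have "eval_current m e \<psi> x v = (\<lambda>\<phi>. 0)"
    proof
      show "eval_current m e \<psi> x v \<zeta> = 0" for \<zeta>
        using cov[of \<zeta>] ij by (auto simp: eval_current_def covectors_def)
    qed
    then show "charge_form m e \<psi> \<omega> x v = 0" by (simp add: charge_form_def normal_functional_zero[OF \<omega>])
  qed
qed

lemma eval_current_scaled_linear:
  assumes \<psi>: "test_function \<psi>"
  shows "eval_current m e (scaled_dird e (h + k) \<psi>) x v \<zeta> = eval_current m e (scaled_dird e h \<psi>) x v \<zeta> + eval_current m e (scaled_dird e k \<psi>) x v \<zeta>"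
    and "eval_current m e (scaled_dird e (c *\<^sub>R h) \<psi>) x v \<zeta> = c * eval_current m e (scaled_dird e h \<psi>) x v \<zeta>"
proof -
  note s = test_function_smooth[OF \<psi>]
  note t = test_function_smooth[OF test_function_scaled_dird[OF \<psi>]]
  have "scaled_dird e (h + k) \<psi> = (\<lambda>z. scaled_dird e h \<psi> z + scaled_dird e k \<psi> z)"
    by (simp add: fun_eq_iff linear_add[OF linear_dird[OF smooth_differentiable[OF s]]] distrib_left)
  then show "eval_current m e (scaled_dird e (h + k) \<psi>) x v \<zeta> = eval_current m e (scaled_dird e h \<psi>) x v \<zeta> + eval_current m e (scaled_dird e k \<psi>) x v \<zeta>"
    unfolding eval_current_def average_form_def
    using smear_add_left[OF t t smooth_forms_smooth] by simp
  have "scaled_dird e (c *\<^sub>R h) \<psi> = (\<lambda>z. c * scaled_dird e h \<psi> z)"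
    by (simp add: fun_eq_iff dird_scaleR[OF s])
  then show "eval_current m e (scaled_dird e (c *\<^sub>R h) \<psi>) x v \<zeta> = c * eval_current m e (scaled_dird e h \<psi>) x v \<zeta>"
    unfolding eval_current_def average_form_def by (simp only: smear_cmult_left) simp
qed

text \<open>The error of the first-order expansion in the centre, uniform over test forms bounded on
  a fixed ball. As a predicate it allows one constant to be chosen for each boundary term.\<close>

definition taylor_le :: "nat \<Rightarrow> real \<Rightarrow> ('a::euclidean_space \<Rightarrow> real) \<Rightarrow> 'a \<Rightarrow> (nat \<Rightarrow> 'a) \<Rightarrow> real \<Rightarrow> bool" where
  "taylor_le m e \<psi> x v Q \<longleftrightarrow> (\<forall>h \<zeta> B. norm h \<le> 1 \<longrightarrow> \<zeta> \<in> smooth_forms m \<longrightarrow> 0 \<le> B \<longrightarrow>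
     form_le m (cball x (1 + e)) B \<zeta> \<longrightarrow>
     \<bar>eval_current m e \<psi> (x + h) v \<zeta> - eval_current m e \<psi> x v \<zeta> - eval_current m e (scaled_dird e h \<psi>) x v \<zeta>\<bar>
       \<le> (norm h)\<^sup>2 * Q * B)"

lemma taylor_leD:
  "taylor_le m e \<psi> x v Q \<Longrightarrow> norm h \<le> 1 \<Longrightarrow> \<zeta> \<in> smooth_forms m \<Longrightarrow> 0 \<le> B \<Longrightarrow> form_le m (cball x (1 + e)) B \<zeta> \<Longrightarrow>
   \<bar>eval_current m e \<psi> (x + h) v \<zeta> - eval_current m e \<psi> x v \<zeta> - eval_current m e (scaled_dird e h \<psi>) x v \<zeta>\<bar>
     \<le> (norm h)\<^sup>2 * Q * B"
  by (simp only: taylor_le_def)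

lemma eval_current_taylor:
  fixes \<psi> :: "'a::euclidean_space \<Rightarrow> real"
  assumes \<psi>: "test_function \<psi>" and e: "0 < e"
  shows "\<exists>Q\<ge>0. taylor_le m e \<psi> x v Q"
proof -
  obtain C where C: "0 \<le> C" "\<And>u h z. \<bar>dird h (dird u \<psi>) z\<bar> \<le> norm h * norm u * C"
    by (rule test_function_bounds[OF \<psi>]) blast
  show ?thesis
  proof (rule exI[of _ "C / e\<^sup>2 * 2 ^ DIM('a) * tuple_norm m v"], rule conjI)
    show "0 \<le> C / e\<^sup>2 * 2 ^ DIM('a) * tuple_norm m v" using C e tuple_norm_nonneg[of m v] by simp
    show "taylor_le m e \<psi> x v (C / e\<^sup>2 * 2 ^ DIM('a) * tuple_norm m v)"
      unfolding taylor_le_def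
    proof (intro allI impI)
    fix h :: 'a and \<zeta> :: "'a form" and B :: real
    assume h: "norm h \<le> 1" and \<zeta>: "\<zeta> \<in> smooth_forms m" and B: "0 \<le> B" "form_le m (cball x (1 + e)) B \<zeta>"
    have "\<bar>smear e \<psi> (\<lambda>y. \<zeta> y v) (x + h) - smear e \<psi> (\<lambda>y. \<zeta> y v) x - smear e (scaled_dird e h \<psi>) (\<lambda>y. \<zeta> y v) x\<bar>
      \<le> (norm h)\<^sup>2 * (C / e\<^sup>2 * 2 ^ DIM('a)) * (tuple_norm m v * B)"
      by (rule smear_taylor[OF \<psi> smooth_forms_smooth[OF \<zeta>] e _ C form_le_tuple_norm[OF \<zeta> B(2,1)]])
        (use h tuple_norm_nonneg[of m v] B(1) in auto)
    then show "\<bar>eval_current m e \<psi> (x + h) v \<zeta> - eval_current m e \<psi> x v \<zeta> - eval_current m e (scaled_dird e h \<psi>) x v \<zeta>\<bar>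
      \<le> (norm h)\<^sup>2 * (C / e\<^sup>2 * 2 ^ DIM('a) * tuple_norm m v) * B"
      using \<zeta> by (simp add: eval_current_def average_form_def ac_simps)
    qed
  qed
qed

text \<open>The Taylor remainder in the centre is itself a normal current, of normal mass O(|h|^2),
  to which the boundedness of the charge applies. Its boundary consists of Taylor remainders of
  evaluations with differentiated kernels, so the expansion is used for these kernels as
  well.\<close>

lemma charge_form_has_derivative:
  fixes \<psi> :: "'a::euclidean_space \<Rightarrow> real"
  assumes \<omega>: "locally_bounded m \<omega>" and \<psi>: "test_function \<psi>" and e: "0 < e"
  shows "((\<lambda>x. charge_form m e \<psi> \<omega> x v) has_derivative (\<lambda>h. charge_form m e (scaled_dird e h \<psi>) \<omega> x v)) (at x)"
proof -
  note \<omega>f = locally_bounded_functional[OF \<omega>]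
  note t = test_function_scaled_dird[OF \<psi>]
  have N: "eval_current m e \<theta> y w \<in> normal_currents m" if "test_function \<theta>" for \<theta> y w
    by (rule normal_currents_inD(1)[OF eval_current_normal[OF that e]])
  let ?K = "cball x (1 + e)"
  obtain C where C: "0 \<le> C" "\<And>T. T \<in> normal_currents_in m ?K \<Longrightarrow> \<bar>\<omega> T\<bar> \<le> C * real_normal_mass m T"
    using locally_boundedD[OF \<omega> compact_cball] by blast
  obtain Q where Q: "0 \<le> Q" "taylor_le m e \<psi> x v Q"
    using eval_current_taylor[OF \<psi> e] by blast
  have "\<forall>i. \<exists>P\<ge>0. taylor_le (m - 1) e (scaled_dird e (v i) \<psi>) x (delete i v) P"
    using eval_current_taylor[OF t e] by blast
  then obtain P where P: "\<And>i. 0 \<le> P i"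
    "\<And>i. taylor_le (m - 1) e (scaled_dird e (v i) \<psi>) x (delete i v) (P i)" by metis
  define R where "R = (\<Sum>i\<le>m. P i)"
  have R: "0 \<le> R" unfolding R_def by (intro sum_nonneg P)
  \<comment> \<open>Symmetry of the second derivatives of the kernel: the boundary of the linear
    term is the linear term of the boundary.\<close>
  have swap: "scaled_dird e h (scaled_dird e u \<psi>) = scaled_dird e u (scaled_dird e h \<psi>)" for h u
    unfolding dird_cmult[OF smooth_differentiable[OF smooth_dird[OF test_function_smooth[OF \<psi>]]]]
    by (simp add: dird_commute[OF test_function_smooth[OF \<psi>], of h])
  have rem: "\<bar>charge_form m e \<psi> \<omega> (x + h) v - charge_form m e \<psi> \<omega> x v - charge_form m e (scaled_dird e h \<psi>) \<omega> x v\<bar>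
      \<le> C * ((norm h)\<^sup>2 * (Q + R))" if h: "norm h \<le> 1" for h
  proof -
    define D where "D = (\<lambda>\<phi>. 1 * eval_current m e \<psi> x v \<phi> + 1 * eval_current m e (scaled_dird e h \<psi>) x v \<phi>)"
    define E where "E = (\<lambda>\<phi>. 1 * eval_current m e \<psi> (x + h) v \<phi> + (-1) * D \<phi>)"
    have ND: "D \<in> normal_currents m" unfolding D_def by (rule normal_comb_UNIV[OF N[OF \<psi>] N[OF t]])
    have NE: "E \<in> normal_currents m" unfolding E_def by (rule normal_comb_UNIV[OF N[OF \<psi>] ND])
    have E: "E \<zeta> = eval_current m e \<psi> (x + h) v \<zeta> - eval_current m e \<psi> x v \<zeta> - eval_current m e (scaled_dird e h \<psi>) x v \<zeta>" for \<zeta>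
      by (simp add: E_def D_def)
    have 1: "\<bar>E \<zeta>\<bar> \<le> ((norm h)\<^sup>2 * Q) * B" if "\<zeta> \<in> smooth_forms m" "0 \<le> B" "form_le m ?K B \<zeta>" for \<zeta> B
      unfolding E by (rule taylor_leD[OF Q(2) h that])
    have 2: "\<bar>E (ext_deriv k \<zeta>)\<bar> \<le> ((norm h)\<^sup>2 * R) * B"
      if m: "m = Suc k" and w: "\<zeta> \<in> smooth_forms k" "0 \<le> B" "form_le k ?K B \<zeta>" for k \<zeta> B
    proof -
      have e0: "e \<noteq> 0" using e by simp
      have "E (ext_deriv k \<zeta>) = (\<Sum>i\<le>k. (-1) ^ i *
          (eval_current k e (scaled_dird e (v i) \<psi>) (x + h) (delete i v) \<zeta> - eval_current k e (scaled_dird e (v i) \<psi>) x (delete i v) \<zeta>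
        - eval_current k e (scaled_dird e h (scaled_dird e (v i) \<psi>)) x (delete i v) \<zeta>))"
        unfolding E m eval_current_ext_deriv[OF \<psi> e0 w(1)] eval_current_ext_deriv[OF t e0 w(1)] swap
        by (simp only: sum_subtractf right_diff_distrib)
      then have "\<bar>E (ext_deriv k \<zeta>)\<bar> \<le> (\<Sum>i\<le>k. \<bar>(-1) ^ i *
          (eval_current k e (scaled_dird e (v i) \<psi>) (x + h) (delete i v) \<zeta> - eval_current k e (scaled_dird e (v i) \<psi>) x (delete i v) \<zeta>
        - eval_current k e (scaled_dird e h (scaled_dird e (v i) \<psi>)) x (delete i v) \<zeta>)\<bar>)"
        by (simp only: sum_abs)
      also have "\<dots> \<le> (\<Sum>i\<le>k. (norm h)\<^sup>2 * P i * B)"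
        unfolding abs_sign_mult
      proof (rule sum_mono)
        fix i
        have "taylor_le k e (scaled_dird e (v i) \<psi>) x (delete i v) (P i)" using P(2)[of i] by (simp only: m diff_Suc_1)
        from taylor_leD[OF this h w]
        show "\<bar>eval_current k e (scaled_dird e (v i) \<psi>) (x + h) (delete i v) \<zeta> - eval_current k e (scaled_dird e (v i) \<psi>) x (delete i v) \<zeta>
          - eval_current k e (scaled_dird e h (scaled_dird e (v i) \<psi>)) x (delete i v) \<zeta>\<bar> \<le> (norm h)\<^sup>2 * P i * B" .
      qed
      also have "\<dots> = (norm h)\<^sup>2 * B * (\<Sum>i\<le>k. P i)"
        unfolding sum_distrib_left by (rule sum.cong) (simp_all add: ac_simps)
      also have "\<dots> \<le> (norm h)\<^sup>2 * B * R"
        unfolding R_def m using P(1)[of "Suc k"] w(2) by (intro mult_left_mono) auto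
      finally show ?thesis by (simp add: ac_simps)
    qed
    have QR: "0 \<le> (norm h)\<^sup>2 * Q" "0 \<le> (norm h)\<^sup>2 * R" using Q(1) R by simp_all
    note F = normal_currents_functional[OF NE]
    have EK: "E \<in> normal_currents_in m ?K"
      by (rule normal_currentI(1)[OF F compact_cball QR]) (rule 1 2; assumption)+
    have "real_normal_mass m E \<le> (norm h)\<^sup>2 * Q + (norm h)\<^sup>2 * R"
      by (rule normal_currentI(3)[OF F compact_cball QR]) (rule 1 2; assumption)+
    then have "\<bar>\<omega> E\<bar> \<le> C * ((norm h)\<^sup>2 * (Q + R))"
      using C(2)[OF EK] C(1) by (metis distrib_left mult_left_mono order_trans)
    moreover have "\<omega> E = \<omega> (eval_current m e \<psi> (x + h) v) - (\<omega> (eval_current m e \<psi> x v) + \<omega> (eval_current m e (scaled_dird e h \<psi>) x v))"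
      unfolding E_def normal_functional_comb[OF \<omega>f N[OF \<psi>] ND] unfolding D_def normal_functional_comb[OF \<omega>f N[OF \<psi>] N[OF t]] by simp
    ultimately show ?thesis by (simp add: charge_form_def algebra_simps)
  qed
  have lin: "linear (\<lambda>h. charge_form m e (scaled_dird e h \<psi>) \<omega> x v)"
  proof (rule linearI)
    fix h k
    have eq: "eval_current m e (scaled_dird e (h + k) \<psi>) x v = (\<lambda>\<phi>. 1 * eval_current m e (scaled_dird e h \<psi>) x v \<phi> + 1 * eval_current m e (scaled_dird e k \<psi>) x v \<phi>)"
      by (rule ext) (simp only: eval_current_scaled_linear(1)[OF \<psi>] mult_1)
    show "charge_form m e (scaled_dird e (h + k) \<psi>) \<omega> x v = charge_form m e (scaled_dird e h \<psi>) \<omega> x v + charge_form m e (scaled_dird e k \<psi>) \<omega> x v"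
      unfolding charge_form_def eq normal_functional_comb[OF \<omega>f N[OF t] N[OF t]] by simp
  next
    fix c h
    have eq: "eval_current m e (scaled_dird e (c *\<^sub>R h) \<psi>) x v = (\<lambda>\<phi>. c * eval_current m e (scaled_dird e h \<psi>) x v \<phi> + 0 * eval_current m e (scaled_dird e h \<psi>) x v \<phi>)"
      by (rule ext) (simp only: eval_current_scaled_linear(2)[OF \<psi>] mult_zero_left add_0_right)
    show "charge_form m e (scaled_dird e (c *\<^sub>R h) \<psi>) \<omega> x v = c *\<^sub>R charge_form m e (scaled_dird e h \<psi>) \<omega> x v"
      unfolding charge_form_def eq normal_functional_comb[OF \<omega>f N[OF t] N[OF t]] by simp
  qed
  show ?thesis
  proof (rule has_derivativeI_sandwich[of 1 _ _ _ _ "\<lambda>y. C * (Q + R) * norm (y - x)"])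
    show "bounded_linear (\<lambda>h. charge_form m e (scaled_dird e h \<psi>) \<omega> x v)"
      using lin by (simp add: linear_conv_bounded_linear)
    fix y assume y: "y \<noteq> x" "dist y x < 1"
    have n: "norm (y - x) \<le> 1" "norm (y - x) > 0" using y by (simp_all add: dist_norm)
    have "\<bar>charge_form m e \<psi> \<omega> y v - charge_form m e \<psi> \<omega> x v - charge_form m e (scaled_dird e (y - x) \<psi>) \<omega> x v\<bar>
      \<le> C * ((norm (y - x))\<^sup>2 * (Q + R))"
      using rem[OF n(1)] by simp
    then show "norm (charge_form m e \<psi> \<omega> y v - charge_form m e \<psi> \<omega> x v - charge_form m e (scaled_dird e (y - x) \<psi>) \<omega> x v) / norm (y - x)
      \<le> C * (Q + R) * norm (y - x)"
      using n(2) by (simp add: pos_divide_le_eq power2_eq_square ac_simps)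
  next
    have "((\<lambda>y. C * (Q + R) * norm (y - x)) \<longlongrightarrow> C * (Q + R) * norm (x - x)) (at x)" by (intro tendsto_intros)
    then show "((\<lambda>y. C * (Q + R) * norm (y - x)) \<longlongrightarrow> 0) (at x)" by simp
  qed simp
qed

lemma dird_charge_form:
  assumes "locally_bounded m \<omega>" "test_function \<psi>" "0 < e"
  shows "dird u (\<lambda>x. charge_form m e \<psi> \<omega> x v) = (\<lambda>x. charge_form m e (scaled_dird e u \<psi>) \<omega> x v)"
  using dird_eqI[OF charge_form_has_derivative[OF assms]] by (intro ext)

text \<open>Differentiation only changes the kernel, so coinduction over kernels yields all
  derivatives.\<close>

lemma smooth_forms_charge_form:
  assumes \<omega>: "locally_bounded m \<omega>" and \<psi>: "test_function \<psi>" and e: "0 < e"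
  shows "charge_form m e \<psi> \<omega> \<in> smooth_forms m"
proof (rule smooth_formsI)
  show "charge_form m e \<psi> \<omega> x \<in> covectors m" for x
    by (rule charge_form_covector[OF locally_bounded_functional[OF \<omega>] \<psi> e])
  fix v
  show "smooth_function (\<lambda>x. charge_form m e \<psi> \<omega> x v)"
  proof (rule smooth_coinduct[where P="\<lambda>f. \<exists>\<psi>. test_function \<psi> \<and> f = (\<lambda>x. charge_form m e \<psi> \<omega> x v)"])
    show "\<exists>\<theta>. test_function \<theta> \<and> (\<lambda>x. charge_form m e \<psi> \<omega> x v) = (\<lambda>x. charge_form m e \<theta> \<omega> x v)"
      by (rule exI[of _ \<psi>]) (simp add: \<psi>)
  next
    fix f :: "'a \<Rightarrow> real" and x
    assume "\<exists>\<psi>. test_function \<psi> \<and> f = (\<lambda>x. charge_form m e \<psi> \<omega> x v)"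
    then obtain \<psi> where \<psi>: "test_function \<psi>" "f = (\<lambda>x. charge_form m e \<psi> \<omega> x v)" by blast
    show "f differentiable at x"
      unfolding \<psi>(2) using charge_form_has_derivative[OF \<omega> \<psi>(1) e] by (rule differentiableI)
    show "\<exists>\<psi>. test_function \<psi> \<and> dird u f = (\<lambda>x. charge_form m e \<psi> \<omega> x v)" for u
      by (rule exI[of _ "scaled_dird e u \<psi>"])
        (simp only: \<psi>(2) dird_charge_form[OF \<omega> \<psi>(1) e] test_function_scaled_dird[OF \<psi>(1)] simp_thms)
  qed
qed

text \<open>Differentiating in the centre produces exactly the evaluations with differentiated
  kernels that make up the boundary of an evaluation of degree m + 1.\<close>

lemma ext_deriv_charge_form:
  fixes \<omega> :: "'a::euclidean_space charge"
  assumes \<omega>: "locally_bounded m \<omega>" and e: "0 < e"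
  shows "ext_deriv m (charge_form m e moll \<omega>) x v = \<omega> (boundary (Suc m) (eval_current (Suc m) e moll x v))"
proof -
  note t = test_function_scaled_dird[OF test_function_moll]
  have e0: "e \<noteq> 0" using e by simp
  have "boundary (Suc m) (eval_current (Suc m) e moll x v)
      = (\<lambda>\<phi>. \<Sum>i\<le>m. (-1) ^ i * eval_current m e (scaled_dird e (v i) moll) x (delete i v) \<phi>)"
  proof
    fix \<zeta> :: "'a form"
    show "boundary (Suc m) (eval_current (Suc m) e moll x v) \<zeta>
      = (\<Sum>i\<le>m. (-1) ^ i * eval_current m e (scaled_dird e (v i) moll) x (delete i v) \<zeta>)"
    proof (cases "\<zeta> \<in> smooth_forms m")
      case True
      then show ?thesis by (simp only: boundary_apply[OF True] eval_current_ext_deriv[OF test_function_moll e0 True])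
    next
      case False
      then show ?thesis by (simp add: boundary_def eval_current_def)
    qed
  qed
  moreover have "\<omega> (\<lambda>\<phi>. \<Sum>i\<le>m. (-1) ^ i * eval_current m e (scaled_dird e (v i) moll) x (delete i v) \<phi>)
    = (\<Sum>i\<le>m. (-1) ^ i * \<omega> (eval_current m e (scaled_dird e (v i) moll) x (delete i v)))"
    by (rule conjunct2[OF normal_functional_sum[OF locally_bounded_functional[OF \<omega>] compact_cball
          eval_current_normal[OF t e] finite_atMost]])
  ultimately show ?thesis
    unfolding ext_deriv_dird dird_charge_form[OF \<omega> test_function_moll e] by (simp only: charge_form_def)
qed

section \<open>Partitions of unity\<close>

text \<open>The sum is 1 on an open neighbourhood \<open>V\<close> of \<open>L\<close>, not just on
  \<open>L\<close>, because the value of a current on a form depends on the form near the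
  support.\<close>

definition partition_near :: "'a::euclidean_space set \<Rightarrow> real \<Rightarrow> 'a set \<Rightarrow> ('a \<Rightarrow> 'a \<Rightarrow> real) \<Rightarrow> 'a set \<Rightarrow> bool" where
  "partition_near L \<delta> D \<theta> V \<longleftrightarrow> finite D \<and> D \<subseteq> L \<and> open V \<and> L \<subseteq> V \<and>
     (\<forall>x\<in>D. smooth_function (\<theta> x)) \<and> (\<forall>x\<in>D. \<forall>y. 0 \<le> \<theta> x y) \<and>
     (\<forall>x\<in>D. \<forall>y. \<theta> x y \<noteq> 0 \<longrightarrow> dist x y \<le> \<delta>) \<and>
     (\<forall>y. (\<Sum>x\<in>D. \<theta> x y) \<le> 1) \<and> (\<forall>y\<in>V. (\<Sum>x\<in>D. \<theta> x y) = 1)"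

text \<open>Points are added one at a time: a new point receives its bump multiplied by the product
  of 1 - bump over the earlier points, so that the sums telescope.\<close>

lemma partition_exists:
  fixes L :: "'a::euclidean_space set"
  assumes L: "compact L" and \<delta>: "0 < \<delta>"
  shows "\<exists>D \<theta> V. partition_near L \<delta> D \<theta> V"
proof -
  have "L \<subseteq> (\<Union>x\<in>L. ball x (\<delta>/2))" using \<delta> by force
  then obtain D where D: "D \<subseteq> L" "finite D" "L \<subseteq> (\<Union>x\<in>D. ball x (\<delta>/2))"
    using compactE_image[OF L, of L "\<lambda>x. ball x (\<delta>/2)"] by auto
  have "\<exists>\<theta>. (\<forall>x\<in>D. smooth_function (\<theta> x)) \<and> (\<forall>x\<in>D. \<forall>y. 0 \<le> \<theta> x y \<and> \<theta> x y \<le> bump x (\<delta>/2) y) \<and>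
      (\<forall>y. (\<Sum>x\<in>D. \<theta> x y) = 1 - (\<Prod>x\<in>D. 1 - bump x (\<delta>/2) y))"
    using D(2)
  proof (induction D rule: finite_induct)
    case empty
    then show ?case by simp
  next
    case (insert a D)
    then obtain \<theta> where \<theta>: "\<And>x. x \<in> D \<Longrightarrow> smooth_function (\<theta> x)"
      "\<And>x y. x \<in> D \<Longrightarrow> 0 \<le> \<theta> x y \<and> \<theta> x y \<le> bump x (\<delta>/2) y"
      "\<And>y. (\<Sum>x\<in>D. \<theta> x y) = 1 - (\<Prod>x\<in>D. 1 - bump x (\<delta>/2) y)" by blast
    define P where "P y = (\<Prod>x\<in>D. 1 - bump x (\<delta>/2) y)" for y
    define \<eta> where "\<eta> = \<theta>(a := \<lambda>y. P y * bump a (\<delta>/2) y)"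
    have P01: "0 \<le> P y" "P y \<le> 1" for y
      unfolding P_def using bump_bounds[of _ "\<delta>/2" y] by (auto intro!: prod_nonneg prod_le_1)
    have "P = (\<lambda>y. 1 - (\<Sum>x\<in>D. \<theta> x y))" using \<theta>(3) by (simp add: P_def fun_eq_iff)
    then have sP: "smooth_function P" using \<theta>(1) by (simp add: smooth_diff smooth_sum)
    have "smooth_function (\<eta> x)" if "x \<in> insert a D" for x
      using that \<theta>(1) smooth_mult[OF sP smooth_bump] by (cases "x = a") (auto simp: \<eta>_def)
    moreover have "0 \<le> \<eta> x y \<and> \<eta> x y \<le> bump x (\<delta>/2) y" if "x \<in> insert a D" for x y
      using that \<theta>(2) P01[of y] bump_bounds[of a "\<delta>/2" y]
      by (cases "x = a") (auto simp: \<eta>_def mult_left_le_one_le)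
    moreover have "(\<Sum>x\<in>insert a D. \<eta> x y) = 1 - (\<Prod>x\<in>insert a D. 1 - bump x (\<delta>/2) y)" for y
    proof -
      have "(\<Sum>x\<in>D. \<eta> x y) = (\<Sum>x\<in>D. \<theta> x y)"
        using insert(2) by (intro sum.cong) (auto simp: \<eta>_def)
      then show ?thesis using insert(1,2) \<theta>(3)[of y] by (simp add: \<eta>_def P_def algebra_simps)
    qed
    ultimately show ?case by (intro exI[of _ \<eta>]) simp
  qed
  then obtain \<theta> where \<theta>: "\<And>x. x \<in> D \<Longrightarrow> smooth_function (\<theta> x)"
    "\<And>x y. x \<in> D \<Longrightarrow> 0 \<le> \<theta> x y \<and> \<theta> x y \<le> bump x (\<delta>/2) y"
    "\<And>y. (\<Sum>x\<in>D. \<theta> x y) = 1 - (\<Prod>x\<in>D. 1 - bump x (\<delta>/2) y)" by blast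
  have "partition_near L \<delta> D \<theta> (\<Union>x\<in>D. ball x (\<delta>/2))"
    unfolding partition_near_def
  proof (intro conjI ballI allI impI)
    fix x y assume x: "x \<in> D" and n: "\<theta> x y \<noteq> 0"
    show "dist x y \<le> \<delta>"
    proof (rule ccontr)
      assume "\<not> dist x y \<le> \<delta>"
      then have "bump x (\<delta>/2) y = 0" using \<delta> by (intro bump_eq_0) (auto simp: dist_norm norm_minus_commute)
      then show False using \<theta>(2)[OF x, of y] n by simp
    qed
  next
    fix y
    have "0 \<le> (\<Prod>x\<in>D. 1 - bump x (\<delta>/2) y)" using bump_bounds by (intro prod_nonneg) auto
    then show "(\<Sum>x\<in>D. \<theta> x y) \<le> 1" by (simp add: \<theta>(3))
  next
    fix y assume "y \<in> (\<Union>x\<in>D. ball x (\<delta>/2))"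
    then obtain x where x: "x \<in> D" "dist x y < \<delta>/2" by auto
    have "bump x (\<delta>/2) y = 1" using x(2) \<delta> by (intro bump_eq_1) (auto simp: dist_norm norm_minus_commute)
    then have "(\<Prod>x\<in>D. 1 - bump x (\<delta>/2) y) = 0" using x(1) D(2) by (intro prod_zero) auto
    then show "(\<Sum>x\<in>D. \<theta> x y) = 1" by (simp add: \<theta>(3))
  qed (use D \<theta> in auto)
  then show ?thesis by blast
qed

lemma partition_nearD:
  assumes "partition_near L \<delta> D \<theta> V"
  shows "finite D" "D \<subseteq> L" "open V" "L \<subseteq> V" "\<And>x. x \<in> D \<Longrightarrow> smooth_function (\<theta> x)"
    "\<And>x y. x \<in> D \<Longrightarrow> 0 \<le> \<theta> x y" "\<And>x y. x \<in> D \<Longrightarrow> \<theta> x y \<noteq> 0 \<Longrightarrow> dist x y \<le> \<delta>"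
    "\<And>y. (\<Sum>x\<in>D. \<theta> x y) \<le> 1" "\<And>y. y \<in> V \<Longrightarrow> (\<Sum>x\<in>D. \<theta> x y) = 1"
  using assms unfolding partition_near_def by blast+

definition discretize :: "'a set \<Rightarrow> ('a \<Rightarrow> 'a \<Rightarrow> real) \<Rightarrow> 'a::euclidean_space form \<Rightarrow> 'a form" where
  "discretize D \<theta> \<eta> y v = (\<Sum>x\<in>D. \<theta> x y * \<eta> x v)"

lemma smooth_forms_discretize:
  assumes "partition_near L \<delta> D \<theta> V" "\<And>x. \<eta> x \<in> covectors m"
  shows "discretize D \<theta> \<eta> \<in> smooth_forms m"
  unfolding discretize_def[abs_def]
  by (rule smooth_forms_sum, rule smooth_forms_const[OF assms(2) partition_nearD(5)[OF assms(1)]])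

text \<open>Expanding the covectors in a basis turns the value of a current on a discretized form
  into a finite combination of point evaluations of the form.\<close>

lemma current_discretize_expand:
  assumes p: "partition_near L \<delta> D \<theta> V" and F: "form_functional m T" and \<eta>: "\<And>x. \<eta> x \<in> covectors m"
  shows "T (discretize D \<theta> \<eta>) = (\<Sum>q\<in>D \<times> tuples m. T (\<lambda>y v. \<theta> (fst q) y * dual_tuple m (snd q) v) * \<eta> (fst q) (snd q))"
proof -
  let ?E = "\<lambda>q y v. \<eta> (fst q) (snd q) * (\<theta> (fst q) y * dual_tuple m (snd q) v)"
  have s0: "(\<lambda>y v. \<theta> (fst q) y * dual_tuple m (snd q) v) \<in> smooth_forms m" if "q \<in> D \<times> tuples m" for q
    by (rule smooth_forms_const[OF dual_tuple_covector partition_nearD(5)[OF p]]) (use that in auto)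
  have eq: "discretize D \<theta> \<eta> = (\<lambda>y v. \<Sum>q\<in>D \<times> tuples m. ?E q y v)"
  proof (intro ext)
    fix y v
    have "discretize D \<theta> \<eta> y v = (\<Sum>x\<in>D. \<theta> x y * (\<Sum>I\<in>tuples m. \<eta> x I * dual_tuple m I v))"
      unfolding discretize_def by (intro sum.cong refl) (simp only: covector_expand[OF \<eta>, symmetric])
    also have "\<dots> = (\<Sum>x\<in>D. \<Sum>I\<in>tuples m. \<eta> x I * (\<theta> x y * dual_tuple m I v))"
      by (simp add: sum_distrib_left mult.left_commute)
    finally show "discretize D \<theta> \<eta> y v = (\<Sum>q\<in>D \<times> tuples m. ?E q y v)"
      by (simp add: sum.cartesian_product case_prod_beta)
  qed
  have "T (discretize D \<theta> \<eta>) = (\<Sum>q\<in>D \<times> tuples m. T (?E q))"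
    unfolding eq by (rule form_functional_sum[OF F smooth_forms_cmult[OF s0]])
  also have "\<dots> = (\<Sum>q\<in>D \<times> tuples m. T (\<lambda>y v. \<theta> (fst q) y * dual_tuple m (snd q) v) * \<eta> (fst q) (snd q))"
    by (intro sum.cong refl) (simp only: form_functionalD(3)[OF F s0] mult.commute)
  finally show ?thesis .
qed

text \<open>Multiplying \<open>\<eta>\<close> by the sum of the partition does not change the value
  of \<open>T\<close>, since that sum is 1 near the support. What remains is a combination, with
  weights of sum at most 1, of oscillations of \<open>\<eta>\<close> over distances at most
  \<open>\<delta>\<close>.\<close>

lemma current_discretize_bound:
  fixes T :: "'a::euclidean_space current"
  assumes p: "partition_near (thick 1 K) \<delta> D \<theta> V" and T: "T \<in> currents m" and spt: "spt m T \<subseteq> K"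
    and bnd: "\<And>\<omega> B. \<omega> \<in> smooth_forms m \<Longrightarrow> 0 \<le> B \<Longrightarrow> form_le m (thick 1 K) B \<omega> \<Longrightarrow> \<bar>T \<omega>\<bar> \<le> a * B"
    and \<eta>: "\<eta> \<in> smooth_forms m" and c: "0 \<le> c"
    and osc: "\<And>x y v. x \<in> thick 1 K \<Longrightarrow> y \<in> thick 1 K \<Longrightarrow> dist x y \<le> \<delta> \<Longrightarrow> unit_vectors m v \<Longrightarrow> \<bar>\<eta> y v - \<eta> x v\<bar> \<le> c"
  shows "\<bar>T (discretize D \<theta> \<eta>) - T \<eta>\<bar> \<le> a * c"
proof -
  note P = partition_nearD[OF p]
  note F = currents_functional[OF T]
  let ?\<Theta> = "\<lambda>y. \<Sum>x\<in>D. \<theta> x y"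
  have s\<Theta>: "smooth_function ?\<Theta>" by (rule smooth_sum[OF P(5)])
  have s1: "discretize D \<theta> \<eta> \<in> smooth_forms m"
    by (rule smooth_forms_discretize[OF p smooth_forms_covector[OF \<eta>]])
  have s2: "(\<lambda>y v. ?\<Theta> y * \<eta> y v) \<in> smooth_forms m" by (rule smooth_forms_mult[OF \<eta> s\<Theta>])
  have "K \<subseteq> V" using subset_thick[of 1 K] P(4) by auto
  then have "T (\<lambda>y v. ?\<Theta> y * \<eta> y v) = T \<eta>"
    by (intro current_cutoff[OF T _ P(3) s\<Theta> P(9) \<eta>]) (use spt in auto)
  moreover have "\<bar>T (\<lambda>y v. discretize D \<theta> \<eta> y v - ?\<Theta> y * \<eta> y v)\<bar> \<le> a * c"
  proof (rule bnd[OF smooth_forms_diff[OF s1 s2] c], rule form_leI)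
    fix y and v :: "nat \<Rightarrow> 'a" assume y: "y \<in> thick 1 K" and v: "unit_vectors m v"
    have "discretize D \<theta> \<eta> y v - ?\<Theta> y * \<eta> y v = (\<Sum>x\<in>D. \<theta> x y * (\<eta> x v - \<eta> y v))"
      by (simp add: discretize_def sum_distrib_right right_diff_distrib sum_subtractf)
    also have "\<bar>\<dots>\<bar> \<le> (\<Sum>x\<in>D. \<theta> x y * c)"
    proof (intro order_trans[OF sum_abs] sum_mono)
      fix x assume x: "x \<in> D"
      show "\<bar>\<theta> x y * (\<eta> x v - \<eta> y v)\<bar> \<le> \<theta> x y * c"
      proof (cases "\<theta> x y = 0")
        case False
        have "\<bar>\<eta> y v - \<eta> x v\<bar> \<le> c" using P(2) x by (intro osc[OF _ y P(7)[OF x False] v]) auto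
        then show ?thesis using P(6)[OF x, of y] by (simp add: abs_mult abs_minus_commute mult_left_mono)
      qed simp
    qed
    also have "\<dots> = ?\<Theta> y * c" by (simp add: sum_distrib_right)
    also have "\<dots> \<le> 1 * c" using P(8)[of y] c by (intro mult_right_mono)
    finally show "\<bar>discretize D \<theta> \<eta> y v - ?\<Theta> y * \<eta> y v\<bar> \<le> c" by simp
  qed
  ultimately show ?thesis by (simp only: form_functional_diff[OF F s1 s2])
qed

section \<open>Mollified charges are given by smooth forms\<close>

text \<open>Per unit of distance between the centres, the first summand bounds the mass and the
  second the boundary mass of a difference of evaluations.\<close>

definition lipschitz_const :: "'a::euclidean_space itself \<Rightarrow> nat \<Rightarrow> real \<Rightarrow> real" where
  "lipschitz_const T m e = moll_bound T / e * 2 ^ DIM('a) + real m * (moll_bound T / e / e * 2 ^ DIM('a))"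

lemma eval_moll_diff_normal:
  fixes x :: "'a::euclidean_space"
  assumes e: "0 < e" and v: "unit_vectors m v" and h: "norm h \<le> 1"
  shows "real_normal_mass m (\<lambda>\<phi>. 1 * eval_current m e moll (x + h) v \<phi> + (-1) * eval_current m e moll x v \<phi>)
     \<le> norm h * lipschitz_const TYPE('a) m e"
proof -
  let ?R = "\<lambda>\<phi>. 1 * eval_current m e moll (x + h) v \<phi> + (-1) * eval_current m e moll x v \<phi>"
  let ?a = "norm h * (moll_bound TYPE('a) / e * 2 ^ DIM('a))"
  let ?b = "norm h * (real m * (moll_bound TYPE('a) / e / e * 2 ^ DIM('a)))"
  have ab: "0 \<le> ?a" "0 \<le> ?b" using moll_bound(1)[where 'a='a] e by simp_all
  have F: "form_functional m ?R"
    by (rule functional_comb[OF eval_current_functional[OF smooth_moll] eval_current_functional[OF smooth_moll]])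
  have 1: "\<bar>?R \<zeta>\<bar> \<le> ?a * B" if "\<zeta> \<in> smooth_forms m" "0 \<le> B" "form_le m (cball x (1 + e)) B \<zeta>" for \<zeta> B
    using eval_moll_lipschitz[OF that(1) e v h that(2,3)] by simp
  have 2: "\<bar>?R (ext_deriv k \<zeta>)\<bar> \<le> ?b * B"
    if "m = Suc k" "\<zeta> \<in> smooth_forms k" "0 \<le> B" "form_le k (cball x (1 + e)) B \<zeta>" for k \<zeta> B
    using eval_moll_ext_deriv_lipschitz[OF that(2) e _ h that(3,4), of v] v unfolding that(1) by simp
  have "real_normal_mass m ?R \<le> ?a + ?b"
    by (rule normal_currentI(3)[OF F compact_cball ab]) (rule 1 2; assumption)+
  then show ?thesis by (simp add: lipschitz_const_def distrib_left)
qed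

lemma eval_moll_diff_in:
  assumes e: "0 < e" and h: "norm h \<le> 1"
  shows "(\<lambda>\<phi>. 1 * eval_current m e moll (x + h) v \<phi> + (-1) * eval_current m e moll x v \<phi>) \<in> normal_currents_in m (cball x (1 + e))"
proof (rule normal_comb(1)[OF _ _ compact_cball])
  have "cball (x + h) e \<subseteq> cball x (1 + e)"
  proof
    fix y assume "y \<in> cball (x + h) e"
    then show "y \<in> cball x (1 + e)"
      using dist_triangle[of x y "x + h"] h by (simp add: dist_norm)
  qed
  then show "eval_current m e moll (x + h) v \<in> normal_currents_in m (cball x (1 + e))"
    by (rule normal_currents_in_mono[OF eval_current_normal[OF test_function_moll e]])
  have "cball x e \<subseteq> cball x (1 + e)" by auto
  then show "eval_current m e moll x v \<in> normal_currents_in m (cball x (1 + e))"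
    by (rule normal_currents_in_mono[OF eval_current_normal[OF test_function_moll e]])
qed

lemma charge_form_lipschitz:
  fixes x :: "'a::euclidean_space"
  assumes \<omega>: "\<omega> \<in> normal_functionals m" and e: "0 < e" and v: "unit_vectors m v" and h: "norm h \<le> 1"
    and C: "0 \<le> C" "\<And>T. T \<in> normal_currents_in m (cball x (1 + e)) \<Longrightarrow> \<bar>\<omega> T\<bar> \<le> C * real_normal_mass m T"
  shows "\<bar>charge_form m e moll \<omega> (x + h) v - charge_form m e moll \<omega> x v\<bar> \<le> C * (norm h * lipschitz_const TYPE('a) m e)"
proof -
  have N: "eval_current m e moll y v \<in> normal_currents m" for y
    by (rule normal_currents_inD(1)[OF eval_current_normal[OF test_function_moll e]])
  have "charge_form m e moll \<omega> (x + h) v - charge_form m e moll \<omega> x v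
    = \<omega> (\<lambda>\<phi>. 1 * eval_current m e moll (x + h) v \<phi> + (-1) * eval_current m e moll x v \<phi>)"
    unfolding normal_functional_comb[OF \<omega> N N] by (simp add: charge_form_def)
  also have "\<bar>\<dots>\<bar> \<le> C * real_normal_mass m (\<lambda>\<phi>. 1 * eval_current m e moll (x + h) v \<phi> + (-1) * eval_current m e moll x v \<phi>)"
    by (rule C(2)[OF eval_moll_diff_in[OF e h]])
  also have "\<dots> \<le> C * (norm h * lipschitz_const TYPE('a) m e)"
    by (intro mult_left_mono eval_moll_diff_normal e v h C)
  finally show ?thesis .
qed

text \<open>Both sides are limits of the value of the charge on discretizations of the mollified current,
  which are finite combinations of mollified point evaluations.\<close>

lemma charge_form_apply:
  fixes T :: "'a::euclidean_space current"
  assumes \<omega>: "locally_bounded m \<omega>" and T: "T \<in> normal_currents_in m K" and K: "compact K" and e: "0 < e" "e \<le> 1"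
  shows "T (charge_form m e moll \<omega>) = \<omega> (moll_current m e T)"
proof -
  note \<omega>f = locally_bounded_functional[OF \<omega>]
  note nT = normal_currents_inD[OF T]
  note cT = normal_currents_currents[OF nT(1)]
  note F = currents_functional[OF cT]
  let ?\<Omega> = "charge_form m e moll \<omega>"
  have s\<Omega>: "?\<Omega> \<in> smooth_forms m" by (rule smooth_forms_charge_form[OF \<omega> test_function_moll e(1)])
  obtain a b where ab: "0 \<le> a" "0 \<le> b" "normal_mass m T = ereal (a + b)"
    "\<And>K r \<omega> B. compact K \<Longrightarrow> spt m T \<subseteq> K \<Longrightarrow> 0 < r \<Longrightarrow> \<omega> \<in> smooth_forms m \<Longrightarrow> 0 \<le> B \<Longrightarrow>
      form_le m (thick r K) B \<omega> \<Longrightarrow> \<bar>T \<omega>\<bar> \<le> a * B"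
    by (rule normal_currentD[OF nT(1)]) blast
  have bnd: "\<bar>T \<omega>\<bar> \<le> a * B" if "\<omega> \<in> smooth_forms m" "0 \<le> B" "form_le m (thick 1 K) B \<omega>" for \<omega> B
    by (rule ab(4)[OF K nT(2) zero_less_one that])
  \<comment> \<open>Room for the balls of radius 1 + e around points of \<open>thick 1 K\<close> and
    for the support of the mollified current.\<close>
  define M where "M = thick 3 K"
  have M: "compact M" unfolding M_def by (rule compact_thick[OF K])
  have ball_sub: "cball x (1 + e) \<subseteq> M" if "x \<in> thick 1 K" for x
  proof
    fix y assume "y \<in> cball x (1 + e)"
    then have "dist x y \<le> 2" using e by simp
    then have "y \<in> thick 2 (thick 1 K)" by (rule thickI[OF that])
    then show "y \<in> M" unfolding M_def using thick_thick[of 2 1 K] by auto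
  qed
  obtain C where C: "0 \<le> C" "\<And>T. T \<in> normal_currents_in m M \<Longrightarrow> \<bar>\<omega> T\<bar> \<le> C * real_normal_mass m T"
    using locally_boundedD[OF \<omega> M] by blast
  define l where "l = lipschitz_const TYPE('a) m e"
  define la where "la = moll_bound TYPE('a) / e * 2 ^ DIM('a)"
  define lb where "lb = real m * (moll_bound TYPE('a) / e / e * 2 ^ DIM('a))"
  have l: "0 \<le> la" "0 \<le> lb" "l = la + lb"
    using moll_bound(1)[where 'a='a] e by (simp_all add: la_def lb_def l_def lipschitz_const_def)
  define E where "E = a * (C * l) + C * (a * (la + lb))"
  have key: "\<bar>T ?\<Omega> - \<omega> (moll_current m e T)\<bar> \<le> \<delta> * E" if \<delta>: "0 < \<delta>" "\<delta> \<le> 1" for \<delta>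
  proof -
    obtain D \<theta> V where p: "partition_near (thick 1 K) \<delta> D \<theta> V"
      using partition_exists[OF compact_thick[OF K] \<delta>(1)] by blast
    note P = partition_nearD[OF p]
    have near: "\<exists>h. y = x + h \<and> norm h \<le> \<delta>" if "dist x y \<le> \<delta>" for x y :: 'a
      by (rule exI[of _ "y - x"]) (use that in \<open>simp add: dist_norm norm_minus_commute\<close>)
    have 1: "\<bar>T (discretize D \<theta> ?\<Omega>) - T ?\<Omega>\<bar> \<le> a * (C * (\<delta> * l))"
    proof (rule current_discretize_bound[OF p cT nT(2) bnd s\<Omega>])
      show "0 \<le> C * (\<delta> * l)" using C(1) \<delta> l by simp
      fix x y and v :: "nat \<Rightarrow> 'a" assume x: "x \<in> thick 1 K" and d: "dist x y \<le> \<delta>" and v: "unit_vectors m v"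
      obtain h where h: "y = x + h" "norm h \<le> \<delta>" using near[OF d] by blast
      have "\<bar>?\<Omega> (x + h) v - ?\<Omega> x v\<bar> \<le> C * (norm h * l)"
        unfolding l_def
        by (rule charge_form_lipschitz[OF \<omega>f e(1) v _ C(1) C(2)[OF normal_currents_in_mono[OF _ ball_sub[OF x]]]])
          (use h \<delta> in auto)
      also have "\<dots> \<le> C * (\<delta> * l)" using C(1) h(2) l by (intro mult_left_mono mult_right_mono) auto
      finally show "\<bar>?\<Omega> y v - ?\<Omega> x v\<bar> \<le> C * (\<delta> * l)" by (simp add: h(1))
    qed
    define c where "c q = T (\<lambda>y v. \<theta> (fst q) y * dual_tuple m (snd q) v)" for q
    define R where "R = (\<lambda>\<phi>. \<Sum>q\<in>D \<times> tuples m. c q * eval_current m e moll (fst q) (snd q) \<phi>)"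
    have fin: "finite (D \<times> (tuples m :: (nat \<Rightarrow> 'a) set))" using P(1) finite_tuples by blast
    have ev: "eval_current m e moll (fst q) (snd q) \<in> normal_currents_in m M" if "q \<in> D \<times> tuples m" for q
    proof (rule normal_currents_in_mono[OF eval_current_normal[OF test_function_moll e(1)]])
      have "fst q \<in> thick 1 K" using that P(2) by auto
      then show "cball (fst q) e \<subseteq> M" using ball_sub[of "fst q"] by (auto simp: subset_iff)
    qed
    have RM: "R \<in> normal_currents_in m M" and \<omega>R: "\<omega> R = (\<Sum>q\<in>D \<times> tuples m. c q * \<omega> (eval_current m e moll (fst q) (snd q)))"
      using normal_functional_sum[OF \<omega>f M ev fin, where c=c] unfolding R_def by auto
    have 2: "T (discretize D \<theta> ?\<Omega>) = \<omega> R"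
      unfolding \<omega>R current_discretize_expand[OF p F smooth_forms_covector[OF s\<Omega>]] c_def charge_form_def ..
    have R: "R \<zeta> = T (discretize D \<theta> (smear_form e moll \<zeta>))" if "\<zeta> \<in> smooth_forms m" for \<zeta>
      unfolding R_def current_discretize_expand[OF p F smooth_forms_covector[OF smooth_forms_moll[OF that]]] c_def
      by (simp add: eval_current_def that)
    have "thick (2 * e) K \<subseteq> M" unfolding M_def by (rule thick_mono) (use e in auto)
    then have mM: "moll_current m e T \<in> normal_currents_in m M"
      by (rule normal_currents_in_mono[OF moll_current_normal(1)[OF T K e(1)]])
    \<comment> \<open>On a test form, \<open>?G\<close> is the error of discretizing the mollified
      test form. The oscillation of that form is controlled by the comass of the test form, and for
      an exterior derivative by the comass of its primitive; so \<open>?G\<close> is small in normal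
      mass.\<close>
    let ?G = "\<lambda>\<phi>. 1 * R \<phi> + (-1) * moll_current m e T \<phi>"
    have GM: "?G \<in> normal_currents_in m M" by (rule normal_comb(1)[OF RM mM M])
    have G: "?G \<zeta> = T (discretize D \<theta> (smear_form e moll \<zeta>)) - T (smear_form e moll \<zeta>)" if "\<zeta> \<in> smooth_forms m" for \<zeta>
      using that by (simp add: R moll_current_def)
    have ev2: "smear_form e moll \<zeta> x v = eval_current m e moll x v \<zeta>" if "\<zeta> \<in> smooth_forms m" for \<zeta> x v
      by (simp add: eval_current_def that)
    have a1: "\<bar>?G \<zeta>\<bar> \<le> (a * (\<delta> * la)) * B" if z: "\<zeta> \<in> smooth_forms m" "0 \<le> B" "form_le m M B \<zeta>" for \<zeta> B
    proof -
      have "\<bar>T (discretize D \<theta> (smear_form e moll \<zeta>)) - T (smear_form e moll \<zeta>)\<bar> \<le> a * (\<delta> * la * B)"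
      proof (rule current_discretize_bound[OF p cT nT(2) bnd smooth_forms_moll[OF z(1)]])
        show "0 \<le> \<delta> * la * B" using \<delta> l z(2) by simp
        fix x y and v :: "nat \<Rightarrow> 'a" assume x: "x \<in> thick 1 K" and d: "dist x y \<le> \<delta>" and v: "unit_vectors m v"
        obtain h where h: "y = x + h" "norm h \<le> \<delta>" using near[OF d] by blast
        have "\<bar>eval_current m e moll (x + h) v \<zeta> - eval_current m e moll x v \<zeta>\<bar> \<le> norm h * la * B"
          unfolding la_def by (rule eval_moll_lipschitz[OF z(1) e(1) v _ z(2) form_le_mono[OF z(3) ball_sub[OF x] order_refl]])
            (use h \<delta> in auto)
        also have "\<dots> \<le> \<delta> * la * B" using h(2) l z(2) by (intro mult_right_mono) auto
        finally show "\<bar>smear_form e moll \<zeta> y v - smear_form e moll \<zeta> x v\<bar> \<le> \<delta> * la * B" by (simp add: h(1) ev2[OF z(1)])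
      qed
      then show ?thesis by (simp only: G[OF z(1)] mult.assoc)
    qed
    have b1: "\<bar>?G (ext_deriv k \<zeta>)\<bar> \<le> (a * (\<delta> * lb)) * B"
      if m: "m = Suc k" and z: "\<zeta> \<in> smooth_forms k" "0 \<le> B" "form_le k M B \<zeta>" for k \<zeta> B
    proof -
      have dz: "ext_deriv k \<zeta> \<in> smooth_forms m" unfolding m by (rule smooth_forms_ext_deriv[OF z(1)])
      have "\<bar>T (discretize D \<theta> (smear_form e moll (ext_deriv k \<zeta>))) - T (smear_form e moll (ext_deriv k \<zeta>))\<bar> \<le> a * (\<delta> * lb * B)"
      proof (rule current_discretize_bound[OF p cT nT(2) bnd smooth_forms_moll[OF dz]])
        show "0 \<le> \<delta> * lb * B" using \<delta> l z(2) by simp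
        fix x y and v :: "nat \<Rightarrow> 'a" assume x: "x \<in> thick 1 K" and d: "dist x y \<le> \<delta>" and v: "unit_vectors m v"
        obtain h where h: "y = x + h" "norm h \<le> \<delta>" using near[OF d] by blast
        have "\<bar>eval_current m e moll (x + h) v (ext_deriv k \<zeta>) - eval_current m e moll x v (ext_deriv k \<zeta>)\<bar> \<le> norm h * lb * B"
          unfolding lb_def m
          by (rule eval_moll_ext_deriv_lipschitz[OF z(1) e(1) v[unfolded m] _ z(2) form_le_mono[OF z(3) ball_sub[OF x] order_refl]])
            (use h \<delta> in auto)
        also have "\<dots> \<le> \<delta> * lb * B" using h(2) l z(2) by (intro mult_right_mono) auto
        finally show "\<bar>smear_form e moll (ext_deriv k \<zeta>) y v - smear_form e moll (ext_deriv k \<zeta>) x v\<bar> \<le> \<delta> * lb * B"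
          by (simp add: h(1) ev2[OF dz])
      qed
      then show ?thesis by (simp only: G[OF dz] mult.assoc)
    qed
    have nn: "0 \<le> a * (\<delta> * la)" "0 \<le> a * (\<delta> * lb)" using ab \<delta> l by simp_all
    note FG = normal_currents_functional[OF normal_currents_inD(1)[OF GM]]
    have "real_normal_mass m ?G \<le> a * (\<delta> * la) + a * (\<delta> * lb)"
      by (rule normal_currentI(3)[OF FG M nn]) (rule a1 b1; assumption)+
    then have 3: "\<bar>\<omega> ?G\<bar> \<le> C * (a * (\<delta> * la) + a * (\<delta> * lb))"
      using C(2)[OF GM] C(1) by (meson mult_left_mono order_trans)
    have "\<omega> ?G = \<omega> R - \<omega> (moll_current m e T)"
      using normal_functional_comb[OF \<omega>f normal_currents_inD(1)[OF RM] normal_currents_inD(1)[OF mM], of 1 "-1"] by simp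
    then have "\<bar>T ?\<Omega> - \<omega> (moll_current m e T)\<bar> \<le> a * (C * (\<delta> * l)) + C * (a * (\<delta> * la) + a * (\<delta> * lb))"
      using 1 2 3 by linarith
    also have "\<dots> = \<delta> * E" by (simp add: E_def algebra_simps)
    finally show ?thesis .
  qed
  \<comment> \<open>The comparison holds for every mesh size up to 1 and its error is linear in the
    mesh size.\<close>
  have "\<bar>T ?\<Omega> - \<omega> (moll_current m e T)\<bar> \<le> 0"
  proof (rule tendsto_lowerbound[of "\<lambda>\<delta>. \<delta> * E" 0 "at_right 0"])
    have "((\<lambda>\<delta>. \<delta> * E) \<longlongrightarrow> 0 * E) (at_right 0)" by (intro tendsto_intros)
    then show "((\<lambda>\<delta>. \<delta> * E) \<longlongrightarrow> 0) (at_right 0)" by simp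
    have "\<forall>\<^sub>F \<delta> in at_right 0. (\<delta>::real) \<in> {0<..<1}" by (rule eventually_at_right_real) simp
    then show "\<forall>\<^sub>F \<delta> in at_right 0. \<bar>T ?\<Omega> - \<omega> (moll_current m e T)\<bar> \<le> \<delta> * E"
      by (rule eventually_mono) (rule key, auto)
  qed simp
  then show ?thesis by simp
qed

section \<open>Quantitative approximation of fractional charges and construction of the
  product\<close>

section \<open>Mollification of fractional charges\<close>

lemma interpolation_le:
  fixes N F :: real
  assumes "0 \<le> F" "F \<le> N" "0 \<le> \<alpha>" "\<alpha> \<le> 1"
  shows "N powr (1 - \<alpha>) * F powr \<alpha> \<le> N"
proof -
  have "N powr (1 - \<alpha>) * F powr \<alpha> \<le> N powr (1 - \<alpha>) * N powr \<alpha>"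
    using assms by (intro mult_left_mono powr_mono2) auto
  also have "\<dots> = N" using assms by (cases "N = 0") (auto simp: powr_add[symmetric])
  finally show ?thesis .
qed

lemma fractional_boundD:
  assumes "fractional_bound m \<alpha> K \<omega> C"
  shows "0 \<le> C" "T \<in> normal_currents_in m K \<Longrightarrow>
    \<bar>\<omega> T\<bar> \<le> C * real_normal_mass m T powr (1 - \<alpha>) * real_flat_norm m T powr \<alpha>"
  using assms by (auto simp: fractional_bound_def)

lemma fractional_bound_powr_le:
  assumes f: "fractional_bound m \<alpha> K \<omega> C" and T: "T \<in> normal_currents_in m K" and \<alpha>: "0 \<le> \<alpha>" "\<alpha> \<le> 1"
    and N: "real_normal_mass m T \<le> N" and F: "real_flat_norm m T \<le> F"
  shows "\<bar>\<omega> T\<bar> \<le> C * N powr (1 - \<alpha>) * F powr \<alpha>"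
proof -
  note nT = normal_currents_inD(1)[OF T]
  have "\<bar>\<omega> T\<bar> \<le> C * real_normal_mass m T powr (1 - \<alpha>) * real_flat_norm m T powr \<alpha>"
    by (rule fractional_boundD(2)[OF f T])
  also have "\<dots> \<le> C * N powr (1 - \<alpha>) * F powr \<alpha>"
    using fractional_boundD(1)[OF f] real_normal_mass(2)[OF nT] real_flat_norm(2)[OF nT] \<alpha> N F
    by (intro mult_mono powr_mono2) auto
  finally show ?thesis .
qed

lemma fractional_bound_mass:
  assumes f: "fractional_bound m \<alpha> K \<omega> C" and T: "T \<in> normal_currents_in m K" and \<alpha>: "0 \<le> \<alpha>" "\<alpha> \<le> 1"
  shows "\<bar>\<omega> T\<bar> \<le> C * real_normal_mass m T"
proof -
  note nT = normal_currents_inD(1)[OF T]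
  have "\<bar>\<omega> T\<bar> \<le> C * (real_normal_mass m T powr (1 - \<alpha>) * real_flat_norm m T powr \<alpha>)"
    using fractional_boundD(2)[OF f T] by (simp add: mult.assoc)
  also have "\<dots> \<le> C * real_normal_mass m T"
    by (intro mult_left_mono interpolation_le real_flat_norm[OF nT] \<alpha> fractional_boundD(1)[OF f])
  finally show ?thesis .
qed

lemma fractional_locally_bounded:
  assumes \<omega>: "\<omega> \<in> fractional_charges m \<alpha>" and \<alpha>: "0 \<le> \<alpha>" "\<alpha> \<le> 1"
  shows "locally_bounded m \<omega>"
  unfolding locally_bounded_def
proof (intro conjI allI impI)
  show "\<omega> \<in> normal_functionals m" using \<omega> by (simp add: fractional_charges_def)
  fix K :: "'a set" assume "compact K"
  then obtain C where "fractional_bound m \<alpha> K \<omega> C" using \<omega> by (auto simp: fractional_charges_def)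
  then show "\<exists>C\<ge>0. \<forall>T\<in>normal_currents_in m K. \<bar>\<omega> T\<bar> \<le> C * real_normal_mass m T"
    using fractional_bound_mass[OF _ _ \<alpha>] fractional_boundD(1) by blast
qed

text \<open>By duality the error is the charge evaluated on the difference of the mollified current
  and \<open>T\<close>, which has normal mass at most 2 N(T) and flat norm at most e N(T). The bound
  on \<open>e\<close> keeps the mollified support inside \<open>thick 1 K\<close>.\<close>

lemma charge_form_close:
  fixes T :: "'a::euclidean_space current"
  assumes \<omega>: "\<omega> \<in> fractional_charges m \<alpha>" and \<alpha>: "0 \<le> \<alpha>" "\<alpha> \<le> 1" and K: "compact K"
    and A: "fractional_bound m \<alpha> (thick 1 K) \<omega> A" and T: "T \<in> normal_currents_in m K" and e: "0 < e" "e \<le> 1/2"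
  shows "\<bar>T (charge_form m e moll \<omega>) - \<omega> T\<bar> \<le> 2 * A * e powr \<alpha> * real_normal_mass m T"
proof -
  note lb = fractional_locally_bounded[OF \<omega> \<alpha>]
  let ?G = "\<lambda>\<phi>. 1 * moll_current m e T \<phi> + (-1) * T \<phi>"
  define N where "N = real_normal_mass m T"
  have N: "0 \<le> N" unfolding N_def by (rule real_normal_mass(2)[OF normal_currents_inD(1)[OF T]])
  have A0: "0 \<le> A" by (rule fractional_boundD(1)[OF A])
  have T1: "T \<in> normal_currents_in m (thick 1 K)"
    by (rule normal_currents_in_mono[OF T subset_thick]) simp
  have "thick (2 * e) K \<subseteq> thick 1 K" by (rule thick_mono) (use e in auto)
  then have M1: "moll_current m e T \<in> normal_currents_in m (thick 1 K)"
    by (rule normal_currents_in_mono[OF moll_current_normal(1)[OF T K e(1)]])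
  note comb = normal_comb[OF M1 T1 compact_thick[OF K], of 1 "-1"]
  have "T (charge_form m e moll \<omega>) - \<omega> T = \<omega> (moll_current m e T) - \<omega> T"
    using charge_form_apply[OF lb T K e(1)] e(2) by simp
  also have "\<dots> = \<omega> ?G"
    using normal_functional_comb[OF locally_bounded_functional[OF lb] normal_currents_inD(1)[OF M1] normal_currents_inD(1)[OF T], of 1 "-1"] by simp
  also have "\<bar>\<dots>\<bar> \<le> A * (2 * N) powr (1 - \<alpha>) * (e * N) powr \<alpha>"
  proof (rule fractional_bound_powr_le[OF A comb(1) \<alpha>])
    show "real_normal_mass m ?G \<le> 2 * N"
      using comb(2) moll_current_normal(2)[OF T K e(1)] by (simp add: N_def)
    show "real_flat_norm m ?G \<le> e * N" unfolding N_def by (rule moll_current_flat[OF T K e(1)])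
  qed
  also have "\<dots> = A * (2 powr (1 - \<alpha>) * e powr \<alpha> * (N powr (1 - \<alpha>) * N powr \<alpha>))"
    using N e by (simp add: powr_mult)
  also have "N powr (1 - \<alpha>) * N powr \<alpha> = N" using N by (cases "N = 0") (auto simp: powr_add[symmetric])
  also have "A * (2 powr (1 - \<alpha>) * e powr \<alpha> * N) \<le> A * (2 powr 1 * e powr \<alpha> * N)"
    using A0 N \<alpha> by (intro mult_left_mono mult_right_mono powr_mono) auto
  finally show ?thesis by (simp add: N_def mult.assoc mult.left_commute)
qed

text \<open>The values of the form and of its exterior derivative on unit vectors are values of the
  charge on evaluations and on boundaries of evaluations; both have normal mass O(1/e) and flat norm
  at most 1.\<close>

lemma charge_form_flat_le:
  fixes \<omega> :: "'a::euclidean_space charge"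
  assumes \<omega>: "\<omega> \<in> fractional_charges m \<alpha>" and \<alpha>: "0 \<le> \<alpha>" "\<alpha> \<le> 1"
    and A: "fractional_bound m \<alpha> (thick 1 K) \<omega> A" and e: "0 < e" "e \<le> 1/2"
  shows "flat_form_le m K (eval_const TYPE('a) m * A * e powr (\<alpha> - 1)) (charge_form m e moll \<omega>)"
proof -
  note lb = fractional_locally_bounded[OF \<omega> \<alpha>]
  let ?C = "eval_const TYPE('a) m"
  have A0: "0 \<le> A" by (rule fractional_boundD(1)[OF A])
  have C: "1 \<le> ?C" by (rule eval_const_ge_1)
  have e1: "e \<le> 1" using e by simp
  have sub: "cball x e \<subseteq> thick 1 K" if "x \<in> K" for x
    using that e1 by (auto intro: thickI)
  have est: "\<bar>\<omega> T\<bar> \<le> ?C * A * e powr (\<alpha> - 1)"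
    if T: "T \<in> normal_currents_in m (thick 1 K)" "real_normal_mass m T \<le> ?C / e" "real_flat_norm m T \<le> 1" for T
  proof -
    have "\<bar>\<omega> T\<bar> \<le> A * (?C / e) powr (1 - \<alpha>) * 1 powr \<alpha>"
      by (rule fractional_bound_powr_le[OF A T(1) \<alpha> T(2,3)])
    also have "\<dots> = A * (?C powr (1 - \<alpha>) * e powr (\<alpha> - 1))"
    proof -
      have "(?C / e) powr (1 - \<alpha>) = ?C powr (1 - \<alpha>) / e powr (1 - \<alpha>)"
        using C e by (simp add: powr_divide)
      also have "\<dots> = ?C powr (1 - \<alpha>) * e powr (\<alpha> - 1)"
        using powr_minus_divide[of e "1 - \<alpha>"] by simp
      finally show ?thesis by simp
    qed
    also have "\<dots> \<le> A * (?C powr 1 * e powr (\<alpha> - 1))"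
      using A0 C \<alpha> by (intro mult_left_mono mult_right_mono powr_mono) auto
    finally show ?thesis using C by (simp add: mult.assoc mult.left_commute)
  qed
  show ?thesis
    unfolding flat_form_le_def
  proof (intro conjI form_leI)
    fix x and v :: "nat \<Rightarrow> 'a" assume x: "x \<in> K" and v: "unit_vectors m v"
    show "\<bar>charge_form m e moll \<omega> x v\<bar> \<le> ?C * A * e powr (\<alpha> - 1)"
      unfolding charge_form_def
      by (rule est[OF normal_currents_in_mono[OF eval_current_normal[OF test_function_moll e(1)] sub[OF x]]
            eval_moll_normal[OF e(1) e1 v]])
  next
    fix x and v :: "nat \<Rightarrow> 'a" assume x: "x \<in> K" and v: "unit_vectors (Suc m) v"
    show "\<bar>ext_deriv m (charge_form m e moll \<omega>) x v\<bar> \<le> ?C * A * e powr (\<alpha> - 1)"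
      unfolding ext_deriv_charge_form[OF lb e(1)]
      by (rule est[OF normal_currents_in_mono[OF eval_moll_boundary_normal(1)[OF e(1) v] sub[OF x]]
            eval_moll_boundary_normal(2,3)[OF e(1) v]])
  qed
qed

section \<open>Slicing a normal current by a smooth form\<close>

text \<open>One constant for slicing on either side: the terms come from the mass of the slice and
  from the two parts of the Leibniz rule for its boundary. Truncated subtraction in degree 0 only
  enlarges it.\<close>

definition slice_const :: "nat \<Rightarrow> nat \<Rightarrow> real" where
  "slice_const m n = wedge_const m n + wedge_const (m - 1) n + wedge_const (m - 1) (Suc n) + wedge_const m (n - 1) + wedge_const (Suc m) (n - 1)"

lemma slice_const_nonneg: "0 \<le> slice_const m n"
  unfolding slice_const_def
  using wedge_const_pos[of m n] wedge_const_pos[of "m - 1" n] wedge_const_pos[of "m - 1" "Suc n"]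
    wedge_const_pos[of m "n - 1"] wedge_const_pos[of "Suc m" "n - 1"] by linarith

lemma wedge_current_bound:
  fixes T :: "'a::euclidean_space current"
  assumes bnd: "\<And>\<omega> B. \<omega> \<in> smooth_forms p \<Longrightarrow> 0 \<le> B \<Longrightarrow> form_le p S B \<omega> \<Longrightarrow> \<bar>T \<omega>\<bar> \<le> a * B"
    and p: "p = m + n" and \<zeta>: "\<zeta> \<in> smooth_forms m" "form_le m S B \<zeta>" and \<eta>: "\<eta> \<in> smooth_forms n" "form_le n S D \<eta>"
    and BD: "0 \<le> B" "0 \<le> D"
  shows "\<bar>T (wedge_form m n \<zeta> \<eta>)\<bar> \<le> a * wedge_const m n * D * B"
proof -
  have "\<bar>T (wedge_form m n \<zeta> \<eta>)\<bar> \<le> a * (wedge_const m n * B * D)"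
    unfolding p using bnd[unfolded p, OF smooth_forms_wedge[OF \<zeta>(1) \<eta>(1)] _ wedge_form_le[OF \<zeta>(2) \<eta>(2) BD(1)]]
      wedge_const_pos[of m n] BD by simp
  then show ?thesis by (simp add: ac_simps)
qed

text \<open>By the Leibniz rule, \<open>\<zeta> \<mapsto> T (\<zeta> \<and> \<eta>)\<close> is a normal current, to which a bound for \<open>\<xi>\<close> in terms of
  normal mass applies.\<close>

lemma slice_left:
  fixes T :: "'a::euclidean_space current"
  assumes T: "T \<in> normal_currents_in (m + n) K" and K: "compact K"
    and \<xi>: "\<xi> \<in> smooth_forms m" and \<eta>: "\<eta> \<in> smooth_forms n" "flat_form_le n (thick 1 K) D \<eta>" and D: "0 \<le> D"
    and c: "0 \<le> c" "\<And>S. S \<in> normal_currents_in m (thick 1 K) \<Longrightarrow> \<bar>S \<xi>\<bar> \<le> c * real_normal_mass m S"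
  shows "\<bar>T (wedge_form m n \<xi> \<eta>)\<bar> \<le> slice_const m n * c * D * real_normal_mass (m + n) T"
proof -
  note nT = normal_currents_inD[OF T]
  note F = normal_currents_functional[OF nT(1)]
  obtain a b where ab: "0 \<le> a" "0 \<le> b" "normal_mass (m + n) T = ereal (a + b)"
    "\<And>K r \<omega> B. compact K \<Longrightarrow> spt (m + n) T \<subseteq> K \<Longrightarrow> 0 < r \<Longrightarrow> \<omega> \<in> smooth_forms (m + n) \<Longrightarrow> 0 \<le> B \<Longrightarrow>
      form_le (m + n) (thick r K) B \<omega> \<Longrightarrow> \<bar>T \<omega>\<bar> \<le> a * B"
    "\<And>k K r \<omega> B. m + n = Suc k \<Longrightarrow> compact K \<Longrightarrow> spt (m + n) T \<subseteq> K \<Longrightarrow> 0 < r \<Longrightarrow> \<omega> \<in> smooth_forms k \<Longrightarrow> 0 \<le> B \<Longrightarrow>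
      form_le k (thick r K) B \<omega> \<Longrightarrow> \<bar>T (ext_deriv k \<omega>)\<bar> \<le> b * B"
    by (rule normal_currentD[OF nT(1)]) blast
  note bnd = ab(4)[OF K nT(2) zero_less_one]
  define S where "S \<zeta> = (if \<zeta> \<in> smooth_forms m then T (wedge_form m n \<zeta> \<eta>) else 0)" for \<zeta>
  have D1: "form_le n (thick 1 K) D \<eta>" "form_le (Suc n) (thick 1 K) D (ext_deriv n \<eta>)"
    using \<eta>(2) by (auto simp: flat_form_le_def)
  have FS: "form_functional m S"
    unfolding form_functional_def
  proof (intro conjI allI ballI impI)
    fix \<omega> \<omega>' :: "'a form" assume s: "\<omega> \<in> smooth_forms m" "\<omega>' \<in> smooth_forms m"
    have "wedge_form m n (\<lambda>x v. \<omega> x v + \<omega>' x v) \<eta> = (\<lambda>x v. wedge_form m n \<omega> \<eta> x v + wedge_form m n \<omega>' \<eta> x v)"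
      by (intro ext) (rule wedge_form_linear_left(1))
    then show "S (\<lambda>x v. \<omega> x v + \<omega>' x v) = S \<omega> + S \<omega>'"
      using s form_functionalD(2)[OF F smooth_forms_wedge[OF s(1) \<eta>(1)] smooth_forms_wedge[OF s(2) \<eta>(1)]]
      by (simp add: S_def smooth_forms_add)
  next
    fix r and \<omega> :: "'a form" assume s: "\<omega> \<in> smooth_forms m"
    have "wedge_form m n (\<lambda>x v. r * \<omega> x v) \<eta> = (\<lambda>x v. r * wedge_form m n \<omega> \<eta> x v)"
      by (intro ext) (rule wedge_form_linear_left(2))
    then show "S (\<lambda>x v. r * \<omega> x v) = r * S \<omega>"
      using s form_functionalD(3)[OF F smooth_forms_wedge[OF s \<eta>(1)]] by (simp add: S_def smooth_forms_cmult)
  qed (simp add: S_def)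
  let ?a = "a * wedge_const m n * D"
  let ?b = "(b * wedge_const (m - 1) n + a * wedge_const (m - 1) (Suc n)) * D"
  have nn: "0 \<le> ?a" "0 \<le> ?b" using ab D less_imp_le[OF wedge_const_pos] by simp_all
  have 1: "\<bar>S \<zeta>\<bar> \<le> ?a * B" if z: "\<zeta> \<in> smooth_forms m" "0 \<le> B" "form_le m (thick 1 K) B \<zeta>" for \<zeta> B
    using wedge_current_bound[OF bnd refl z(1,3) \<eta>(1) D1(1) z(2) D] z(1) by (simp add: S_def)
  have 2: "\<bar>S (ext_deriv k \<zeta>)\<bar> \<le> ?b * B"
    if m: "m = Suc k" and z: "\<zeta> \<in> smooth_forms k" "0 \<le> B" "form_le k (thick 1 K) B \<zeta>" for k \<zeta> B
  proof -
    have mn: "m + n = Suc (k + n)" "m + n = k + Suc n" using m by simp_all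
    note w1 = smooth_forms_wedge[OF smooth_forms_ext_deriv[OF z(1)] \<eta>(1)]
    note w2 = smooth_forms_wedge[OF z(1) smooth_forms_ext_deriv[OF \<eta>(1)]]
    note w3 = smooth_forms_wedge[OF z(1) \<eta>(1)]
    have w2': "wedge_form k (Suc n) \<zeta> (ext_deriv n \<eta>) \<in> smooth_forms (m + n)" using w2 mn by simp
    have w4: "ext_deriv (k + n) (wedge_form k n \<zeta> \<eta>) \<in> smooth_forms (m + n)"
      unfolding mn by (rule smooth_forms_ext_deriv[OF w3])
    \<comment> \<open>The Leibniz rule solved for the term in which the test form is differentiated:
      one part is seen by the boundary of \<open>T\<close>, the other by \<open>T\<close>
      itself.\<close>
    have eq: "wedge_form m n (ext_deriv k \<zeta>) \<eta> = (\<lambda>x v. ext_deriv (k + n) (wedge_form k n \<zeta> \<eta>) x v + (- ((-1) ^ k)) * wedge_form k (Suc n) \<zeta> (ext_deriv n \<eta>) x v)"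
      by (intro ext) (simp add: ext_deriv_wedge[OF z(1) \<eta>(1)] m)
    have "S (ext_deriv k \<zeta>) = T (wedge_form m n (ext_deriv k \<zeta>) \<eta>)"
      using smooth_forms_ext_deriv[OF z(1)] by (simp add: S_def m)
    also have "\<dots> = T (ext_deriv (k + n) (wedge_form k n \<zeta> \<eta>)) + (- ((-1) ^ k)) * T (wedge_form k (Suc n) \<zeta> (ext_deriv n \<eta>))"
      unfolding eq form_functionalD(2)[OF F w4 smooth_forms_cmult[OF w2']] form_functionalD(3)[OF F w2'] ..
    finally have "\<bar>S (ext_deriv k \<zeta>)\<bar> \<le> \<bar>T (ext_deriv (k + n) (wedge_form k n \<zeta> \<eta>))\<bar> + \<bar>T (wedge_form k (Suc n) \<zeta> (ext_deriv n \<eta>))\<bar>"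
      by (simp add: order_trans[OF abs_triangle_ineq] order_trans[OF abs_triangle_ineq4] abs_sign_mult abs_mult power_abs)
    moreover have "\<bar>T (ext_deriv (k + n) (wedge_form k n \<zeta> \<eta>))\<bar> \<le> b * (wedge_const k n * B * D)"
      by (rule ab(5)[OF mn(1) K nT(2) zero_less_one w3 _ wedge_form_le[OF z(3) D1(1) z(2)]])
        (use wedge_const_pos[of k n] z(2) D in simp)
    moreover have "\<bar>T (wedge_form k (Suc n) \<zeta> (ext_deriv n \<eta>))\<bar> \<le> a * wedge_const k (Suc n) * D * B"
      by (rule wedge_current_bound[OF bnd mn(2) z(1,3) smooth_forms_ext_deriv[OF \<eta>(1)] D1(2) z(2) D])
    ultimately show ?thesis unfolding m by (simp add: algebra_simps)
  qed
  have SK: "S \<in> normal_currents_in m (thick 1 K)"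
    by (rule normal_currentI(1)[OF FS compact_thick[OF K] nn]) (rule 1 2; assumption)+
  have "real_normal_mass m S \<le> ?a + ?b"
    by (rule normal_currentI(3)[OF FS compact_thick[OF K] nn]) (rule 1 2; assumption)+
  also have "\<dots> \<le> slice_const m n * D * (a + b)"
  proof -
    have "a * wedge_const m n + (b * wedge_const (m - 1) n + a * wedge_const (m - 1) (Suc n)) \<le> slice_const m n * (a + b)"
    proof -
      have "slice_const m n * (a + b) = a * wedge_const m n + (b * wedge_const (m - 1) n + a * wedge_const (m - 1) (Suc n))
        + (b * wedge_const m n + a * wedge_const (m - 1) n + b * wedge_const (m - 1) (Suc n) + (a + b) * wedge_const m (n - 1) + (a + b) * wedge_const (Suc m) (n - 1))"
        unfolding slice_const_def by (simp add: algebra_simps)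
      moreover have "0 \<le> b * wedge_const m n + a * wedge_const (m - 1) n + b * wedge_const (m - 1) (Suc n) + (a + b) * wedge_const m (n - 1) + (a + b) * wedge_const (Suc m) (n - 1)"
        using ab less_imp_le[OF wedge_const_pos] by (intro add_nonneg_nonneg mult_nonneg_nonneg) auto
      ultimately show ?thesis by linarith
    qed
    from mult_left_mono[OF this D] show ?thesis by (simp add: algebra_simps)
  qed
  finally have "c * real_normal_mass m S \<le> c * (slice_const m n * D * (a + b))" using c(1) by (rule mult_left_mono)
  then have "\<bar>S \<xi>\<bar> \<le> c * (slice_const m n * D * (a + b))" using c(2)[OF SK] by linarith
  then show ?thesis using \<xi> by (simp add: S_def ab(3) ac_simps)
qed

text \<open>The mirror image of \<open>slice_left\<close>, with \<open>\<xi>\<close> as the right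
  factor. The Leibniz rule is now solved for the term that carries the sign (-1)^m.\<close>

lemma slice_right:
  fixes T :: "'a::euclidean_space current"
  assumes T: "T \<in> normal_currents_in (m + n) K" and K: "compact K"
    and \<omega>: "\<omega> \<in> smooth_forms m" "flat_form_le m (thick 1 K) D \<omega>" and \<xi>: "\<xi> \<in> smooth_forms n" and D: "0 \<le> D"
    and c: "0 \<le> c" "\<And>S. S \<in> normal_currents_in n (thick 1 K) \<Longrightarrow> \<bar>S \<xi>\<bar> \<le> c * real_normal_mass n S"
  shows "\<bar>T (wedge_form m n \<omega> \<xi>)\<bar> \<le> slice_const m n * c * D * real_normal_mass (m + n) T"
proof -
  note nT = normal_currents_inD[OF T]
  note F = normal_currents_functional[OF nT(1)]
  obtain a b where ab: "0 \<le> a" "0 \<le> b" "normal_mass (m + n) T = ereal (a + b)"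
    "\<And>K r \<omega> B. compact K \<Longrightarrow> spt (m + n) T \<subseteq> K \<Longrightarrow> 0 < r \<Longrightarrow> \<omega> \<in> smooth_forms (m + n) \<Longrightarrow> 0 \<le> B \<Longrightarrow>
      form_le (m + n) (thick r K) B \<omega> \<Longrightarrow> \<bar>T \<omega>\<bar> \<le> a * B"
    "\<And>k K r \<omega> B. m + n = Suc k \<Longrightarrow> compact K \<Longrightarrow> spt (m + n) T \<subseteq> K \<Longrightarrow> 0 < r \<Longrightarrow> \<omega> \<in> smooth_forms k \<Longrightarrow> 0 \<le> B \<Longrightarrow>
      form_le k (thick r K) B \<omega> \<Longrightarrow> \<bar>T (ext_deriv k \<omega>)\<bar> \<le> b * B"
    by (rule normal_currentD[OF nT(1)]) blast
  note bnd = ab(4)[OF K nT(2) zero_less_one]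
  define S where "S \<zeta> = (if \<zeta> \<in> smooth_forms n then T (wedge_form m n \<omega> \<zeta>) else 0)" for \<zeta>
  have D1: "form_le m (thick 1 K) D \<omega>" "form_le (Suc m) (thick 1 K) D (ext_deriv m \<omega>)"
    using \<omega>(2) by (auto simp: flat_form_le_def)
  have FS: "form_functional n S"
    unfolding form_functional_def
  proof (intro conjI allI ballI impI)
    fix \<zeta> \<zeta>' :: "'a form" assume s: "\<zeta> \<in> smooth_forms n" "\<zeta>' \<in> smooth_forms n"
    have "wedge_form m n \<omega> (\<lambda>x v. \<zeta> x v + \<zeta>' x v) = (\<lambda>x v. wedge_form m n \<omega> \<zeta> x v + wedge_form m n \<omega> \<zeta>' x v)"
      by (intro ext) (rule wedge_form_linear_right(1))
    then show "S (\<lambda>x v. \<zeta> x v + \<zeta>' x v) = S \<zeta> + S \<zeta>'"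
      using s form_functionalD(2)[OF F smooth_forms_wedge[OF \<omega>(1) s(1)] smooth_forms_wedge[OF \<omega>(1) s(2)]]
      by (simp add: S_def smooth_forms_add)
  next
    fix r and \<zeta> :: "'a form" assume s: "\<zeta> \<in> smooth_forms n"
    have "wedge_form m n \<omega> (\<lambda>x v. r * \<zeta> x v) = (\<lambda>x v. r * wedge_form m n \<omega> \<zeta> x v)"
      by (intro ext) (rule wedge_form_linear_right(2))
    then show "S (\<lambda>x v. r * \<zeta> x v) = r * S \<zeta>"
      using s form_functionalD(3)[OF F smooth_forms_wedge[OF \<omega>(1) s]] by (simp add: S_def smooth_forms_cmult)
  qed (simp add: S_def)
  let ?a = "a * wedge_const m n * D"
  let ?b = "(b * wedge_const m (n - 1) + a * wedge_const (Suc m) (n - 1)) * D"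
  have nn: "0 \<le> ?a" "0 \<le> ?b" using ab D less_imp_le[OF wedge_const_pos] by simp_all
  have 1: "\<bar>S \<zeta>\<bar> \<le> ?a * B" if z: "\<zeta> \<in> smooth_forms n" "0 \<le> B" "form_le n (thick 1 K) B \<zeta>" for \<zeta> B
    using wedge_current_bound[OF bnd refl \<omega>(1) D1(1) z(1,3) D z(2)] z(1) by (simp add: S_def ac_simps)
  have 2: "\<bar>S (ext_deriv k \<zeta>)\<bar> \<le> ?b * B"
    if n: "n = Suc k" and z: "\<zeta> \<in> smooth_forms k" "0 \<le> B" "form_le k (thick 1 K) B \<zeta>" for k \<zeta> B
  proof -
    have mn: "m + n = Suc (m + k)" "m + n = Suc m + k" using n by simp_all
    note w2 = smooth_forms_wedge[OF smooth_forms_ext_deriv[OF \<omega>(1)] z(1)]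
    note w3 = smooth_forms_wedge[OF \<omega>(1) z(1)]
    have w2': "wedge_form (Suc m) k (ext_deriv m \<omega>) \<zeta> \<in> smooth_forms (m + n)" using w2 mn by simp
    have w4: "ext_deriv (m + k) (wedge_form m k \<omega> \<zeta>) \<in> smooth_forms (m + n)"
      unfolding mn by (rule smooth_forms_ext_deriv[OF w3])
    have sq: "(-1) ^ m * ((-1) ^ m * t) = (t::real)" for t by (simp add: mult.assoc[symmetric] power_add[symmetric])
    have eq: "wedge_form m n \<omega> (ext_deriv k \<zeta>) = (\<lambda>x v. (-1) ^ m * ext_deriv (m + k) (wedge_form m k \<omega> \<zeta>) x v + (- ((-1) ^ m)) * wedge_form (Suc m) k (ext_deriv m \<omega>) \<zeta> x v)"
      by (intro ext) (simp add: ext_deriv_wedge[OF \<omega>(1) z(1)] n distrib_left sq)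
    have "S (ext_deriv k \<zeta>) = T (wedge_form m n \<omega> (ext_deriv k \<zeta>))"
      using smooth_forms_ext_deriv[OF z(1)] by (simp add: S_def n)
    also have "\<dots> = (-1) ^ m * T (ext_deriv (m + k) (wedge_form m k \<omega> \<zeta>)) + (- ((-1) ^ m)) * T (wedge_form (Suc m) k (ext_deriv m \<omega>) \<zeta>)"
      unfolding eq form_functionalD(2)[OF F smooth_forms_cmult[OF w4] smooth_forms_cmult[OF w2']]
        form_functionalD(3)[OF F w2'] form_functionalD(3)[OF F w4] ..
    also have "\<bar>\<dots>\<bar> \<le> \<bar>(-1) ^ m * T (ext_deriv (m + k) (wedge_form m k \<omega> \<zeta>))\<bar> + \<bar>(- ((-1) ^ m)) * T (wedge_form (Suc m) k (ext_deriv m \<omega>) \<zeta>)\<bar>"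
      by (rule abs_triangle_ineq)
    also have "\<dots> = \<bar>T (ext_deriv (m + k) (wedge_form m k \<omega> \<zeta>))\<bar> + \<bar>T (wedge_form (Suc m) k (ext_deriv m \<omega>) \<zeta>)\<bar>"
      by (simp add: abs_mult power_abs)
    finally have "\<bar>S (ext_deriv k \<zeta>)\<bar> \<le> \<bar>T (ext_deriv (m + k) (wedge_form m k \<omega> \<zeta>))\<bar> + \<bar>T (wedge_form (Suc m) k (ext_deriv m \<omega>) \<zeta>)\<bar>" .
    moreover have "\<bar>T (ext_deriv (m + k) (wedge_form m k \<omega> \<zeta>))\<bar> \<le> b * (wedge_const m k * D * B)"
      by (rule ab(5)[OF mn(1) K nT(2) zero_less_one w3 _ wedge_form_le[OF D1(1) z(3) D]])
        (use wedge_const_pos[of m k] z(2) D in simp)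
    moreover have "\<bar>T (wedge_form (Suc m) k (ext_deriv m \<omega>) \<zeta>)\<bar> \<le> a * wedge_const (Suc m) k * B * D"
      by (rule wedge_current_bound[OF bnd mn(2) smooth_forms_ext_deriv[OF \<omega>(1)] D1(2) z(1,3) D z(2)])
    ultimately show ?thesis unfolding n by (simp add: algebra_simps)
  qed
  have SK: "S \<in> normal_currents_in n (thick 1 K)"
    by (rule normal_currentI(1)[OF FS compact_thick[OF K] nn]) (rule 1 2; assumption)+
  have "real_normal_mass n S \<le> ?a + ?b"
    by (rule normal_currentI(3)[OF FS compact_thick[OF K] nn]) (rule 1 2; assumption)+
  also have "\<dots> \<le> slice_const m n * D * (a + b)"
  proof -
    have "a * wedge_const m n + (b * wedge_const m (n - 1) + a * wedge_const (Suc m) (n - 1)) \<le> slice_const m n * (a + b)"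
    proof -
      have "slice_const m n * (a + b) = a * wedge_const m n + (b * wedge_const m (n - 1) + a * wedge_const (Suc m) (n - 1))
        + (b * wedge_const m n + a * wedge_const m (n - 1) + b * wedge_const (Suc m) (n - 1) + (a + b) * wedge_const (m - 1) n + (a + b) * wedge_const (m - 1) (Suc n))"
        unfolding slice_const_def by (simp add: algebra_simps)
      moreover have "0 \<le> b * wedge_const m n + a * wedge_const m (n - 1) + b * wedge_const (Suc m) (n - 1) + (a + b) * wedge_const (m - 1) n + (a + b) * wedge_const (m - 1) (Suc n)"
        using ab less_imp_le[OF wedge_const_pos] by (intro add_nonneg_nonneg mult_nonneg_nonneg) auto
      ultimately show ?thesis by linarith
    qed
    from mult_left_mono[OF this D] show ?thesis by (simp add: algebra_simps)
  qed
  finally have "c * real_normal_mass n S \<le> c * (slice_const m n * D * (a + b))" using c(1) by (rule mult_left_mono)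
  then have "\<bar>S \<xi>\<bar> \<le> c * (slice_const m n * D * (a + b))" using c(2)[OF SK] by linarith
  then show ?thesis using \<xi> by (simp add: S_def ab(3) ac_simps)
qed

text \<open>Telescoping of a difference of products; each of the two terms has the shape treated by
  one of the slicing lemmas.\<close>

lemma wedge_form_diff:
  assumes s: "\<omega> \<in> smooth_forms m" "\<omega>' \<in> smooth_forms m" "\<eta> \<in> smooth_forms n" "\<eta>' \<in> smooth_forms n"
    and F: "form_functional (m + n) T"
  shows "T (wedge_form m n \<omega> \<eta>) - T (wedge_form m n \<omega>' \<eta>') =
    T (wedge_form m n (\<lambda>x v. \<omega> x v - \<omega>' x v) \<eta>) + T (wedge_form m n \<omega>' (\<lambda>x v. \<eta> x v - \<eta>' x v))"
proof -
  note w = smooth_forms_wedge[OF s(1,3)] smooth_forms_wedge[OF s(2,3)] smooth_forms_wedge[OF s(2,4)]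
  have 1: "wedge_form m n (\<lambda>x v. \<omega> x v - \<omega>' x v) \<eta> = (\<lambda>x v. wedge_form m n \<omega> \<eta> x v - wedge_form m n \<omega>' \<eta> x v)"
    using wedge_form_linear_left(1)[of m n \<omega> "\<lambda>x v. (-1) * \<omega>' x v" \<eta>] wedge_form_linear_left(2)[of m n "-1" \<omega>' \<eta>]
    by (intro ext) simp
  have 2: "wedge_form m n \<omega>' (\<lambda>x v. \<eta> x v - \<eta>' x v) = (\<lambda>x v. wedge_form m n \<omega>' \<eta> x v - wedge_form m n \<omega>' \<eta>' x v)"
    using wedge_form_linear_right(1)[of m n \<omega>' \<eta> "\<lambda>x v. (-1) * \<eta>' x v"] wedge_form_linear_right(2)[of m n \<omega>' "-1" \<eta>']
    by (intro ext) simp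
  show ?thesis
    unfolding 1 2 form_functional_diff[OF F w(1,2)] form_functional_diff[OF F w(2,3)] by simp
qed

lemma flat_form_le_wedge:
  assumes \<omega>: "\<omega> \<in> smooth_forms m" "flat_form_le m S A \<omega>" and \<eta>: "\<eta> \<in> smooth_forms n" "flat_form_le n S B \<eta>"
    and AB: "0 \<le> A" "0 \<le> B"
  shows "flat_form_le (m + n) S ((wedge_const m n + wedge_const (Suc m) n + wedge_const m (Suc n)) * A * B) (wedge_form m n \<omega> \<eta>)"
proof -
  have A1: "form_le m S A \<omega>" "form_le (Suc m) S A (ext_deriv m \<omega>)" using \<omega>(2) by (auto simp: flat_form_le_def)
  have B1: "form_le n S B \<eta>" "form_le (Suc n) S B (ext_deriv n \<eta>)" using \<eta>(2) by (auto simp: flat_form_le_def)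
  have pos: "0 \<le> wedge_const p q * A * B" for p q
    using AB less_imp_le[OF wedge_const_pos[of p q]] by simp
  have eq: "ext_deriv (m + n) (wedge_form m n \<omega> \<eta>) = (\<lambda>x v. wedge_form (Suc m) n (ext_deriv m \<omega>) \<eta> x v + (-1) ^ m * wedge_form m (Suc n) \<omega> (ext_deriv n \<eta>) x v)"
    by (intro ext) (rule ext_deriv_wedge[OF \<omega>(1) \<eta>(1)])
  have w: "form_le (Suc (m + n)) S (wedge_const (Suc m) n * A * B) (wedge_form (Suc m) n (ext_deriv m \<omega>) \<eta>)"
    using wedge_form_le[OF A1(2) B1(1) AB(1)] by simp
  have "form_le (Suc (m + n)) S (wedge_const m (Suc n) * A * B) (wedge_form m (Suc n) \<omega> (ext_deriv n \<eta>))"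
    using wedge_form_le[OF A1(1) B1(2) AB(1)] by simp
  from form_le_add[OF w form_le_cmult[OF this, of "(-1) ^ m"]]
  have d: "form_le (Suc (m + n)) S (wedge_const (Suc m) n * A * B + wedge_const m (Suc n) * A * B) (ext_deriv (m + n) (wedge_form m n \<omega> \<eta>))"
    unfolding eq by (simp add: power_abs)
  show ?thesis
    unfolding flat_form_le_def
  proof
    show "form_le (m + n) S ((wedge_const m n + wedge_const (Suc m) n + wedge_const m (Suc n)) * A * B) (wedge_form m n \<omega> \<eta>)"
      by (rule form_le_mono[OF wedge_form_le[OF A1(1) B1(1) AB(1)] order_refl])
        (use pos[of "Suc m" n] pos[of m "Suc n"] in \<open>simp add: distrib_right\<close>)
    show "form_le (Suc (m + n)) S ((wedge_const m n + wedge_const (Suc m) n + wedge_const m (Suc n)) * A * B) (ext_deriv (m + n) (wedge_form m n \<omega> \<eta>))"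
      by (rule form_le_mono[OF d order_refl]) (use pos[of m n] in \<open>simp add: distrib_right\<close>)
  qed
qed

section \<open>The exterior product of fractional charges\<close>

text \<open>Dyadic scales starting at 1/2, the largest scale for which the approximation estimates
  are stated.\<close>

definition moll_scale :: "nat \<Rightarrow> real" where
  "moll_scale n = (1 / 2) ^ Suc n"

lemma moll_scale: "0 < moll_scale n" "moll_scale n \<le> 1 / 2" "moll_scale n \<le> 1" "moll_scale (Suc n) = moll_scale n / 2"
proof -
  have "(1 / 2 :: real) ^ n \<le> 1" by (rule power_le_one) auto
  then show "moll_scale n \<le> 1 / 2" "moll_scale n \<le> 1" by (simp_all add: moll_scale_def)
qed (simp_all add: moll_scale_def)

lemma moll_scale_tendsto: "moll_scale \<longlonglongrightarrow> 0"
  unfolding moll_scale_def[abs_def]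
  using LIMSEQ_ignore_initial_segment[OF LIMSEQ_power_zero[of "1/2 :: real"], of 1] by simp

lemma moll_scale_powr_tendsto:
  assumes "0 < \<gamma>" shows "(\<lambda>n. moll_scale n powr \<gamma>) \<longlonglongrightarrow> 0"
  by (rule tendsto_zero_powrI[OF moll_scale_tendsto tendsto_const _ assms])
    (simp add: less_imp_le[OF moll_scale(1)])

abbreviation approx_form :: "nat \<Rightarrow> 'a::euclidean_space charge \<Rightarrow> nat \<Rightarrow> 'a form" where
  "approx_form m \<omega> n \<equiv> charge_form m (moll_scale n) moll \<omega>"

lemma smooth_forms_approx:
  assumes "\<omega> \<in> fractional_charges m \<alpha>" "0 \<le> \<alpha>" "\<alpha> \<le> 1"
  shows "approx_form m \<omega> n \<in> smooth_forms m"
  by (rule smooth_forms_charge_form[OF fractional_locally_bounded[OF assms] test_function_moll moll_scale(1)])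

lemma approx_form_close:
  fixes T :: "'a::euclidean_space current"
  assumes \<omega>: "\<omega> \<in> fractional_charges m \<alpha>" "0 \<le> \<alpha>" "\<alpha> \<le> 1" and K: "compact K"
    and A: "fractional_bound m \<alpha> (thick 1 K) \<omega> A" and T: "T \<in> normal_currents_in m K"
  shows "\<bar>T (approx_form m \<omega> n) - \<omega> T\<bar> \<le> 2 * A * moll_scale n powr \<alpha> * real_normal_mass m T"
  by (rule charge_form_close[OF \<omega> K A T moll_scale(1,2)])

lemma approx_form_flat_le:
  fixes \<omega> :: "'a::euclidean_space charge"
  assumes \<omega>: "\<omega> \<in> fractional_charges m \<alpha>" "0 \<le> \<alpha>" "\<alpha> \<le> 1" and A: "fractional_bound m \<alpha> (thick 1 K) \<omega> A"
  shows "flat_form_le m K (eval_const TYPE('a) m * A * moll_scale n powr (\<alpha> - 1)) (approx_form m \<omega> n)"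
  by (rule charge_form_flat_le[OF \<omega> A moll_scale(1,2)])

text \<open>Both consecutive approximations are compared with the charge itself, which doubles the
  constant 2; the error at the finer scale is estimated by the one at the coarser scale.\<close>

lemma approx_form_step:
  fixes T :: "'a::euclidean_space current"
  assumes \<omega>: "\<omega> \<in> fractional_charges m \<alpha>" "0 \<le> \<alpha>" "\<alpha> \<le> 1" and K: "compact K"
    and A: "fractional_bound m \<alpha> (thick 1 K) \<omega> A" and T: "T \<in> normal_currents_in m K"
  shows "\<bar>T (\<lambda>x v. approx_form m \<omega> (Suc n) x v - approx_form m \<omega> n x v)\<bar> \<le> 4 * A * moll_scale n powr \<alpha> * real_normal_mass m T"
proof -
  let ?N = "real_normal_mass m T"
  have N: "0 \<le> ?N" by (rule real_normal_mass(2)[OF normal_currents_inD(1)[OF T]])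
  have A0: "0 \<le> A" by (rule fractional_boundD(1)[OF A])
  have "moll_scale (Suc n) powr \<alpha> \<le> moll_scale n powr \<alpha>"
    using moll_scale(1)[of n] \<omega>(2) by (intro powr_mono2) (auto simp: moll_scale(4))
  then have "2 * A * moll_scale (Suc n) powr \<alpha> * ?N \<le> 2 * A * moll_scale n powr \<alpha> * ?N"
    using A0 N by (intro mult_right_mono mult_left_mono) auto
  then have "\<bar>T (approx_form m \<omega> (Suc n)) - \<omega> T\<bar> \<le> 2 * A * moll_scale n powr \<alpha> * ?N"
    using approx_form_close[OF \<omega> K A T, of "Suc n"] by linarith
  then have "\<bar>T (approx_form m \<omega> (Suc n)) - T (approx_form m \<omega> n)\<bar> \<le> 4 * A * moll_scale n powr \<alpha> * ?N"
    using approx_form_close[OF \<omega> K A T, of n] by linarith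
  then show ?thesis
    by (simp only: form_functional_diff[OF normal_currents_functional[OF normal_currents_inD(1)[OF T]] smooth_forms_approx[OF \<omega>] smooth_forms_approx[OF \<omega>]])
qed

definition charge_wedge :: "nat \<Rightarrow> nat \<Rightarrow> 'a::euclidean_space charge \<Rightarrow> 'a charge \<Rightarrow> 'a charge" where
  "charge_wedge m m' \<omega> \<eta> T = (if T \<in> normal_currents (m + m')
     then lim (\<lambda>n. T (wedge_form m m' (approx_form m \<omega> n) (approx_form m' \<eta> n))) else 0)"

lemma geometric_limit:
  fixes x :: "nat \<Rightarrow> real"
  assumes step: "\<And>n. \<bar>x (Suc n) - x n\<bar> \<le> D * q ^ n" and q: "0 \<le> q" "q < 1" and D: "0 \<le> D"
  shows "x \<longlonglongrightarrow> lim x" "\<bar>lim x - x n\<bar> \<le> D / (1 - q) * q ^ n"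
proof -
  have partial: "\<bar>x (n + k) - x n\<bar> \<le> D / (1 - q) * q ^ n" for n k
  proof -
    \<comment> \<open>The factor 1 - q^k keeps the exact partial sum of the geometric series, which
      makes the induction close.\<close>
    have "\<bar>x (n + k) - x n\<bar> \<le> D / (1 - q) * q ^ n * (1 - q ^ k)"
    proof (induction k)
      case (Suc k)
      have "\<bar>x (n + Suc k) - x n\<bar> \<le> D * q ^ (n + k) + D / (1 - q) * q ^ n * (1 - q ^ k)"
        using step[of "n + k"] Suc by simp
      also have "\<dots> = D / (1 - q) * q ^ n * (1 - q ^ Suc k)"
        using q by (simp add: field_simps power_add)
      finally show ?case .
    qed simp
    also have "\<dots> \<le> D / (1 - q) * q ^ n * 1"
      using q D by (intro mult_left_mono) auto
    finally show ?thesis by simp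
  qed
  have lim0: "(\<lambda>n. D / (1 - q) * q ^ n) \<longlonglongrightarrow> 0"
    using tendsto_mult_right_zero[OF LIMSEQ_power_zero[of q]] q by simp
  have "Cauchy x"
  proof (rule metric_CauchyI)
    fix e :: real assume "0 < e"
    then have "eventually (\<lambda>n. \<bar>D / (1 - q) * q ^ n\<bar> < e / 2) sequentially"
      using tendstoD[OF lim0, of "e / 2"] by (simp add: dist_real_def)
    then obtain N where N: "\<bar>D / (1 - q) * q ^ N\<bar> < e / 2" by (auto simp: eventually_sequentially)
    have "dist (x i) (x N) < e / 2" if i: "N \<le> i" for i
    proof -
      have "dist (x i) (x N) \<le> D / (1 - q) * q ^ N"
        using partial[of N "i - N"] unfolding dist_real_def le_add_diff_inverse[OF i] .
      then show ?thesis using N by linarith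
    qed
    then show "\<exists>M. \<forall>i\<ge>M. \<forall>j\<ge>M. dist (x i) (x j) < e"
      by (intro exI[of _ N]) (metis dist_triangle_half_r dist_commute)
  qed
  then show l: "x \<longlonglongrightarrow> lim x" using convergent_LIMSEQ_iff Cauchy_convergent by blast
  show "\<bar>lim x - x n\<bar> \<le> D / (1 - q) * q ^ n"
  proof (rule tendsto_upperbound)
    show "(\<lambda>k. \<bar>x (k + n) - x n\<bar>) \<longlonglongrightarrow> \<bar>lim x - x n\<bar>"
      by (intro tendsto_intros LIMSEQ_ignore_initial_segment l)
    show "\<forall>\<^sub>F k in sequentially. \<bar>x (k + n) - x n\<bar> \<le> D / (1 - q) * q ^ n"
      using partial[of n] by (simp add: add.commute)
  qed simp
qed

text \<open>In both terms the factor 4 is the constant for consecutive scales. In the first it is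
  doubled, because there the other factor is taken at the finer scale, where its bound is at most
  twice as large.\<close>

definition wedge_step_const :: "'a::euclidean_space itself \<Rightarrow> nat \<Rightarrow> nat \<Rightarrow> real" where
  "wedge_step_const T m m' = slice_const m m' * (8 * eval_const T m' + 4 * eval_const T m)"

lemma wedge_step_const_nonneg: "0 \<le> wedge_step_const TYPE('a::euclidean_space) m m'"
  unfolding wedge_step_const_def
  using slice_const_nonneg[of m m'] eval_const_ge_1[where 'a='a, of m] eval_const_ge_1[where 'a='a, of m'] by simp

text \<open>In each term of the telescoped difference one factor contributes its error, e^\<alpha>
  or e^\<beta>, and the other its size, e^(\<beta> - 1) or e^(\<alpha> - 1); both products have
  exponent \<alpha> + \<beta> - 1. Of the two thickenings of \<open>K\<close>, one is used by
  slicing and the other by mollification.\<close>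

lemma wedge_step:
  fixes T :: "'a::euclidean_space current"
  assumes \<omega>: "\<omega> \<in> fractional_charges m \<alpha>" "0 \<le> \<alpha>" "\<alpha> \<le> 1" and \<eta>: "\<eta> \<in> fractional_charges m' \<beta>" "0 \<le> \<beta>" "\<beta> \<le> 1"
    and K: "compact K" and T: "T \<in> normal_currents_in (m + m') K"
    and A: "fractional_bound m \<alpha> (thick 1 (thick 1 K)) \<omega> A" and B: "fractional_bound m' \<beta> (thick 1 (thick 1 K)) \<eta> B"
  shows "\<bar>T (wedge_form m m' (approx_form m \<omega> (Suc n)) (approx_form m' \<eta> (Suc n))) - T (wedge_form m m' (approx_form m \<omega> n) (approx_form m' \<eta> n))\<bar>
    \<le> wedge_step_const TYPE('a) m m' * A * B * moll_scale n powr (\<alpha> + \<beta> - 1) * real_normal_mass (m + m') T"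
proof -
  let ?e = "moll_scale n" and ?N = "real_normal_mass (m + m') T"
  let ?a = "approx_form m \<omega>" and ?b = "approx_form m' \<eta>"
  have A0: "0 \<le> A" "0 \<le> B" using fractional_boundD(1) A B by blast+
  have N: "0 \<le> ?N" by (rule real_normal_mass(2)[OF normal_currents_inD(1)[OF T]])
  note K1 = compact_thick[OF K, of 1]
  have e: "0 < ?e" by (rule moll_scale)
  have C: "0 \<le> eval_const TYPE('a) m" "0 \<le> eval_const TYPE('a) m'"
    using eval_const_ge_1[where 'a='a, of m] eval_const_ge_1[where 'a='a, of m'] by linarith+
  have "moll_scale (Suc n) powr (\<beta> - 1) = ?e powr (\<beta> - 1) / 2 powr (\<beta> - 1)"
    using e by (simp add: moll_scale(4) powr_divide)
  also have "\<dots> = ?e powr (\<beta> - 1) * 2 powr (1 - \<beta>)"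
    using powr_minus_divide[of 2 "\<beta> - 1"] by simp
  also have "\<dots> \<le> ?e powr (\<beta> - 1) * 2 powr 1"
    using \<eta> by (intro mult_left_mono powr_mono) auto
  finally have e2: "moll_scale (Suc n) powr (\<beta> - 1) \<le> 2 * ?e powr (\<beta> - 1)" by simp
  have t1: "\<bar>T (wedge_form m m' (\<lambda>x v. ?a (Suc n) x v - ?a n x v) (?b (Suc n)))\<bar>
      \<le> slice_const m m' * (4 * A * ?e powr \<alpha>) * (eval_const TYPE('a) m' * B * moll_scale (Suc n) powr (\<beta> - 1)) * ?N"
    by (rule slice_left[OF T K smooth_forms_diff[OF smooth_forms_approx[OF \<omega>] smooth_forms_approx[OF \<omega>]] smooth_forms_approx[OF \<eta>]
          approx_form_flat_le[OF \<eta> B] _ _ approx_form_step[OF \<omega> K1 A]]) (use A0 C in auto)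
  also have "\<dots> \<le> slice_const m m' * (4 * A * ?e powr \<alpha>) * (eval_const TYPE('a) m' * B * (2 * ?e powr (\<beta> - 1))) * ?N"
    using e2 A0 C N slice_const_nonneg[of m m'] by (intro mult_right_mono mult_left_mono) auto
  also have "\<dots> = slice_const m m' * 8 * eval_const TYPE('a) m' * A * B * (?e powr \<alpha> * ?e powr (\<beta> - 1)) * ?N"
    by (simp only: ac_simps)
  finally have t1': "\<bar>T (wedge_form m m' (\<lambda>x v. ?a (Suc n) x v - ?a n x v) (?b (Suc n)))\<bar>
    \<le> slice_const m m' * 8 * eval_const TYPE('a) m' * A * B * ?e powr (\<alpha> + \<beta> - 1) * ?N"
    using powr_add[of ?e \<alpha> "\<beta> - 1"] by (simp add: add_diff_eq)
  have "\<bar>T (wedge_form m m' (?a n) (\<lambda>x v. ?b (Suc n) x v - ?b n x v))\<bar>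
      \<le> slice_const m m' * (4 * B * ?e powr \<beta>) * (eval_const TYPE('a) m * A * ?e powr (\<alpha> - 1)) * ?N"
    by (rule slice_right[OF T K smooth_forms_approx[OF \<omega>] approx_form_flat_le[OF \<omega> A]
          smooth_forms_diff[OF smooth_forms_approx[OF \<eta>] smooth_forms_approx[OF \<eta>]] _ _ approx_form_step[OF \<eta> K1 B]])
      (use A0 C in auto)
  also have "\<dots> = slice_const m m' * 4 * eval_const TYPE('a) m * A * B * (?e powr \<beta> * ?e powr (\<alpha> - 1)) * ?N"
    by (simp only: ac_simps)
  finally have t2': "\<bar>T (wedge_form m m' (?a n) (\<lambda>x v. ?b (Suc n) x v - ?b n x v))\<bar>
    \<le> slice_const m m' * 4 * eval_const TYPE('a) m * A * B * ?e powr (\<alpha> + \<beta> - 1) * ?N"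
    using powr_add[of ?e \<beta> "\<alpha> - 1"] by (simp add: add_diff_eq add.commute)
  have "\<bar>T (wedge_form m m' (?a (Suc n)) (?b (Suc n))) - T (wedge_form m m' (?a n) (?b n))\<bar>
    \<le> slice_const m m' * 8 * eval_const TYPE('a) m' * A * B * ?e powr (\<alpha> + \<beta> - 1) * ?N
      + slice_const m m' * 4 * eval_const TYPE('a) m * A * B * ?e powr (\<alpha> + \<beta> - 1) * ?N"
    unfolding wedge_form_diff[OF smooth_forms_approx[OF \<omega>] smooth_forms_approx[OF \<omega>] smooth_forms_approx[OF \<eta>] smooth_forms_approx[OF \<eta>]
        normal_currents_functional[OF normal_currents_inD(1)[OF T]]]
    using t1' t2' by linarith
  then show ?thesis by (simp add: wedge_step_const_def algebra_simps)
qed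

text \<open>The remainder of a geometric series is proportional to its current term, so the error at
  scale \<open>n\<close> is again a power of that scale.\<close>

lemma charge_wedge_limit:
  fixes T :: "'a::euclidean_space current"
  assumes \<omega>: "\<omega> \<in> fractional_charges m \<alpha>" "0 \<le> \<alpha>" "\<alpha> \<le> 1" and \<eta>: "\<eta> \<in> fractional_charges m' \<beta>" "0 \<le> \<beta>" "\<beta> \<le> 1"
    and \<gamma>: "\<gamma> = \<alpha> + \<beta> - 1" "0 < \<gamma>"
    and K: "compact K" and T: "T \<in> normal_currents_in (m + m') K"
    and A: "fractional_bound m \<alpha> (thick 1 (thick 1 K)) \<omega> A" and B: "fractional_bound m' \<beta> (thick 1 (thick 1 K)) \<eta> B"
  shows "(\<lambda>n. T (wedge_form m m' (approx_form m \<omega> n) (approx_form m' \<eta> n))) \<longlonglongrightarrow> charge_wedge m m' \<omega> \<eta> T"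
    and "\<bar>charge_wedge m m' \<omega> \<eta> T - T (wedge_form m m' (approx_form m \<omega> n) (approx_form m' \<eta> n))\<bar>
      \<le> wedge_step_const TYPE('a) m m' / (1 - (1/2) powr \<gamma>) * A * B * moll_scale n powr \<gamma> * real_normal_mass (m + m') T"
proof -
  let ?N = "real_normal_mass (m + m') T" and ?C = "wedge_step_const TYPE('a) m m'"
  define q :: real where "q = (1/2) powr \<gamma>"
  define x where "x = (\<lambda>n. T (wedge_form m m' (approx_form m \<omega> n) (approx_form m' \<eta> n)))"
  have A0: "0 \<le> A" "0 \<le> B" using fractional_boundD(1) A B by blast+
  have N: "0 \<le> ?N" by (rule real_normal_mass(2)[OF normal_currents_inD(1)[OF T]])
  have q0: "0 \<le> q" by (simp add: q_def)
  have "(1/2::real) powr \<gamma> < (1/2) powr 0" using \<gamma>(2) by (intro powr_less_mono') auto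
  then have q1: "q < 1" by (simp add: q_def)
  \<comment> \<open>The powers of the scales form a geometric sequence of ratio \<open>q\<close>;
    the extra factor \<open>q\<close> reflects that the first scale is 1/2.\<close>
  have sc: "moll_scale n powr \<gamma> = q * q ^ n" for n
  proof -
    have "moll_scale n = (1/2) powr real (Suc n)" unfolding moll_scale_def by (subst powr_realpow) auto
    then have "moll_scale n powr \<gamma> = ((1/2) powr \<gamma>) powr real (Suc n)" by (simp only: powr_powr mult.commute)
    also have "\<dots> = q ^ Suc n" unfolding q_def by (rule powr_realpow) simp
    finally show ?thesis by simp
  qed
  let ?D = "?C * A * B * ?N * q"
  have D: "0 \<le> ?D" using wedge_step_const_nonneg[where 'a='a, of m m'] A0 N q0 by simp
  have step: "\<bar>x (Suc n) - x n\<bar> \<le> ?D * q ^ n" for n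
    using wedge_step[OF \<omega> \<eta> K T A B, of n] unfolding x_def \<gamma>(1)[symmetric] sc by (simp only: ac_simps)
  have cw: "charge_wedge m m' \<omega> \<eta> T = lim x"
    using normal_currents_inD(1)[OF T] by (simp add: charge_wedge_def x_def)
  show "(\<lambda>n. T (wedge_form m m' (approx_form m \<omega> n) (approx_form m' \<eta> n))) \<longlonglongrightarrow> charge_wedge m m' \<omega> \<eta> T"
    unfolding cw using geometric_limit(1)[OF step q0 q1 D] by (simp only: x_def)
  have "\<bar>lim x - x n\<bar> \<le> ?D / (1 - q) * q ^ n" by (rule geometric_limit(2)[OF step q0 q1 D])
  then show "\<bar>charge_wedge m m' \<omega> \<eta> T - T (wedge_form m m' (approx_form m \<omega> n) (approx_form m' \<eta> n))\<bar>
      \<le> ?C / (1 - (1/2) powr \<gamma>) * A * B * moll_scale n powr \<gamma> * ?N"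
    unfolding cw sc q_def[symmetric] by (simp add: x_def ac_simps)
qed

text \<open>Balancing the two terms calls for a scale comparable with F / N, which is at most 1.
  Since \<gamma> - 1 is nonpositive and \<gamma> is positive, the scale has to be compared with F /
  N from both sides.\<close>

lemma dyadic_interpolation:
  assumes \<gamma>: "0 < \<gamma>" "\<gamma> \<le> 1" and FN: "0 \<le> F" "F \<le> N" and c: "0 \<le> c1" "0 \<le> c2"
    and le: "\<And>n. w \<le> c1 * moll_scale n powr (\<gamma> - 1) * F + c2 * moll_scale n powr \<gamma> * N"
  shows "w \<le> (2 * c1 + c2) * (N powr (1 - \<gamma>) * F powr \<gamma>)"
proof (cases "F = 0")
  case True
  \<comment> \<open>For F = 0 the first term disappears and the scale may tend to 0.\<close>
  have "w \<le> c2 * 0 * N"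
  proof (rule tendsto_lowerbound)
    show "(\<lambda>n. c2 * moll_scale n powr \<gamma> * N) \<longlonglongrightarrow> c2 * 0 * N"
      by (intro tendsto_intros moll_scale_powr_tendsto \<gamma>)
    show "\<forall>\<^sub>F n in sequentially. w \<le> c2 * moll_scale n powr \<gamma> * N" using le True by simp
  qed simp
  then show ?thesis using True by simp
next
  case False
  then have F: "0 < F" and N: "0 < N" using FN by auto
  define t where "t = F / N"
  have t: "0 < t" "t \<le> 1" using F N FN by (simp_all add: t_def)
  have "\<exists>n. moll_scale n \<le> t"
    using order_tendstoD(2)[OF moll_scale_tendsto t(1)] by (auto simp: eventually_sequentially intro: less_imp_le)
  then obtain n where n: "moll_scale n \<le> t" "\<And>k. k < n \<Longrightarrow> \<not> moll_scale k \<le> t"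
    by (meson exists_least_iff)
  \<comment> \<open>The first scale below F / N is comparable to it: the previous scale exceeds F /
    N, and if there is none, the scale is 1/2 while F / N is at most 1.\<close>
  have up: "t \<le> 2 * moll_scale n"
  proof (cases n)
    case 0
    then show ?thesis using t by (simp add: moll_scale_def)
  next
    case (Suc k)
    then show ?thesis using n(2)[of k] moll_scale(4)[of k] by simp
  qed
  have X: "t powr \<gamma> * N = N powr (1 - \<gamma>) * F powr \<gamma>"
  proof -
    have "t powr \<gamma> * N = F powr \<gamma> * (N powr 1 / N powr \<gamma>)" unfolding t_def using F N by (simp add: powr_divide)
    also have "N powr 1 / N powr \<gamma> = N powr (1 - \<gamma>)" by (rule powr_diff[symmetric])
    finally show ?thesis by simp
  qed
  have "moll_scale n powr \<gamma> \<le> t powr \<gamma>" using moll_scale(1)[of n] n(1) \<gamma> by (intro powr_mono2) auto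
  then have 1: "c2 * moll_scale n powr \<gamma> * N \<le> c2 * t powr \<gamma> * N" using c N by (intro mult_right_mono mult_left_mono) auto
  have "moll_scale n powr (\<gamma> - 1) \<le> (t / 2) powr (\<gamma> - 1)" using up t \<gamma> by (intro powr_mono2') auto
  also have "\<dots> = t powr (\<gamma> - 1) * 2 powr (1 - \<gamma>)"
    using t powr_minus_divide[of 2 "\<gamma> - 1"] by (simp add: powr_divide)
  also have "\<dots> \<le> t powr (\<gamma> - 1) * 2 powr 1" using \<gamma> by (intro mult_left_mono powr_mono) auto
  finally have "c1 * moll_scale n powr (\<gamma> - 1) * F \<le> c1 * (t powr (\<gamma> - 1) * 2) * F" using c F by (intro mult_right_mono mult_left_mono) auto
  also have "\<dots> = 2 * c1 * (t powr (\<gamma> - 1) * t powr 1) * N"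
  proof -
    have "t powr 1 = t" using t(1) by simp
    moreover have "F = t * N" using N by (simp add: t_def)
    ultimately show ?thesis by (simp only: ac_simps)
  qed
  also have "t powr (\<gamma> - 1) * t powr 1 = t powr \<gamma>" by (simp only: powr_add[symmetric]) simp
  finally have "w \<le> 2 * c1 * t powr \<gamma> * N + c2 * t powr \<gamma> * N" using le[of n] 1 by linarith
  also have "\<dots> = (2 * c1 + c2) * (t powr \<gamma> * N)" by (simp add: algebra_simps)
  finally show ?thesis unfolding X .
qed

text \<open>The constant is independent of the charges, whose own constants enter bilinearly. This
  uniformity serves both for bounded sequences and for small perturbations. At each scale the
  product of mollified forms has size e^(\<alpha> - 1) * e^(\<beta> - 1) = e^(\<gamma> - 1),
  together with its derivative.\<close>

lemma charge_wedge_fractional_bound: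
  fixes K :: "'a::euclidean_space set"
  assumes \<alpha>: "0 \<le> \<alpha>" "\<alpha> \<le> 1" and \<beta>: "0 \<le> \<beta>" "\<beta> \<le> 1" and \<gamma>: "\<gamma> = \<alpha> + \<beta> - 1" "0 < \<gamma>" and K: "compact K"
  obtains C where "0 \<le> C"
    "\<And>\<omega> \<eta> A B. \<omega> \<in> fractional_charges m \<alpha> \<Longrightarrow> \<eta> \<in> fractional_charges m' \<beta> \<Longrightarrow>
      fractional_bound m \<alpha> (thick 1 (thick 1 K)) \<omega> A \<Longrightarrow> fractional_bound m' \<beta> (thick 1 (thick 1 K)) \<eta> B \<Longrightarrow>
      fractional_bound (m + m') \<gamma> K (charge_wedge m m' \<omega> \<eta>) (C * A * B)"
proof -
  obtain CF where CF: "1 \<le> CF"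
    "\<And>T \<omega> B. T \<in> normal_currents_in (m + m') K \<Longrightarrow> \<omega> \<in> smooth_forms (m + m') \<Longrightarrow> 0 \<le> B \<Longrightarrow> flat_form_le (m + m') (thick 1 K) B \<omega> \<Longrightarrow>
      \<bar>T \<omega>\<bar> \<le> CF * real_flat_norm (m + m') T * B"
    by (rule flat_norm_local[OF K zero_less_one]) blast
  define w where "w = wedge_const m m' + wedge_const (Suc m) m' + wedge_const m (Suc m')"
  have w: "0 \<le> w" unfolding w_def using wedge_const_pos[of m m'] wedge_const_pos[of "Suc m" m'] wedge_const_pos[of m "Suc m'"] by linarith
  define E where "E = eval_const TYPE('a) m * eval_const TYPE('a) m'"
  have E1: "0 \<le> eval_const TYPE('a) m" "0 \<le> eval_const TYPE('a) m'"
    using eval_const_ge_1[where 'a='a, of m] eval_const_ge_1[where 'a='a, of m'] by linarith+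
  have E: "0 \<le> E" unfolding E_def using E1 by simp
  define S where "S = wedge_step_const TYPE('a) m m' / (1 - (1/2) powr \<gamma>)"
  have "(1/2::real) powr \<gamma> < (1/2) powr 0" using \<gamma>(2) by (intro powr_less_mono') auto
  then have S: "0 \<le> S" unfolding S_def using wedge_step_const_nonneg[where 'a='a, of m m'] by simp
  define C where "C = 2 * (CF * w * E) + S"
  have C: "0 \<le> C" unfolding C_def using CF(1) w E S by simp
  show thesis
  proof (rule that[OF C])
    fix \<omega> \<eta> :: "'a charge" and A B
    assume \<omega>: "\<omega> \<in> fractional_charges m \<alpha>" and \<eta>: "\<eta> \<in> fractional_charges m' \<beta>"
      and A: "fractional_bound m \<alpha> (thick 1 (thick 1 K)) \<omega> A" and B: "fractional_bound m' \<beta> (thick 1 (thick 1 K)) \<eta> B"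
    have A0: "0 \<le> A" "0 \<le> B" using fractional_boundD(1) A B by blast+
    show "fractional_bound (m + m') \<gamma> K (charge_wedge m m' \<omega> \<eta>) (C * A * B)"
      unfolding fractional_bound_def
    proof (intro conjI ballI)
      show "0 \<le> C * A * B" using C A0 by simp
      fix T assume T: "T \<in> normal_currents_in (m + m') K"
      let ?N = "real_normal_mass (m + m') T" and ?F = "real_flat_norm (m + m') T"
      note nT = normal_currents_inD(1)[OF T]
      have "\<bar>charge_wedge m m' \<omega> \<eta> T\<bar> \<le> (CF * w * E * A * B) * moll_scale n powr (\<gamma> - 1) * ?F + (S * A * B) * moll_scale n powr \<gamma> * ?N" for n
      proof -
        let ?a = "approx_form m \<omega> n" and ?b = "approx_form m' \<eta> n" and ?e = "moll_scale n"
        have "flat_form_le (m + m') (thick 1 K) (w * (eval_const TYPE('a) m * A * ?e powr (\<alpha> - 1)) * (eval_const TYPE('a) m' * B * ?e powr (\<beta> - 1))) (wedge_form m m' ?a ?b)"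
          unfolding w_def
          by (rule flat_form_le_wedge[OF smooth_forms_approx[OF \<omega> \<alpha>] approx_form_flat_le[OF \<omega> \<alpha> A] smooth_forms_approx[OF \<eta> \<beta>] approx_form_flat_le[OF \<eta> \<beta> B]])
            (use A0 E1 in auto)
        from CF(2)[OF T smooth_forms_wedge[OF smooth_forms_approx[OF \<omega> \<alpha>] smooth_forms_approx[OF \<eta> \<beta>]] _ this]
        have "\<bar>T (wedge_form m m' ?a ?b)\<bar> \<le> CF * ?F * (w * (eval_const TYPE('a) m * A * ?e powr (\<alpha> - 1)) * (eval_const TYPE('a) m' * B * ?e powr (\<beta> - 1)))"
          using w A0 E1 by simp
        also have "\<dots> = CF * w * E * A * B * (?e powr (\<alpha> - 1) * ?e powr (\<beta> - 1)) * ?F"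
          unfolding E_def by (simp only: ac_simps)
        also have "?e powr (\<alpha> - 1) * ?e powr (\<beta> - 1) = ?e powr (\<gamma> - 1)"
          unfolding powr_add[symmetric] \<gamma>(1) by (simp add: algebra_simps)
        finally have "\<bar>T (wedge_form m m' ?a ?b)\<bar> \<le> (CF * w * E * A * B) * ?e powr (\<gamma> - 1) * ?F" .
        moreover have "\<bar>charge_wedge m m' \<omega> \<eta> T - T (wedge_form m m' ?a ?b)\<bar> \<le> S * A * B * ?e powr \<gamma> * ?N"
          unfolding S_def by (rule charge_wedge_limit(2)[OF \<omega> \<alpha> \<eta> \<beta> \<gamma> K T A B])
        ultimately show ?thesis by linarith
      qed
      then have "\<bar>charge_wedge m m' \<omega> \<eta> T\<bar> \<le> (2 * (CF * w * E * A * B) + S * A * B) * (?N powr (1 - \<gamma>) * ?F powr \<gamma>)"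
        using \<alpha> \<beta> \<gamma> real_flat_norm[OF nT] CF(1) w E A0 S by (intro dyadic_interpolation) auto
      then show "\<bar>charge_wedge m m' \<omega> \<eta> T\<bar> \<le> C * A * B * ?N powr (1 - \<gamma>) * ?F powr \<gamma>"
        by (simp add: C_def algebra_simps)
    qed
  qed
qed

lemma fractional_chargesD:
  assumes "\<omega> \<in> fractional_charges m \<alpha>"
  shows "\<omega> \<in> normal_functionals m" "compact K \<Longrightarrow> \<exists>C. fractional_bound m \<alpha> K \<omega> C"
  using assms by (auto simp: fractional_charges_def)

lemma charge_wedge_tendsto:
  fixes T :: "'a::euclidean_space current"
  assumes \<omega>: "\<omega> \<in> fractional_charges m \<alpha>" "0 \<le> \<alpha>" "\<alpha> \<le> 1" and \<eta>: "\<eta> \<in> fractional_charges m' \<beta>" "0 \<le> \<beta>" "\<beta> \<le> 1"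
    and \<gamma>: "1 < \<alpha> + \<beta>" and T: "T \<in> normal_currents (m + m')"
  shows "(\<lambda>n. T (wedge_form m m' (approx_form m \<omega> n) (approx_form m' \<eta> n))) \<longlonglongrightarrow> charge_wedge m m' \<omega> \<eta> T"
proof -
  let ?K = "spt (m + m') T"
  have K: "compact ?K" by (rule compact_spt[OF normal_currents_currents[OF T]])
  obtain A where A: "fractional_bound m \<alpha> (thick 1 (thick 1 ?K)) \<omega> A"
    using fractional_chargesD(2)[OF \<omega>(1) compact_thick[OF compact_thick[OF K]]] by blast
  obtain B where B: "fractional_bound m' \<beta> (thick 1 (thick 1 ?K)) \<eta> B"
    using fractional_chargesD(2)[OF \<eta>(1) compact_thick[OF compact_thick[OF K]]] by blast
  show ?thesis
    by (rule charge_wedge_limit(1)[OF \<omega> \<eta> refl _ K normal_currents_in_spt[OF T] A B]) (use \<gamma> in simp)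
qed

lemma charge_wedge_fractional:
  fixes \<omega> \<eta> :: "'a::euclidean_space charge"
  assumes \<omega>: "\<omega> \<in> fractional_charges m \<alpha>" "0 \<le> \<alpha>" "\<alpha> \<le> 1" and \<eta>: "\<eta> \<in> fractional_charges m' \<beta>" "0 \<le> \<beta>" "\<beta> \<le> 1"
    and \<gamma>: "1 < \<alpha> + \<beta>"
  shows "charge_wedge m m' \<omega> \<eta> \<in> fractional_charges (m + m') (\<alpha> + \<beta> - 1)"
proof -
  note lim = charge_wedge_tendsto[OF \<omega> \<eta> \<gamma>]
  let ?w = "\<lambda>n. wedge_form m m' (approx_form m \<omega> n) (approx_form m' \<eta> n)"
  have "charge_wedge m m' \<omega> \<eta> \<in> normal_functionals (m + m')"
    unfolding normal_functionals_def
  proof (intro CollectI conjI allI ballI impI)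
    show "charge_wedge m m' \<omega> \<eta> T = 0" if "T \<notin> normal_currents (m + m')" for T
      using that by (simp add: charge_wedge_def)
  next
    fix S T :: "'a current" assume S: "S \<in> normal_currents (m + m')" and T: "T \<in> normal_currents (m + m')"
    have "(\<lambda>\<phi>. S \<phi> + T \<phi>) \<in> normal_currents (m + m')" using normal_comb_UNIV[OF S T, of 1 1] by simp
    from lim[OF this] have "(\<lambda>n. S (?w n) + T (?w n)) \<longlonglongrightarrow> charge_wedge m m' \<omega> \<eta> (\<lambda>\<phi>. S \<phi> + T \<phi>)" .
    moreover have "(\<lambda>n. S (?w n) + T (?w n)) \<longlonglongrightarrow> charge_wedge m m' \<omega> \<eta> S + charge_wedge m m' \<omega> \<eta> T"
      by (rule tendsto_add[OF lim[OF S] lim[OF T]])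
    ultimately show "charge_wedge m m' \<omega> \<eta> (\<lambda>\<phi>. S \<phi> + T \<phi>) = charge_wedge m m' \<omega> \<eta> S + charge_wedge m m' \<omega> \<eta> T"
      by (rule LIMSEQ_unique)
  next
    fix c and T :: "'a current" assume T: "T \<in> normal_currents (m + m')"
    have "(\<lambda>\<phi>. c * T \<phi>) \<in> normal_currents (m + m')" using normal_comb_UNIV[OF T T, of c 0] by simp
    from lim[OF this] have "(\<lambda>n. c * T (?w n)) \<longlonglongrightarrow> charge_wedge m m' \<omega> \<eta> (\<lambda>\<phi>. c * T \<phi>)" .
    moreover have "(\<lambda>n. c * T (?w n)) \<longlonglongrightarrow> c * charge_wedge m m' \<omega> \<eta> T"
      by (rule tendsto_mult_left[OF lim[OF T]])
    ultimately show "charge_wedge m m' \<omega> \<eta> (\<lambda>\<phi>. c * T \<phi>) = c * charge_wedge m m' \<omega> \<eta> T"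
      by (rule LIMSEQ_unique)
  qed
  moreover have "\<exists>C. fractional_bound (m + m') (\<alpha> + \<beta> - 1) K (charge_wedge m m' \<omega> \<eta>) C" if K: "compact K" for K
  proof -
    obtain A where A: "fractional_bound m \<alpha> (thick 1 (thick 1 K)) \<omega> A"
      using fractional_chargesD(2)[OF \<omega>(1) compact_thick[OF compact_thick[OF K]]] by blast
    obtain B where B: "fractional_bound m' \<beta> (thick 1 (thick 1 K)) \<eta> B"
      using fractional_chargesD(2)[OF \<eta>(1) compact_thick[OF compact_thick[OF K]]] by blast
    have g: "0 < \<alpha> + \<beta> - 1" using \<gamma> by simp
    obtain C where "\<And>\<omega> \<eta> A B. \<omega> \<in> fractional_charges m \<alpha> \<Longrightarrow> \<eta> \<in> fractional_charges m' \<beta> \<Longrightarrow>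
      fractional_bound m \<alpha> (thick 1 (thick 1 K)) \<omega> A \<Longrightarrow> fractional_bound m' \<beta> (thick 1 (thick 1 K)) \<eta> B \<Longrightarrow>
      fractional_bound (m + m') (\<alpha> + \<beta> - 1) K (charge_wedge m m' \<omega> \<eta>) (C * A * B)"
      by (rule charge_wedge_fractional_bound[OF \<omega>(2,3) \<eta>(2,3) refl g K, of m m']) blast
    from this[OF \<omega>(1) \<eta>(1) A B] show ?thesis by blast
  qed
  ultimately show ?thesis by (simp add: fractional_charges_def)
qed

text \<open>Mollification is linear in the charge, so the telescoping identity for products of forms
  passes to the limit.\<close>

lemma charge_wedge_diff:
  fixes \<omega> \<eta> :: "'a::euclidean_space charge"
  assumes \<omega>: "\<omega> \<in> fractional_charges m \<alpha>" "\<omega>' \<in> fractional_charges m \<alpha>" "\<omega> - \<omega>' \<in> fractional_charges m \<alpha>" "0 \<le> \<alpha>" "\<alpha> \<le> 1"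
    and \<eta>: "\<eta> \<in> fractional_charges m' \<beta>" "\<eta>' \<in> fractional_charges m' \<beta>" "\<eta> - \<eta>' \<in> fractional_charges m' \<beta>" "0 \<le> \<beta>" "\<beta> \<le> 1"
    and \<gamma>: "1 < \<alpha> + \<beta>"
  shows "charge_wedge m m' \<omega> \<eta> - charge_wedge m m' \<omega>' \<eta>' = (\<lambda>T. charge_wedge m m' (\<omega> - \<omega>') \<eta> T + charge_wedge m m' \<omega>' (\<eta> - \<eta>') T)"
proof
  fix T :: "'a current"
  show "(charge_wedge m m' \<omega> \<eta> - charge_wedge m m' \<omega>' \<eta>') T = charge_wedge m m' (\<omega> - \<omega>') \<eta> T + charge_wedge m m' \<omega>' (\<eta> - \<eta>') T"
  proof (cases "T \<in> normal_currents (m + m')")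
    case T: True
    have d: "approx_form k (\<theta> - \<theta>') n = (\<lambda>x v. approx_form k \<theta> n x v - approx_form k \<theta>' n x v)" for k n and \<theta> \<theta>' :: "'a charge"
      by (simp add: charge_form_def fun_eq_iff)
    have eq: "T (wedge_form m m' (approx_form m \<omega> n) (approx_form m' \<eta> n)) - T (wedge_form m m' (approx_form m \<omega>' n) (approx_form m' \<eta>' n))
      = T (wedge_form m m' (approx_form m (\<omega> - \<omega>') n) (approx_form m' \<eta> n)) + T (wedge_form m m' (approx_form m \<omega>' n) (approx_form m' (\<eta> - \<eta>') n))" for n
      unfolding d
      by (rule wedge_form_diff[OF smooth_forms_approx[OF \<omega>(1,4,5)] smooth_forms_approx[OF \<omega>(2,4,5)] smooth_forms_approx[OF \<eta>(1,4,5)] smooth_forms_approx[OF \<eta>(2,4,5)]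
            normal_currents_functional[OF T]])
    have "(\<lambda>n. T (wedge_form m m' (approx_form m \<omega> n) (approx_form m' \<eta> n)) - T (wedge_form m m' (approx_form m \<omega>' n) (approx_form m' \<eta>' n)))
      \<longlonglongrightarrow> charge_wedge m m' \<omega> \<eta> T - charge_wedge m m' \<omega>' \<eta>' T"
      by (rule tendsto_diff[OF charge_wedge_tendsto[OF \<omega>(1,4,5) \<eta>(1,4,5) \<gamma> T] charge_wedge_tendsto[OF \<omega>(2,4,5) \<eta>(2,4,5) \<gamma> T]])
    moreover have "(\<lambda>n. T (wedge_form m m' (approx_form m \<omega> n) (approx_form m' \<eta> n)) - T (wedge_form m m' (approx_form m \<omega>' n) (approx_form m' \<eta>' n)))
      \<longlonglongrightarrow> charge_wedge m m' (\<omega> - \<omega>') \<eta> T + charge_wedge m m' \<omega>' (\<eta> - \<eta>') T"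
      unfolding eq
      by (rule tendsto_add[OF charge_wedge_tendsto[OF \<omega>(3,4,5) \<eta>(1,4,5) \<gamma> T] charge_wedge_tendsto[OF \<omega>(2,4,5) \<eta>(3,4,5) \<gamma> T]])
    ultimately show ?thesis using LIMSEQ_unique by simp
  qed (simp add: charge_wedge_def)
qed

section \<open>Topologies on charges, uniqueness and continuity of the product\<close>

section \<open>Spaces of charges\<close>

text \<open>The subbasic balls have arbitrary centres, and the triangle inequality fits a ball
  around the limit into such a ball. It is assumed on \<open>S\<close> only, where the suprema
  defining the charge seminorms are finite.\<close>

lemma limitin_seminorm_topologyI:
  assumes f: "\<And>n. f n \<in> S" and l: "l \<in> S" and P: "P \<noteq> {}"
    and tri: "\<And>p x y z. p \<in> P \<Longrightarrow> x \<in> S \<Longrightarrow> y \<in> S \<Longrightarrow> z \<in> S \<Longrightarrow> p (x - z) \<le> p (x - y) + p (y - z)"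
    and lim: "\<And>p. p \<in> P \<Longrightarrow> (\<lambda>n. p (f n - l)) \<longlonglongrightarrow> 0"
  shows "limitin (seminorm_topology S P) f l sequentially"
  unfolding limitin_def
proof (intro conjI allI impI)
  show "l \<in> topspace (seminorm_topology S P)" using topspace_seminorm_topology[OF P] l by simp
  fix U assume "openin (seminorm_topology S P) U \<and> l \<in> U"
  then have "generate_topology_on {{y \<in> S. p (y - x) < e} | p x e. p \<in> P \<and> x \<in> S \<and> 0 < e} U" "l \<in> U"
    by (simp_all only: seminorm_topology_def openin_topology_generated_by_iff)
  then show "\<forall>\<^sub>F n in sequentially. f n \<in> U"
  proof (induction rule: generate_topology_on.induct)
    case (Int a b)
    then show ?case by (auto intro: eventually_conj)
  next
    case (UN \<K>)
    then obtain k where k: "k \<in> \<K>" "l \<in> k" by blast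
    then have "\<forall>\<^sub>F n in sequentially. f n \<in> k" using UN.IH by blast
    then show ?case by (rule eventually_mono) (use k(1) in blast)
  next
    case (Basis s)
    then obtain p x e where s: "s = {y \<in> S. p (y - x) < e}" "p \<in> P" "x \<in> S" by blast
    have "p (l - x) < e" using Basis.prems s(1) by simp
    then have "\<forall>\<^sub>F n in sequentially. p (f n - l) < e - p (l - x)"
      using order_tendstoD(2)[OF lim[OF s(2)], of "e - p (l - x)"] by simp
    then show ?case
    proof (rule eventually_mono)
      fix n assume "p (f n - l) < e - p (l - x)"
      then have "p (f n - x) < e" using tri[OF s(2) f l s(3), of n] by linarith
      then show "f n \<in> s" using f s(1) by simp
    qed
  qed simp
qed

lemma openin_seminorm_ball:
  "p \<in> P \<Longrightarrow> x \<in> S \<Longrightarrow> 0 < e \<Longrightarrow> openin (seminorm_topology S P) {y \<in> S. p (y - x) < e}"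
  unfolding seminorm_topology_def by (rule topology_generated_by_Basis) blast

text \<open>Only the ball centred at the limit is tested; it contains its centre because
  \<open>p\<close> vanishes at \<open>l - l\<close>.\<close>

lemma limitin_seminorm_topologyD:
  assumes lim: "limitin (seminorm_topology S P) f l sequentially" and P: "P \<noteq> {}" "p \<in> P" and p: "p (l - l) = 0" and e: "0 < e"
  shows "\<forall>\<^sub>F n in sequentially. p (f n - l) < e"
proof -
  have l: "l \<in> S" using limitin_topspace[OF lim] topspace_seminorm_topology[OF P(1)] by simp
  have "\<forall>\<^sub>F n in sequentially. f n \<in> {y \<in> S. p (y - l) < e}"
  proof -
    have "l \<in> {y \<in> S. p (y - l) < e}" using l p e by simp
    with lim openin_seminorm_ball[OF P(2) l e] show ?thesis unfolding limitin_def by blast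
  qed
  then show ?thesis by (rule eventually_mono) simp
qed

lemma normal_functionals_diff:
  assumes "\<omega> \<in> normal_functionals m" "\<eta> \<in> normal_functionals m"
  shows "\<omega> - \<eta> \<in> normal_functionals m"
  using assms by (simp add: normal_functionals_def algebra_simps)

lemma charges_functional: "\<omega> \<in> charges m \<Longrightarrow> \<omega> \<in> normal_functionals m"
  by (simp add: charges_def)

lemma charges_diff:
  assumes "\<omega> \<in> charges m" "\<eta> \<in> charges m" shows "\<omega> - \<eta> \<in> charges m"
  unfolding charges_def
proof (intro CollectI conjI allI impI)
  show "\<omega> - \<eta> \<in> normal_functionals m" using assms normal_functionals_diff charges_functional by blast
  fix T :: "nat \<Rightarrow> 'a current"
  assume "(\<forall>n. T n \<in> normal_currents m) \<and> (\<lambda>n. flat_norm m (T n)) \<longlonglongrightarrow> 0 \<and>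
    (SUP n. normal_mass m (T n)) < \<infinity> \<and> bounded (\<Union>n. spt m (T n))"
  then have "(\<lambda>n. \<omega> (T n)) \<longlonglongrightarrow> 0" "(\<lambda>n. \<eta> (T n)) \<longlonglongrightarrow> 0" using assms unfolding charges_def by blast+
  from tendsto_diff[OF this] show "(\<lambda>n. (\<omega> - \<eta>) (T n)) \<longlonglongrightarrow> 0" by simp
qed

lemma normal_cmult:
  assumes T: "T \<in> normal_currents_in m K" and K: "compact K"
  shows "(\<lambda>\<phi>. c * T \<phi>) \<in> normal_currents_in m K" "real_normal_mass m (\<lambda>\<phi>. c * T \<phi>) \<le> \<bar>c\<bar> * real_normal_mass m T"
  using normal_comb[OF T T K, of c 0] by simp_all

lemma normal_functional_cmult:
  "\<omega> \<in> normal_functionals m \<Longrightarrow> T \<in> normal_currents m \<Longrightarrow> \<omega> (\<lambda>\<phi>. c * T \<phi>) = c * \<omega> T"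
  by (simp add: normal_functionals_def)

lemma normal_mass_le_iff: "T \<in> normal_currents m \<Longrightarrow> normal_mass m T \<le> ereal c \<longleftrightarrow> real_normal_mass m T \<le> c"
  using real_normal_mass(1) by (metis ereal_less_eq(3))

text \<open>If the values were unbounded, currents on which the charge exceeds n + 1, divided by n +
  1, would tend to 0 in normal mass, hence in flat norm, within a fixed compact set, while the
  charge stays at least 1 on them. The supremum in \<open>charge_seminorm\<close> is therefore over
  a bounded set.\<close>

lemma charge_bounded:
  assumes \<omega>: "\<omega> \<in> charges m" and K: "compact K"
  shows "\<exists>C. \<forall>T\<in>normal_currents_in m K. real_normal_mass m T \<le> 1 \<longrightarrow> \<omega> T \<le> C"
proof (rule ccontr)
  assume "\<not> ?thesis"
  then have "\<forall>n. \<exists>T\<in>normal_currents_in m K. real_normal_mass m T \<le> 1 \<and> real (Suc n) < \<omega> T" by (meson not_le_imp_less)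
  then obtain T where T: "\<And>n. T n \<in> normal_currents_in m K" "\<And>n. real_normal_mass m (T n) \<le> 1" "\<And>n. real (Suc n) < \<omega> (T n)"
    by metis
  define R where "R n = (\<lambda>\<phi>. inverse (real (Suc n)) * T n \<phi>)" for n
  have RK: "R n \<in> normal_currents_in m K" for n
    unfolding R_def by (rule normal_cmult(1)[OF T(1) K])
  note nR = normal_currents_inD(1)[OF RK]
  have NR: "real_normal_mass m (R n) \<le> inverse (real (Suc n))" for n
  proof -
    have "real_normal_mass m (R n) \<le> \<bar>inverse (real (Suc n))\<bar> * real_normal_mass m (T n)"
      unfolding R_def by (rule normal_cmult(2)[OF T(1) K])
    also have "\<dots> \<le> \<bar>inverse (real (Suc n))\<bar> * 1" by (intro mult_left_mono T) simp
    finally show ?thesis by simp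
  qed
  have "0 \<le> real_flat_norm m (R n)" "real_flat_norm m (R n) \<le> inverse (real (Suc n))" for n
    using real_flat_norm(2,3)[OF nR, of n] NR[of n] by linarith+
  then have "(\<lambda>n. real_flat_norm m (R n)) \<longlonglongrightarrow> 0"
    by (intro tendsto_sandwich[OF _ _ tendsto_const LIMSEQ_inverse_real_of_nat] always_eventually allI)
  then have "(\<lambda>n. flat_norm m (R n)) \<longlonglongrightarrow> 0"
    by (subst real_flat_norm(1)[OF nR]) (simp add: zero_ereal_def)
  moreover have "(SUP n. normal_mass m (R n)) < \<infinity>"
  proof -
    have "(SUP n. normal_mass m (R n)) \<le> ereal 1"
    proof (rule SUP_least)
      fix n
      have "inverse (real (Suc n)) \<le> 1" by (simp add: field_simps)
      then show "normal_mass m (R n) \<le> ereal 1" using NR[of n] normal_mass_le_iff[OF nR, of n 1] by linarith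
    qed
    then show ?thesis by (rule le_less_trans) simp
  qed
  moreover have "bounded (\<Union>n. spt m (R n))"
    by (rule bounded_subset[OF compact_imp_bounded[OF K]]) (use normal_currents_inD(2)[OF RK] in blast)
  ultimately have "(\<lambda>n. \<omega> (R n)) \<longlonglongrightarrow> 0" using \<omega> nR unfolding charges_def by blast
  moreover have "1 \<le> \<omega> (R n)" for n
    unfolding R_def normal_functional_cmult[OF charges_functional[OF \<omega>] normal_currents_inD(1)[OF T(1)]]
    using T(3)[of n] by (simp add: field_simps)
  ultimately have "(1::real) \<le> 0" by (intro tendsto_lowerbound[where F = sequentially]) auto
  then show False by simp
qed

lemma zero_current_mass: "real_normal_mass m (\<lambda>(\<phi> :: 'a::euclidean_space form). 0) = 0"
proof -
  have z: "(\<lambda>(\<phi> :: 'a form). 0) \<in> normal_currents_in m {}" by (rule zero_current_normal[OF compact_empty])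
  have "real_normal_mass m (\<lambda>(\<phi> :: 'a form). 0 * 0) \<le> \<bar>0\<bar> * real_normal_mass m (\<lambda>(\<phi> :: 'a form). 0)"
    by (rule normal_cmult(2)[OF z compact_empty])
  with real_normal_mass(2)[OF normal_currents_inD(1)[OF z]] show ?thesis
    unfolding mult_zero_left abs_zero by (rule antisym[rotated])
qed

lemma charge_seminorm_le:
  fixes \<omega> :: "'a::euclidean_space charge"
  assumes K: "compact K" and le: "\<And>T. T \<in> normal_currents_in m K \<Longrightarrow> real_normal_mass m T \<le> 1 \<Longrightarrow> \<omega> T \<le> c"
  shows "charge_seminorm m K \<omega> \<le> c"
  unfolding charge_seminorm_def
proof (rule cSUP_least)
  note z = zero_current_normal[OF K, where m=m]
  have "normal_mass m (\<lambda>(\<phi> :: 'a form). 0) \<le> ereal 1"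
    unfolding normal_mass_le_iff[OF normal_currents_inD(1)[OF z]] zero_current_mass by simp
  with z have "(\<lambda>\<phi>. 0) \<in> {T \<in> normal_currents_in m K. normal_mass m T \<le> 1}" by (simp add: one_ereal_def)
  then show "{T \<in> normal_currents_in m K. normal_mass m T \<le> 1} \<noteq> {}" by blast
next
  fix T assume "T \<in> {T \<in> normal_currents_in m K. normal_mass m T \<le> 1}"
  then show "\<omega> T \<le> c" using le normal_mass_le_iff[of T m 1] normal_currents_inD(1) by (auto simp: one_ereal_def)
qed

lemma charge_seminorm_ge:
  assumes \<omega>: "\<omega> \<in> charges m" and K: "compact K" and T: "T \<in> normal_currents_in m K" "real_normal_mass m T \<le> 1"
  shows "\<omega> T \<le> charge_seminorm m K \<omega>"
  unfolding charge_seminorm_def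
proof (rule cSUP_upper)
  show "T \<in> {T \<in> normal_currents_in m K. normal_mass m T \<le> 1}"
    using T normal_mass_le_iff[of T m 1] normal_currents_inD(1) by (auto simp: one_ereal_def)
  obtain C where C: "\<forall>T\<in>normal_currents_in m K. real_normal_mass m T \<le> 1 \<longrightarrow> \<omega> T \<le> C"
    using charge_bounded[OF \<omega> K] by blast
  show "bdd_above (\<omega> ` {T \<in> normal_currents_in m K. normal_mass m T \<le> 1})"
  proof (rule bdd_aboveI2)
    fix T assume "T \<in> {T \<in> normal_currents_in m K. normal_mass m T \<le> 1}"
    then show "\<omega> T \<le> C" using C normal_mass_le_iff[of T m 1] normal_currents_inD(1) by (auto simp: one_ereal_def)
  qed
qed

lemma charge_seminorm_nonneg:
  fixes \<omega> :: "'a::euclidean_space charge"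
  assumes \<omega>: "\<omega> \<in> charges m" and K: "compact K" shows "0 \<le> charge_seminorm m K \<omega>"
proof -
  have "real_normal_mass m (\<lambda>(\<phi> :: 'a form). 0) \<le> 1" unfolding zero_current_mass by simp
  from charge_seminorm_ge[OF \<omega> K zero_current_normal[OF K] this] show ?thesis
    by (simp only: normal_functional_zero[OF charges_functional[OF \<omega>]])
qed

text \<open>Homogeneity: \<open>T\<close> divided by any number exceeding its normal mass is
  admissible in the supremum, with either sign. Letting that number decrease covers currents of
  normal mass 0.\<close>

lemma charge_seminorm_bound:
  assumes \<omega>: "\<omega> \<in> charges m" and K: "compact K" and T: "T \<in> normal_currents_in m K"
  shows "\<bar>\<omega> T\<bar> \<le> charge_seminorm m K \<omega> * real_normal_mass m T"
proof (rule le_mult_limit)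
  show N: "0 \<le> real_normal_mass m T" by (rule real_normal_mass(2)[OF normal_currents_inD(1)[OF T]])
  fix B assume B: "real_normal_mass m T < B"
  have "c * \<omega> T \<le> charge_seminorm m K \<omega>" if c: "\<bar>c\<bar> = 1 / B" for c
  proof -
    have "\<bar>c\<bar> * real_normal_mass m T \<le> 1" unfolding c using B N by simp
    then have "real_normal_mass m (\<lambda>\<phi>. c * T \<phi>) \<le> 1" using normal_cmult(2)[OF T K, of c] by linarith
    from charge_seminorm_ge[OF \<omega> K normal_cmult(1)[OF T K] this] show ?thesis
      by (simp add: normal_functional_cmult[OF charges_functional[OF \<omega>] normal_currents_inD(1)[OF T]])
  qed
  from this[of "1/B"] this[of "-(1/B)"] show "\<bar>\<omega> T\<bar> \<le> charge_seminorm m K \<omega> * B"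
    using B N by (auto simp: field_simps abs_le_iff)
qed

lemma charge_seminorm_triangle:
  assumes "x \<in> charges m" "y \<in> charges m" "z \<in> charges m" and K: "compact K"
  shows "charge_seminorm m K (x - z) \<le> charge_seminorm m K (x - y) + charge_seminorm m K (y - z)"
proof (rule charge_seminorm_le[OF K])
  fix T assume T: "T \<in> normal_currents_in m K" "real_normal_mass m T \<le> 1"
  show "(x - z) T \<le> charge_seminorm m K (x - y) + charge_seminorm m K (y - z)"
    using charge_seminorm_ge[OF charges_diff[OF assms(1,2)] K T] charge_seminorm_ge[OF charges_diff[OF assms(2,3)] K T]
    by simp
qed

lemma charge_topology_limitI:
  fixes l :: "'a::euclidean_space charge"
  assumes "\<And>n. f n \<in> charges m" "l \<in> charges m" "\<And>K. compact K \<Longrightarrow> (\<lambda>n. charge_seminorm m K (f n - l)) \<longlonglongrightarrow> 0"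
  shows "limitin (charge_topology m) f l sequentially"
  unfolding charge_topology_def
proof (rule limitin_seminorm_topologyI[OF assms(1,2)])
  show "{charge_seminorm m K | K. compact K} \<noteq> {}" using compact_empty by blast
next
  fix p :: "'a charge \<Rightarrow> real" and x y z :: "'a charge"
  assume p: "p \<in> {charge_seminorm m K | K. compact K}" and xyz: "x \<in> charges m" "y \<in> charges m" "z \<in> charges m"
  from p obtain K where "p = charge_seminorm m K" "compact K" by blast
  then show "p (x - z) \<le> p (x - y) + p (y - z)" using charge_seminorm_triangle[OF xyz] by simp
next
  fix p :: "'a charge \<Rightarrow> real" assume "p \<in> {charge_seminorm m K | K. compact K}"
  then show "(\<lambda>n. p (f n - l)) \<longlonglongrightarrow> 0" using assms(3) by blast
qed

lemma charge_topology_limitD: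
  assumes lim: "limitin (charge_topology m) f l sequentially" and f: "\<And>n. f n \<in> charges m" and l: "l \<in> charges m" and K: "compact K"
  shows "(\<lambda>n. charge_seminorm m K (f n - l)) \<longlonglongrightarrow> 0"
proof -
  have z: "charge_seminorm m K (l - l) = 0"
    by (intro antisym charge_seminorm_le[OF K] charge_seminorm_nonneg[OF charges_diff[OF l l] K]) simp
  have "\<forall>\<^sub>F n in sequentially. charge_seminorm m K (f n - l) < e" if e: "0 < e" for e
    by (rule limitin_seminorm_topologyD[where p="charge_seminorm m K", OF lim[unfolded charge_topology_def] _ _ z e]) (use K in blast)+
  then show ?thesis
  proof (rule order_tendstoI[rotated])
    fix a :: real assume a: "a < 0"
    have "a < charge_seminorm m K (f n - l)" for n
      using charge_seminorm_nonneg[OF charges_diff[OF f l] K, of n] a by linarith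
    then show "\<forall>\<^sub>F n in sequentially. a < charge_seminorm m K (f n - l)" by (simp add: always_eventually)
  qed
qed

lemma fractional_seminorm_le: "fractional_bound m \<alpha> K \<omega> C \<Longrightarrow> fractional_seminorm m \<alpha> K \<omega> \<le> C"
  unfolding fractional_seminorm_def by (rule cInf_lower) (auto intro!: bdd_belowI[where m=0] simp: fractional_bound_def)

text \<open>The infimum of the admissible constants is attained: where the interpolated norm of
  \<open>T\<close> is positive one divides by it, and where it vanishes any admissible constant
  shows that the charge vanishes.\<close>

lemma fractional_seminorm_bound:
  assumes \<omega>: "\<omega> \<in> fractional_charges m \<alpha>" and K: "compact K"
  shows "fractional_bound m \<alpha> K \<omega> (fractional_seminorm m \<alpha> K \<omega>)"
  unfolding fractional_bound_def mult.assoc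
proof (intro conjI ballI)
  let ?X = "{C. fractional_bound m \<alpha> K \<omega> C}"
  have X: "?X \<noteq> {}" using fractional_chargesD(2)[OF \<omega> K] by blast
  show "0 \<le> fractional_seminorm m \<alpha> K \<omega>"
    unfolding fractional_seminorm_def using X fractional_boundD(1) by (intro cInf_greatest) blast+
  fix T assume T: "T \<in> normal_currents_in m K"
  let ?g = "real_normal_mass m T powr (1 - \<alpha>) * real_flat_norm m T powr \<alpha>"
  have g: "\<bar>\<omega> T\<bar> \<le> C * ?g" if "C \<in> ?X" for C
    using fractional_boundD(2)[of m \<alpha> K \<omega> C, OF _ T] that by (simp add: mult.assoc)
  have g0: "0 \<le> ?g" by simp
  show "\<bar>\<omega> T\<bar> \<le> fractional_seminorm m \<alpha> K \<omega> * ?g"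
  proof (cases "?g = 0")
    case True
    obtain C where "C \<in> ?X" using X by blast
    from g[OF this] show ?thesis unfolding True by simp
  next
    case False
    then have "0 < ?g" using g0 by linarith
    moreover from this have "\<bar>\<omega> T\<bar> / ?g \<le> fractional_seminorm m \<alpha> K \<omega>"
      unfolding fractional_seminorm_def by (intro cInf_greatest X) (simp only: pos_divide_le_eq g)
    ultimately show ?thesis by (simp only: pos_divide_le_eq)
  qed
qed

lemma fractional_bound_add:
  assumes "fractional_bound m \<alpha> K \<omega> A" "fractional_bound m \<alpha> K \<eta> B"
  shows "fractional_bound m \<alpha> K (\<lambda>T. \<omega> T + \<eta> T) (A + B)"
  unfolding fractional_bound_def
proof (intro conjI ballI)
  fix T assume "T \<in> normal_currents_in m K"
  from fractional_boundD(2)[OF assms(1) this] fractional_boundD(2)[OF assms(2) this]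
  show "\<bar>\<omega> T + \<eta> T\<bar> \<le> (A + B) * real_normal_mass m T powr (1 - \<alpha>) * real_flat_norm m T powr \<alpha>"
    by (simp add: distrib_right)
qed (rule add_nonneg_nonneg[OF fractional_boundD(1)[OF assms(1)] fractional_boundD(1)[OF assms(2)]])

lemma fractional_bound_diff:
  assumes "fractional_bound m \<alpha> K \<omega> A" "fractional_bound m \<alpha> K \<eta> B"
  shows "fractional_bound m \<alpha> K (\<omega> - \<eta>) (A + B)"
proof -
  have "fractional_bound m \<alpha> K (\<lambda>T. - \<eta> T) B" using assms(2) by (simp add: fractional_bound_def)
  from fractional_bound_add[OF assms(1) this] show ?thesis by (simp add: fun_diff_def)
qed

lemma fractional_charges_diff:
  fixes \<omega> :: "'a::euclidean_space charge"
  assumes "\<omega> \<in> fractional_charges m \<alpha>" "\<eta> \<in> fractional_charges m \<alpha>"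
  shows "\<omega> - \<eta> \<in> fractional_charges m \<alpha>"
  unfolding fractional_charges_def
proof (intro CollectI conjI allI impI)
  show "\<omega> - \<eta> \<in> normal_functionals m" by (rule normal_functionals_diff[OF assms[THEN fractional_chargesD(1)]])
  fix K :: "'a set" assume K: "compact K"
  show "\<exists>C. fractional_bound m \<alpha> K (\<omega> - \<eta>) C"
    using fractional_bound_diff[OF fractional_seminorm_bound[OF assms(1) K] fractional_seminorm_bound[OF assms(2) K]] by blast
qed

text \<open>With a positive exponent, bounded normal masses and flat norms tending to 0 make the
  interpolated bound tend to 0. The closure of the union of the supports is the compact set on which
  the bound is taken.\<close>

lemma fractional_charges_charges:
  fixes \<omega> :: "'a::euclidean_space charge"
  assumes \<omega>: "\<omega> \<in> fractional_charges m \<alpha>" and \<alpha>: "0 < \<alpha>" "\<alpha> \<le> 1"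
  shows "\<omega> \<in> charges m"
  unfolding charges_def
proof (intro CollectI conjI allI impI, rule fractional_chargesD(1)[OF \<omega>], elim conjE)
  fix T :: "nat \<Rightarrow> 'a current"
  assume T: "\<forall>n. T n \<in> normal_currents m" and F: "(\<lambda>n. flat_norm m (T n)) \<longlonglongrightarrow> 0"
    and N: "(SUP n. normal_mass m (T n)) < \<infinity>" and b: "bounded (\<Union>n. spt m (T n))"
  let ?K = "closure (\<Union>n. spt m (T n))"
  have K: "compact ?K" using b by (simp add: compact_closure)
  have TK: "T n \<in> normal_currents_in m ?K" for n
    using T closure_subset[of "\<Union>n. spt m (T n)"] unfolding normal_currents_in_def by blast
  obtain C where C: "fractional_bound m \<alpha> ?K \<omega> C" using fractional_chargesD(2)[OF \<omega> K] by blast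
  let ?M = "real_of_ereal (SUP n. normal_mass m (T n))"
  have up: "normal_mass m (T n) \<le> (SUP n. normal_mass m (T n))" for n by (rule SUP_upper) simp
  \<comment> \<open>Nonnegativity of one term excludes the value minus infinity, so the supremum is
    a real number.\<close>
  have "0 \<le> normal_mass m (T 0)" using real_normal_mass[OF T[rule_format], of 0] by (metis ereal_less_eq(5))
  then have "(SUP n. normal_mass m (T n)) = ereal ?M"
    using N up[of 0] by (cases "SUP n. normal_mass m (T n)") auto
  then have M: "real_normal_mass m (T n) \<le> ?M" for n
    using up[of n] normal_mass_le_iff[OF T[rule_format]] by metis
  have F': "(\<lambda>n. real_flat_norm m (T n)) \<longlonglongrightarrow> 0"
    by (rule lim_real_of_ereal) (use F in \<open>simp add: zero_ereal_def\<close>)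
  define N where "N = ?M powr (1 - \<alpha>)"
  have le: "\<bar>\<omega> (T n)\<bar> \<le> C * N * real_flat_norm m (T n) powr \<alpha>" for n
    unfolding N_def by (rule fractional_bound_powr_le[OF C TK less_imp_le[OF \<alpha>(1)] \<alpha>(2) M order_refl])
  have ev: "\<forall>\<^sub>F n in sequentially. 0 \<le> real_flat_norm m (T n)"
    by (rule always_eventually, rule allI, rule real_flat_norm(2)[OF T[rule_format]])
  have "(\<lambda>n. real_flat_norm m (T n) powr \<alpha>) \<longlonglongrightarrow> 0"
    by (rule tendsto_zero_powrI[OF F' tendsto_const ev \<alpha>(1)])
  then have lim: "(\<lambda>n. C * N * real_flat_norm m (T n) powr \<alpha>) \<longlonglongrightarrow> 0"
    by (rule tendsto_mult_right_zero)
  show "(\<lambda>n. \<omega> (T n)) \<longlonglongrightarrow> 0"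
  proof (rule Lim_null_comparison[OF _ lim])
    show "\<forall>\<^sub>F n in sequentially. norm (\<omega> (T n)) \<le> C * N * real_flat_norm m (T n) powr \<alpha>"
      unfolding real_norm_def by (rule always_eventually, rule allI, rule le)
  qed
qed

section \<open>Charges associated with smooth forms\<close>

lemma form_bounded_on_compact:
  assumes \<omega>: "\<omega> \<in> smooth_forms m" and K: "compact K"
  obtains B where "0 \<le> B" "form_le m K B \<omega>"
proof -
  have "\<exists>C\<ge>0. \<forall>x\<in>K. \<bar>\<omega> x v\<bar> \<le> C" for v
    using bounded_smooth_on_compact[OF smooth_forms_smooth[OF \<omega>] K] by metis
  then obtain C where C: "\<And>v. 0 \<le> C v" "\<And>v x. x \<in> K \<Longrightarrow> \<bar>\<omega> x v\<bar> \<le> C v" by metis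
  show thesis
  proof (rule that[of "\<Sum>I\<in>tuples m. C I"])
    show "0 \<le> (\<Sum>I\<in>tuples m. C I)" by (intro sum_nonneg C)
    show "form_le m K (\<Sum>I\<in>tuples m. C I) \<omega>"
      by (intro form_leI order_trans[OF multilin_bound[OF smooth_forms_multilin[OF \<omega>]]] sum_mono C)
  qed
qed

lemma flat_form_bounded_on_compact:
  assumes \<omega>: "\<omega> \<in> smooth_forms m" and K: "compact K"
  obtains B where "0 \<le> B" "flat_form_le m K B \<omega>"
proof -
  obtain B where B: "0 \<le> B" "form_le m K B \<omega>" by (rule form_bounded_on_compact[OF \<omega> K])
  obtain C where C: "0 \<le> C" "form_le (Suc m) K C (ext_deriv m \<omega>)" by (rule form_bounded_on_compact[OF smooth_forms_ext_deriv[OF \<omega>] K])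
  show thesis
    by (rule that[of "B + C"]) (use B C in \<open>auto simp: flat_form_le_def intro: form_le_mono\<close>)
qed

lemma charge_of_form_apply: "T \<in> normal_currents_in m K \<Longrightarrow> charge_of_form m \<omega> T = T \<omega>"
  by (simp add: charge_of_form_def normal_currents_in_def)

text \<open>Over a compact set a smooth form is bounded by the flat norm alone, and the flat norm is
  dominated by the interpolated norm because it does not exceed the normal mass.\<close>

lemma charge_of_form_fractional:
  fixes \<omega> :: "'a::euclidean_space form"
  assumes \<omega>: "\<omega> \<in> smooth_forms m" and \<alpha>: "0 \<le> \<alpha>" "\<alpha> \<le> 1"
  shows "charge_of_form m \<omega> \<in> fractional_charges m \<alpha>"
  unfolding fractional_charges_def
proof (intro CollectI conjI allI impI)
  show "charge_of_form m \<omega> \<in> normal_functionals m"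
    using normal_comb_UNIV[where c=1 and d=1] normal_comb_UNIV[where d=0]
    by (fastforce simp: normal_functionals_def charge_of_form_def)
  fix K :: "'a set" assume K: "compact K"
  obtain B where B: "0 \<le> B" "flat_form_le m (thick 1 K) B \<omega>"
    by (rule flat_form_bounded_on_compact[OF \<omega> compact_thick[OF K]])
  obtain C where C: "1 \<le> C"
    "\<And>T \<omega> B. T \<in> normal_currents_in m K \<Longrightarrow> \<omega> \<in> smooth_forms m \<Longrightarrow> 0 \<le> B \<Longrightarrow> flat_form_le m (thick 1 K) B \<omega> \<Longrightarrow>
      \<bar>T \<omega>\<bar> \<le> C * real_flat_norm m T * B"
    by (rule flat_norm_local[OF K zero_less_one]) blast
  have "fractional_bound m \<alpha> K (charge_of_form m \<omega>) (C * B)"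
    unfolding fractional_bound_def
  proof (intro conjI ballI)
    fix T assume T: "T \<in> normal_currents_in m K"
    let ?F = "real_flat_norm m T" and ?N = "real_normal_mass m T"
    note nF = real_flat_norm[OF normal_currents_inD(1)[OF T]]
    have "?F = ?F powr (1 - \<alpha>) * ?F powr \<alpha>"
      by (simp only: powr_add[symmetric] diff_add_cancel powr_one[OF nF(2)])
    also have "\<dots> \<le> ?N powr (1 - \<alpha>) * ?F powr \<alpha>"
      using nF \<alpha> by (intro mult_right_mono powr_mono2) auto
    finally have "C * B * ?F \<le> C * B * (?N powr (1 - \<alpha>) * ?F powr \<alpha>)"
      using B(1) C(1) by (intro mult_left_mono) auto
    then show "\<bar>charge_of_form m \<omega> T\<bar> \<le> C * B * ?N powr (1 - \<alpha>) * ?F powr \<alpha>"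
      using C(2)[OF T \<omega> B] by (simp add: charge_of_form_apply[OF T] ac_simps)
  qed (use B(1) C(1) in simp)
  then show "\<exists>C. fractional_bound m \<alpha> K (charge_of_form m \<omega>) C" by blast
qed

text \<open>The forms themselves now replace the finer approximation in the telescoping: one term
  pairs an error with the size of a mollified form, the other pairs an error with a fixed bound for
  \<open>\<omega>\<close>. The resulting powers of the scale, \<alpha> + \<beta> - 1 and \<beta>,
  are both positive.\<close>

lemma charge_wedge_of_forms:
  fixes \<omega> \<eta> :: "'a::euclidean_space form" and \<alpha> \<beta> :: real
  assumes \<omega>: "\<omega> \<in> smooth_forms m" and \<eta>: "\<eta> \<in> smooth_forms m'"
    and \<alpha>: "0 < \<alpha>" "\<alpha> \<le> 1" and \<beta>: "0 < \<beta>" "\<beta> \<le> 1" and \<gamma>: "1 < \<alpha> + \<beta>"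
  shows "charge_wedge m m' (charge_of_form m \<omega>) (charge_of_form m' \<eta>) = charge_of_form (m + m') (wedge_form m m' \<omega> \<eta>)"
proof
  fix T :: "'a current"
  let ?\<omega> = "charge_of_form m \<omega>" and ?\<eta> = "charge_of_form m' \<eta>"
  show "charge_wedge m m' ?\<omega> ?\<eta> T = charge_of_form (m + m') (wedge_form m m' \<omega> \<eta>) T"
  proof (cases "T \<in> normal_currents (m + m')")
    case nT: True
    define K where "K = spt (m + m') T"
    have K: "compact K" unfolding K_def by (rule compact_spt[OF normal_currents_currents[OF nT]])
    have T: "T \<in> normal_currents_in (m + m') K" unfolding K_def by (rule normal_currents_in_spt[OF nT])
    let ?a = "approx_form m ?\<omega>" and ?b = "approx_form m' ?\<eta>" and ?N = "real_normal_mass (m + m') T"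
    note \<alpha>' = less_imp_le[OF \<alpha>(1)] \<alpha>(2) and \<beta>' = less_imp_le[OF \<beta>(1)] \<beta>(2)
    note f\<omega> = charge_of_form_fractional[OF \<omega> \<alpha>'] and f\<eta> = charge_of_form_fractional[OF \<eta> \<beta>']
    note K1 = compact_thick[OF K, of 1]
    note sa = smooth_forms_approx[OF f\<omega> \<alpha>'] and sb = smooth_forms_approx[OF f\<eta> \<beta>']
    obtain A where A: "fractional_bound m \<alpha> (thick 1 (thick 1 K)) ?\<omega> A"
      using fractional_chargesD(2)[OF f\<omega> compact_thick[OF K1]] by blast
    obtain B where B: "fractional_bound m' \<beta> (thick 1 (thick 1 K)) ?\<eta> B"
      using fractional_chargesD(2)[OF f\<eta> compact_thick[OF K1]] by blast
    note A0 = fractional_boundD(1)[OF A] and B0 = fractional_boundD(1)[OF B]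
    obtain D where D: "0 \<le> D" "flat_form_le m (thick 1 K) D \<omega>"
      by (rule flat_form_bounded_on_compact[OF \<omega> K1])
    define E where "E = eval_const TYPE('a) m'"
    have E: "0 \<le> E" unfolding E_def using eval_const_ge_1[where 'a='a, of m'] by linarith
    have c1: "\<bar>S (\<lambda>x v. ?a n x v - \<omega> x v)\<bar> \<le> (2 * A * moll_scale n powr \<alpha>) * real_normal_mass m S"
      if S: "S \<in> normal_currents_in m (thick 1 K)" for S n
      using approx_form_close[OF f\<omega> \<alpha>' K1 A S, of n]
      by (simp only: charge_of_form_apply[OF S] form_functional_diff[OF normal_currents_functional[OF normal_currents_inD(1)[OF S]] sa \<omega>])
    have c2: "\<bar>S (\<lambda>x v. ?b n x v - \<eta> x v)\<bar> \<le> (2 * B * moll_scale n powr \<beta>) * real_normal_mass m' S"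
      if S: "S \<in> normal_currents_in m' (thick 1 K)" for S n
      using approx_form_close[OF f\<eta> \<beta>' K1 B S, of n]
      by (simp only: charge_of_form_apply[OF S] form_functional_diff[OF normal_currents_functional[OF normal_currents_inD(1)[OF S]] sb \<eta>])
    define G where "G n = slice_const m m' * (2 * A * moll_scale n powr \<alpha>) * (E * B * moll_scale n powr (\<beta> - 1)) * ?N
      + slice_const m m' * (2 * B * moll_scale n powr \<beta>) * D * ?N" for n
    have le: "\<bar>T (wedge_form m m' (?a n) (?b n)) - T (wedge_form m m' \<omega> \<eta>)\<bar> \<le> G n" for n
    proof -
      have "\<bar>T (wedge_form m m' (\<lambda>x v. ?a n x v - \<omega> x v) (?b n))\<bar>
        \<le> slice_const m m' * (2 * A * moll_scale n powr \<alpha>) * (E * B * moll_scale n powr (\<beta> - 1)) * ?N"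
        unfolding E_def
        by (rule slice_left[OF T K smooth_forms_diff[OF sa \<omega>] sb approx_form_flat_le[OF f\<eta> \<beta>' B] _ _ c1])
          (use A0 B0 E in \<open>simp_all add: E_def\<close>)
      moreover have "\<bar>T (wedge_form m m' \<omega> (\<lambda>x v. ?b n x v - \<eta> x v))\<bar> \<le> slice_const m m' * (2 * B * moll_scale n powr \<beta>) * D * ?N"
        by (rule slice_right[OF T K \<omega> D(2) smooth_forms_diff[OF sb \<eta>] D(1) _ c2]) (use B0 in simp)
      ultimately show ?thesis
        unfolding wedge_form_diff[OF sa \<omega> sb \<eta> normal_currents_functional[OF nT]] G_def by linarith
    qed
    have "G = (\<lambda>n. (slice_const m m' * 2 * A * E * B * ?N) * moll_scale n powr (\<alpha> + \<beta> - 1) + (slice_const m m' * 2 * B * D * ?N) * moll_scale n powr \<beta>)"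
    proof
      fix n
      have "moll_scale n powr (\<alpha> + \<beta> - 1) = moll_scale n powr \<alpha> * moll_scale n powr (\<beta> - 1)"
        by (simp add: powr_add[symmetric] add_diff_eq)
      then show "G n = (slice_const m m' * 2 * A * E * B * ?N) * moll_scale n powr (\<alpha> + \<beta> - 1) + (slice_const m m' * 2 * B * D * ?N) * moll_scale n powr \<beta>"
        unfolding G_def by (simp only: ac_simps)
    qed
    moreover have "(\<lambda>n. (slice_const m m' * 2 * A * E * B * ?N) * moll_scale n powr (\<alpha> + \<beta> - 1) + (slice_const m m' * 2 * B * D * ?N) * moll_scale n powr \<beta>) \<longlonglongrightarrow> 0"
      by (intro tendsto_add_zero tendsto_mult_right_zero moll_scale_powr_tendsto) (use \<gamma> \<beta> in simp_all)
    ultimately have G: "G \<longlonglongrightarrow> 0" by (simp only:)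
    have "(\<lambda>n. T (wedge_form m m' (?a n) (?b n)) - T (wedge_form m m' \<omega> \<eta>)) \<longlonglongrightarrow> 0"
      by (rule Lim_null_comparison[OF always_eventually G]) (unfold real_norm_def, rule allI, rule le)
    then have "(\<lambda>n. T (wedge_form m m' (?a n) (?b n))) \<longlonglongrightarrow> T (wedge_form m m' \<omega> \<eta>)"
      by (simp add: LIM_zero_iff)
    from LIMSEQ_unique[OF charge_wedge_tendsto[OF f\<omega> \<alpha>' f\<eta> \<beta>' \<gamma> nT] this]
    show ?thesis by (simp only: charge_of_form_apply[OF T])
  qed (simp add: charge_wedge_def charge_of_form_def)
qed

text \<open>Dual to the fact that mollification preserves bounds on a form and on its exterior
  derivative.\<close>

lemma moll_current_flat_le:
  fixes T :: "'a::euclidean_space current"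
  assumes T: "T \<in> normal_currents_in m K" and K: "compact K" and e: "0 < e"
  shows "real_flat_norm m (moll_current m e T) \<le> real_flat_norm m T"
proof (rule real_flat_norm_leI[OF normal_currents_inD(1)[OF moll_current_normal(1)[OF T K e]]])
  fix \<zeta> :: "'a form" and B assume \<zeta>: "\<zeta> \<in> smooth_forms m" and B: "0 < B" "flat_form_le m UNIV B \<zeta>"
  have B': "form_le m (thick e UNIV) B \<zeta>" "form_le (Suc m) (thick e UNIV) B (ext_deriv m \<zeta>)"
    using B(2) by (auto simp: flat_form_le_def intro: form_le_mono)
  have "flat_form_le m UNIV B (smear_form e moll \<zeta>)"
    unfolding flat_form_le_def ext_deriv_average[OF averaging_smear[OF smooth_moll] \<zeta>]
    using form_le_moll[OF \<zeta> less_imp_le[OF e] B'(1)] form_le_moll[OF smooth_forms_ext_deriv[OF \<zeta>] less_imp_le[OF e] B'(2)] by blast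
  from real_flat_norm_apply[OF normal_currents_inD(1)[OF T] smooth_forms_moll[OF \<zeta>] less_imp_le[OF B(1)] this]
  show "\<bar>moll_current m e T \<zeta>\<bar> \<le> real_flat_norm m T * B" using \<zeta> by (simp add: moll_current_def)
qed

lemma moll_current_scale:
  assumes T: "T \<in> normal_currents_in m K" and K: "compact K"
  shows "moll_current m (moll_scale n) T \<in> normal_currents_in m (thick 1 K)"
proof -
  have "thick (2 * moll_scale n) K \<subseteq> thick 1 K" using moll_scale(2)[of n] by (intro thick_mono) auto
  then show ?thesis by (rule normal_currents_in_mono[OF moll_current_normal(1)[OF T K moll_scale(1)]])
qed

text \<open>Uniformly in the scale, mollification is bounded in terms of the charge on a slightly
  larger compact set. Applied to differences, this turns convergence of charges into convergence of
  mollified forms.\<close>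

lemma approx_form_charge_le:
  assumes \<omega>: "locally_bounded m \<omega>" and K: "compact K"
    and s: "0 \<le> s" "\<And>T. T \<in> normal_currents_in m (thick 1 K) \<Longrightarrow> \<bar>\<omega> T\<bar> \<le> s * real_normal_mass m T"
    and T: "T \<in> normal_currents_in m K"
  shows "\<bar>T (approx_form m \<omega> n)\<bar> \<le> s * real_normal_mass m T"
proof -
  have "\<bar>\<omega> (moll_current m (moll_scale n) T)\<bar> \<le> s * real_normal_mass m (moll_current m (moll_scale n) T)"
    by (rule s(2)[OF moll_current_scale[OF T K]])
  also have "\<dots> \<le> s * real_normal_mass m T"
    by (rule mult_left_mono[OF moll_current_normal(2)[OF T K moll_scale(1)] s(1)])
  finally show ?thesis unfolding charge_form_apply[OF \<omega> T K moll_scale(1,3)] .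
qed

text \<open>The form acts on \<open>T\<close> as the charge acts on the mollified current, and
  mollification increases neither norm, so the constant of the charge works at all scales. This is
  the uniform bound contained in weak-* convergence.\<close>

lemma approx_form_fractional_bound:
  assumes \<omega>: "\<omega> \<in> fractional_charges m \<alpha>" "0 \<le> \<alpha>" "\<alpha> \<le> 1" and K: "compact K" and A: "fractional_bound m \<alpha> (thick 1 K) \<omega> A"
  shows "fractional_bound m \<alpha> K (charge_of_form m (approx_form m \<omega> n)) A"
  unfolding fractional_bound_def
proof (intro conjI ballI)
  show "0 \<le> A" by (rule fractional_boundD(1)[OF A])
  fix T assume T: "T \<in> normal_currents_in m K"
  show "\<bar>charge_of_form m (approx_form m \<omega> n) T\<bar> \<le> A * real_normal_mass m T powr (1 - \<alpha>) * real_flat_norm m T powr \<alpha>"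
    unfolding charge_of_form_apply[OF T] charge_form_apply[OF fractional_locally_bounded[OF \<omega>] T K moll_scale(1,3)]
    by (rule fractional_bound_powr_le[OF A moll_current_scale[OF T K] \<omega>(2,3) moll_current_normal(2)[OF T K moll_scale(1)]
          moll_current_flat_le[OF T K moll_scale(1)]])
qed

lemma approx_form_weakly_star_converges:
  fixes \<omega> :: "'a::euclidean_space charge"
  assumes \<omega>: "\<omega> \<in> fractional_charges m \<alpha>" and \<alpha>: "0 < \<alpha>" "\<alpha> \<le> 1"
  shows "weakly_star_converges m \<alpha> (\<lambda>n. charge_of_form m (approx_form m \<omega> n)) \<omega>"
  unfolding weakly_star_converges_def
proof (intro conjI allI impI)
  note \<alpha>' = less_imp_le[OF \<alpha>(1)] \<alpha>(2)
  show f: "charge_of_form m (approx_form m \<omega> n) \<in> fractional_charges m \<alpha>" for n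
    by (rule charge_of_form_fractional[OF smooth_forms_approx[OF \<omega> \<alpha>'] \<alpha>'])
  show "\<omega> \<in> fractional_charges m \<alpha>" by (rule \<omega>)
  note fc = fractional_charges_charges[OF _ \<alpha>]
  show "bdd_above (range (\<lambda>n. fractional_seminorm m \<alpha> K (charge_of_form m (approx_form m \<omega> n))))" if K: "compact K" for K
  proof -
    obtain A where A: "fractional_bound m \<alpha> (thick 1 K) \<omega> A" using fractional_chargesD(2)[OF \<omega> compact_thick[OF K]] by blast
    show ?thesis by (rule bdd_aboveI2[OF fractional_seminorm_le[OF approx_form_fractional_bound[OF \<omega> \<alpha>' K A]]])
  qed
  show "limitin (charge_topology m) (\<lambda>n. charge_of_form m (approx_form m \<omega> n)) \<omega> sequentially"
  proof (rule charge_topology_limitI[OF fc[OF f] fc[OF \<omega>]])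
    fix K :: "'a set" assume K: "compact K"
    obtain A where A: "fractional_bound m \<alpha> (thick 1 K) \<omega> A" using fractional_chargesD(2)[OF \<omega> compact_thick[OF K]] by blast
    have le: "charge_seminorm m K (charge_of_form m (approx_form m \<omega> n) - \<omega>) \<le> 2 * A * moll_scale n powr \<alpha>" for n
    proof (rule charge_seminorm_le[OF K])
      fix T assume T: "T \<in> normal_currents_in m K" "real_normal_mass m T \<le> 1"
      have "\<bar>T (approx_form m \<omega> n) - \<omega> T\<bar> \<le> 2 * A * moll_scale n powr \<alpha> * real_normal_mass m T"
        by (rule approx_form_close[OF \<omega> \<alpha>' K A T(1)])
      also have "\<dots> \<le> 2 * A * moll_scale n powr \<alpha> * 1"
        using T(2) fractional_boundD(1)[OF A] by (intro mult_left_mono) auto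
      finally show "(charge_of_form m (approx_form m \<omega> n) - \<omega>) T \<le> 2 * A * moll_scale n powr \<alpha>"
        by (simp add: charge_of_form_apply[OF T(1)])
    qed
    have lim: "(\<lambda>n. 2 * A * moll_scale n powr \<alpha>) \<longlonglongrightarrow> 0"
      by (rule tendsto_mult_right_zero[OF moll_scale_powr_tendsto[OF \<alpha>(1)]])
    show "(\<lambda>n. charge_seminorm m K (charge_of_form m (approx_form m \<omega> n) - \<omega>)) \<longlonglongrightarrow> 0"
      by (rule tendsto_sandwich[OF always_eventually always_eventually tendsto_const lim])
        (rule allI, rule charge_seminorm_nonneg[OF charges_diff[OF fc[OF f] fc[OF \<omega>]] K], rule allI, rule le)
  qed
qed

section \<open>Weak-* continuity and continuity of the wedge product\<close>

lemma fractional_bound_mono: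
  assumes f: "fractional_bound m \<alpha> K \<omega> A" and AB: "A \<le> B" shows "fractional_bound m \<alpha> K \<omega> B"
  unfolding fractional_bound_def mult.assoc
proof (intro conjI ballI)
  show "0 \<le> B" using fractional_boundD(1)[OF f] AB by linarith
  fix T assume T: "T \<in> normal_currents_in m K"
  have "\<bar>\<omega> T\<bar> \<le> A * (real_normal_mass m T powr (1 - \<alpha>) * real_flat_norm m T powr \<alpha>)"
    using fractional_boundD(2)[OF f T] by (simp only: mult.assoc)
  also have "\<dots> \<le> B * (real_normal_mass m T powr (1 - \<alpha>) * real_flat_norm m T powr \<alpha>)"
    using AB by (rule mult_right_mono) simp
  finally show "\<bar>\<omega> T\<bar> \<le> B * (real_normal_mass m T powr (1 - \<alpha>) * real_flat_norm m T powr \<alpha>)" .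
qed

lemma weakly_star_convergesD:
  fixes \<omega> :: "'a::euclidean_space charge"
  assumes w: "weakly_star_converges m \<alpha> \<omega>s \<omega>" and \<alpha>: "0 < \<alpha>" "\<alpha> \<le> 1"
  shows "\<omega>s n \<in> fractional_charges m \<alpha>" "\<omega> \<in> fractional_charges m \<alpha>"
    "compact K \<Longrightarrow> (\<lambda>n. charge_seminorm m K (\<omega>s n - \<omega>)) \<longlonglongrightarrow> 0"
    "compact K \<Longrightarrow> \<exists>A. fractional_bound m \<alpha> K \<omega> A \<and> (\<forall>n. fractional_bound m \<alpha> K (\<omega>s n) A)"
proof -
  show f: "\<omega>s n \<in> fractional_charges m \<alpha>" "\<omega> \<in> fractional_charges m \<alpha>" for n
    using w by (simp_all add: weakly_star_converges_def)
  note fc = fractional_charges_charges[OF _ \<alpha>]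
  have lim: "limitin (charge_topology m) \<omega>s \<omega> sequentially" using w by (simp add: weakly_star_converges_def)
  show "(\<lambda>n. charge_seminorm m K (\<omega>s n - \<omega>)) \<longlonglongrightarrow> 0" if "compact K"
    by (rule charge_topology_limitD[OF lim fc[OF f(1)] fc[OF f(2)] that])
  show "\<exists>A. fractional_bound m \<alpha> K \<omega> A \<and> (\<forall>n. fractional_bound m \<alpha> K (\<omega>s n) A)" if K: "compact K"
  proof -
    have "bdd_above (range (\<lambda>n. fractional_seminorm m \<alpha> K (\<omega>s n)))" using w K by (simp add: weakly_star_converges_def)
    then obtain M where M: "\<And>n. fractional_seminorm m \<alpha> K (\<omega>s n) \<le> M" unfolding bdd_above_def by blast
    let ?A = "max M (fractional_seminorm m \<alpha> K \<omega>)"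
    have "fractional_bound m \<alpha> K (\<omega>s n) ?A" for n
      by (rule fractional_bound_mono[OF fractional_seminorm_bound[OF f(1) K]]) (use M in \<open>simp add: le_max_iff_disj\<close>)
    moreover have "fractional_bound m \<alpha> K \<omega> ?A"
      by (rule fractional_bound_mono[OF fractional_seminorm_bound[OF f(2) K]]) simp
    ultimately show ?thesis by blast
  qed
qed

text \<open>The index \<open>n\<close> is fixed to make \<open>u n\<close> small, and only then does
  \<open>j\<close> tend to infinity: the coefficients \<open>P n\<close> and \<open>Q n\<close> may
  blow up with \<open>n\<close>.\<close>

lemma tendsto_zero_two_scales:
  fixes x :: "nat \<Rightarrow> real"
  assumes x: "\<And>j. 0 \<le> x j" and le: "\<And>n j. x j \<le> u n + P n * s j + Q n * t j"
    and lim: "u \<longlonglongrightarrow> 0" "s \<longlonglongrightarrow> 0" "t \<longlonglongrightarrow> 0"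
  shows "x \<longlonglongrightarrow> 0"
proof (rule order_tendstoI[rotated])
  fix e :: real assume e: "0 < e"
  from order_tendstoD(2)[OF lim(1), of "e / 2"] e obtain n where n: "u n < e / 2"
    by (auto simp: eventually_sequentially)
  have "(\<lambda>j. P n * s j + Q n * t j) \<longlonglongrightarrow> 0" by (intro tendsto_add_zero tendsto_mult_right_zero lim)
  from order_tendstoD(2)[OF this, of "e / 2"] e have "\<forall>\<^sub>F j in sequentially. P n * s j + Q n * t j < e / 2" by simp
  then show "\<forall>\<^sub>F j in sequentially. x j < e"
    by (rule eventually_mono) (use n le[of _ n] in \<open>smt (verit) field_sum_of_halves\<close>)
next
  fix a :: real assume "a < 0"
  then show "\<forall>\<^sub>F j in sequentially. a < x j" using x by (intro always_eventually allI) (rule less_le_trans)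
qed

text \<open>At a fixed scale the products of mollified forms converge, because slices are normal
  currents on which differences of charges are controlled by the charge seminorms. The distance from
  these products to the wedge products is small uniformly along the sequences, by the uniform
  fractional bounds.\<close>

lemma charge_wedge_weakly_star:
  fixes \<omega> \<eta> :: "'a::euclidean_space charge"
  assumes w\<omega>: "weakly_star_converges m \<alpha> \<omega>s \<omega>" and w\<eta>: "weakly_star_converges m' \<beta> \<eta>s \<eta>"
    and \<alpha>: "0 < \<alpha>" "\<alpha> \<le> 1" and \<beta>: "0 < \<beta>" "\<beta> \<le> 1" and \<gamma>: "1 < \<alpha> + \<beta>"
  shows "weakly_star_converges (m + m') (\<alpha> + \<beta> - 1) (\<lambda>n. charge_wedge m m' (\<omega>s n) (\<eta>s n)) (charge_wedge m m' \<omega> \<eta>)"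
proof -
  define g where "g = \<alpha> + \<beta> - 1"
  have g: "0 < g" "g \<le> 1" using \<gamma> \<alpha> \<beta> by (simp_all add: g_def)
  note \<alpha>' = less_imp_le[OF \<alpha>(1)] \<alpha>(2) and \<beta>' = less_imp_le[OF \<beta>(1)] \<beta>(2)
  note D\<omega> = weakly_star_convergesD[OF w\<omega> \<alpha>] and D\<eta> = weakly_star_convergesD[OF w\<eta> \<beta>]
  let ?W = "\<lambda>n. charge_wedge m m' (\<omega>s n) (\<eta>s n)" and ?w = "charge_wedge m m' \<omega> \<eta>"
  have f: "?W n \<in> fractional_charges (m + m') g" "?w \<in> fractional_charges (m + m') g" for n
    unfolding g_def by (rule charge_wedge_fractional[OF D\<omega>(1) \<alpha>' D\<eta>(1) \<beta>' \<gamma>], rule charge_wedge_fractional[OF D\<omega>(2) \<alpha>' D\<eta>(2) \<beta>' \<gamma>])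
  note fc = fractional_charges_charges[OF _ g]
  have "bdd_above (range (\<lambda>n. fractional_seminorm (m + m') g K (?W n)))" if K: "compact K" for K
  proof -
    let ?L = "thick 1 (thick 1 K)"
    have L: "compact ?L" by (intro compact_thick K)
    obtain A where A: "\<And>n. fractional_bound m \<alpha> ?L (\<omega>s n) A" using D\<omega>(4)[OF L] by blast
    obtain B where B: "\<And>n. fractional_bound m' \<beta> ?L (\<eta>s n) B" using D\<eta>(4)[OF L] by blast
    obtain C where C: "\<And>\<omega> \<eta> A B. \<omega> \<in> fractional_charges m \<alpha> \<Longrightarrow> \<eta> \<in> fractional_charges m' \<beta> \<Longrightarrow>
      fractional_bound m \<alpha> ?L \<omega> A \<Longrightarrow> fractional_bound m' \<beta> ?L \<eta> B \<Longrightarrow>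
      fractional_bound (m + m') g K (charge_wedge m m' \<omega> \<eta>) (C * A * B)"
      by (rule charge_wedge_fractional_bound[OF \<alpha>' \<beta>' g_def g(1) K, of m m']) blast
    show ?thesis by (rule bdd_aboveI2[OF fractional_seminorm_le[OF C[OF D\<omega>(1) D\<eta>(1) A B]]])
  qed
  moreover have "limitin (charge_topology (m + m')) ?W ?w sequentially"
  proof (rule charge_topology_limitI[OF fc[OF f(1)] fc[OF f(2)]])
    fix K :: "'a set" assume K: "compact K"
    note K1 = compact_thick[OF K, of 1]
    define L where "L = thick 1 (thick 1 K)"
    have L: "compact L" unfolding L_def by (rule compact_thick[OF K1])
    obtain A where A: "fractional_bound m \<alpha> L \<omega> A" "\<And>n. fractional_bound m \<alpha> L (\<omega>s n) A" using D\<omega>(4)[OF L] by blast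
    obtain B where B: "fractional_bound m' \<beta> L \<eta> B" "\<And>n. fractional_bound m' \<beta> L (\<eta>s n) B" using D\<eta>(4)[OF L] by blast
    note A' = A[unfolded L_def] and B' = B[unfolded L_def]
    note A0 = fractional_boundD(1)[OF A(1)] and B0 = fractional_boundD(1)[OF B(1)]
    define E where "E = eval_const TYPE('a) m"
    define E' where "E' = eval_const TYPE('a) m'"
    have E: "0 \<le> E" "0 \<le> E'"
      unfolding E_def E'_def using eval_const_ge_1[where 'a='a, of m] eval_const_ge_1[where 'a='a, of m'] by linarith+
    define s where "s j = charge_seminorm m L (\<omega>s j - \<omega>)" for j
    define t where "t j = charge_seminorm m' L (\<eta>s j - \<eta>)" for j
    define S where "S = wedge_step_const TYPE('a) m m' / (1 - (1/2) powr g)"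
    have S: "0 \<le> S"
    proof -
      have "(1/2::real) powr g < (1/2) powr 0" using g(1) by (intro powr_less_mono') auto
      then show ?thesis unfolding S_def using wedge_step_const_nonneg[where 'a='a, of m m'] by simp
    qed
    \<comment> \<open>\<open>u n\<close> bounds the two errors at scale \<open>n\<close>, uniformly
      in \<open>j\<close>; \<open>P n\<close> and \<open>Q n\<close> contain the sizes of the
      mollified factors, which may grow as the scale decreases.\<close>
    define u where "u n = 2 * (S * A * B) * moll_scale n powr g" for n
    define P where "P n = slice_const m m' * (E' * B * moll_scale n powr (\<beta> - 1))" for n
    define Q where "Q n = slice_const m m' * (E * A * moll_scale n powr (\<alpha> - 1))" for n
    have d\<omega>: "\<omega>s j - \<omega> \<in> fractional_charges m \<alpha>" and d\<eta>: "\<eta>s j - \<eta> \<in> fractional_charges m' \<beta>" for j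
      by (rule fractional_charges_diff D\<omega>(1,2) D\<eta>(1,2))+
    note cd\<omega> = fractional_charges_charges[OF d\<omega> \<alpha>] and cd\<eta> = fractional_charges_charges[OF d\<eta> \<beta>]
    have st: "0 \<le> s j" "0 \<le> t j" for j
      unfolding s_def t_def by (rule charge_seminorm_nonneg[OF cd\<omega> L], rule charge_seminorm_nonneg[OF cd\<eta> L])
    have diff: "approx_form k (\<theta> - \<theta>') n = (\<lambda>x v. approx_form k \<theta> n x v - approx_form k \<theta>' n x v)" for k n and \<theta> \<theta>' :: "'a charge"
      by (simp add: charge_form_def fun_eq_iff)
    have c1: "\<bar>R (\<lambda>x v. approx_form m (\<omega>s j) n x v - approx_form m \<omega> n x v)\<bar> \<le> s j * real_normal_mass m R"
      if R: "R \<in> normal_currents_in m (thick 1 K)" for R j n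
      unfolding diff[symmetric]
      by (rule approx_form_charge_le[OF fractional_locally_bounded[OF d\<omega> \<alpha>'] K1 st(1) _ R])
        (unfold s_def, rule charge_seminorm_bound[OF cd\<omega> L], simp only: L_def)
    have c2: "\<bar>R (\<lambda>x v. approx_form m' (\<eta>s j) n x v - approx_form m' \<eta> n x v)\<bar> \<le> t j * real_normal_mass m' R"
      if R: "R \<in> normal_currents_in m' (thick 1 K)" for R j n
      unfolding diff[symmetric]
      by (rule approx_form_charge_le[OF fractional_locally_bounded[OF d\<eta> \<beta>'] K1 st(2) _ R])
        (unfold t_def, rule charge_seminorm_bound[OF cd\<eta> L], simp only: L_def)
    have le: "charge_seminorm (m + m') K (?W j - ?w) \<le> u n + P n * s j + Q n * t j" for n j
    proof (rule charge_seminorm_le[OF K])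
      fix T assume T: "T \<in> normal_currents_in (m + m') K" "real_normal_mass (m + m') T \<le> 1"
      note nT = normal_currents_inD(1)[OF T(1)]
      let ?N = "real_normal_mass (m + m') T"
      have N: "0 \<le> ?N" by (rule real_normal_mass(2)[OF nT])
      let ?a = "approx_form m \<omega> n" and ?b = "approx_form m' \<eta> n" and ?aj = "approx_form m (\<omega>s j) n" and ?bj = "approx_form m' (\<eta>s j) n"
      note sa = smooth_forms_approx[OF D\<omega>(2) \<alpha>', of n] and sb = smooth_forms_approx[OF D\<eta>(2) \<beta>', of n]
        and saj = smooth_forms_approx[OF D\<omega>(1) \<alpha>', of n j] and sbj = smooth_forms_approx[OF D\<eta>(1) \<beta>', of n j]
      have 1: "\<bar>?W j T - T (wedge_form m m' ?aj ?bj)\<bar> \<le> S * A * B * moll_scale n powr g * ?N"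
        unfolding S_def by (rule charge_wedge_limit(2)[OF D\<omega>(1) \<alpha>' D\<eta>(1) \<beta>' g_def g(1) K T(1) A'(2) B'(2)])
      have 2: "\<bar>?w T - T (wedge_form m m' ?a ?b)\<bar> \<le> S * A * B * moll_scale n powr g * ?N"
        unfolding S_def by (rule charge_wedge_limit(2)[OF D\<omega>(2) \<alpha>' D\<eta>(2) \<beta>' g_def g(1) K T(1) A'(1) B'(1)])
      have 3: "\<bar>T (wedge_form m m' (\<lambda>x v. ?aj x v - ?a x v) ?bj)\<bar> \<le> slice_const m m' * s j * (E' * B * moll_scale n powr (\<beta> - 1)) * ?N"
        unfolding E'_def
        by (rule slice_left[OF T(1) K smooth_forms_diff[OF saj sa] sbj approx_form_flat_le[OF D\<eta>(1) \<beta>' B'(2)] _ st(1) c1])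
          (use B0 E in \<open>simp_all add: E'_def\<close>)
      have 4: "\<bar>T (wedge_form m m' ?a (\<lambda>x v. ?bj x v - ?b x v))\<bar> \<le> slice_const m m' * t j * (E * A * moll_scale n powr (\<alpha> - 1)) * ?N"
        unfolding E_def
        by (rule slice_right[OF T(1) K sa approx_form_flat_le[OF D\<omega>(2) \<alpha>' A'(1)] smooth_forms_diff[OF sbj sb] _ st(2) c2])
          (use A0 E in \<open>simp_all add: E_def\<close>)
      have "?W j T - ?w T = (?W j T - T (wedge_form m m' ?aj ?bj)) - (?w T - T (wedge_form m m' ?a ?b))
          + (T (wedge_form m m' ?aj ?bj) - T (wedge_form m m' ?a ?b))" by simp
      also have "\<dots> \<le> 2 * (S * A * B * moll_scale n powr g * ?N) + (slice_const m m' * s j * (E' * B * moll_scale n powr (\<beta> - 1)) * ?N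
          + slice_const m m' * t j * (E * A * moll_scale n powr (\<alpha> - 1)) * ?N)"
        unfolding wedge_form_diff[OF saj sa sbj sb normal_currents_functional[OF nT]] using 1 2 3 4 by linarith
      also have "\<dots> = (u n + P n * s j + Q n * t j) * ?N"
        unfolding u_def P_def Q_def by (simp add: algebra_simps)
      also have "\<dots> \<le> (u n + P n * s j + Q n * t j) * 1"
        unfolding u_def P_def Q_def using T(2) A0 B0 E S st slice_const_nonneg[of m m']
        by (intro mult_left_mono add_nonneg_nonneg mult_nonneg_nonneg) auto
      finally show "(?W j - ?w) T \<le> u n + P n * s j + Q n * t j" by simp
    qed
    show "(\<lambda>n. charge_seminorm (m + m') K (?W n - ?w)) \<longlonglongrightarrow> 0"
    proof (rule tendsto_zero_two_scales[OF _ le])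
      show "0 \<le> charge_seminorm (m + m') K (?W j - ?w)" for j
        by (rule charge_seminorm_nonneg[OF charges_diff[OF fc[OF f(1)] fc[OF f(2)]] K])
      show "u \<longlonglongrightarrow> 0"
        unfolding u_def by (rule tendsto_mult_right_zero[OF moll_scale_powr_tendsto[OF g(1)]])
      show "s \<longlonglongrightarrow> 0" unfolding s_def by (rule D\<omega>(3)[OF L])
      show "t \<longlonglongrightarrow> 0" unfolding t_def by (rule D\<eta>(3)[OF L])
    qed
  qed
  ultimately show ?thesis using f unfolding weakly_star_converges_def g_def by blast
qed

text \<open>The charge seminorm over the support of \<open>T\<close> controls the value at
  \<open>T\<close>, so weak-* limits are pointwise limits; off the normal currents all functionals
  are 0.\<close>

lemma weakly_star_limit_unique:
  fixes \<omega> \<omega>' :: "'a::euclidean_space charge"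
  assumes w: "weakly_star_converges m \<alpha> \<omega>s \<omega>" "weakly_star_converges m \<alpha> \<omega>s \<omega>'" and \<alpha>: "0 < \<alpha>" "\<alpha> \<le> 1"
  shows "\<omega> = \<omega>'"
proof
  fix T :: "'a current"
  note D = weakly_star_convergesD[OF w(1) \<alpha>] and D' = weakly_star_convergesD[OF w(2) \<alpha>]
  note c = fractional_charges_charges[OF _ \<alpha>]
  show "\<omega> T = \<omega>' T"
  proof (cases "T \<in> normal_currents m")
    case nT: True
    let ?K = "spt m T"
    have K: "compact ?K" by (rule compact_spt[OF normal_currents_currents[OF nT]])
    note T = normal_currents_in_spt[OF nT]
    have lim: "(\<lambda>n. \<omega>s n T) \<longlonglongrightarrow> \<theta> T" if w: "weakly_star_converges m \<alpha> \<omega>s \<theta>" for \<theta>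
    proof -
      note D = weakly_star_convergesD[OF w \<alpha>]
      have le: "\<bar>\<omega>s n T - \<theta> T\<bar> \<le> charge_seminorm m ?K (\<omega>s n - \<theta>) * real_normal_mass m T" for n
        using charge_seminorm_bound[OF charges_diff[OF c[OF D(1)] c[OF D(2)]] K T, of n] by simp
      have "(\<lambda>n. charge_seminorm m ?K (\<omega>s n - \<theta>) * real_normal_mass m T) \<longlonglongrightarrow> 0"
        by (rule tendsto_mult_left_zero[OF D(3)[OF K]])
      then have "(\<lambda>n. \<omega>s n T - \<theta> T) \<longlonglongrightarrow> 0"
        by (rule Lim_null_comparison[OF always_eventually, rotated]) (unfold real_norm_def, rule allI, rule le)
      then show ?thesis by (simp add: LIM_zero_iff)
    qed
    show ?thesis by (rule LIMSEQ_unique[OF lim[OF w(1)] lim[OF w(2)]])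
  next
    case False
    then show ?thesis using fractional_chargesD(1)[OF D(2)] fractional_chargesD(1)[OF D'(2)] by (simp add: normal_functionals_def)
  qed
qed

lemma fractional_wedge_products_unique:
  fixes W W' :: "'a::euclidean_space charge \<times> 'a charge \<Rightarrow> 'a charge"
  assumes W: "W \<in> fractional_wedge_products m m' \<alpha> \<beta>" and W': "W' \<in> fractional_wedge_products m m' \<alpha> \<beta>"
    and \<alpha>: "0 < \<alpha>" "\<alpha> \<le> 1" and \<beta>: "0 < \<beta>" "\<beta> \<le> 1" and \<gamma>: "1 < \<alpha> + \<beta>"
  shows "W = W'"
proof (rule PiE_ext)
  note \<alpha>' = less_imp_le[OF \<alpha>(1)] \<alpha>(2) and \<beta>' = less_imp_le[OF \<beta>(1)] \<beta>(2)
  show "W \<in> fractional_charges m \<alpha> \<times> fractional_charges m' \<beta> \<rightarrow>\<^sub>E fractional_charges (m + m') (\<alpha> + \<beta> - 1)"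
    "W' \<in> fractional_charges m \<alpha> \<times> fractional_charges m' \<beta> \<rightarrow>\<^sub>E fractional_charges (m + m') (\<alpha> + \<beta> - 1)"
    using W W' by (simp_all add: fractional_wedge_products_def)
  fix z :: "'a charge \<times> 'a charge" assume "z \<in> fractional_charges m \<alpha> \<times> fractional_charges m' \<beta>"
  then obtain \<omega> \<eta> where z: "z = (\<omega>, \<eta>)" and \<omega>: "\<omega> \<in> fractional_charges m \<alpha>" and \<eta>: "\<eta> \<in> fractional_charges m' \<beta>" by blast
  let ?a = "\<lambda>n. charge_of_form m (approx_form m \<omega> n)" and ?b = "\<lambda>n. charge_of_form m' (approx_form m' \<eta> n)"
  note sa = smooth_forms_approx[OF \<omega> \<alpha>'] and sb = smooth_forms_approx[OF \<eta> \<beta>']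
  note wa = approx_form_weakly_star_converges[OF \<omega> \<alpha>] and wb = approx_form_weakly_star_converges[OF \<eta> \<beta>]
  have eq: "W (?a n, ?b n) = W' (?a n, ?b n)" for n
    using W W' sa sb by (simp add: fractional_wedge_products_def extends_wedge_form_def)
  have cont: "weakly_star_converges (m + m') (\<alpha> + \<beta> - 1) (\<lambda>n. V (?a n, ?b n)) (V (\<omega>, \<eta>))"
    if "V \<in> fractional_wedge_products m m' \<alpha> \<beta>" for V
  proof -
    have "weak_star_continuous m m' \<alpha> \<beta> V" using that by (simp add: fractional_wedge_products_def)
    then show ?thesis using wa wb unfolding weak_star_continuous_def by blast
  qed
  show "W z = W' z"
    unfolding z using cont[OF W] cont[OF W', folded eq]
    by (rule weakly_star_limit_unique) (use \<alpha> \<beta> \<gamma> in simp_all)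
qed

lemma charge_wedge_product:
  assumes \<alpha>: "0 < \<alpha>" "\<alpha> \<le> 1" and \<beta>: "0 < \<beta>" "\<beta> \<le> 1" and \<gamma>: "1 < \<alpha> + \<beta>"
  shows "restrict (\<lambda>(\<omega>, \<eta>). charge_wedge m m' \<omega> \<eta>) (fractional_charges m \<alpha> \<times> fractional_charges m' \<beta> :: ('a::euclidean_space charge \<times> 'a charge) set)
    \<in> fractional_wedge_products m m' \<alpha> \<beta>"
  unfolding fractional_wedge_products_def
proof (intro CollectI conjI)
  note \<alpha>' = less_imp_le[OF \<alpha>(1)] \<alpha>(2) and \<beta>' = less_imp_le[OF \<beta>(1)] \<beta>(2)
  let ?W = "restrict (\<lambda>(\<omega>, \<eta>). charge_wedge m m' \<omega> \<eta>) (fractional_charges m \<alpha> \<times> fractional_charges m' \<beta> :: ('a charge \<times> 'a charge) set)"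
  show "?W \<in> fractional_charges m \<alpha> \<times> fractional_charges m' \<beta> \<rightarrow>\<^sub>E fractional_charges (m + m') (\<alpha> + \<beta> - 1)"
    by (rule restrict_PiE_iff[THEN iffD2]) (use charge_wedge_fractional[OF _ \<alpha>' _ \<beta>' \<gamma>] in auto)
  show "extends_wedge_form m m' ?W"
    unfolding extends_wedge_form_def
    by (simp add: charge_of_form_fractional \<alpha>' \<beta>' charge_wedge_of_forms[OF _ _ \<alpha> \<beta> \<gamma>])
  show "weak_star_continuous m m' \<alpha> \<beta> ?W"
    unfolding weak_star_continuous_def
  proof (intro allI impI, elim conjE)
    fix \<omega>s \<eta>s and \<omega> \<eta> :: "'a charge"
    assume w: "weakly_star_converges m \<alpha> \<omega>s \<omega>" "weakly_star_converges m' \<beta> \<eta>s \<eta>"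
    then show "weakly_star_converges (m + m') (\<alpha> + \<beta> - 1) (\<lambda>n. ?W (\<omega>s n, \<eta>s n)) (?W (\<omega>, \<eta>))"
      using charge_wedge_weakly_star[OF w \<alpha> \<beta> \<gamma>] weakly_star_convergesD(1,2)[OF w(1) \<alpha>] weakly_star_convergesD(1,2)[OF w(2) \<beta>]
      by simp
  qed
qed

lemma topspace_fractional_topology: "topspace (fractional_topology m \<alpha>) = fractional_charges m \<alpha>"
  unfolding fractional_topology_def by (rule topspace_seminorm_topology) (use compact_empty in blast)

lemma openin_fractional_ball:
  "compact K \<Longrightarrow> \<omega> \<in> fractional_charges m \<alpha> \<Longrightarrow> 0 < e \<Longrightarrow>
    openin (fractional_topology m \<alpha>) {\<eta> \<in> fractional_charges m \<alpha>. fractional_seminorm m \<alpha> K (\<eta> - \<omega>) < e}"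
  unfolding fractional_topology_def by (rule openin_seminorm_ball) blast

lemma fractional_seminorm_self: "fractional_seminorm m \<alpha> K (\<omega> - \<omega>) \<le> 0"
  by (rule fractional_seminorm_le) (simp add: fractional_bound_def)

text \<open>Checked on the subbasic balls of the target, whose centres need not be values of the
  product. Around a point of the preimage, the bilinear bound for the two terms of the telescoped
  difference leaves room for a product of small balls.\<close>

lemma charge_wedge_continuous:
  assumes \<alpha>: "0 < \<alpha>" "\<alpha> \<le> 1" and \<beta>: "0 < \<beta>" "\<beta> \<le> 1" and \<gamma>: "1 < \<alpha> + \<beta>"
  shows "continuous_map (prod_topology (fractional_topology m \<alpha>) (fractional_topology m' \<beta>))
    (fractional_topology (m + m') (\<alpha> + \<beta> - 1))
    (restrict (\<lambda>(\<omega>, \<eta>). charge_wedge m m' \<omega> \<eta>) (fractional_charges m \<alpha> \<times> fractional_charges m' \<beta> :: ('a::euclidean_space charge \<times> 'a charge) set))"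
    (is "continuous_map ?X _ ?W")
proof -
  define g where "g = \<alpha> + \<beta> - 1"
  have g: "0 < g" using \<gamma> by (simp add: g_def)
  note \<alpha>' = less_imp_le[OF \<alpha>(1)] \<alpha>(2) and \<beta>' = less_imp_le[OF \<beta>(1)] \<beta>(2)
  have top: "topspace ?X = fractional_charges m \<alpha> \<times> fractional_charges m' \<beta>"
    by (simp only: topspace_prod_topology topspace_fractional_topology)
  have WF: "charge_wedge m m' \<omega> \<eta> \<in> fractional_charges (m + m') g"
    if "\<omega> \<in> fractional_charges m \<alpha>" "\<eta> \<in> fractional_charges m' \<beta>" for \<omega> \<eta> :: "'a charge"
    unfolding g_def by (rule charge_wedge_fractional[OF that(1) \<alpha>' that(2) \<beta>' \<gamma>])
  let ?Y = "fractional_charges (m + m') g :: 'a charge set" and ?p = "fractional_seminorm (m + m') g"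
  have op: "openin ?X (?W -` {y \<in> ?Y. ?p K (y - x) < e} \<inter> topspace ?X)"
    if K: "compact K" and x: "x \<in> ?Y" for K x e
  proof (subst openin_subopen, rule ballI)
    fix z assume "z \<in> ?W -` {y \<in> ?Y. ?p K (y - x) < e} \<inter> topspace ?X"
    then obtain \<omega>0 \<eta>0 where z: "z = (\<omega>0, \<eta>0)" and \<omega>0: "\<omega>0 \<in> fractional_charges m \<alpha>" and \<eta>0: "\<eta>0 \<in> fractional_charges m' \<beta>"
      and e: "?p K (charge_wedge m m' \<omega>0 \<eta>0 - x) < e" unfolding top by auto
    let ?L = "thick 1 (thick 1 K)"
    have L: "compact ?L" by (intro compact_thick K)
    obtain C where C: "0 \<le> C" "\<And>\<omega> \<eta> A B. \<omega> \<in> fractional_charges m \<alpha> \<Longrightarrow> \<eta> \<in> fractional_charges m' \<beta> \<Longrightarrow>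
      fractional_bound m \<alpha> ?L \<omega> A \<Longrightarrow> fractional_bound m' \<beta> ?L \<eta> B \<Longrightarrow>
      fractional_bound (m + m') g K (charge_wedge m m' \<omega> \<eta>) (C * A * B)"
      by (rule charge_wedge_fractional_bound[OF \<alpha>' \<beta>' g_def g K, of m m']) blast
    obtain A where A: "fractional_bound m \<alpha> ?L \<omega>0 A" using fractional_chargesD(2)[OF \<omega>0 L] by blast
    obtain B where B: "fractional_bound m' \<beta> ?L \<eta>0 B" using fractional_chargesD(2)[OF \<eta>0 L] by blast
    \<comment> \<open>\<open>d\<close> is the room left inside the ball, \<open>q\<close> bounds the
      increment per unit of \<open>r\<close>, and \<open>r\<close> is capped by 1 so that the
      constant of the second factor stays below 1 + B.\<close>
    define d where "d = e - ?p K (charge_wedge m m' \<omega>0 \<eta>0 - x)"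
    define q where "q = C * (1 + B) + C * A"
    define r where "r = min 1 (d / (q + 1))"
    have d: "0 < d" using e by (simp add: d_def)
    have q: "0 \<le> q" unfolding q_def using C(1) fractional_boundD(1)[OF A] fractional_boundD(1)[OF B] by simp
    have r: "0 < r" "r \<le> 1" unfolding r_def using d q by simp_all
    have "r \<le> d / (q + 1)" by (simp add: r_def)
    then have "r * (q + 1) \<le> d" using q by (simp add: pos_le_divide_eq)
    then have rq: "r * q < d" using r by (simp add: algebra_simps)
    let ?U = "{\<omega> \<in> fractional_charges m \<alpha>. fractional_seminorm m \<alpha> ?L (\<omega> - \<omega>0) < r}"
    let ?V = "{\<eta> \<in> fractional_charges m' \<beta>. fractional_seminorm m' \<beta> ?L (\<eta> - \<eta>0) < r}"
    have "openin ?X (?U \<times> ?V)"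
      unfolding openin_prod_Times_iff using openin_fractional_ball[OF L \<omega>0 r(1)] openin_fractional_ball[OF L \<eta>0 r(1)] by blast
    moreover have "z \<in> ?U \<times> ?V"
      unfolding z by (intro SigmaI CollectI conjI \<omega>0 \<eta>0 le_less_trans[OF fractional_seminorm_self r(1)])
    moreover have "?U \<times> ?V \<subseteq> ?W -` {y \<in> ?Y. ?p K (y - x) < e} \<inter> topspace ?X"
    proof
      fix y assume "y \<in> ?U \<times> ?V"
      then obtain \<omega> \<eta> where y: "y = (\<omega>, \<eta>)" and \<omega>: "\<omega> \<in> fractional_charges m \<alpha>" "fractional_seminorm m \<alpha> ?L (\<omega> - \<omega>0) < r"
        and \<eta>: "\<eta> \<in> fractional_charges m' \<beta>" "fractional_seminorm m' \<beta> ?L (\<eta> - \<eta>0) < r" by blast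
      note d\<omega> = fractional_charges_diff[OF \<omega>(1) \<omega>0] and d\<eta> = fractional_charges_diff[OF \<eta>(1) \<eta>0]
      have b\<omega>: "fractional_bound m \<alpha> ?L (\<omega> - \<omega>0) r"
        by (rule fractional_bound_mono[OF fractional_seminorm_bound[OF d\<omega> L] less_imp_le[OF \<omega>(2)]])
      have b\<eta>: "fractional_bound m' \<beta> ?L (\<eta> - \<eta>0) r"
        by (rule fractional_bound_mono[OF fractional_seminorm_bound[OF d\<eta> L] less_imp_le[OF \<eta>(2)]])
      have "fractional_bound m' \<beta> ?L (\<lambda>T. (\<eta> - \<eta>0) T + \<eta>0 T) (1 + B)"
        by (rule fractional_bound_add[OF fractional_bound_mono[OF b\<eta> r(2)] B])
      then have b\<eta>': "fractional_bound m' \<beta> ?L \<eta> (1 + B)" by simp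
      have bx: "fractional_bound (m + m') g K (charge_wedge m m' \<omega>0 \<eta>0 - x) (?p K (charge_wedge m m' \<omega>0 \<eta>0 - x))"
        by (rule fractional_seminorm_bound[OF fractional_charges_diff[OF WF[OF \<omega>0 \<eta>0] x] K])
      have bW: "fractional_bound (m + m') g K (charge_wedge m m' \<omega> \<eta> - charge_wedge m m' \<omega>0 \<eta>0) (C * r * (1 + B) + C * A * r)"
        unfolding charge_wedge_diff[OF \<omega>(1) \<omega>0 d\<omega> \<alpha>' \<eta>(1) \<eta>0 d\<eta> \<beta>' \<gamma>]
        by (rule fractional_bound_add[OF C(2)[OF d\<omega> \<eta>(1) b\<omega> b\<eta>'] C(2)[OF \<omega>0 d\<eta> A b\<eta>]])
      have split: "charge_wedge m m' \<omega> \<eta> - x = (\<lambda>T. (charge_wedge m m' \<omega> \<eta> - charge_wedge m m' \<omega>0 \<eta>0) T + (charge_wedge m m' \<omega>0 \<eta>0 - x) T)"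
        by (simp add: fun_eq_iff)
      have "?p K (charge_wedge m m' \<omega> \<eta> - x) \<le> (C * r * (1 + B) + C * A * r) + ?p K (charge_wedge m m' \<omega>0 \<eta>0 - x)"
        by (subst split) (rule fractional_seminorm_le[OF fractional_bound_add[OF bW bx]])
      also have "C * r * (1 + B) + C * A * r = r * q" by (simp add: q_def algebra_simps)
      finally have "?p K (charge_wedge m m' \<omega> \<eta> - x) < e" using rq unfolding d_def by linarith
      then show "y \<in> ?W -` {y \<in> ?Y. ?p K (y - x) < e} \<inter> topspace ?X"
        unfolding top y using \<omega>(1) \<eta>(1) WF[OF \<omega>(1) \<eta>(1)] by simp
    qed
    ultimately show "\<exists>V. openin ?X V \<and> z \<in> V \<and> V \<subseteq> ?W -` {y \<in> ?Y. ?p K (y - x) < e} \<inter> topspace ?X" by blast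
  qed
  let ?B = "{{y \<in> ?Y. p (y - x) < e} | p x e. p \<in> {?p K | K. compact K} \<and> x \<in> ?Y \<and> 0 < e}"
  have "topspace (fractional_topology (m + m') g) = \<Union>?B"
    unfolding fractional_topology_def seminorm_topology_def by (rule topology_generated_by_topspace)
  then have cover: "\<Union>?B = ?Y" unfolding topspace_fractional_topology by simp
  show ?thesis
    unfolding g_def[symmetric] fractional_topology_def[of "m + m'"] seminorm_topology_def continuous_on_generated_topo_iff cover
  proof (intro conjI allI impI)
    fix U assume "U \<in> ?B"
    then obtain K x e where "U = {y \<in> ?Y. ?p K (y - x) < e}" "compact K" "x \<in> ?Y" by blast
    then show "openin ?X (?W -` U \<inter> topspace ?X)" using op by simp
  next
    show "?W ` topspace ?X \<subseteq> ?Y" unfolding top using WF by auto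
  qed
qed

theorem theorem9p1:
  fixes m m' :: nat and \<alpha> \<beta> :: real
  assumes "0 < \<alpha>" and "\<alpha> \<le> 1" and "0 < \<beta>" and "\<beta> \<le> 1" and "\<alpha> + \<beta> > 1"
  shows "(\<exists>!W :: (real ^ 'n) charge \<times> (real ^ 'n) charge \<Rightarrow> (real ^ 'n) charge.
            W \<in> fractional_wedge_products m m' \<alpha> \<beta>) \<and>
         (\<forall>W :: (real ^ 'n) charge \<times> (real ^ 'n) charge \<Rightarrow> (real ^ 'n) charge.
            W \<in> fractional_wedge_products m m' \<alpha> \<beta> \<longrightarrow>
            continuous_map
              (prod_topology (fractional_topology m \<alpha>) (fractional_topology m' \<beta>))
              (fractional_topology (m + m') (\<alpha> + \<beta> - 1)) W)"
proof (intro conjI allI impI)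
  note unique = fractional_wedge_products_unique[OF _ charge_wedge_product[OF assms] assms]
  show "\<exists>!W :: (real ^ 'n) charge \<times> (real ^ 'n) charge \<Rightarrow> (real ^ 'n) charge. W \<in> fractional_wedge_products m m' \<alpha> \<beta>"
    by (rule ex1I, rule charge_wedge_product[OF assms], rule unique)
  fix W :: "(real ^ 'n) charge \<times> (real ^ 'n) charge \<Rightarrow> (real ^ 'n) charge"
  assume W: "W \<in> fractional_wedge_products m m' \<alpha> \<beta>"
  show "continuous_map (prod_topology (fractional_topology m \<alpha>) (fractional_topology m' \<beta>))
      (fractional_topology (m + m') (\<alpha> + \<beta> - 1)) W"
    unfolding unique[OF W] by (rule charge_wedge_continuous[OF assms])
qed

end
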